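(* Let $p$ be an $I\times J$ matrix with entries in the algebra of polynomials in $d$ commuting variables, and let $V$ be an algebraic set in $G_p$ (that is, $V=A\cap G_p$ with $A\subseteq\mathbb{C}^d$ the common zero set of a collection of polynomials). If $f\in\mathrm{Hol}^\infty_{p,V}$, then there exists an extension $F\in\mathrm{Hol}^\infty_p$ such that $$F|_V=f\qquad\text{and}\qquad\|F\|_p=\|f\|_{p,V}.$$ Moreover, this norm estimate cannot be improved: if $F\in\mathrm{Hol}^\infty_p$, then $F|_V\in\mathrm{Hol}^\infty_{p,V}$ and $\|F|_V\|_{p,V}\le\|F\|_p$.
   Context: $G_p=\{\lambda\in\mathbb{C}^d : \|p(\lambda)\|<1\}$ (operator norm). $\mathcal{M}^{[d]}_{\rm com}$ is the set of all $d$-tuples $x=(x_1,\dots,x_d)$ of pairwise commuting $n\times n$ complex matrices, over all $n\ge1$; for such $x$, $p(x)=[p_{ij}(x)]$ is the block matrix with operator norm, and $\sigma(x)\subset\mathbb{C}^d$ is the joint spectrum (set of joint eigenvalues). $\mathcal{F}_p=\{x\in\mathcal{M}^{[d]}_{\rm com} : \|p(x)\|<1\}$; for $x\in\mathcal{F}_p$ one has $\sigma(x)\subseteq G_p$. Functional calculus: if $g$ is holomorphic near $\lambda$ and $\sigma(x)=\{\lambda\}$, $g(x)$ is obtained by inserting $x$ into the power series of $g$ at $\lambda$ (a finite sum); every $y\in\mathcal{M}^{[d]}_{\rm com}$ can be written $y=S^{-1}(\bigoplus_i x_i)S$ with each $\sigma(x_i)$ a single point, and $g(y)=S^{-1}(\bigoplus_i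 g(x_i))S$ for $g$ holomorphic near $\sigma(y)$. For $F$ holomorphic on $G_p$, $\|F\|_p=\sup_{x\in\mathcal{F}_p}\|F(x)\|$, and $\mathrm{Hol}^\infty_p=\{F\in\mathrm{Hol}(G_p) : \|F\|_p<\infty\}$. For $V\subseteq G_p$, $\mathrm{Hol}(V)$ is the set of $f:V\to\mathbb{C}$ such that each $\lambda\in V$ has an open neighborhood in $\mathbb{C}^d$ on which some holomorphic function agrees with $f$ on $V$. $Y_V$ is the set of $y\in\mathcal{M}^{[d]}_{\rm com}$ with $\sigma(y)\subseteq V$. An element $y\in Y_V$ is subordinate to $V$ if $g(y)=0$ whenever $g$ is holomorphic on a neighborhood $U$ of $\sigma(y)$ in $\mathbb{C}^d$ and vanishes on $U\cap V$. Let $\mathcal{F}_{p,V}=\{y\in Y_V : y\text{ is subordinate to }V\}\cap\mathcal{F}_p$. For $f\in\mathrm{Hol}(V)$ and $y=S^{-1}(\bigoplus_i x_i)S\in\mathcal{F}_{p,V}$ with $\sigma(x_i)=\{\lambda_i\}$, $\lambda_i\in V$, one sets $f(y)=S^{-1}(\bigoplus_i f_i(x_i))S$, where $f_i$ is a holomorphic function on a neighborhood of $\lambda_i$ in $\mathbb{C}^d$ that agrees with $f$ on $V$ there, and $f_i(x_i)$ is obtained by inserting $x_i$ into the power series of $f_i$ at $\lambda_i$ (well defined since $y$ is subordinate to $V$). $\|f\|_{p,V}=\sup_{y\in\mathcal{F}_{p,V}}\|f(y)\|$ and $\mathrm{Hol}^\infty_{p,V}=\{f\in\mathrm{Hol}(V)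 : \|f\|_{p,V}<\infty\}$. *)

theory Defs
  imports
    "HOL-Analysis.Analysis"
    "HOL-Library.Poly_Mapping"
    "Jordan_Normal_Form.Char_Poly"
begin

no_notation Matrix.vec_index (infixl \<open>$\<close> 100)

section \<open>Polynomials in commuting variables indexed by a finite type\<close>

text \<open>The number of variables is \<open>CARD('d)\<close>; monomials are their exponent vectors.\<close>

type_synonym 'd mpoly = "('d \<Rightarrow>\<^sub>0 nat) \<Rightarrow>\<^sub>0 complex"

type_synonym 'd mat_tuple = "'d \<Rightarrow> complex mat"

definition monom_eval :: "('d::finite \<Rightarrow>\<^sub>0 nat) \<Rightarrow> complex ^ 'd \<Rightarrow> complex" where
  "monom_eval \<alpha> z = (\<Prod>i\<in>UNIV. (z $ i) ^ Poly_Mapping.lookup \<alpha> i)"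

definition mpoly_eval :: "'d::finite mpoly \<Rightarrow> complex ^ 'd \<Rightarrow> complex" where
  "mpoly_eval q z =
     (\<Sum>\<alpha>\<in>Poly_Mapping.keys q. Poly_Mapping.lookup q \<alpha> * monom_eval \<alpha> z)"

definition pmat_eval :: "'d::finite mpoly mat \<Rightarrow> complex ^ 'd \<Rightarrow> complex mat" where
  "pmat_eval p z = map_mat (\<lambda>q. mpoly_eval q z) p"

section \<open>Commuting tuples of matrices\<close>

text \<open>Tuples of pairwise commuting square matrices of a common size, all sizes at once.\<close>

definition comm_tuples :: "('d::finite) mat_tuple set" where
  "comm_tuples = {x. \<exists>n\<ge>1. (\<forall>i. x i \<in> carrier_mat n n) \<and> (\<forall>i j. x i * x j = x j * x i)}"

definition tuple_size :: "('d::finite) mat_tuple \<Rightarrow> nat" where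
  "tuple_size x = (THE n. \<forall>i. x i \<in> carrier_mat n n)"

text \<open>Matrix multiplication is not commutative, so a monomial is written as a product along a
  fixed enumeration of the variables; for commuting tuples the enumeration is irrelevant.\<close>

definition var_list :: "('d::finite) list" where
  "var_list = (SOME is. distinct is \<and> set is = UNIV)"

definition monom_mat :: "('d::finite \<Rightarrow>\<^sub>0 nat) \<Rightarrow> 'd mat_tuple \<Rightarrow> complex mat" where
  "monom_mat \<alpha> x =
     foldr (\<lambda>i A. (x i ^\<^sub>m Poly_Mapping.lookup \<alpha> i) * A) var_list (1\<^sub>m (tuple_size x))"

definition mpoly_mat :: "'d::finite mpoly \<Rightarrow> 'd mat_tuple \<Rightarrow> complex mat" where
  "mpoly_mat q x = mat (tuple_size x) (tuple_size x) (\<lambda>rc.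
     \<Sum>\<alpha>\<in>Poly_Mapping.keys q. Poly_Mapping.lookup q \<alpha> * monom_mat \<alpha> x $$ rc)"

text \<open>The block matrix \<open>[p\<^sub>i\<^sub>j(x)]\<close>: its \<open>(i, j)\<close> block is the
  \<open>n \<times> n\<close> matrix \<open>p\<^sub>i\<^sub>j(x)\<close>.\<close>

definition pmat_mat :: "'d::finite mpoly mat \<Rightarrow> 'd mat_tuple \<Rightarrow> complex mat" where
  "pmat_mat p x = (let n = tuple_size x in
     mat (dim_row p * n) (dim_col p * n)
       (\<lambda>(r, c). mpoly_mat (p $$ (r div n, c div n)) x $$ (r mod n, c mod n)))"

definition joint_spectrum :: "('d::finite) mat_tuple \<Rightarrow> (complex ^ 'd) set" where
  "joint_spectrum x = {\<mu>. \<exists>v. \<forall>i. eigenvector (x i) v (\<mu> $ i)}"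

definition vec_l2 :: "complex Matrix.vec \<Rightarrow> real" where
  "vec_l2 v = sqrt (\<Sum>i<dim_vec v. (cmod (vec_index v i))\<^sup>2)"

definition op_norm :: "complex mat \<Rightarrow> real" where
  "op_norm A = (SUP v \<in> {v \<in> carrier_vec (dim_col A). vec_l2 v \<le> 1}. vec_l2 (A *\<^sub>v v))"

definition G_dom :: "'d::finite mpoly mat \<Rightarrow> (complex ^ 'd) set" where
  "G_dom p = {z. op_norm (pmat_eval p z) < 1}"

definition F_dom :: "'d::finite mpoly mat \<Rightarrow> 'd mat_tuple set" where
  "F_dom p = {x \<in> comm_tuples. op_norm (pmat_mat p x) < 1}"

section \<open>Holomorphic functions of several variables\<close>

text \<open>Complex Frechet differentiability: the real derivative exists and is complex linear.\<close>

definition holo_on :: "(complex ^ 'd \<Rightarrow> complex) \<Rightarrow> (complex ^ 'd::finite) set \<Rightarrow> bool" where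
  "holo_on g U \<longleftrightarrow> (\<forall>z\<in>U. \<exists>D. (g has_derivative D) (at z within U) \<and> (\<forall>c v. D (c *s v) = c * D v))"

definition power_series_at ::
    "(complex ^ 'd \<Rightarrow> complex) \<Rightarrow> complex ^ 'd \<Rightarrow> ('d::finite \<Rightarrow>\<^sub>0 nat) \<Rightarrow> complex" where
  "power_series_at g \<mu> = (THE a. \<exists>r>0. \<forall>z\<in>ball \<mu> r.
     ((\<lambda>\<alpha>. a \<alpha> * monom_eval \<alpha> (z - \<mu>)) has_sum g z) UNIV)"

text \<open>A function on \<open>V\<close> is represented by a total function whose values
  outside \<open>V\<close> are irrelevant.\<close>

definition local_extension ::
    "(complex ^ 'd) set \<Rightarrow> (complex ^ 'd \<Rightarrow> complex) \<Rightarrow> complex ^ 'd::finite \<Rightarrow>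
      (complex ^ 'd \<Rightarrow> complex) \<Rightarrow> bool" where
  "local_extension V f \<mu> g \<longleftrightarrow>
     (\<exists>U. open U \<and> \<mu> \<in> U \<and> holo_on g U \<and> (\<forall>z\<in>U \<inter> V. g z = f z))"

definition Hol_sub :: "(complex ^ 'd::finite) set \<Rightarrow> (complex ^ 'd \<Rightarrow> complex) set" where
  "Hol_sub V = {f. \<forall>\<mu>\<in>V. \<exists>g. local_extension V f \<mu> g}"

section \<open>Functional calculus\<close>

text \<open>\<open>\<Sum>\<^sub>\<alpha> a\<^sub>\<alpha> (x - \<mu>)\<^sup>\<alpha>\<close>, with
  \<open>a\<close> the power series of \<open>g\<close> at \<open>\<mu>\<close>. When the joint spectrum of \<open>x\<close>
  is \<open>{\<mu>}\<close>, the entries of \<open>x - \<mu>\<close> are nilpotent and only finitely many monomials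
  are nonzero.\<close>

definition insert_series ::
    "(complex ^ 'd \<Rightarrow> complex) \<Rightarrow> complex ^ 'd \<Rightarrow> ('d::finite) mat_tuple \<Rightarrow> complex mat" where
  "insert_series g \<mu> x =
     (let n = tuple_size x; y = (\<lambda>i. x i - (\<mu> $ i) \<cdot>\<^sub>m 1\<^sub>m n)
      in mat n n (\<lambda>rc. \<Sum>\<alpha> | monom_mat \<alpha> y \<noteq> 0\<^sub>m n n.
           power_series_at g \<mu> \<alpha> * monom_mat \<alpha> y $$ rc))"

text \<open>\<open>calc_value y ts z\<close>: the triples \<open>(g\<^sub>k, \<mu>\<^sub>k, x\<^sub>k)\<close> in \<open>ts\<close>
  satisfy \<open>\<sigma>(x\<^sub>k) = {\<mu>\<^sub>k}\<close>, and for some invertible \<open>S\<close> with inverse \<open>T\<close>,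
  \<open>y = T (\<Oplus>\<^sub>k x\<^sub>k) S\<close> and
  \<open>z = T (\<Oplus>\<^sub>k g\<^sub>k(x\<^sub>k)) S\<close>.\<close>

definition calc_value ::
    "('d::finite) mat_tuple \<Rightarrow>
     ((complex ^ 'd \<Rightarrow> complex) \<times> (complex ^ 'd) \<times> 'd mat_tuple) list \<Rightarrow> complex mat \<Rightarrow> bool" where
  "calc_value y ts z \<longleftrightarrow>
     (\<forall>(g, \<mu>, x)\<in>set ts. x \<in> comm_tuples \<and> joint_spectrum x = {\<mu>}) \<and>
     (\<exists>T S.
        (\<forall>i. similar_mat_wit (y i) (diag_block_mat (map (\<lambda>(g, \<mu>, x). x i) ts)) T S) \<and>
        z = T * diag_block_mat (map (\<lambda>(g, \<mu>, x). insert_series g \<mu> x) ts) * S)"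

definition fun_calc :: "(complex ^ 'd \<Rightarrow> complex) \<Rightarrow> ('d::finite) mat_tuple \<Rightarrow> complex mat" where
  "fun_calc g y = (THE z. \<exists>ts. calc_value y ts z \<and> (\<forall>(h, \<mu>, x)\<in>set ts. h = g))"

definition fun_calc_sub ::
    "(complex ^ 'd) set \<Rightarrow> (complex ^ 'd \<Rightarrow> complex) \<Rightarrow> ('d::finite) mat_tuple \<Rightarrow> complex mat" where
  "fun_calc_sub V f y =
     (THE z. \<exists>ts. calc_value y ts z \<and> (\<forall>(h, \<mu>, x)\<in>set ts. local_extension V f \<mu> h))"

definition Y_set :: "(complex ^ 'd::finite) set \<Rightarrow> 'd mat_tuple set" where
  "Y_set V = {y \<in> comm_tuples. joint_spectrum y \<subseteq> V}"

definition subordinate :: "(complex ^ 'd::finite) set \<Rightarrow> 'd mat_tuple \<Rightarrow> bool" where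
  "subordinate V y \<longleftrightarrow>
     (\<forall>U g. open U \<and> joint_spectrum y \<subseteq> U \<and> holo_on g U \<and> (\<forall>z\<in>U \<inter> V. g z = 0) \<longrightarrow>
        fun_calc g y = 0\<^sub>m (tuple_size y) (tuple_size y))"

definition F_dom_sub :: "'d::finite mpoly mat \<Rightarrow> (complex ^ 'd) set \<Rightarrow> 'd mat_tuple set" where
  "F_dom_sub p V = {y \<in> Y_set V. subordinate V y} \<inter> F_dom p"

section \<open>Norms\<close>

text \<open>The suprema are taken in \<open>[0, \<infinity>]\<close>; in particular a supremum over the empty set is
  \<open>0\<close>, which matters when \<open>V\<close> is empty.\<close>

definition norm_p :: "'d::finite mpoly mat \<Rightarrow> (complex ^ 'd \<Rightarrow> complex) \<Rightarrow> ennreal" where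
  "norm_p p F = (SUP x \<in> F_dom p. ennreal (op_norm (fun_calc F x)))"

definition norm_p_sub ::
    "'d::finite mpoly mat \<Rightarrow> (complex ^ 'd) set \<Rightarrow> (complex ^ 'd \<Rightarrow> complex) \<Rightarrow> ennreal" where
  "norm_p_sub p V f = (SUP y \<in> F_dom_sub p V. ennreal (op_norm (fun_calc_sub V f y)))"

definition Hol_inf :: "'d::finite mpoly mat \<Rightarrow> (complex ^ 'd \<Rightarrow> complex) set" where
  "Hol_inf p = {F. holo_on F (G_dom p) \<and> norm_p p F < \<infinity>}"

definition Hol_inf_sub ::
    "'d::finite mpoly mat \<Rightarrow> (complex ^ 'd) set \<Rightarrow> (complex ^ 'd \<Rightarrow> complex) set" where
  "Hol_inf_sub p V = {f \<in> Hol_sub V. norm_p_sub p V f < \<infinity>}"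

definition algebraic_in :: "(complex ^ 'd::finite) set \<Rightarrow> (complex ^ 'd) set \<Rightarrow> bool" where
  "algebraic_in V G \<longleftrightarrow>
     (\<exists>Q :: 'd mpoly set. V = {z. \<forall>q\<in>Q. mpoly_eval q z = 0} \<inter> G)"

end

theory Submission
  imports Defs "HOL-Complex_Analysis.Complex_Analysis" "Jordan_Normal_Form.Jordan_Normal_Form_Existence"
begin

text \<open>On a finite subset of \<open>V\<close> the kernel \<open>c\<^sup>2 - cnj (f z) * f w\<close> lies in the
  closed cone of kernels \<open>H (z, w) - p(z)* H (z, w) p(w)\<close> with \<open>H\<close> positive: otherwise a separating functional,
  by the GNS construction, is a diagonalizable tuple in \<open>F_dom_sub p V\<close> at which \<open>f\<close> has norm
  larger than \<open>c\<close>. A lurking isometry turns this model into a contractive realization, whose fixed point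
  iteration started at \<open>0\<close> produces polynomials that converge to \<open>f\<close> on the finite set, and whose norms on
  \<open>F_dom p\<close> are asymptotically at most \<open>c\<close>. By Cauchy estimates the Taylor coefficients of these
  polynomials are locally bounded, so by Tychonoff's theorem they have a cluster point along the finite subsets of
  \<open>V\<close>; it consists of the Taylor coefficients of the extension.\<close>

text \<open>Two obstacles shape the proof. \<open>power_series_at\<close>, \<open>fun_calc\<close>
  and \<open>fun_calc_sub\<close> are definite descriptions, so they can be used only after
  uniqueness of power series and independence of the block decomposition; the latter rests on one
  principle, that a matrix intertwining two tuples also intertwines everything computed from them.
  And membership in \<open>F_dom p\<close> is a strict inequality, while a separating functional
  yields a weak one. A multiple \<epsilon> of the identity restores strictness, because on a finite
  set the norms of p stay below a common bound less than 1; \<epsilon> is sent to 0 afterwards.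
  Finite sets also keep the cone and the realization finite-dimensional. The realization is iterated
  instead of solved because the iterates are polynomials, whose functional calculus is plain
  substitution. Its energy balance gives exactly \<open>c\<close> only at a stationary state;
  starting from 0 costs the factor \<open>sqrt (1 + 2 * \<rho> ^ m / (1 - \<rho>))\<close>, with
  \<rho> the norm of p at the tuple, and this factor tends to 1. The reverse inequality holds since
  an extension of f is a local extension at every point of V.\<close>

no_notation Matrix.vec_index (infixl \<open>$\<close> 100)
no_notation fps_nth (infixl \<open>$\<close> 75)

section \<open>Power series in several variables\<close>

text \<open>The bound on f is known only on the open disc, so Cauchy's inequality is applied on
  circles of radius r < R, and r is sent to R.\<close>

lemma norm_taylor_coeff_le:
  fixes f :: "complex \<Rightarrow> complex"
  assumes "f holomorphic_on ball 0 R" "R > 0" "\<And>z. z \<in> ball 0 R \<Longrightarrow> cmod (f z) \<le> M"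
  shows "cmod ((deriv ^^ k) f 0 / fact k) \<le> M / R ^ k"
proof -
  have *: "cmod ((deriv ^^ k) f 0) / fact k \<le> M / r ^ k" if r: "0 < r" "r < R" for r
  proof -
    have "cmod ((deriv ^^ k) f 0) \<le> fact k * M / r ^ k"
    proof (rule Cauchy_inequality)
      show "f holomorphic_on ball 0 r" using assms(1) r by (auto intro: holomorphic_on_subset)
      show "continuous_on (cball 0 r) f"
        using assms(1) r
        by (intro holomorphic_on_imp_continuous_on) (auto elim!: holomorphic_on_subset)
      show "cmod (f x) \<le> M" if "cmod (0 - x) = r" for x using that assms(3) r by auto
    qed (use r in auto)
    thus ?thesis by (simp add: field_simps)
  qed
  have "((\<lambda>r. M / r ^ k) \<longlongrightarrow> M / R ^ k) (at_left R)"
    using \<open>R > 0\<close> by (intro tendsto_intros) auto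
  moreover have "eventually (\<lambda>r. cmod ((deriv ^^ k) f 0) / fact k \<le> M / r ^ k) (at_left R)"
    using eventually_at_left_real[OF \<open>R > 0\<close>] by eventually_elim (use * in auto)
  ultimately have "cmod ((deriv ^^ k) f 0) / fact k \<le> M / R ^ k"
    by (rule tendsto_lowerbound) auto
  thus ?thesis by (simp add: norm_divide)
qed

text \<open>Only separate holomorphy and a common bound are given. The coefficient c_k is the
  uniform limit of the quotients Q_n(t) = (h(s_n, t) - lower Taylor terms) / s_n^k with s_n tending
  to 0. The lower coefficients occur in Q_n, hence the strong induction.\<close>

lemma taylor_coeff_holomorphic_param:
  fixes h :: "complex \<Rightarrow> complex \<Rightarrow> complex"
  assumes R: "R > 0"
    and hs: "\<And>t. t \<in> ball 0 R \<Longrightarrow> (\<lambda>s. h s t) holomorphic_on ball 0 R"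
    and ht: "\<And>s. s \<in> ball 0 R \<Longrightarrow> h s holomorphic_on ball 0 R"
    and bd: "\<And>s t. s \<in> ball 0 R \<Longrightarrow> t \<in> ball 0 R \<Longrightarrow> cmod (h s t) \<le> M"
  shows "(\<lambda>t. (deriv ^^ k) (\<lambda>s. h s t) 0 / fact k) holomorphic_on ball 0 R"
proof (induction k rule: less_induct)
  case (less k)
  define c where "c l t = (deriv ^^ l) (\<lambda>s. h s t) 0 / fact l" for l t
  \<comment> \<open>Points of modulus R q with q = 1 / (n + 2): nonzero, inside the disc already for
    n = 0, and the geometric tail q / (1 - q) of the error becomes 1 / (n + 1).\<close>
  define s where "s n = complex_of_real (R / (real n + 2))" for n
  have s: "s n \<in> ball 0 R" "s n \<noteq> 0" for n
    using R by (auto simp: s_def norm_divide field_simps add_pos_nonneg simp del: of_real_divide of_real_add)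
  define Q where "Q n t = (h (s n) t - (\<Sum>l<k. c l t * s n ^ l)) / s n ^ k" for n t
  have c: "cmod (c l t) \<le> M / R ^ l" if "t \<in> ball 0 R" for l t
    unfolding c_def using that by (intro norm_taylor_coeff_le hs bd R)
  have M: "M \<ge> 0" using bd[of 0 0] R by (smt (verit) centre_in_ball norm_ge_zero)
  have est: "cmod (Q n t - c k t) \<le> M / R ^ k / (real n + 1)" if t: "t \<in> ball 0 R" for n t
  proof -
    define q where "q = 1 / (real n + 2)"
    have q: "0 < q" "q < 1" by (auto simp: q_def)
    have sq: "cmod (s n) = R * q" using R by (simp add: s_def q_def norm_divide del: of_real_add of_real_divide)
    have sums: "(\<lambda>l. c l t * s n ^ l) sums h (s n) t"
      using holomorphic_power_series[OF hs[OF t] s(1)] by (simp add: c_def)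
    have "(\<lambda>l. c (l + Suc k) t * s n ^ (l + Suc k)) sums (h (s n) t - (\<Sum>l<Suc k. c l t * s n ^ l))"
      using sums_split_initial_segment[OF sums, of "Suc k"] by simp
    from sums_divide[OF this, of "s n ^ k"]
    have S: "(\<lambda>l. c (l + Suc k) t * s n ^ Suc l) sums (Q n t - c k t)"
      using s(2)[of n] by (simp add: Q_def field_simps power_add)
    have G: "(\<lambda>l. M / R ^ k * q * q ^ l) sums (M / R ^ k * q * (1 / (1 - q)))"
      using q by (intro sums_mult geometric_sums) auto
    have "cmod (c (l + Suc k) t * s n ^ Suc l) \<le> M / R ^ k * q * q ^ l" for l
    proof -
      have "cmod (c (l + Suc k) t * s n ^ Suc l) \<le> M / R ^ (l + Suc k) * (R * q) ^ Suc l"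
        unfolding norm_mult norm_power sq by (intro mult_right_mono c[OF t]) (use R q in auto)
      also have "\<dots> = M / R ^ k * q * q ^ l"
        using R by (simp add: power_add power_mult_distrib field_simps)
      finally show ?thesis .
    qed
    hence "cmod (Q n t - c k t) \<le> M / R ^ k * q * (1 / (1 - q))"
      using S G by (metis (no_types, lifting) norm_suminf_le sums_iff)
    also have "\<dots> = M / R ^ k / (real n + 1)"
    proof -
      have "1 - q = (real n + 1) / (real n + 2)" by (simp add: q_def field_simps)
      hence "q * (1 / (1 - q)) = 1 / (real n + 1)" by (simp add: q_def)
      thus ?thesis by (metis (no_types, lifting) mult.assoc mult.right_neutral times_divide_eq_right)
    qed
    finally show ?thesis .
  qed
  have "c k holomorphic_on ball 0 R"
  proof (rule holomorphic_uniform_sequence)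
    show "Q n holomorphic_on ball 0 R" for n
      unfolding Q_def using less.IH[folded c_def] s by (intro holomorphic_intros ht) auto
    show "\<exists>d>0. cball x d \<subseteq> ball 0 R \<and> uniform_limit (cball x d) Q (c k) sequentially"
      if x: "x \<in> ball 0 R" for x
    proof -
      obtain d where d: "d > 0" "cball x d \<subseteq> ball 0 R" 
        using x by (meson open_ball open_contains_cball)
      have "uniform_limit (cball x d) Q (c k) sequentially"
      proof (rule uniform_limitI)
        fix e :: real assume "e > 0"
        have "(\<lambda>n. M / R ^ k / (real n + 1)) \<longlonglongrightarrow> 0"
          by real_asymp
        from order_tendstoD(2)[OF this \<open>e > 0\<close>]
        show "\<forall>\<^sub>F n in sequentially. \<forall>t\<in>cball x d. dist (Q n t) (c k t) < e"
        proof eventually_elim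
          case (elim n)
          show ?case
          proof
            fix t assume "t \<in> cball x d"
            hence "t \<in> ball 0 R" using d by blast
            from est[OF this, of n] elim show "dist (Q n t) (c k t) < e" by (simp add: dist_norm)
          qed
        qed
      qed
      with d show ?thesis by blast
    qed
  qed auto
  thus ?case by (simp add: c_def[abs_def])
qed

section \<open>Polydiscs, multi-indices and Osgood's lemma\<close>

definition polydisc :: "real \<Rightarrow> (complex ^ 'd) set" where
  "polydisc R = {z. \<forall>i. cmod (z $ i) < R}"

definition coord_upd :: "complex ^ 'd \<Rightarrow> 'd \<Rightarrow> complex \<Rightarrow> complex ^ 'd" where
  "coord_upd z i t = (\<chi> j. if j = i then t else z $ j)"

definition mono_deg :: "('d::finite \<Rightarrow>\<^sub>0 nat) \<Rightarrow> nat" where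
  "mono_deg \<alpha> = (\<Sum>i\<in>UNIV. Poly_Mapping.lookup \<alpha> i)"

lemma coord_upd_nth [simp]: "coord_upd z i t $ j = (if j = i then t else z $ j)"
  by (simp add: coord_upd_def)

lemma coord_upd_in_polydisc: "z \<in> polydisc R \<Longrightarrow> cmod t < R \<Longrightarrow> coord_upd z i t \<in> polydisc R"
  by (auto simp: polydisc_def)

lemma mono_deg_0 [simp]: "mono_deg 0 = 0"
  by (simp add: mono_deg_def)

lemma mono_deg_add: "mono_deg (\<alpha> + \<beta>) = mono_deg \<alpha> + mono_deg \<beta>"
  by (simp add: mono_deg_def lookup_add sum.distrib)

lemma mono_deg_single [simp]: "mono_deg (Poly_Mapping.single i k) = k"
  by (simp add: mono_deg_def lookup_single when_def)

lemma mono_deg_eq_0_iff: "mono_deg \<alpha> = 0 \<longleftrightarrow> \<alpha> = 0"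
  by (auto simp: mono_deg_def intro!: poly_mapping_eqI)

lemma monom_eval_0 [simp]: "monom_eval 0 z = 1"
  by (simp add: monom_eval_def)

lemma monom_eval_add: "monom_eval (\<alpha> + \<beta>) z = monom_eval \<alpha> z * monom_eval \<beta> z"
  by (simp add: monom_eval_def lookup_add power_add prod.distrib)

lemma monom_eval_single: "monom_eval (Poly_Mapping.single i k) z = (z $ i) ^ k"
  by (simp add: monom_eval_def lookup_single when_def if_distrib[of "\<lambda>n. _ ^ n"] cong: if_cong)

lemma norm_monom_eval: "cmod (monom_eval \<alpha> z) = (\<Prod>i\<in>UNIV. cmod (z $ i) ^ Poly_Mapping.lookup \<alpha> i)"
  by (simp add: monom_eval_def norm_power flip: prod_norm)

lemma monom_eval_cong:
  "(\<And>i. i \<in> Poly_Mapping.keys \<alpha> \<Longrightarrow> z $ i = w $ i) \<Longrightarrow> monom_eval \<alpha> z = monom_eval \<alpha> w"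
  unfolding monom_eval_def by (intro prod.cong refl) (metis in_keys_iff power_0)

lemma monom_eval_zero: "monom_eval \<alpha> 0 = (if \<alpha> = 0 then 1 else 0)"
proof (cases "\<alpha> = 0")
  case False
  then obtain i where "Poly_Mapping.lookup \<alpha> i \<noteq> 0" by (metis lookup_zero poly_mapping_eqI)
  hence "monom_eval \<alpha> 0 = 0" unfolding monom_eval_def by (intro prod_zero) (auto intro!: exI[of _ i])
  with False show ?thesis by simp
qed simp

text \<open>Splits off the exponent of the variable s, so that sums over multi-indices can be
  treated by induction on the set of variables that occur.\<close>

lemma bij_betw_multiindex_insert:
  assumes "s \<notin> S"
  shows "bij_betw (\<lambda>(k, \<beta>). \<beta> + Poly_Mapping.single s k) (UNIV \<times> {\<beta>. Poly_Mapping.keys \<beta> \<subseteq> S})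
           {\<alpha> :: 'd \<Rightarrow>\<^sub>0 nat. Poly_Mapping.keys \<alpha> \<subseteq> insert s S}"
proof (rule bij_betwI[where g = "\<lambda>\<alpha>. (Poly_Mapping.lookup \<alpha> s, Poly_Mapping.update s 0 \<alpha>)"])
  have z: "Poly_Mapping.lookup \<beta> s = 0" if "Poly_Mapping.keys \<beta> \<subseteq> S" for \<beta> :: "'d \<Rightarrow>\<^sub>0 nat"
    using that assms by (metis in_keys_iff subsetD)
  show "(\<lambda>(k, \<beta>). \<beta> + Poly_Mapping.single s k) \<in> UNIV \<times> {\<beta> :: 'd \<Rightarrow>\<^sub>0 nat. Poly_Mapping.keys \<beta> \<subseteq> S} \<rightarrow>
          {\<alpha>. Poly_Mapping.keys \<alpha> \<subseteq> insert s S}"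
    by (auto simp: in_keys_iff lookup_add lookup_single when_def split: if_splits)
       (metis in_keys_iff not_gr_zero subset_iff)
  show "(\<lambda>\<alpha>. (Poly_Mapping.lookup \<alpha> s, Poly_Mapping.update s 0 \<alpha>)) \<in>
     {\<alpha> :: 'd \<Rightarrow>\<^sub>0 nat. Poly_Mapping.keys \<alpha> \<subseteq> insert s S} \<rightarrow> UNIV \<times> {\<beta>. Poly_Mapping.keys \<beta> \<subseteq> S}"
    by (auto simp: keys_update)
  show "(\<lambda>\<alpha>. (Poly_Mapping.lookup \<alpha> s, Poly_Mapping.update s 0 \<alpha>))
          ((\<lambda>(k, \<beta>). \<beta> + Poly_Mapping.single s k) x) = x"
    if "x \<in> UNIV \<times> {\<beta> :: 'd \<Rightarrow>\<^sub>0 nat. Poly_Mapping.keys \<beta> \<subseteq> S}" for x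
    using that z by (auto intro!: poly_mapping_eqI simp: lookup_add lookup_single lookup_update when_def)
  show "(\<lambda>(k, \<beta>). \<beta> + Poly_Mapping.single s k) (Poly_Mapping.lookup \<alpha> s, Poly_Mapping.update s 0 \<alpha>) = \<alpha>"
    for \<alpha> :: "'d \<Rightarrow>\<^sub>0 nat"
    by (auto intro!: poly_mapping_eqI simp: lookup_add lookup_single lookup_update when_def)
qed

lemma summable_geometric_multiindex:
  fixes t :: "'d::finite \<Rightarrow> real"
  assumes "\<And>i. 0 \<le> t i" "\<And>i. t i < 1"
  shows "(\<lambda>\<alpha>. \<Prod>i\<in>UNIV. t i ^ Poly_Mapping.lookup \<alpha> i) summable_on UNIV"
proof -
  let ?f = "\<lambda>\<alpha>. \<Prod>i\<in>UNIV. t i ^ Poly_Mapping.lookup \<alpha> i"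
  have "?f summable_on {\<alpha>. Poly_Mapping.keys \<alpha> \<subseteq> S}" for S
  proof (induction S rule: finite_induct[OF finite])
    case 1
    have "{\<alpha> :: 'd \<Rightarrow>\<^sub>0 nat. Poly_Mapping.keys \<alpha> \<subseteq> {}} = {0}" by auto
    thus ?case by simp
  next
    case (2 s S)
    have split: "?f (\<beta> + Poly_Mapping.single s k) = t s ^ k * ?f \<beta>" for k \<beta>
      by (simp add: lookup_add power_add prod.distrib lookup_single when_def if_distrib[of "\<lambda>n. _ ^ n"] 
          cong: if_cong)
    have "(\<lambda>(k, \<beta>). t s ^ k * ?f \<beta>) summable_on (UNIV \<times> {\<beta>. Poly_Mapping.keys \<beta> \<subseteq> S})"
    proof (rule summable_on_SigmaI)
      show "((\<lambda>\<beta>. case (k, \<beta>) of (k, \<beta>) \<Rightarrow> t s ^ k * ?f \<beta>) has_sum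
          t s ^ k * infsum ?f {\<beta>. Poly_Mapping.keys \<beta> \<subseteq> S}) {\<beta>. Poly_Mapping.keys \<beta> \<subseteq> S}" for k
        using has_sum_infsum[OF 2(3)] by (auto intro!: has_sum_cmult_right)
      show "(\<lambda>k. t s ^ k * infsum ?f {\<beta>. Poly_Mapping.keys \<beta> \<subseteq> S}) summable_on UNIV"
        using assms[of s] by (intro summable_on_cmult_left norm_summable_imp_summable_on) simp
    qed (auto intro!: mult_nonneg_nonneg prod_nonneg zero_le_power assms)
    hence "(\<lambda>x. ?f ((\<lambda>(k, \<beta>). \<beta> + Poly_Mapping.single s k) x)) summable_on
             (UNIV \<times> {\<beta>. Poly_Mapping.keys \<beta> \<subseteq> S})"
      by (rule summable_on_cong[THEN iffD1, rotated]) (auto simp: split)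
    thus ?case
      using summable_on_reindex_bij_betw[OF bij_betw_multiindex_insert[OF 2(2)], of ?f] by simp
  qed
  from this[of UNIV] show ?thesis by simp
qed

text \<open>The terms are dominated by a product of geometric series with ratios |z_i| / R.\<close>

lemma abs_summable_power_series:
  fixes a :: "('d::finite \<Rightarrow>\<^sub>0 nat) \<Rightarrow> complex"
  assumes a: "\<And>\<alpha>. cmod (a \<alpha>) \<le> M / R ^ mono_deg \<alpha>" and R: "R > 0" and z: "z \<in> polydisc R"
  shows "(\<lambda>\<alpha>. cmod (a \<alpha> * monom_eval \<alpha> z)) summable_on A"
proof -
  have *: "cmod (a \<alpha> * monom_eval \<alpha> z) \<le> M * (\<Prod>i\<in>UNIV. (cmod (z $ i) / R) ^ Poly_Mapping.lookup \<alpha> i)" for \<alpha>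
  proof -
    have "cmod (a \<alpha> * monom_eval \<alpha> z) \<le> M / R ^ mono_deg \<alpha> * (\<Prod>i\<in>UNIV. cmod (z $ i) ^ Poly_Mapping.lookup \<alpha> i)"
      unfolding norm_mult norm_monom_eval by (intro mult_right_mono a prod_nonneg) auto
    also have "\<dots> = M * (\<Prod>i\<in>UNIV. (cmod (z $ i) / R) ^ Poly_Mapping.lookup \<alpha> i)"
      by (simp add: mono_deg_def power_sum power_divide prod_dividef)
    finally show ?thesis .
  qed
  have "(\<lambda>\<alpha>. M * (\<Prod>i\<in>UNIV. (cmod (z $ i) / R) ^ Poly_Mapping.lookup \<alpha> i)) summable_on UNIV"
    using R z by (intro summable_on_cmult_right summable_geometric_multiindex) (auto simp: polydisc_def)
  hence "(\<lambda>\<alpha>. cmod (a \<alpha> * monom_eval \<alpha> z)) summable_on UNIV"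
    by (rule Infinite_Sum.abs_summable_on_comparison_test') (use * in auto)
  thus ?thesis by (rule summable_on_subset_banach) auto
qed

text \<open>Osgood's lemma, by induction on the set S of variables on which g depends. The Taylor
  coefficients of g in one variable are functions of the remaining ones; they inherit separate
  holomorphy by \<open>taylor_coeff_holomorphic_param\<close> and have the bound
  \<open>M / R ^ k\<close> by Cauchy, which accounts for the exponent
  \<open>mono_deg \<alpha>\<close> in the end.\<close>

lemma separately_holomorphic_power_series_aux:
  fixes g :: "complex ^ 'd::finite \<Rightarrow> complex"
  assumes R: "R > 0"
    and "\<And>z i. z \<in> polydisc R \<Longrightarrow> (\<lambda>t. g (coord_upd z i t)) holomorphic_on ball 0 R"
    and "\<And>z. z \<in> polydisc R \<Longrightarrow> cmod (g z) \<le> M"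
    and "\<And>z w. (\<forall>i\<in>S. z $ i = w $ i) \<Longrightarrow> g z = g w"
  shows "\<exists>a. (\<forall>\<alpha>. cmod (a \<alpha>) \<le> M / R ^ mono_deg \<alpha>) \<and>
    (\<forall>z\<in>polydisc R. ((\<lambda>\<alpha>. a \<alpha> * monom_eval \<alpha> z) has_sum g z) {\<alpha>. Poly_Mapping.keys \<alpha> \<subseteq> S})"
  using assms(2-)
proof (induction S arbitrary: g M rule: finite_induct[OF finite])
  case 1
  have 0: "0 \<in> polydisc R" using R by (simp add: polydisc_def)
  have M: "M \<ge> 0" using 1(2)[OF 0] norm_ge_zero order_trans by blast
  have g: "g z = g 0" for z by (rule 1(3)) auto
  have e: "{\<alpha> :: 'd \<Rightarrow>\<^sub>0 nat. Poly_Mapping.keys \<alpha> \<subseteq> {}} = {0}" by auto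
  show ?case
    using M 1(2)[OF 0] g R unfolding e
    by (intro exI[of _ "\<lambda>\<alpha>. if \<alpha> = 0 then g 0 else 0"]) (auto intro!: has_sum_finiteI)
next
  case (2 s S)
  define c where "c k z = (deriv ^^ k) (\<lambda>t. g (coord_upd z s t)) 0 / fact k" for k z
  have swap: "coord_upd (coord_upd z i t) s u = coord_upd (coord_upd z s u) i t" if "i \<noteq> s" for z i t u
    using that by (auto simp: Finite_Cartesian_Product.vec_eq_iff)
  have idem: "coord_upd (coord_upd z s t) s u = coord_upd z s u" for z t u
    by (auto simp: Finite_Cartesian_Product.vec_eq_iff)
  have "\<exists>a. (\<forall>\<alpha>. cmod (a \<alpha>) \<le> (M / R ^ k) / R ^ mono_deg \<alpha>) \<and>
    (\<forall>z\<in>polydisc R. ((\<lambda>\<alpha>. a \<alpha> * monom_eval \<alpha> z) has_sum c k z) {\<alpha>. Poly_Mapping.keys \<alpha> \<subseteq> S})" for k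
  proof (rule 2(3))
    show "cmod (c k z) \<le> M / R ^ k" if "z \<in> polydisc R" for z
      unfolding c_def using that
      by (intro norm_taylor_coeff_le 2(4,5) R coord_upd_in_polydisc) auto
    show "(\<lambda>t. c k (coord_upd z i t)) holomorphic_on ball 0 R" if z: "z \<in> polydisc R" for z i
    proof (cases "i = s")
      case True
      thus ?thesis by (simp add: c_def idem)
    next
      case False
      show ?thesis unfolding c_def
      proof (rule taylor_coeff_holomorphic_param[OF R])
        show "(\<lambda>u. g (coord_upd (coord_upd z i t) s u)) holomorphic_on ball 0 R" if "t \<in> ball 0 R" for t
          using that z by (intro 2(4) coord_upd_in_polydisc) auto
        show "(\<lambda>t. g (coord_upd (coord_upd z i t) s u)) holomorphic_on ball 0 R" if "u \<in> ball 0 R" for u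
          unfolding swap[OF False] using that z by (intro 2(4) coord_upd_in_polydisc) auto
        show "cmod (g (coord_upd (coord_upd z i t) s u)) \<le> M" if "u \<in> ball 0 R" "t \<in> ball 0 R" for t u
          using that z by (intro 2(5) coord_upd_in_polydisc) auto
      qed
    qed
    show "c k z = c k w" if "\<forall>i\<in>S. z $ i = w $ i" for z w
    proof -
      have "(\<lambda>t. g (coord_upd z s t)) = (\<lambda>t. g (coord_upd w s t))"
        by (rule ext, rule 2(6)) (use that in auto)
      thus ?thesis by (simp add: c_def)
    qed
  qed
  then obtain A where A: "\<And>k \<alpha>. cmod (A k \<alpha>) \<le> (M / R ^ k) / R ^ mono_deg \<alpha>"
     "\<And>k z. z \<in> polydisc R \<Longrightarrow> ((\<lambda>\<alpha>. A k \<alpha> * monom_eval \<alpha> z) has_sum c k z) {\<alpha>. Poly_Mapping.keys \<alpha> \<subseteq> S}"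
    by metis
  define a where "a \<alpha> = A (Poly_Mapping.lookup \<alpha> s) (Poly_Mapping.update s 0 \<alpha>)" for \<alpha>
  have upd: "Poly_Mapping.update s 0 \<alpha> + Poly_Mapping.single s (Poly_Mapping.lookup \<alpha> s) = \<alpha>" for \<alpha> :: "'d \<Rightarrow>\<^sub>0 nat"
    by (auto intro!: poly_mapping_eqI simp: lookup_add lookup_single lookup_update when_def)
  have a_bound: "cmod (a \<alpha>) \<le> M / R ^ mono_deg \<alpha>" for \<alpha>
  proof -
    have "mono_deg \<alpha> = mono_deg (Poly_Mapping.update s 0 \<alpha>) + Poly_Mapping.lookup \<alpha> s"
      by (subst (1) upd[symmetric]) (simp only: mono_deg_add mono_deg_single)
    thus ?thesis unfolding a_def using A(1)[of "Poly_Mapping.lookup \<alpha> s" "Poly_Mapping.update s 0 \<alpha>"]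
      by (simp add: power_add field_simps)
  qed
  have a_split: "a (\<beta> + Poly_Mapping.single s k) = A k \<beta>" if "Poly_Mapping.keys \<beta> \<subseteq> S" for \<beta> k
  proof -
    have "Poly_Mapping.lookup \<beta> s = 0" using that 2(2) by (metis in_keys_iff subsetD)
    moreover from this have "Poly_Mapping.update s 0 (\<beta> + Poly_Mapping.single s k) = \<beta>"
      by (auto intro!: poly_mapping_eqI simp: lookup_add lookup_single lookup_update when_def)
    ultimately show ?thesis by (simp add: a_def lookup_add)
  qed
  show ?case
  proof (intro exI[of _ a] conjI allI ballI a_bound)
    fix z :: "complex ^ 'd" assume z: "z \<in> polydisc R"
    let ?e = "\<lambda>(k, \<beta>). \<beta> + Poly_Mapping.single s k"
    let ?f = "\<lambda>\<alpha>. a \<alpha> * monom_eval \<alpha> z"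
    let ?B = "{\<beta>. Poly_Mapping.keys \<beta> \<subseteq> S}"
    have zs: "cmod (z $ s) < R" using z by (simp add: polydisc_def)
    have "((\<lambda>x. ?f (?e x)) has_sum g z) (UNIV \<times> ?B)"
    proof (rule has_sum_SigmaI)
      show "((\<lambda>\<beta>. ?f (?e (k, \<beta>))) has_sum (c k z * z $ s ^ k)) ?B" for k
        using has_sum_cmult_left[OF A(2)[OF z], of k "z $ s ^ k"]
        by (rule has_sum_cong[THEN iffD1, rotated])
           (simp add: a_split monom_eval_add monom_eval_single)
      have gz: "g (coord_upd z s t) = g z" if "t = z $ s" for t
        by (rule 2(6)) (use that in auto)
      have "(\<lambda>k. c k z * z $ s ^ k) sums g z"
        using holomorphic_power_series[OF 2(4)[OF z, of s], of "z $ s"] zs by (simp add: c_def gz)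
      moreover have "summable (\<lambda>k. cmod (c k z * z $ s ^ k))"
      proof (rule summable_comparison_test'[where N = 0])
        have "cmod (z $ s / of_real R) < 1" using zs R by (simp add: norm_divide)
        thus "summable (\<lambda>k. M * cmod (z $ s / of_real R) ^ k)"
          by (intro summable_mult summable_geometric) auto
        have "cmod (c k z) \<le> M / R ^ k" for k
          unfolding c_def using z
          by (intro norm_taylor_coeff_le 2(4,5) R coord_upd_in_polydisc) auto
        hence "cmod (c k z) * cmod (z $ s) ^ k \<le> M / R ^ k * cmod (z $ s) ^ k" for k
          by (intro mult_right_mono) auto
        thus "norm (cmod (c k z * z $ s ^ k)) \<le> M * cmod (z $ s / of_real R) ^ k" for k
          using R by (simp add: norm_mult norm_power norm_divide power_divide)
      qed
      ultimately show "((\<lambda>k. c k z * z $ s ^ k) has_sum g z) UNIV"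
        by (rule norm_summable_imp_has_sum[rotated])
      have "?f summable_on {\<alpha>. Poly_Mapping.keys \<alpha> \<subseteq> insert s S}"
        by (rule Infinite_Sum.abs_summable_summable[OF abs_summable_power_series[OF a_bound R z]])
      thus "(\<lambda>x. ?f (?e x)) summable_on (UNIV \<times> ?B)"
        using summable_on_reindex_bij_betw[OF bij_betw_multiindex_insert[OF 2(2)], of ?f] by simp
    qed
    thus "(?f has_sum g z) {\<alpha>. Poly_Mapping.keys \<alpha> \<subseteq> insert s S}"
      using has_sum_reindex_bij_betw[OF bij_betw_multiindex_insert[OF 2(2)], of ?f] by simp
  qed
qed

lemma separately_holomorphic_power_series:
  fixes g :: "complex ^ 'd::finite \<Rightarrow> complex"
  assumes "R > 0"
    and "\<And>z i. z \<in> polydisc R \<Longrightarrow> (\<lambda>t. g (coord_upd z i t)) holomorphic_on ball 0 R"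
    and "\<And>z. z \<in> polydisc R \<Longrightarrow> cmod (g z) \<le> M"
  obtains a where "\<And>\<alpha>. cmod (a \<alpha>) \<le> M / R ^ mono_deg \<alpha>"
    and "\<And>z. z \<in> polydisc R \<Longrightarrow> ((\<lambda>\<alpha>. a \<alpha> * monom_eval \<alpha> z) has_sum g z) UNIV"
proof -
  have "g z = g w" if "\<forall>i\<in>UNIV. z $ i = w $ i" for z w
    using that by (metis UNIV_I Finite_Cartesian_Product.vec_eq_iff)
  from separately_holomorphic_power_series_aux[OF assms this, of UNIV] that show ?thesis by auto
qed

section \<open>Uniqueness of the coefficients\<close>

lemma powser_zero_imp_coeffs_zero:
  fixes a :: "nat \<Rightarrow> complex"
  assumes "r > 0" "\<And>t. cmod t < r \<Longrightarrow> (\<lambda>n. a n * t ^ n) sums 0"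
  shows "a n = 0"
proof (rule ccontr)
  assume n: "a n \<noteq> 0"
  have "a 0 = 0" using assms(2)[of 0] \<open>r > 0\<close> by simp
  hence "n > 0" using n by (metis not_gr_zero)
  show False
  proof (rule powser_0_nonzero[of r 0 a "\<lambda>_. 0" n])
    fix s :: real assume "0 < s" "\<And>z. z \<in> cball (0::complex) s - {0} \<Longrightarrow> (0 :: complex) \<noteq> 0"
    from this(2)[of "of_real s"] this(1) show False by auto
  qed (use assms n \<open>n > 0\<close> in auto)
qed

text \<open>With the other variables fixed, the sum is a vanishing power series in the variable s.
  Its coefficients are power series in fewer variables that vanish on the whole polydisc, so the
  induction hypothesis applies to them.\<close>

lemma power_series_zero_aux:
  fixes d :: "('d::finite \<Rightarrow>\<^sub>0 nat) \<Rightarrow> complex"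
  assumes "r > 0"
    and "\<And>z. z \<in> polydisc r \<Longrightarrow> ((\<lambda>\<alpha>. d \<alpha> * monom_eval \<alpha> z) has_sum 0) {\<alpha>. Poly_Mapping.keys \<alpha> \<subseteq> S}"
    and "Poly_Mapping.keys \<alpha> \<subseteq> S"
  shows "d \<alpha> = 0"
  using assms(2-)
proof (induction S arbitrary: d \<alpha> rule: finite_induct[OF finite])
  case 1
  have e: "{\<alpha> :: 'd \<Rightarrow>\<^sub>0 nat. Poly_Mapping.keys \<alpha> \<subseteq> {}} = {0}" by auto
  have "0 \<in> polydisc r" using \<open>r > 0\<close> by (simp add: polydisc_def)
  from 1(1)[OF this] have "d 0 = 0"
    unfolding e using has_sum_finite[of "{0}" "\<lambda>\<alpha>. d \<alpha> * monom_eval \<alpha> 0"] has_sum_unique by fastforce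
  with 1(2) show ?case by auto
next
  case (2 s S)
  let ?B = "{\<beta> :: 'd \<Rightarrow>\<^sub>0 nat. Poly_Mapping.keys \<beta> \<subseteq> S}"
  let ?e = "\<lambda>(k, \<beta>). \<beta> + Poly_Mapping.single s k"
  define D where "D k \<beta> = d (\<beta> + Poly_Mapping.single s k)" for k \<beta>
  have D: "((\<lambda>(k, \<beta>). D k \<beta> * monom_eval \<beta> z * z $ s ^ k) has_sum 0) (UNIV \<times> ?B)" if "z \<in> polydisc r" for z
    using 2(4)[OF that]
    unfolding has_sum_reindex_bij_betw[OF bij_betw_multiindex_insert[OF 2(2)], symmetric]
    by (simp add: case_prod_unfold D_def monom_eval_add monom_eval_single mult.assoc)
  have upd: "monom_eval \<beta> (coord_upd z s t) = monom_eval \<beta> z" if "\<beta> \<in> ?B" for \<beta> z t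
    using that 2(2) by (intro monom_eval_cong) auto
  have summ: "(\<lambda>\<beta>. D k \<beta> * monom_eval \<beta> z) summable_on ?B" if z: "z \<in> polydisc r" for z k
  proof -
    \<comment> \<open>Any nonzero value of the variable s in the disc would do: division by its k-th
      power extracts summability of the inner series from that of the double series.\<close>
    let ?t = "complex_of_real (r / 2)"
    have "(\<lambda>(k, \<beta>). D k \<beta> * monom_eval \<beta> z * ?t ^ k) summable_on (UNIV \<times> ?B)"
      using D[OF coord_upd_in_polydisc[OF z, of ?t s]] \<open>r > 0\<close>
      by (intro has_sum_imp_summable, subst has_sum_cong) (auto simp: upd)
    from summable_on_SigmaD1[OF this, of k] have "(\<lambda>\<beta>. D k \<beta> * monom_eval \<beta> z * ?t ^ k) summable_on ?B"
      by simp
    thus ?thesis using \<open>r > 0\<close> by (subst (asm) summable_on_cmult_left') auto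
  qed
  have "((\<lambda>\<beta>. D k \<beta> * monom_eval \<beta> z) has_sum 0) ?B" if z: "z \<in> polydisc r" for z k
  proof -
    define C where "C k = infsum (\<lambda>\<beta>. D k \<beta> * monom_eval \<beta> z) ?B" for k
    have "(\<lambda>k. C k * t ^ k) sums 0" if t: "cmod t < r" for t
    proof -
      have "((\<lambda>(k, \<beta>). D k \<beta> * monom_eval \<beta> z * t ^ k) has_sum 0) (UNIV \<times> ?B)"
        using D[OF coord_upd_in_polydisc[OF z t, of s]]
        by (subst has_sum_cong) (auto simp: upd)
      hence "((\<lambda>k. C k * t ^ k) has_sum 0) UNIV"
      proof (rule has_sum_Sigma')
        show "((\<lambda>\<beta>. case (k, \<beta>) of (k, \<beta>) \<Rightarrow> D k \<beta> * monom_eval \<beta> z * t ^ k) has_sum C k * t ^ k) ?B" for k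
          using has_sum_infsum[OF summ[OF z, of k]] by (auto simp: C_def intro!: has_sum_cmult_left)
      qed
      thus ?thesis by (rule has_sum_imp_sums)
    qed
    from powser_zero_imp_coeffs_zero[OF \<open>r > 0\<close> this, of k] show ?thesis
      using has_sum_infsum[OF summ[OF z, of k]] by (simp add: C_def)
  qed
  from 2(3)[OF this] have *: "D k \<beta> = 0" if "\<beta> \<in> ?B" for k \<beta> using that by simp
  have "\<alpha> \<in> ?e ` (UNIV \<times> ?B)"
    unfolding bij_betw_imp_surj_on[OF bij_betw_multiindex_insert[OF 2(2)]] using 2(5) by simp
  then obtain k \<beta> where "\<beta> \<in> ?B" "\<alpha> = \<beta> + Poly_Mapping.single s k" by auto
  with * show ?case by (simp add: D_def)
qed

lemma norm_less_imp_polydisc: "norm z < R \<Longrightarrow> z \<in> polydisc R"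
  unfolding polydisc_def using Finite_Cartesian_Product.norm_nth_le[of z] by (auto intro: le_less_trans)

lemma polydisc_imp_norm_less:
  fixes z :: "complex ^ 'd::finite"
  assumes "z \<in> polydisc (r / CARD('d))"
  shows "norm z < r"
proof -
  have "norm z \<le> (\<Sum>i\<in>UNIV. cmod (z $ i))"
    unfolding norm_vec_def by (rule L2_set_le_sum) auto
  also have "\<dots> < (\<Sum>i\<in>(UNIV :: 'd set). r / CARD('d))"
    using assms by (intro sum_strict_mono) (auto simp: polydisc_def)
  also have "\<dots> = r" by simp
  finally show ?thesis .
qed

lemma power_series_unique:
  fixes a b :: "('d::finite \<Rightarrow>\<^sub>0 nat) \<Rightarrow> complex"
  assumes "r > 0"
    and "\<And>z. norm z < r \<Longrightarrow> ((\<lambda>\<alpha>. a \<alpha> * monom_eval \<alpha> z) has_sum g z) UNIV"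
    and "\<And>z. norm z < r \<Longrightarrow> ((\<lambda>\<alpha>. b \<alpha> * monom_eval \<alpha> z) has_sum g z) UNIV"
  shows "a = b"
proof
  fix \<alpha>
  have "a \<alpha> - b \<alpha> = 0"
  proof (rule power_series_zero_aux[where S = UNIV and d = "\<lambda>\<alpha>. a \<alpha> - b \<alpha>" and r = "r / CARD('d)"])
    fix z :: "complex ^ 'd" assume "z \<in> polydisc (r / CARD('d))"
    hence "norm z < r" by (rule polydisc_imp_norm_less)
    from has_sum_add[OF assms(2)[OF this] has_sum_uminusI[OF assms(3)[OF this]]]
    show "((\<lambda>\<alpha>. (a \<alpha> - b \<alpha>) * monom_eval \<alpha> z) has_sum 0) {\<alpha>. Poly_Mapping.keys \<alpha> \<subseteq> UNIV}"
      by (simp add: ring_distribs)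
  qed (use \<open>r > 0\<close> in auto)
  thus "a \<alpha> = b \<alpha>" by simp
qed

text \<open>Evaluates the definite description: an expansion on any ball around \<mu> is the right
  one, since two expansions can be compared on the smaller ball.\<close>

lemma power_series_at_eqI:
  fixes a :: "('d::finite \<Rightarrow>\<^sub>0 nat) \<Rightarrow> complex"
  assumes "r > 0" "\<And>z. norm z < r \<Longrightarrow> ((\<lambda>\<alpha>. a \<alpha> * monom_eval \<alpha> z) has_sum g (\<mu> + z)) UNIV"
  shows "power_series_at g \<mu> = a"
  unfolding power_series_at_def
proof (rule the_equality)
  show "\<exists>r>0. \<forall>z\<in>ball \<mu> r. ((\<lambda>\<alpha>. a \<alpha> * monom_eval \<alpha> (z - \<mu>)) has_sum g z) UNIV"
    using assms(1) assms(2)[of "z - \<mu>" for z]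
    by (intro exI[of _ r]) (auto simp: dist_norm norm_minus_commute)
  fix b assume "\<exists>r>0. \<forall>z\<in>ball \<mu> r. ((\<lambda>\<alpha>. b \<alpha> * monom_eval \<alpha> (z - \<mu>)) has_sum g z) UNIV"
  then obtain r' where r': "r' > 0" "\<And>z. z\<in>ball \<mu> r' \<Longrightarrow> ((\<lambda>\<alpha>. b \<alpha> * monom_eval \<alpha> (z - \<mu>)) has_sum g z) UNIV"
    by auto
  show "b = a"
  proof (rule power_series_unique[where r = "min r r'" and g = "\<lambda>z. g (\<mu> + z)"])
    show "((\<lambda>\<alpha>. b \<alpha> * monom_eval \<alpha> z) has_sum g (\<mu> + z)) UNIV" if "norm z < min r r'" for z
      using r'(2)[of "\<mu> + z"] that by (simp add: dist_norm)
  qed (use assms r' in auto)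
qed

lemma separately_holomorphic_power_series_at:
  fixes g :: "complex ^ 'd::finite \<Rightarrow> complex"
  assumes R: "R > 0"
    and hol: "\<And>z i. z \<in> polydisc R \<Longrightarrow> (\<lambda>t. g (\<mu> + coord_upd z i t)) holomorphic_on ball 0 R"
    and bd: "\<And>z. z \<in> polydisc R \<Longrightarrow> cmod (g (\<mu> + z)) \<le> M"
  shows "cmod (power_series_at g \<mu> \<alpha>) \<le> M / R ^ mono_deg \<alpha>"
    and "z \<in> polydisc R \<Longrightarrow> ((\<lambda>\<alpha>. power_series_at g \<mu> \<alpha> * monom_eval \<alpha> z) has_sum g (\<mu> + z)) UNIV"
proof -
  obtain a where a: "\<And>\<alpha>. cmod (a \<alpha>) \<le> M / R ^ mono_deg \<alpha>"
    "\<And>z. z \<in> polydisc R \<Longrightarrow> ((\<lambda>\<alpha>. a \<alpha> * monom_eval \<alpha> z) has_sum g (\<mu> + z)) UNIV"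
    using separately_holomorphic_power_series[of R "\<lambda>z. g (\<mu> + z)" M] assms by blast
  have "power_series_at g \<mu> = a"
    by (rule power_series_at_eqI[OF R]) (auto intro: a norm_less_imp_polydisc)
  with a show "cmod (power_series_at g \<mu> \<alpha>) \<le> M / R ^ mono_deg \<alpha>"
    "z \<in> polydisc R \<Longrightarrow> ((\<lambda>\<alpha>. power_series_at g \<mu> \<alpha> * monom_eval \<alpha> z) has_sum g (\<mu> + z)) UNIV"
    by auto
qed

section \<open>Complex differentiability and local expansions\<close>

lemma holo_on_imp_has_derivative:
  assumes "holo_on g U" "open U" "z \<in> U"
  obtains D where "(g has_derivative D) (at z)" "\<And>c v. D (c *s v) = c * D v"
  using assms unfolding holo_on_def by (metis at_within_open)

lemma holo_on_subset: "holo_on g U \<Longrightarrow> V \<subseteq> U \<Longrightarrow> holo_on g V"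
  unfolding holo_on_def by (meson has_derivative_subset subsetD)

lemma bounded_linear_axis_smult: "bounded_linear (\<lambda>t. t *s (axis i 1 :: complex ^ 'd::finite))"
proof -
  have "linear (\<lambda>t. t *s (axis i 1 :: complex ^ 'd))"
    by (rule linearI) (auto simp: Finite_Cartesian_Product.vec_eq_iff ring_distribs)
  thus ?thesis by (simp add: linear_conv_bounded_linear)
qed

lemma coord_upd_eq: "coord_upd z i t = coord_upd z i 0 + t *s axis i 1"
  by (auto simp: Finite_Cartesian_Product.vec_eq_iff axis_def)

text \<open>Complex linearity turns the derivative along a coordinate line into multiplication by a
  complex number.\<close>

lemma holo_on_imp_separately_holomorphic:
  fixes g :: "complex ^ 'd::finite \<Rightarrow> complex"
  assumes g: "holo_on g U" "open U" and sub: "\<And>z. z \<in> polydisc R \<Longrightarrow> \<mu> + z \<in> U" and z: "z \<in> polydisc R"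
  shows "(\<lambda>t. g (\<mu> + coord_upd z i t)) holomorphic_on ball 0 R"
proof (rule holomorphic_onI)
  fix t :: complex assume t: "t \<in> ball 0 R"
  hence "\<mu> + coord_upd z i t \<in> U" using z by (intro sub coord_upd_in_polydisc) auto
  then obtain D where D: "(g has_derivative D) (at (\<mu> + coord_upd z i t))" "\<And>c v. D (c *s v) = c * D v"
    using holo_on_imp_has_derivative[OF g] by blast
  have "((\<lambda>t. \<mu> + coord_upd z i t) has_derivative (\<lambda>h. h *s axis i 1)) (at t)"
  proof -
    have "(\<lambda>t. \<mu> + coord_upd z i t) = (\<lambda>t. (\<mu> + coord_upd z i 0) + t *s axis i 1)"
      by (rule ext, subst coord_upd_eq, rule add.assoc[symmetric])
    thus ?thesis
      by (auto intro!: derivative_eq_intros bounded_linear.has_derivative[OF bounded_linear_axis_smult])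
  qed
  from has_derivative_compose[OF this D(1)]
  have "((\<lambda>t. g (\<mu> + coord_upd z i t)) has_field_derivative D (axis i 1)) (at t)"
    by (simp add: has_field_derivative_def D(2) mult_commute_abs)
  thus "(\<lambda>t. g (\<mu> + coord_upd z i t)) field_differentiable at t within ball 0 R"
    unfolding field_differentiable_def by (blast intro: has_field_derivative_at_within)
qed

text \<open>Differentiability gives continuity at \<mu>, hence the local bound |g \<mu>| + 1 that
  Osgood's lemma asks for.\<close>

lemma holo_on_power_series_at:
  fixes g :: "complex ^ 'd::finite \<Rightarrow> complex"
  assumes "holo_on g U" "open U" "\<mu> \<in> U"
  obtains r where "r > 0"
    "\<And>z. norm z < r \<Longrightarrow> ((\<lambda>\<alpha>. power_series_at g \<mu> \<alpha> * monom_eval \<alpha> z) has_sum g (\<mu> + z)) UNIV"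
proof -
  obtain D where "(g has_derivative D) (at \<mu>)" using holo_on_imp_has_derivative[OF assms] .
  hence "isCont g \<mu>" by (rule has_derivative_continuous)
  hence "eventually (\<lambda>w. dist (g w) (g \<mu>) < 1) (at \<mu>)"
    unfolding isCont_def by (rule tendstoD) simp
  hence "eventually (\<lambda>w. dist (g w) (g \<mu>) < 1 \<and> w \<in> U) (nhds \<mu>)"
    unfolding eventually_nhds_conv_at using eventually_at_in_open'[OF assms(2,3)] assms(3)
    by (auto simp: eventually_conj_iff)
  then obtain e where e: "e > 0" "\<And>w. dist w \<mu> < e \<Longrightarrow> dist (g w) (g \<mu>) < 1 \<and> w \<in> U"
    unfolding eventually_nhds_metric by auto
  \<comment> \<open>A polydisc of this radius lies in the ball of radius e, because the norm is at
    most the sum of the moduli of the coordinates.\<close>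
  define R where "R = e / CARD('d)"
  have R: "R > 0" using e by (simp add: R_def)
  have ball: "dist (\<mu> + z) \<mu> < e" if "z \<in> polydisc R" for z
    using polydisc_imp_norm_less[of z e] that by (simp add: R_def dist_norm)
  have "((\<lambda>\<alpha>. power_series_at g \<mu> \<alpha> * monom_eval \<alpha> z) has_sum g (\<mu> + z)) UNIV" if "z \<in> polydisc R" for z
  proof (rule separately_holomorphic_power_series_at(2)[OF R _ _ that])
    show "(\<lambda>t. g (\<mu> + coord_upd z i t)) holomorphic_on ball 0 R" if "z \<in> polydisc R" for z i
      by (rule holo_on_imp_separately_holomorphic[OF assms(1,2) _ that]) (use e ball in auto)
    show "cmod (g (\<mu> + z)) \<le> cmod (g \<mu>) + 1" if "z \<in> polydisc R" for z
    proof -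
      have "cmod (g (\<mu> + z) - g \<mu>) < 1" using e(2)[OF ball[OF that]] by (simp add: dist_norm)
      thus ?thesis using norm_triangle_ineq2[of "g (\<mu> + z)" "g \<mu>"] by linarith
    qed
  qed
  thus ?thesis using that[OF R] norm_less_imp_polydisc by blast
qed

lemma power_series_constant_coeff:
  fixes g :: "complex ^ 'd::finite \<Rightarrow> complex"
  assumes "r > 0" "\<And>z. norm z < r \<Longrightarrow> ((\<lambda>\<alpha>. a \<alpha> * monom_eval \<alpha> z) has_sum g (\<mu> + z)) UNIV"
  shows "a 0 = g \<mu>"
proof -
  have "((\<lambda>\<alpha>. a \<alpha> * monom_eval \<alpha> (0 :: complex ^ 'd)) has_sum a 0) UNIV"
    by (rule has_sum_finite_neutralI[where B = "{0}"]) (auto simp: monom_eval_zero)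
  moreover have "((\<lambda>\<alpha>. a \<alpha> * monom_eval \<alpha> (0 :: complex ^ 'd)) has_sum g \<mu>) UNIV"
    using assms(2)[of 0] \<open>r > 0\<close> by simp
  ultimately show ?thesis by (rule has_sum_unique)
qed

lemma power_series_at_cong:
  assumes "eventually (\<lambda>z. g z = h z) (nhds \<mu>)"
  shows "power_series_at g \<mu> = power_series_at h \<mu>"
proof -
  obtain e where e: "e > 0" "\<And>z. dist z \<mu> < e \<Longrightarrow> g z = h z"
    using assms unfolding eventually_nhds_metric by auto
  have imp: "(\<exists>r>0. \<forall>z\<in>ball \<mu> r. ((\<lambda>\<alpha>. a \<alpha> * monom_eval \<alpha> (z - \<mu>)) has_sum k z) UNIV)"
    if r: "\<exists>r>0. \<forall>z\<in>ball \<mu> r. ((\<lambda>\<alpha>. a \<alpha> * monom_eval \<alpha> (z - \<mu>)) has_sum l z) UNIV"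
      and eq: "\<And>z. dist z \<mu> < e \<Longrightarrow> k z = l z" for a k l
  proof -
    obtain r where r: "r > 0" "\<And>z. z\<in>ball \<mu> r \<Longrightarrow> ((\<lambda>\<alpha>. a \<alpha> * monom_eval \<alpha> (z - \<mu>)) has_sum l z) UNIV"
      using r by auto
    show ?thesis using r eq e(1) by (intro exI[of _ "min e r"]) (auto simp: dist_commute)
  qed
  have "(\<exists>r>0. \<forall>z\<in>ball \<mu> r. ((\<lambda>\<alpha>. a \<alpha> * monom_eval \<alpha> (z - \<mu>)) has_sum g z) UNIV) \<longleftrightarrow>
        (\<exists>r>0. \<forall>z\<in>ball \<mu> r. ((\<lambda>\<alpha>. a \<alpha> * monom_eval \<alpha> (z - \<mu>)) has_sum h z) UNIV)" for a
    by (rule iffI; erule imp) (use e(2) in auto)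
  thus ?thesis unfolding power_series_at_def by simp
qed

lemma bounded_linear_partial_sum:
  fixes c :: "'d::finite \<Rightarrow> complex"
  shows "bounded_linear (\<lambda>h. \<Sum>i\<in>UNIV. c i * h $ i)"
proof -
  have "linear (\<lambda>h. \<Sum>i\<in>UNIV. c i * h $ i)"
    by (rule linearI) (auto simp: ring_distribs sum.distrib scaleR_right.sum)
  thus ?thesis by (simp add: linear_conv_bounded_linear)
qed

text \<open>Only the derivative at the centre is computed, since the extension constructed later
  comes with an expansion around each point. The terms of degree at least 2 are estimated directly
  instead of differentiating termwise.\<close>

lemma power_series_has_derivative:
  fixes g :: "complex ^ 'd::finite \<Rightarrow> complex"
  assumes R: "R > 0" and a: "\<And>\<alpha>. cmod (a \<alpha>) \<le> M / R ^ mono_deg \<alpha>"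
    and s: "\<And>z. z \<in> polydisc R \<Longrightarrow> ((\<lambda>\<alpha>. a \<alpha> * monom_eval \<alpha> z) has_sum g (\<mu> + z)) UNIV"
  shows "(g has_derivative (\<lambda>h. \<Sum>i\<in>UNIV. a (Poly_Mapping.single i 1) * h $ i)) (at \<mu>)"
proof -
  let ?D = "\<lambda>h :: complex ^ 'd. \<Sum>i\<in>UNIV. a (Poly_Mapping.single i 1) * h $ i"
  let ?e = "\<lambda>i :: 'd. Poly_Mapping.single i (1 :: nat)"
  let ?L = "insert 0 (range ?e)"
  have M: "M \<ge> 0" using order_trans[OF norm_ge_zero a[of 0]] by simp
  have deg2: "mono_deg \<alpha> \<ge> 2" if "\<alpha> \<notin> ?L" for \<alpha> :: "'d \<Rightarrow>\<^sub>0 nat"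
  proof (rule ccontr)
    assume "\<not> mono_deg \<alpha> \<ge> 2"
    hence d: "mono_deg \<alpha> \<le> 1" by simp
    have "\<alpha> \<noteq> 0" using that by auto
    then obtain i where i: "Poly_Mapping.lookup \<alpha> i \<noteq> 0" by (metis lookup_zero poly_mapping_eqI)
    have "mono_deg \<alpha> = Poly_Mapping.lookup \<alpha> i + (\<Sum>j\<in>UNIV - {i}. Poly_Mapping.lookup \<alpha> j)"
      unfolding mono_deg_def by (rule sum.remove) auto
    hence "Poly_Mapping.lookup \<alpha> i = 1" "(\<Sum>j\<in>UNIV - {i}. Poly_Mapping.lookup \<alpha> j) = 0"
      using d i by linarith+
    hence "\<alpha> = ?e i" by (intro poly_mapping_eqI) (auto simp: lookup_single when_def)
    thus False using that by auto
  qed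
  have e0: "0 \<notin> range ?e"
  proof
    assume "0 \<in> range ?e"
    then obtain i where "0 = ?e i" by auto
    hence "mono_deg 0 = mono_deg (?e i)" by simp
    thus False by simp
  qed
  have inj_e: "inj ?e"
    by (rule injI) (metis lookup_single_eq lookup_single_not_eq zero_neq_one)
  define W where "W = infsum (\<lambda>\<alpha> :: 'd \<Rightarrow>\<^sub>0 nat. (1/2::real) ^ mono_deg \<alpha>) UNIV"
  have W: "(\<lambda>\<alpha> :: 'd \<Rightarrow>\<^sub>0 nat. (1/2::real) ^ mono_deg \<alpha>) summable_on UNIV"
    using summable_geometric_multiindex[of "\<lambda>_::'d. 1/2"] unfolding mono_deg_def power_sum by simp
  have rem: "cmod (g (\<mu> + h) - g \<mu> - ?D h) \<le> M * (2 * norm h / R)\<^sup>2 * W" if h: "norm h < R / 2" for h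
  proof -
    have hp: "h \<in> polydisc R" using h by (intro norm_less_imp_polydisc) (use R norm_ge_zero[of h] in linarith)
    have a0: "a 0 = g \<mu>"
      by (rule power_series_constant_coeff[OF R]) (auto intro: s norm_less_imp_polydisc)
    have "((\<lambda>\<alpha>. a \<alpha> * monom_eval \<alpha> h) has_sum (\<Sum>\<alpha>\<in>?L. a \<alpha> * monom_eval \<alpha> h)) ?L"
      by (rule has_sum_finite) auto
    also have "(\<Sum>\<alpha>\<in>?L. a \<alpha> * monom_eval \<alpha> h) = g \<mu> + ?D h"
      using e0 by (subst sum.insert) (auto simp: a0 sum.reindex[OF inj_e] o_def monom_eval_single simp del: One_nat_def)
    finally have "((\<lambda>\<alpha>. a \<alpha> * monom_eval \<alpha> h) has_sum (g (\<mu> + h) - (g \<mu> + ?D h))) (UNIV - ?L)"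
      by (intro has_sum_Diff s hp) auto
    moreover have "((\<lambda>\<alpha>. M * (2 * norm h / R)\<^sup>2 * (1/2) ^ mono_deg \<alpha>) has_sum
        M * (2 * norm h / R)\<^sup>2 * infsum (\<lambda>\<alpha>. (1/2) ^ mono_deg \<alpha>) (UNIV - ?L)) (UNIV - ?L)"
      by (intro has_sum_cmult_right has_sum_infsum summable_on_subset_banach[OF W]) auto
    moreover have "cmod (a \<alpha> * monom_eval \<alpha> h) \<le> M * (2 * norm h / R)\<^sup>2 * (1/2) ^ mono_deg \<alpha>"
      if "\<alpha> \<in> UNIV - ?L" for \<alpha>
    proof -
      have "mono_deg \<alpha> \<ge> 2" using deg2 that by auto
      have "cmod (monom_eval \<alpha> h) \<le> (\<Prod>i\<in>UNIV. norm h ^ Poly_Mapping.lookup \<alpha> i)"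
        unfolding norm_monom_eval
        by (intro prod_mono) (auto intro!: power_mono Finite_Cartesian_Product.norm_nth_le)
      also have "\<dots> = norm h ^ mono_deg \<alpha>" by (simp add: mono_deg_def power_sum)
      finally have "cmod (a \<alpha> * monom_eval \<alpha> h) \<le> M / R ^ mono_deg \<alpha> * norm h ^ mono_deg \<alpha>"
        unfolding norm_mult using R M by (intro mult_mono a) auto
      \<comment> \<open>The powers of 1/2 are kept to sum over \<alpha>; the other base is at most
        1, so its exponent can be lowered to 2, which makes the remainder quadratic in h.\<close>
      also have "\<dots> = M * (2 * norm h / R) ^ mono_deg \<alpha> * (1/2) ^ mono_deg \<alpha>"
        by (simp add: power_divide power_mult_distrib)
      also have "\<dots> \<le> M * (2 * norm h / R)\<^sup>2 * (1/2) ^ mono_deg \<alpha>"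
        using h R M \<open>mono_deg \<alpha> \<ge> 2\<close>
        by (intro mult_right_mono mult_left_mono power_decreasing) auto
      finally show ?thesis .
    qed
    ultimately have "cmod (g (\<mu> + h) - (g \<mu> + ?D h)) \<le>
        M * (2 * norm h / R)\<^sup>2 * infsum (\<lambda>\<alpha>. (1/2) ^ mono_deg \<alpha>) (UNIV - ?L)"
      by (rule norm_infsum_le)
    also have "\<dots> \<le> M * (2 * norm h / R)\<^sup>2 * W"
      unfolding W_def using M
      by (intro mult_left_mono infsum_mono2 W summable_on_subset_banach[OF W]) auto
    finally show ?thesis by (simp add: diff_diff_eq)
  qed
  have "W \<ge> 0" unfolding W_def by (rule infsum_nonneg) auto
  define K where "K = M * (2 / R)\<^sup>2 * W"
  show ?thesis
  proof (rule has_derivativeI_sandwich[where e = "R / 2" and H = "\<lambda>y. K * norm (y - \<mu>)"])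
    show "bounded_linear ?D" by (rule bounded_linear_partial_sum)
    show "norm (g y - g \<mu> - ?D (y - \<mu>)) / norm (y - \<mu>) \<le> K * norm (y - \<mu>)"
      if "y \<noteq> \<mu>" "dist y \<mu> < R / 2" for y
    proof -
      have "norm (g y - g \<mu> - ?D (y - \<mu>)) \<le> M * (2 * norm (y - \<mu>) / R)\<^sup>2 * W"
        using rem[of "y - \<mu>"] that by (simp add: dist_norm)
      also have "\<dots> = K * norm (y - \<mu>) * norm (y - \<mu>)"
        by (simp add: K_def power2_eq_square)
      finally show ?thesis using that by (simp add: divide_le_eq)
    qed
    have "((\<lambda>y. K * norm (y - \<mu>)) \<longlongrightarrow> K * norm (\<mu> - \<mu>)) (at \<mu>)" by (intro tendsto_intros)
    thus "((\<lambda>y. K * norm (y - \<mu>)) \<longlongrightarrow> 0) (at \<mu>)" by simp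
  qed (use R in auto)
qed

text \<open>Dominated convergence for unordered sums. It is stated for a filter because the limit in
  \<open>extension_exists\<close> is taken along a cluster filter and not along a sequence.\<close>

lemma has_sum_dominated_limit:
  fixes f :: "'n \<Rightarrow> 'a \<Rightarrow> complex"
  assumes F: "F \<noteq> bot" and h: "h summable_on UNIV"
    and dom: "\<And>n x. cmod (f n x) \<le> h x"
    and lim: "\<And>x. ((\<lambda>n. f n x) \<longlongrightarrow> f0 x) F"
    and s: "\<And>n. (f n has_sum s n) UNIV" and s0: "(s \<longlongrightarrow> s0) F"
  shows "(f0 has_sum s0) UNIV"
proof -
  have dom0: "cmod (f0 x) \<le> h x" for x
    by (rule tendsto_upperbound[OF tendsto_norm[OF lim] _ F]) (use dom in auto)
  have "(\<lambda>x. cmod (f0 x)) summable_on UNIV"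
    by (rule Infinite_Sum.abs_summable_on_comparison_test'[OF h]) (use dom0 in auto)
  hence f0: "f0 summable_on UNIV" by (rule Infinite_Sum.abs_summable_summable)
  have "(s \<longlongrightarrow> infsum f0 UNIV) F"
  proof (rule tendstoI)
    fix e :: real assume "e > 0"
    obtain A where A: "finite A" "dist (sum h A) (infsum h UNIV) \<le> e / 4"
      using has_sum_finite_approximation[OF has_sum_infsum[OF h], of "e / 4"] \<open>e > 0\<close> by auto
    have tail: "cmod (t - sum k A) \<le> e / 4" if "(k has_sum t) UNIV" "\<And>x. cmod (k x) \<le> h x" for k t
    proof -
      have "cmod (t - sum k A) \<le> infsum h UNIV - sum h A"
      proof (rule norm_infsum_le)
        show "(k has_sum t - sum k A) (UNIV - A)" using that A by (intro has_sum_Diff has_sum_finite) auto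
        show "(h has_sum infsum h UNIV - sum h A) (UNIV - A)"
          using h A by (intro has_sum_Diff has_sum_finite has_sum_infsum) auto
      qed (use that in auto)
      thus ?thesis using A(2) unfolding dist_real_def by linarith
    qed
    have "((\<lambda>n. sum (f n) A) \<longlongrightarrow> sum f0 A) F" by (intro tendsto_sum lim)
    hence "eventually (\<lambda>n. dist (sum (f n) A) (sum f0 A) < e / 4) F"
      by (rule tendstoD) (use \<open>e > 0\<close> in auto)
    thus "eventually (\<lambda>n. dist (s n) (infsum f0 UNIV) < e) F"
    proof eventually_elim
      case (elim n)
      have t1: "cmod (s n - sum (f n) A) \<le> e / 4" by (rule tail[OF s dom])
      have t2: "cmod (infsum f0 UNIV - sum f0 A) \<le> e / 4" by (rule tail[OF has_sum_infsum[OF f0] dom0])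
      have "dist (s n) (infsum f0 UNIV) \<le> cmod (s n - sum (f n) A) + cmod (sum (f n) A - sum f0 A)
          + cmod (infsum f0 UNIV - sum f0 A)"
        unfolding dist_norm using norm_triangle_ineq4[of "s n - sum f0 A" "infsum f0 UNIV - sum f0 A"]
          norm_triangle_ineq[of "s n - sum (f n) A" "sum (f n) A - sum f0 A"] by simp
      also have "\<dots> < e"
        using t1 t2 elim \<open>e > 0\<close> unfolding dist_norm by linarith
      finally show ?case .
    qed
  qed
  with s0 have "s0 = infsum f0 UNIV" using F tendsto_unique by blast
  thus ?thesis using f0 by simp
qed

section \<open>Commuting tuples of matrices\<close>

text \<open>With the size as a parameter, \<open>tuple_size\<close> stays out of the arguments. Size
  0 is allowed here; \<open>comm_tuples\<close> asks for a positive size in addition.\<close>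

definition commuting :: "nat \<Rightarrow> ('d::finite) mat_tuple \<Rightarrow> bool" where
  "commuting n x \<longleftrightarrow> (\<forall>i. x i \<in> carrier_mat n n) \<and> (\<forall>i j. x i * x j = x j * x i)"

lemma comm_tuples_eq: "comm_tuples = {x. \<exists>n\<ge>1. commuting n x}"
  by (simp add: comm_tuples_def commuting_def)

lemma commutingD: "commuting n x \<Longrightarrow> x i \<in> carrier_mat n n" "commuting n x \<Longrightarrow> x i * x j = x j * x i"
  by (auto simp: commuting_def)

lemma tuple_size_eq: "(\<And>i. x i \<in> carrier_mat n n) \<Longrightarrow> tuple_size x = n"
  unfolding tuple_size_def by (rule the_equality) (blast, metis carrier_matD(1))

lemma commuting_tuple_size: "commuting n x \<Longrightarrow> tuple_size x = n"
  by (rule tuple_size_eq) (rule commutingD)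

lemma comm_tuplesE:
  assumes "x \<in> comm_tuples"
  obtains "tuple_size x \<ge> 1" "commuting (tuple_size x) x"
  using assms commuting_tuple_size by (auto simp: comm_tuples_eq)

lemma pow_mat_add:
  assumes "A \<in> carrier_mat n n"
  shows "A ^\<^sub>m (k + l) = A ^\<^sub>m k * (A :: 'a :: semiring_1 mat) ^\<^sub>m l"
proof (induction l)
  case (Suc l)
  thus ?case using assms by (simp add: assoc_mult_mat[of _ n n _ n _ n])
qed (use assms in auto)

text \<open>Start of the intertwining calculus: a relation W x = y W with rectangular W passes to
  powers, monomials, polynomials and inserted power series. It covers similarities, projections onto
  blocks and joint eigenvectors alike.\<close>

lemma intertwine_pow_mat:
  assumes W: "W \<in> carrier_mat m n" and A: "A \<in> carrier_mat n n" and B: "B \<in> carrier_mat m m"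
    and eq: "W * A = B * (W :: 'a :: semiring_1 mat)"
  shows "W * A ^\<^sub>m k = B ^\<^sub>m k * W"
proof (induction k)
  case (Suc k)
  have "W * A ^\<^sub>m Suc k = W * A ^\<^sub>m k * A"
    using assms by (simp add: assoc_mult_mat[of _ m n _ n _ n])
  also have "\<dots> = B ^\<^sub>m k * (W * A)"
    unfolding Suc using assms by (simp add: assoc_mult_mat[of _ m m _ n _ n])
  also have "\<dots> = B ^\<^sub>m Suc k * W"
    unfolding eq using assms by (simp add: assoc_mult_mat[of _ m m _ m _ n])
  finally show ?case .
qed (use assms in auto)

lemma foldr_monom_carrier:
  "(\<And>i. x i \<in> carrier_mat n n) \<Longrightarrow> foldr (\<lambda>i A. (x i ^\<^sub>m e i) * A) is (1\<^sub>m n) \<in> carrier_mat n n"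
  by (induction "is") (auto intro!: mult_carrier_mat[of _ n n] pow_carrier_mat)

lemma intertwine_foldr_monom:
  assumes W: "W \<in> carrier_mat m n" and x: "\<And>i. x i \<in> carrier_mat n n" and y: "\<And>i. y i \<in> carrier_mat m m"
    and eq: "\<And>i. W * x i = y i * (W :: 'a :: semiring_1 mat)"
  shows "W * foldr (\<lambda>i A. (x i ^\<^sub>m e i) * A) is (1\<^sub>m n) = foldr (\<lambda>i A. (y i ^\<^sub>m e i) * A) is (1\<^sub>m m) * W"
proof (induction "is")
  case (Cons i "is")
  let ?X = "foldr (\<lambda>i A. (x i ^\<^sub>m e i) * A) is (1\<^sub>m n)" and ?Y = "foldr (\<lambda>i A. (y i ^\<^sub>m e i) * A) is (1\<^sub>m m)"
  have c: "?X \<in> carrier_mat n n" "?Y \<in> carrier_mat m m"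
    using foldr_monom_carrier[of x n e "is"] foldr_monom_carrier[of y m e "is"] x y by auto
  have p: "x i ^\<^sub>m e i \<in> carrier_mat n n" "y i ^\<^sub>m e i \<in> carrier_mat m m" using x y by auto
  have "W * (x i ^\<^sub>m e i * ?X) = (W * x i ^\<^sub>m e i) * ?X"
    using W p c by (simp add: assoc_mult_mat[of _ m n _ n _ n])
  also have "\<dots> = y i ^\<^sub>m e i * (W * ?X)"
    unfolding intertwine_pow_mat[OF W x y eq] using W p c by (simp add: assoc_mult_mat[of _ m m _ n _ n])
  also have "\<dots> = y i ^\<^sub>m e i * ?Y * W"
    unfolding Cons using W p c by (simp add: assoc_mult_mat[of _ m m _ m _ n])
  finally show ?case by simp
qed (use W in auto)

lemma monom_mat_carrier: "commuting n x \<Longrightarrow> monom_mat \<alpha> x \<in> carrier_mat n n"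
  unfolding monom_mat_def using foldr_monom_carrier[of x n] by (simp add: commuting_tuple_size commutingD)

lemma intertwine_monom_mat:
  assumes W: "W \<in> carrier_mat m n" and x: "commuting n x" and y: "commuting m y"
    and eq: "\<And>i. W * x i = y i * W"
  shows "W * monom_mat \<alpha> x = monom_mat \<alpha> y * W"
  unfolding monom_mat_def commuting_tuple_size[OF x] commuting_tuple_size[OF y]
  by (rule intertwine_foldr_monom[OF W commutingD(1)[OF x] commutingD(1)[OF y] eq])

lemma monom_mat_0: "commuting n x \<Longrightarrow> monom_mat 0 x = 1\<^sub>m n"
proof -
  assume x: "commuting n x"
  have "foldr (\<lambda>i A. (x i ^\<^sub>m 0) * A) is (1\<^sub>m n) = 1\<^sub>m n" for "is"
    using carrier_matD[OF commutingD(1)[OF x]] by (induction "is") auto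
  thus ?thesis by (simp add: monom_mat_def commuting_tuple_size[OF x])
qed

lemma mult_mat_swap:
  assumes "A \<in> carrier_mat n n" "B \<in> carrier_mat n n" "X \<in> carrier_mat n n" "Y \<in> carrier_mat n n"
    and eq: "B * X = X * (B :: 'a :: semiring_1 mat)"
  shows "A * B * (X * Y) = A * X * (B * Y)"
proof -
  have "A * B * (X * Y) = A * (B * X) * Y"
    using assms(1-4) by (simp add: assoc_mult_mat[of _ n n _ n _ n])
  also have "\<dots> = A * X * (B * Y)"
    unfolding eq using assms(1-4) by (simp add: assoc_mult_mat[of _ n n _ n _ n])
  finally show ?thesis .
qed

lemma monom_mat_add:
  assumes x: "commuting n x"
  shows "monom_mat (\<alpha> + \<beta>) x = monom_mat \<alpha> x * monom_mat \<beta> x"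
proof -
  let ?f = "\<lambda>e is. foldr (\<lambda>i A. (x i ^\<^sub>m e i) * A) is (1\<^sub>m n)"
  have c: "?f e is \<in> carrier_mat n n" for e "is"
    by (rule foldr_monom_carrier) (rule commutingD[OF x])
  have p: "x i ^\<^sub>m k \<in> carrier_mat n n" for i k using commutingD(1)[OF x] by auto
  have "?f (\<lambda>i. e i + e' i) is = ?f e is * ?f e' is" for e e' "is"
  proof (induction "is")
    case (Cons i "is")
    \<comment> \<open>A power of one coordinate commutes with every coordinate, hence with the
      remaining product: this is the intertwining lemma with both tuples equal and that power as
      W.\<close>
    have "x i ^\<^sub>m e' i * x j = x j * x i ^\<^sub>m e' i" for j
      using intertwine_pow_mat[OF commutingD(1)[OF x] commutingD(1)[OF x] commutingD(1)[OF x] commutingD(2)[OF x],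
          where k = "e' i"] by (rule sym)
    hence sw: "x i ^\<^sub>m e' i * ?f e is = ?f e is * x i ^\<^sub>m e' i"
      by (rule intertwine_foldr_monom[OF p commutingD(1)[OF x] commutingD(1)[OF x]])
    show ?case
      unfolding foldr.simps o_def Cons
      unfolding pow_mat_add[OF commutingD(1)[OF x]] by (rule mult_mat_swap[OF p p c c sw])
  qed (use x in auto)
  from this[of "Poly_Mapping.lookup \<alpha>" "Poly_Mapping.lookup \<beta>"] show ?thesis
    by (simp add: monom_mat_def commuting_tuple_size[OF x] lookup_add)
qed

lemma var_list: "distinct (var_list :: 'd::finite list)" "set (var_list :: 'd::finite list) = UNIV"
proof -
  have "\<exists>is :: 'd list. distinct is \<and> set is = UNIV"
    using finite_distinct_list[of "UNIV :: 'd set"] by auto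
  from someI_ex[OF this] show "distinct (var_list :: 'd list)" "set (var_list :: 'd list) = UNIV"
    by (auto simp: var_list_def)
qed

lemma monom_mat_single:
  assumes x: "commuting n x"
  shows "monom_mat (Poly_Mapping.single i k) x = x i ^\<^sub>m k"
proof -
  let ?f = "\<lambda>is. foldr (\<lambda>j A. (x j ^\<^sub>m (Poly_Mapping.lookup (Poly_Mapping.single i k) j)) * A) is (1\<^sub>m n)"
  have c: "?f is \<in> carrier_mat n n" for "is"
    by (rule foldr_monom_carrier) (rule commutingD[OF x])
  have "distinct is \<Longrightarrow> ?f is = (if i \<in> set is then x i ^\<^sub>m k else 1\<^sub>m n)" for "is"
    using left_mult_one_mat[OF c] carrier_matD[OF commutingD(1)[OF x]]
      right_mult_one_mat[OF pow_carrier_mat[OF commutingD(1)[OF x]]]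
    by (induction "is") (auto simp: lookup_single when_def)
  from this[OF var_list(1)] show ?thesis
    by (simp add: monom_mat_def commuting_tuple_size[OF x] var_list(2))
qed

section \<open>Polynomials at commuting tuples\<close>

lemma poly_mapping_sum_single: "(\<Sum>\<alpha>\<in>Poly_Mapping.keys q. Poly_Mapping.single \<alpha> (Poly_Mapping.lookup q \<alpha>)) = q"
  by (rule poly_mapping_eqI) (auto simp: lookup_sum lookup_single when_def in_keys_iff)

lemma mpoly_induct [case_names zero single add]:
  fixes q :: "'d mpoly"
  assumes "P 0" "\<And>\<alpha> c. P (Poly_Mapping.single \<alpha> c)" "\<And>p q. P p \<Longrightarrow> P q \<Longrightarrow> P (p + q)"
  shows "P q"
proof -
  have "P (\<Sum>\<alpha>\<in>A. Poly_Mapping.single \<alpha> (Poly_Mapping.lookup q \<alpha>))" if "finite A" for A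
    using that by (induction A rule: finite_induct) (simp_all add: assms)
  from this[OF finite_keys[of q]] show ?thesis unfolding poly_mapping_sum_single .
qed

lemma mpoly_mat_carrier: "commuting n x \<Longrightarrow> mpoly_mat q x \<in> carrier_mat n n"
  by (simp add: mpoly_mat_def commuting_tuple_size)

lemma sum_keys_superset:
  assumes "finite B" "Poly_Mapping.keys q \<subseteq> B"
  shows "(\<Sum>\<alpha>\<in>Poly_Mapping.keys q. Poly_Mapping.lookup q \<alpha> * f \<alpha>) = (\<Sum>\<alpha>\<in>B. (Poly_Mapping.lookup q \<alpha> :: complex) * f \<alpha>)"
  using assms by (intro sum.mono_neutral_left) (auto simp: in_keys_iff)

lemma mpoly_mat_0: "commuting n x \<Longrightarrow> mpoly_mat 0 x = 0\<^sub>m n n"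
  by (auto simp: mpoly_mat_def commuting_tuple_size)

lemma mpoly_mat_add:
  fixes p q :: "'d::finite mpoly"
  assumes "commuting n x"
  shows "mpoly_mat (p + q) x = mpoly_mat p x + mpoly_mat q x"
proof -
  let ?B = "Poly_Mapping.keys p \<union> Poly_Mapping.keys q"
  have *: "(\<Sum>\<alpha>\<in>Poly_Mapping.keys r. Poly_Mapping.lookup r \<alpha> * f \<alpha>) = (\<Sum>\<alpha>\<in>?B. Poly_Mapping.lookup r \<alpha> * f \<alpha>)"
    if "Poly_Mapping.keys r \<subseteq> ?B" for r :: "'d mpoly" and f
    by (rule sum_keys_superset) (use that in auto)
  show ?thesis
    unfolding mpoly_mat_def *[OF keys_add] *[OF Un_upper1] *[OF Un_upper2]
    by (rule eq_matI) (auto simp: lookup_add ring_distribs sum.distrib)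
qed

lemma mpoly_mat_single:
  assumes x: "commuting n x"
  shows "mpoly_mat (Poly_Mapping.single \<alpha> c) x = c \<cdot>\<^sub>m monom_mat \<alpha> x"
proof (cases "c = 0")
  case True
  thus ?thesis using monom_mat_carrier[OF x, of \<alpha>] by (auto simp: mpoly_mat_0[OF x] intro!: eq_matI)
next
  case False
  thus ?thesis using monom_mat_carrier[OF x, of \<alpha>]
    by (auto simp: mpoly_mat_def commuting_tuple_size[OF x] intro!: eq_matI)
qed

lemma mpoly_mat_mult:
  assumes x: "commuting n x"
  shows "mpoly_mat (p * q) x = mpoly_mat p x * mpoly_mat q x"
proof (induction p rule: mpoly_induct)
  case (single \<alpha> c)
  show ?case
  proof (induction q rule: mpoly_induct)
    case (single \<beta> d)
    show ?case
      unfolding mult_single mpoly_mat_single[OF x] monom_mat_add[OF x]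
      using carrier_matD[OF monom_mat_carrier[OF x]]
      by (auto intro!: eq_matI simp: scalar_prod_def sum_distrib_left mult_ac)
  next
    case (add q r)
    thus ?case using mpoly_mat_carrier[OF x]
      by (simp add: ring_distribs mpoly_mat_add[OF x]
          mult_add_distrib_mat[OF mpoly_mat_carrier[OF x] mpoly_mat_carrier[OF x] mpoly_mat_carrier[OF x]])
  qed (simp add: mpoly_mat_0[OF x] right_mult_zero_mat[OF mpoly_mat_carrier[OF x]])
next
  case (add p r)
  thus ?case using mpoly_mat_carrier[OF x]
    by (simp add: ring_distribs mpoly_mat_add[OF x]
        add_mult_distrib_mat[OF mpoly_mat_carrier[OF x] mpoly_mat_carrier[OF x] mpoly_mat_carrier[OF x]])
qed (simp add: mpoly_mat_0[OF x] left_mult_zero_mat[OF mpoly_mat_carrier[OF x]])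

lemma intertwine_mpoly_mat:
  assumes W: "W \<in> carrier_mat m n" and x: "commuting n x" and y: "commuting m y"
    and eq: "\<And>i. W * x i = y i * W"
  shows "W * mpoly_mat q x = mpoly_mat q y * W"
proof (induction q rule: mpoly_induct)
  case zero
  thus ?case using W by (simp add: mpoly_mat_0[OF x] mpoly_mat_0[OF y])
next
  case (single \<alpha> c)
  show ?case
    unfolding mpoly_mat_single[OF x] mpoly_mat_single[OF y] 
      mult_smult_distrib[OF W monom_mat_carrier[OF x]] mult_smult_assoc_mat[OF monom_mat_carrier[OF y] W]
    by (simp add: intertwine_monom_mat[OF assms])
next
  case (add p q)
  thus ?case using W mpoly_mat_carrier[OF x] mpoly_mat_carrier[OF y]
    by (simp add: mpoly_mat_add[OF x] mpoly_mat_add[OF y]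
        mult_add_distrib_mat[OF W mpoly_mat_carrier[OF x] mpoly_mat_carrier[OF x]]
        add_mult_distrib_mat[OF mpoly_mat_carrier[OF y] mpoly_mat_carrier[OF y] W])
qed

text \<open>A point as a tuple of size 1. Identities for \<open>mpoly_eval\<close> and statements
  about \<open>G_dom\<close> become instances of those for matrices.\<close>

definition scalar_tuple :: "complex ^ 'd \<Rightarrow> ('d::finite) mat_tuple" where
  "scalar_tuple z = (\<lambda>i. mat 1 1 (\<lambda>_. z $ i))"

lemma mat_1_1_mult: "mat 1 1 (\<lambda>_. a) * mat 1 1 (\<lambda>_. b) = mat 1 1 (\<lambda>_. a * b :: complex)"
  by (rule eq_matI) (auto simp: scalar_prod_def)

lemma commuting_scalar_tuple: "commuting 1 (scalar_tuple z)"
  by (simp add: commuting_def scalar_tuple_def mat_1_1_mult[unfolded One_nat_def] mult.commute)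

lemma scalar_tuple_pow: "scalar_tuple z i ^\<^sub>m k = mat 1 1 (\<lambda>_. (z $ i) ^ k)"
proof (induction k)
  case 0
  thus ?case by (auto simp: scalar_tuple_def intro!: eq_matI)
next
  case (Suc k)
  thus ?case by (simp only: pow_mat.simps Suc scalar_tuple_def mat_1_1_mult) (simp add: mult.commute)
qed

lemma monom_mat_scalar_tuple: "monom_mat \<alpha> (scalar_tuple z) = mat 1 1 (\<lambda>_. monom_eval \<alpha> z)"
proof -
  have "foldr (\<lambda>i A. (scalar_tuple z i ^\<^sub>m e i) * A) is (1\<^sub>m 1) = mat 1 1 (\<lambda>_. prod_list (map (\<lambda>i. (z $ i) ^ e i) is))" for e "is"
  proof (induction "is")
    case Nil
    thus ?case by (auto intro!: eq_matI)
  next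
    case (Cons i "is")
    thus ?case by (simp only: foldr.simps o_def scalar_tuple_pow mat_1_1_mult) simp
  qed
  moreover have "prod_list (map f var_list) = prod f UNIV" for f :: "'a \<Rightarrow> complex"
    by (metis prod.distinct_set_conv_list var_list)
  ultimately show ?thesis
    by (simp add: monom_mat_def commuting_tuple_size[OF commuting_scalar_tuple] monom_eval_def)
qed

lemma mpoly_mat_scalar_tuple: "mpoly_mat q (scalar_tuple z) = mat 1 1 (\<lambda>_. mpoly_eval q z)"
  by (rule eq_matI)
     (auto simp: mpoly_mat_def commuting_tuple_size[OF commuting_scalar_tuple] monom_mat_scalar_tuple mpoly_eval_def)

lemma mpoly_eval_add: "mpoly_eval (p + q) z = mpoly_eval p z + mpoly_eval q z"
  using arg_cong[OF mpoly_mat_add[OF commuting_scalar_tuple, of p q z], of "\<lambda>A. A $$ (0, 0)"]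
  by (simp add: mpoly_mat_scalar_tuple)

lemma mpoly_eval_mult: "mpoly_eval (p * q) z = mpoly_eval p z * mpoly_eval q z"
  using arg_cong[OF mpoly_mat_mult[OF commuting_scalar_tuple, of p q z], of "\<lambda>A. A $$ (0, 0)"]
  by (simp add: mpoly_mat_scalar_tuple scalar_prod_def)

lemma mpoly_eval_single: "mpoly_eval (Poly_Mapping.single \<alpha> c) z = c * monom_eval \<alpha> z"
  by (auto simp: mpoly_eval_def)

lemma mpoly_eval_0 [simp]: "mpoly_eval 0 z = 0"
  by (simp add: mpoly_eval_def)

section \<open>Operator norms\<close>

lemma index_mult_mat_vec_sum:
  "i < dim_row A \<Longrightarrow> dim_vec v = dim_col A \<Longrightarrow>
     vec_index (A *\<^sub>v v) i = (\<Sum>j<dim_col A. A $$ (i, j) * vec_index v j)"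
  by (simp add: scalar_prod_def atLeast0LessThan)

lemma index_mult_mat_sum:
  "i < dim_row A \<Longrightarrow> j < dim_col B \<Longrightarrow> dim_row B = dim_col A \<Longrightarrow>
     (A * B) $$ (i, j) = (\<Sum>k<dim_col A. A $$ (i, k) * B $$ (k, j))"
  by (simp add: scalar_prod_def atLeast0LessThan)

lemma vec_l2_L2_set: "vec_l2 v = L2_set (\<lambda>i. cmod (vec_index v i)) {..<dim_vec v}"
  by (simp add: vec_l2_def L2_set_def)

lemma vec_l2_nonneg [simp]: "vec_l2 v \<ge> 0"
  by (simp add: vec_l2_L2_set L2_set_nonneg)

lemma vec_l2_square: "(vec_l2 v)\<^sup>2 = (\<Sum>i<dim_vec v. (cmod (vec_index v i))\<^sup>2)"
  by (simp add: vec_l2_def sum_nonneg)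

lemma vec_l2_smult: "vec_l2 (c \<cdot>\<^sub>v v) = cmod c * vec_l2 v"
  unfolding vec_l2_L2_set by (subst L2_set_right_distrib) (auto intro!: L2_set_cong simp: norm_mult)

lemma vec_l2_zero [simp]: "vec_l2 (0\<^sub>v n) = 0"
  by (simp add: vec_l2_def)

text \<open>A crude bound with two purposes: it makes the supremum in \<open>op_norm\<close> finite,
  and through \<open>op_norm_perturb\<close> it gives continuity of the operator norm.\<close>

definition entry_norm :: "complex mat \<Rightarrow> real" where
  "entry_norm A = (\<Sum>i<dim_row A. \<Sum>j<dim_col A. cmod (A $$ (i, j)))"

lemma entry_norm_nonneg: "entry_norm A \<ge> 0"
  unfolding entry_norm_def by (intro sum_nonneg) auto

lemma vec_l2_mult_le_entry_norm:
  assumes "dim_vec v = dim_col A"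
  shows "vec_l2 (A *\<^sub>v v) \<le> entry_norm A * vec_l2 v"
proof -
  have "vec_l2 (A *\<^sub>v v) \<le> (\<Sum>i<dim_row A. cmod (vec_index (A *\<^sub>v v) i))"
    unfolding vec_l2_L2_set dim_mult_mat_vec by (rule L2_set_le_sum) auto
  also have "\<dots> \<le> (\<Sum>i<dim_row A. \<Sum>j<dim_col A. cmod (A $$ (i, j)) * vec_l2 v)"
  proof (intro sum_mono)
    fix i assume "i \<in> {..<dim_row A}"
    hence "cmod (vec_index (A *\<^sub>v v) i) \<le> (\<Sum>j<dim_col A. cmod (A $$ (i, j)) * cmod (vec_index v j))"
      using assms by (simp add: index_mult_mat_vec_sum norm_mult sum_norm_le del: index_mult_mat_vec)
    also have "\<dots> \<le> (\<Sum>j<dim_col A. cmod (A $$ (i, j)) * vec_l2 v)"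
      unfolding vec_l2_L2_set assms by (intro sum_mono mult_left_mono member_le_L2_set) auto
    finally show "cmod (vec_index (A *\<^sub>v v) i) \<le> (\<Sum>j<dim_col A. cmod (A $$ (i, j)) * vec_l2 v)" .
  qed
  also have "\<dots> = entry_norm A * vec_l2 v"
    by (simp add: entry_norm_def sum_distrib_right)
  finally show ?thesis .
qed

lemma op_norm_bdd_above: "bdd_above ((\<lambda>v. vec_l2 (A *\<^sub>v v)) ` {v \<in> carrier_vec (dim_col A). vec_l2 v \<le> 1})"
proof (rule bdd_aboveI2)
  fix v assume v: "v \<in> {v \<in> carrier_vec (dim_col A). vec_l2 v \<le> 1}"
  have "vec_l2 (A *\<^sub>v v) \<le> entry_norm A * vec_l2 v"
    using v by (intro vec_l2_mult_le_entry_norm) auto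
  also have "\<dots> \<le> entry_norm A * 1"
    using v by (intro mult_left_mono entry_norm_nonneg) auto
  finally show "vec_l2 (A *\<^sub>v v) \<le> entry_norm A" by simp
qed

lemma op_norm_nonneg: "op_norm A \<ge> 0"
proof -
  have "vec_l2 (A *\<^sub>v 0\<^sub>v (dim_col A)) \<le> op_norm A"
    unfolding op_norm_def by (rule cSUP_upper[OF _ op_norm_bdd_above]) auto
  thus ?thesis by (rule order_trans[OF vec_l2_nonneg])
qed

lemma op_norm_bound:
  assumes v: "dim_vec v = dim_col A"
  shows "vec_l2 (A *\<^sub>v v) \<le> op_norm A * vec_l2 v"
proof (cases "vec_l2 v = 0")
  case True
  thus ?thesis using vec_l2_mult_le_entry_norm[OF v] by simp
next
  case False
  define c where "c = complex_of_real (1 / vec_l2 v)"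
  have v': "v \<in> carrier_vec (dim_col A)" using v by (rule carrier_vecI)
  have pos: "vec_l2 v > 0" using False by (simp add: order_less_le)
  have nc: "cmod c = 1 / vec_l2 v" using pos unfolding c_def norm_of_real by simp
  have "vec_l2 (A *\<^sub>v (c \<cdot>\<^sub>v v)) \<le> op_norm A"
    unfolding op_norm_def
    by (rule cSUP_upper[OF _ op_norm_bdd_above]) (use v' nc pos in \<open>simp add: vec_l2_smult\<close>)
  also have "A *\<^sub>v (c \<cdot>\<^sub>v v) = c \<cdot>\<^sub>v (A *\<^sub>v v)"
    by (rule mult_mat_vec[OF _ v']) auto
  finally show ?thesis using nc pos by (simp add: vec_l2_smult field_simps)
qed

lemma op_norm_le:
  assumes "C \<ge> 0" "\<And>v. dim_vec v = dim_col A \<Longrightarrow> vec_l2 (A *\<^sub>v v) \<le> C * vec_l2 v"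
  shows "op_norm A \<le> C"
  unfolding op_norm_def
proof (rule cSUP_least)
  have "0\<^sub>v (dim_col A) \<in> {v \<in> carrier_vec (dim_col A). vec_l2 v \<le> 1}" by simp
  thus "{v \<in> carrier_vec (dim_col A). vec_l2 v \<le> 1} \<noteq> {}" by blast
  fix v assume v: "v \<in> {v \<in> carrier_vec (dim_col A). vec_l2 v \<le> 1}"
  have "vec_l2 (A *\<^sub>v v) \<le> C * vec_l2 v" using v by (intro assms) auto
  also have "\<dots> \<le> C * 1" using v by (intro mult_left_mono assms) auto
  finally show "vec_l2 (A *\<^sub>v v) \<le> C" by simp
qed

lemma vec_l2_triangle:
  "dim_vec u = dim_vec v \<Longrightarrow> vec_l2 (u + v) \<le> vec_l2 u + vec_l2 v"
proof -
  assume d: "dim_vec u = dim_vec v"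
  have "vec_l2 (u + v) \<le> L2_set (\<lambda>i. cmod (vec_index u i) + cmod (vec_index v i)) {..<dim_vec v}"
    unfolding vec_l2_L2_set by (auto intro!: L2_set_mono norm_triangle_ineq)
  also have "\<dots> \<le> vec_l2 u + vec_l2 v"
    unfolding vec_l2_L2_set d by (rule L2_set_triangle_ineq)
  finally show ?thesis .
qed

lemma op_norm_perturb:
  assumes A: "A \<in> carrier_mat m n" and B: "B \<in> carrier_mat m n"
  shows "op_norm A \<le> op_norm B + entry_norm (A - B)"
proof (rule op_norm_le)
  fix v :: "complex Matrix.vec" assume v: "dim_vec v = dim_col A"
  hence v': "v \<in> carrier_vec n" using A by (intro carrier_vecI) simp
  have "A *\<^sub>v v = B *\<^sub>v v + (A - B) *\<^sub>v v"
  proof (rule eq_vecI)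
    fix i assume "i < dim_vec (B *\<^sub>v v + (A - B) *\<^sub>v v)"
    hence i: "i < m" using B by simp
    have "vec_index (B *\<^sub>v v + (A - B) *\<^sub>v v) i = (\<Sum>j<n. B $$ (i, j) * vec_index v j) + (\<Sum>j<n. (A - B) $$ (i, j) * vec_index v j)"
      using i A B v' index_mult_mat_vec_sum[of i B v] index_mult_mat_vec_sum[of i "A - B" v] by simp
    also have "\<dots> = (\<Sum>j<n. A $$ (i, j) * vec_index v j)"
      unfolding sum.distrib[symmetric] using i A B by (intro sum.cong) (auto simp: ring_distribs)
    also have "\<dots> = vec_index (A *\<^sub>v v) i"
      using i A v' index_mult_mat_vec_sum[of i A v] by simp
    finally show "vec_index (A *\<^sub>v v) i = vec_index (B *\<^sub>v v + (A - B) *\<^sub>v v) i" ..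
  qed (use A B in auto)
  hence "vec_l2 (A *\<^sub>v v) \<le> vec_l2 (B *\<^sub>v v) + vec_l2 ((A - B) *\<^sub>v v)"
    using A B by (simp add: vec_l2_triangle)
  also have "\<dots> \<le> op_norm B * vec_l2 v + entry_norm (A - B) * vec_l2 v"
    using A B v' by (intro add_mono op_norm_bound vec_l2_mult_le_entry_norm) auto
  finally show "vec_l2 (A *\<^sub>v v) \<le> (op_norm B + entry_norm (A - B)) * vec_l2 v"
    by (simp add: ring_distribs)
qed (intro add_nonneg_nonneg op_norm_nonneg entry_norm_nonneg)

section \<open>Norms of block matrices\<close>

lemma sum_div_mod:
  fixes f :: "nat \<Rightarrow> nat \<Rightarrow> 'a :: comm_monoid_add"
  shows "(\<Sum>i<m * n. f (i div n) (i mod n)) = (\<Sum>a<m. \<Sum>r<n. f a r)"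
proof (cases "n = 0")
  case False
  hence n: "n > 0" by simp
  have lt: "a * n + r < m * n" if "a < m" "r < n" for a r
  proof -
    have "a * n + r < (a + 1) * n" using that by simp
    also have "\<dots> \<le> m * n" using that by (intro mult_le_mono1) auto
    finally show ?thesis .
  qed
  have "(\<Sum>a<m. \<Sum>r<n. f a r) = (\<Sum>(a, r)\<in>{..<m} \<times> {..<n}. f a r)"
    by (rule sum.cartesian_product)
  also have "\<dots> = (\<Sum>i<m * n. f (i div n) (i mod n))"
    by (rule sum.reindex_bij_witness[of _ "\<lambda>i. (i div n, i mod n)" "\<lambda>(a, r). a * n + r"])
       (use n lt in \<open>auto simp: less_mult_imp_div_less\<close>)
  finally show ?thesis by simp
qed auto

lemma dim_pmat_mat:
  assumes "commuting n x"
  shows "dim_row (pmat_mat p x) = dim_row p * n" "dim_col (pmat_mat p x) = dim_col p * n"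
  by (simp_all add: pmat_mat_def commuting_tuple_size[OF assms] Let_def)

lemma pmat_mat_mult_vec:
  assumes x: "commuting n x" and p: "p \<in> carrier_mat I J"
    and W: "dim_vec W = J * n" and i: "i < I * n"
  shows "vec_index (pmat_mat p x *\<^sub>v W) i =
    (\<Sum>b<J. vec_index (mpoly_mat (p $$ (i div n, b)) x *\<^sub>v Matrix.vec n (\<lambda>s. vec_index W (b * n + s))) (i mod n))"
proof -
  have n: "n > 0" using i by (cases n) auto
  have "vec_index (pmat_mat p x *\<^sub>v W) i = (\<Sum>j<J * n. pmat_mat p x $$ (i, j) * vec_index W j)"
    using dim_pmat_mat[OF x, of p] p W i by (simp add: index_mult_mat_vec_sum del: index_mult_mat_vec)
  also have "\<dots> = (\<Sum>j<J * n. mpoly_mat (p $$ (i div n, j div n)) x $$ (i mod n, j mod n) * vec_index W (j div n * n + j mod n))"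
    using p i by (intro sum.cong) (auto simp: pmat_mat_def commuting_tuple_size[OF x] Let_def)
  also have "\<dots> = (\<Sum>b<J. \<Sum>s<n. mpoly_mat (p $$ (i div n, b)) x $$ (i mod n, s) * vec_index W (b * n + s))"
    by (rule sum_div_mod)
  also have "\<dots> = (\<Sum>b<J. vec_index (mpoly_mat (p $$ (i div n, b)) x *\<^sub>v Matrix.vec n (\<lambda>s. vec_index W (b * n + s))) (i mod n))"
    using carrier_matD[OF mpoly_mat_carrier[OF x]] n
    by (intro sum.cong) (auto simp: index_mult_mat_vec_sum simp del: index_mult_mat_vec)
  finally show ?thesis .
qed

text \<open>Hides the \<open>div\<close> and \<open>mod\<close> indexing of the block matrix: later
  arguments see the norm of p(x) only through this inequality for J vectors of length n and its
  converse \<open>pmat_mat_norm_le\<close>.\<close>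

lemma pmat_mat_norm_bound:
  assumes x: "commuting n x" and p: "p \<in> carrier_mat I J"
    and w: "\<And>b. b < J \<Longrightarrow> dim_vec (w b) = n"
  shows "(\<Sum>a<I. \<Sum>r<n. (cmod (\<Sum>b<J. vec_index (mpoly_mat (p $$ (a, b)) x *\<^sub>v w b) r))\<^sup>2)
    \<le> (op_norm (pmat_mat p x))\<^sup>2 * (\<Sum>b<J. \<Sum>r<n. (cmod (vec_index (w b) r))\<^sup>2)"
proof -
  define W where "W = Matrix.vec (J * n) (\<lambda>i. vec_index (w (i div n)) (i mod n))"
  have W: "dim_vec W = J * n" by (simp add: W_def)
  have part: "Matrix.vec n (\<lambda>s. vec_index W (b * n + s)) = w b" if b: "b < J" for b
  proof (rule eq_vecI)
    fix s assume "s < dim_vec (w b)"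
    hence s: "s < n" using w[OF b] by simp
    have "b * n + s < (b + 1) * n" using s by simp
    also have "\<dots> \<le> J * n" using b by (intro mult_le_mono1) auto
    finally show "vec_index (Matrix.vec n (\<lambda>s. vec_index W (b * n + s))) s = vec_index (w b) s"
      using s by (simp add: W_def)
  qed (use w[OF b] in simp)
  have "(vec_l2 (pmat_mat p x *\<^sub>v W))\<^sup>2 = (\<Sum>i<I * n. (cmod (\<Sum>b<J. vec_index (mpoly_mat (p $$ (i div n, b)) x *\<^sub>v w b) (i mod n)))\<^sup>2)"
    unfolding vec_l2_square using dim_pmat_mat[OF x, of p] p
    by (intro sum.cong) (auto simp: pmat_mat_mult_vec[OF x p W] part simp del: index_mult_mat_vec)
  also have "\<dots> = (\<Sum>a<I. \<Sum>r<n. (cmod (\<Sum>b<J. vec_index (mpoly_mat (p $$ (a, b)) x *\<^sub>v w b) r))\<^sup>2)"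
    by (rule sum_div_mod)
  finally have e1: "(vec_l2 (pmat_mat p x *\<^sub>v W))\<^sup>2 = \<dots>" .
  have "(vec_l2 W)\<^sup>2 = (\<Sum>i<J * n. (cmod (vec_index (w (i div n)) (i mod n)))\<^sup>2)"
    unfolding vec_l2_square by (auto simp: W_def)
  also have "\<dots> = (\<Sum>b<J. \<Sum>r<n. (cmod (vec_index (w b) r))\<^sup>2)"
    by (rule sum_div_mod)
  finally have e2: "(vec_l2 W)\<^sup>2 = \<dots>" .
  have "vec_l2 (pmat_mat p x *\<^sub>v W) \<le> op_norm (pmat_mat p x) * vec_l2 W"
    by (rule op_norm_bound) (use dim_pmat_mat[OF x, of p] p W in auto)
  hence "(vec_l2 (pmat_mat p x *\<^sub>v W))\<^sup>2 \<le> (op_norm (pmat_mat p x) * vec_l2 W)\<^sup>2"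
    by (rule power_mono) auto
  thus ?thesis by (simp only: e1 e2 power_mult_distrib)
qed

lemma pmat_mat_norm_le:
  assumes x: "commuting n x" and p: "p \<in> carrier_mat I J" and \<rho>: "\<rho> \<ge> 0"
    and le: "\<And>w. (\<And>b. dim_vec (w b) = n) \<Longrightarrow>
      (\<Sum>a<I. \<Sum>r<n. (cmod (\<Sum>b<J. vec_index (mpoly_mat (p $$ (a, b)) x *\<^sub>v w b) r))\<^sup>2)
       \<le> \<rho>\<^sup>2 * (\<Sum>b<J. \<Sum>r<n. (cmod (vec_index (w b) r))\<^sup>2)"
  shows "op_norm (pmat_mat p x) \<le> \<rho>"
proof (rule op_norm_le[OF \<rho>])
  fix W :: "complex Matrix.vec" assume "dim_vec W = dim_col (pmat_mat p x)"
  hence W: "dim_vec W = J * n" using dim_pmat_mat[OF x, of p] p by simp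
  define w where "w b = Matrix.vec n (\<lambda>s. vec_index W (b * n + s))" for b
  have "(vec_l2 (pmat_mat p x *\<^sub>v W))\<^sup>2 = (\<Sum>i<I * n. (cmod (\<Sum>b<J. vec_index (mpoly_mat (p $$ (i div n, b)) x *\<^sub>v w b) (i mod n)))\<^sup>2)"
    unfolding vec_l2_square using dim_pmat_mat[OF x, of p] p
    by (intro sum.cong) (auto simp: pmat_mat_mult_vec[OF x p W] w_def simp del: index_mult_mat_vec)
  also have "\<dots> = (\<Sum>a<I. \<Sum>r<n. (cmod (\<Sum>b<J. vec_index (mpoly_mat (p $$ (a, b)) x *\<^sub>v w b) r))\<^sup>2)"
    by (rule sum_div_mod)
  also have "\<dots> \<le> \<rho>\<^sup>2 * (\<Sum>b<J. \<Sum>r<n. (cmod (vec_index (w b) r))\<^sup>2)"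
    by (rule le) (simp add: w_def)
  also have "(\<Sum>b<J. \<Sum>r<n. (cmod (vec_index (w b) r))\<^sup>2) = (\<Sum>b<J. \<Sum>r<n. (cmod (vec_index W (b * n + r)))\<^sup>2)"
    by (intro sum.cong) (auto simp: w_def)
  also have "\<dots> = (\<Sum>i<J * n. (cmod (vec_index W (i div n * n + i mod n)))\<^sup>2)"
    by (rule sum_div_mod[symmetric])
  also have "\<dots> = (vec_l2 W)\<^sup>2"
    unfolding vec_l2_square W by (simp add: div_mult_mod_eq)
  finally have "(vec_l2 (pmat_mat p x *\<^sub>v W))\<^sup>2 \<le> (\<rho> * vec_l2 W)\<^sup>2"
    by (simp add: power_mult_distrib)
  thus "vec_l2 (pmat_mat p x *\<^sub>v W) \<le> \<rho> * vec_l2 W"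
    by (rule power2_le_imp_le) (use \<rho> in auto)
qed

lemma pmat_mat_scalar_tuple: "pmat_mat p (scalar_tuple z) = pmat_eval p z"
  by (rule eq_matI)
     (auto simp: pmat_mat_def pmat_eval_def commuting_tuple_size[OF commuting_scalar_tuple] Let_def mpoly_mat_scalar_tuple)

lemma scalar_tuple_in_comm_tuples: "scalar_tuple z \<in> comm_tuples"
  unfolding comm_tuples_eq using commuting_scalar_tuple by blast

lemma scalar_tuple_in_F_dom: "z \<in> G_dom p \<longleftrightarrow> scalar_tuple z \<in> F_dom p"
  by (simp add: G_dom_def F_dom_def pmat_mat_scalar_tuple scalar_tuple_in_comm_tuples)

section \<open>Openness of the domain\<close>

lemma continuous_mpoly_eval: "continuous_on UNIV (mpoly_eval q)"
  unfolding mpoly_eval_def[abs_def] monom_eval_def by (intro continuous_intros)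

lemma continuous_op_norm_pmat_eval:
  assumes p: "p \<in> carrier_mat I J"
  shows "isCont (\<lambda>z. op_norm (pmat_eval p z)) z"
proof -
  let ?E = "\<lambda>w. entry_norm (pmat_eval p w - pmat_eval p z)"
  have c: "pmat_eval p w \<in> carrier_mat I J" for w using p by (simp add: pmat_eval_def)
  have entry: "?E w = (\<Sum>i<I. \<Sum>j<J. cmod (mpoly_eval (p $$ (i, j)) w - mpoly_eval (p $$ (i, j)) z))" for w
    using p by (simp add: entry_norm_def pmat_eval_def)
  have sym: "entry_norm (pmat_eval p z - pmat_eval p w) = ?E w" for w
    using p by (simp add: entry_norm_def pmat_eval_def norm_minus_commute)
  have "((\<lambda>w. mpoly_eval q w) \<longlongrightarrow> mpoly_eval q z) (at z)" for q
    using continuous_mpoly_eval[of q] by (simp add: continuous_on_def)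
  hence "((\<lambda>w. cmod (mpoly_eval q w - mpoly_eval q z)) \<longlongrightarrow> cmod (mpoly_eval q z - mpoly_eval q z)) (at z)" for q
    by (intro tendsto_intros)
  hence "(?E \<longlongrightarrow> (\<Sum>i<I. \<Sum>j<J. 0)) (at z)"
    unfolding entry by (intro tendsto_sum) simp
  hence E: "(?E \<longlongrightarrow> 0) (at z)" by simp
  have "cmod (complex_of_real (op_norm (pmat_eval p w) - op_norm (pmat_eval p z))) \<le> ?E w" for w
    using op_norm_perturb[OF c c, of w z] op_norm_perturb[OF c c, of z w] sym[of w]
    unfolding norm_of_real by (simp add: abs_le_iff)
  hence "\<bar>op_norm (pmat_eval p w) - op_norm (pmat_eval p z)\<bar> \<le> ?E w" for w
    by (simp only: norm_of_real)
  hence "((\<lambda>w. op_norm (pmat_eval p w) - op_norm (pmat_eval p z)) \<longlongrightarrow> 0) (at z)"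
    by (intro Lim_null_comparison[OF _ E]) auto
  thus ?thesis unfolding isCont_def by (simp only: LIM_zero_iff)
qed

lemma open_G_dom: "p \<in> carrier_mat I J \<Longrightarrow> open (G_dom p)"
  unfolding G_dom_def
  by (rule open_Collect_less)
     (auto intro!: continuous_at_imp_continuous_on continuous_op_norm_pmat_eval)

section \<open>Joint spectral decompositions\<close>

text \<open>Nonzero entries lie inside one Jordan block, along which the diagonal is
  constant.\<close>

lemma jordan_matrix_diag_eq:
  fixes n_as :: "(nat \<times> complex) list"
  assumes "r < sum_list (map fst n_as)" "s < sum_list (map fst n_as)" "jordan_matrix n_as $$ (r, s) \<noteq> 0"
  shows "jordan_matrix n_as $$ (r, r) = jordan_matrix n_as $$ (s, s)"
  using assms
proof (induction n_as arbitrary: r s)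
  case (Cons na n_as)
  obtain n a where na: "na = (n, a)" by force
  show ?case using Cons.prems unfolding na jordan_matrix_Cons
    by (auto split: if_splits intro!: Cons.IH)
qed auto

text \<open>Compare the entries (r, s) of Y J and J Y. Apart from the diagonal terms they involve Y
  (r, t) with t < s and Y (t, s) with t > r, where t carries the label of s or of r respectively;
  these vanish by induction on s + (n - r). What remains says that the difference of the two labels
  times Y (r, s) is 0.\<close>

lemma commutes_with_separated_triangular:
  fixes J Y :: "complex mat"
  assumes J: "J \<in> carrier_mat n n" and Y: "Y \<in> carrier_mat n n" and comm: "Y * J = J * Y"
    and ut: "\<And>r s. r < n \<Longrightarrow> s < r \<Longrightarrow> J $$ (r, s) = 0"
    and lab: "\<And>r s. r < n \<Longrightarrow> s < n \<Longrightarrow> J $$ (r, s) \<noteq> 0 \<Longrightarrow> J $$ (r, r) = J $$ (s, s)"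
  shows "r < n \<Longrightarrow> s < n \<Longrightarrow> J $$ (r, r) \<noteq> J $$ (s, s) \<Longrightarrow> Y $$ (r, s) = 0"
proof (induction "s + (n - r)" arbitrary: r s rule: less_induct)
  case less
  have "(\<Sum>t<n. Y $$ (r, t) * J $$ (t, s)) = (\<Sum>t<n. J $$ (r, t) * Y $$ (t, s))"
    using arg_cong[OF comm, of "\<lambda>A. A $$ (r, s)"] J Y less.prems by (simp add: index_mult_mat_sum del: index_mult_mat)
  moreover have "(\<Sum>t<n. Y $$ (r, t) * J $$ (t, s)) = (\<Sum>t\<in>{s}. Y $$ (r, t) * J $$ (t, s))"
  proof (rule sum.mono_neutral_right)
    show "\<forall>t\<in>{..<n} - {s}. Y $$ (r, t) * J $$ (t, s) = 0"
    proof
      fix t assume t: "t \<in> {..<n} - {s}"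
      show "Y $$ (r, t) * J $$ (t, s) = 0"
      proof (cases "J $$ (t, s) = 0")
        case False
        hence "\<not> s < t" "J $$ (t, t) = J $$ (s, s)" using ut[of t s] lab[of t s] t less.prems by auto
        hence "Y $$ (r, t) = 0" using t less.prems by (intro less.hyps) auto
        thus ?thesis by simp
      qed auto
    qed
  qed (use less.prems in auto)
  moreover have "(\<Sum>t<n. J $$ (r, t) * Y $$ (t, s)) = (\<Sum>t\<in>{r}. J $$ (r, t) * Y $$ (t, s))"
  proof (rule sum.mono_neutral_right)
    show "\<forall>t\<in>{..<n} - {r}. J $$ (r, t) * Y $$ (t, s) = 0"
    proof
      fix t assume t: "t \<in> {..<n} - {r}"
      show "J $$ (r, t) * Y $$ (t, s) = 0"
      proof (cases "J $$ (r, t) = 0")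
        case False
        hence "\<not> t < r" "J $$ (r, r) = J $$ (t, t)" using ut[of r t] lab[of r t] t less.prems by auto
        hence "Y $$ (t, s) = 0" using t less.prems by (intro less.hyps) auto
        thus ?thesis by simp
      qed auto
    qed
  qed (use less.prems in auto)
  ultimately have "Y $$ (r, s) * J $$ (s, s) = J $$ (r, r) * Y $$ (r, s)" by simp
  thus ?case using less.prems by (metis mult.commute mult_cancel_left)
qed

text \<open>What the block argument retains of a Jordan matrix.\<close>

definition separated_triangular :: "nat \<Rightarrow> complex mat \<Rightarrow> bool" where
  "separated_triangular n J \<longleftrightarrow> J \<in> carrier_mat n n \<and> (\<forall>r s. r < n \<longrightarrow> s < r \<longrightarrow> J $$ (r, s) = 0) \<and>
    (\<forall>r s. r < n \<longrightarrow> s < n \<longrightarrow> J $$ (r, s) \<noteq> 0 \<longrightarrow> J $$ (r, r) = J $$ (s, s))"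

lemma separated_triangular_form:
  fixes A :: "complex mat"
  assumes A: "A \<in> carrier_mat n n"
  obtains J T S where "similar_mat_wit A J T S" "separated_triangular n J"
proof -
  obtain as where "char_poly A = (\<Prod>a\<leftarrow>as. [:- a, 1:])" using char_poly_factorized[OF A] by auto
  then obtain n_as where "jordan_nf A n_as" using jordan_nf_exists[OF A] by blast
  then obtain T S where TS: "similar_mat_wit A (jordan_matrix n_as) T S"
    by (auto simp: jordan_nf_def similar_mat_def)
  have J: "jordan_matrix n_as \<in> carrier_mat n n" using similar_mat_witD2[OF A TS] by auto
  hence N: "sum_list (map fst n_as) = n" by (metis carrier_matD(1) jordan_matrix_dim(1))
  show ?thesis
    by (rule that[OF TS], unfold separated_triangular_def)
       (use J jordan_matrix_upper_triangular[of _ n_as] jordan_matrix_diag_eq[of _ n_as] N in auto)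
qed

lemma strict_upper_triangular_pow:
  fixes N :: "complex mat"
  assumes N: "N \<in> carrier_mat n n" and su: "\<And>r s. r < n \<Longrightarrow> s < n \<Longrightarrow> s \<le> r \<Longrightarrow> N $$ (r, s) = 0"
  shows "r < n \<Longrightarrow> s < n \<Longrightarrow> s < r + k \<Longrightarrow> (N ^\<^sub>m k) $$ (r, s) = 0"
proof (induction k arbitrary: r s)
  case 0
  thus ?case using N by simp
next
  case (Suc k)
  have c: "N ^\<^sub>m k \<in> carrier_mat n n" using N by simp
  have "(N ^\<^sub>m Suc k) $$ (r, s) = (\<Sum>t<n. (N ^\<^sub>m k) $$ (r, t) * N $$ (t, s))"
    using c N Suc.prems by (simp add: index_mult_mat_sum del: index_mult_mat)
  also have "\<dots> = 0"
  proof (rule sum.neutral, rule ballI)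
    fix t assume "t \<in> {..<n}"
    hence "t < r + k \<or> s \<le> t" using Suc.prems by auto
    thus "(N ^\<^sub>m k) $$ (r, t) * N $$ (t, s) = 0"
      using Suc.IH[of r t] su[of t s] Suc.prems \<open>t \<in> {..<n}\<close> by auto
  qed
  finally show ?case .
qed

text \<open>The nilpotency form of having the joint spectrum {\<mu>}; the equivalence is
  \<open>quasi_scalar_iff\<close>. It is the form in which power series can be inserted.\<close>

definition quasi_scalar :: "nat \<Rightarrow> complex ^ 'd \<Rightarrow> ('d::finite) mat_tuple \<Rightarrow> bool" where
  "quasi_scalar n \<mu> x \<longleftrightarrow> n \<ge> 1 \<and> commuting n x \<and>
     (\<exists>m. \<forall>i. (x i - (\<mu> $ i) \<cdot>\<^sub>m 1\<^sub>m n) ^\<^sub>m m = 0\<^sub>m n n)"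

lemma intertwine_shift:
  assumes W: "W \<in> carrier_mat m n" and A: "A \<in> carrier_mat n n" and B: "B \<in> carrier_mat m m"
    and eq: "W * A = B * (W :: complex mat)"
  shows "W * (A - c \<cdot>\<^sub>m 1\<^sub>m n) = (B - c \<cdot>\<^sub>m 1\<^sub>m m) * W"
proof -
  have "W * (A - c \<cdot>\<^sub>m 1\<^sub>m n) = W * A - c \<cdot>\<^sub>m W"
    using W A by (simp add: mult_minus_distrib_mat[of W m n] mult_smult_distrib[OF W one_carrier_mat] right_mult_one_mat[OF W])
  also have "\<dots> = (B - c \<cdot>\<^sub>m 1\<^sub>m m) * W"
    using W B by (simp add: eq minus_mult_distrib_mat[of B m m] mult_smult_assoc_mat[OF one_carrier_mat W] left_mult_one_mat[OF W])
  finally show ?thesis .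
qed

lemma shift_carrier: "A \<in> carrier_mat n n \<Longrightarrow> A - c \<cdot>\<^sub>m 1\<^sub>m n \<in> carrier_mat n n"
  by auto

lemma single_eigenvalue_nilpotent:
  fixes A :: "complex mat"
  assumes A: "A \<in> carrier_mat n n" and sim: "similar_mat_wit A J T S"
    and ut: "\<And>r s. r < n \<Longrightarrow> s < r \<Longrightarrow> J $$ (r, s) = 0"
    and diag: "\<And>r. r < n \<Longrightarrow> J $$ (r, r) = \<mu>"
  shows "(A - \<mu> \<cdot>\<^sub>m 1\<^sub>m n) ^\<^sub>m n = 0\<^sub>m n n"
proof -
  note D = similar_mat_witD2[OF A sim]
  let ?N = "J - \<mu> \<cdot>\<^sub>m 1\<^sub>m n" and ?M = "A - \<mu> \<cdot>\<^sub>m 1\<^sub>m n"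
  have N: "?N ^\<^sub>m n = 0\<^sub>m n n"
  proof (rule eq_matI)
    fix r s assume rs: "r < dim_row (0\<^sub>m n n)" "s < dim_col (0\<^sub>m n n)"
    have "(?N ^\<^sub>m n) $$ (r, s) = 0"
    proof (rule strict_upper_triangular_pow[of _ n])
      show "?N $$ (r, s) = 0" if "r < n" "s < n" "s \<le> r" for r s
        using that ut[of r s] diag[of r] D(5) by (cases "s = r") auto
    qed (use rs D(5) in auto)
    thus "(?N ^\<^sub>m n) $$ (r, s) = 0\<^sub>m n n $$ (r, s)" using rs by simp
  qed (use D(5) in auto)
  have "A * T = T * J" 
    using D by (simp add: assoc_mult_mat[of _ n n _ n _ n] mult_carrier_mat[of _ n n _ n])
  hence "T * ?N = ?M * T" by (intro intertwine_shift D) auto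
  hence "T * ?N ^\<^sub>m n = ?M ^\<^sub>m n * T"
    using D by (intro intertwine_pow_mat) auto
  hence MT: "?M ^\<^sub>m n * T = 0\<^sub>m n n" using N D(6) by simp
  have M: "?M ^\<^sub>m n \<in> carrier_mat n n" by (intro pow_carrier_mat shift_carrier D(4))
  have "?M ^\<^sub>m n * T * S = ?M ^\<^sub>m n * (T * S)" by (rule assoc_mult_mat[OF M D(6,7)])
  thus ?thesis unfolding MT D(1) using M D(7) by simp
qed

text \<open>The similarity is the permutation matrix that lists the indices with P before the
  others. It is chosen before Y, so it brings all coordinates of a tuple to block form at
  once.\<close>

lemma permute_to_blocks:
  fixes P :: "nat \<Rightarrow> bool"
  obtains k T S where "k = card {r. r < n \<and> P r}" "T \<in> carrier_mat n n" "S \<in> carrier_mat n n"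
    "T * S = 1\<^sub>m n" "S * T = (1\<^sub>m n :: complex mat)"
    "\<forall>Y\<in>carrier_mat n n. (\<forall>r<n. \<forall>s<n. P r \<noteq> P s \<longrightarrow> Y $$ (r, s) = 0) \<longrightarrow>
       (\<forall>i<n. \<forall>j<n. (i < k) \<noteq> (j < k) \<longrightarrow> (S * Y * T) $$ (i, j) = 0)"
proof -
  define xs where "xs = filter P [0..<n] @ filter (\<lambda>r. \<not> P r) [0..<n]"
  define k where "k = length (filter P [0..<n])"
  have k: "k = card {r. r < n \<and> P r}"
    unfolding k_def by (subst distinct_card[symmetric]) (auto intro!: arg_cong[where f = card])
  have len: "length xs = n" unfolding xs_def by (simp add: sum_length_filter_compl)
  have dist: "distinct xs" unfolding xs_def by auto
  have set: "set xs = {..<n}" unfolding xs_def by auto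
  have xs_lt: "xs ! i < n" if "i < n" for i using set that len nth_mem by blast
  have P_iff: "P (xs ! i) \<longleftrightarrow> i < k" if "i < n" for i
  proof (cases "i < k")
    case True
    hence "xs ! i \<in> set (filter P [0..<n])" unfolding xs_def k_def nth_append by (auto simp del: set_filter intro: nth_mem)
    thus ?thesis using True by auto
  next
    case False
    hence "i - k < length (filter (\<lambda>r. \<not> P r) [0..<n])" using that len unfolding xs_def k_def by auto
    hence "xs ! i \<in> set (filter (\<lambda>r. \<not> P r) [0..<n])" using False unfolding xs_def k_def nth_append by (auto simp del: set_filter intro: nth_mem)
    thus ?thesis using False by auto
  qed
  define T :: "complex mat" where "T = mat n n (\<lambda>(i, j). if i = xs ! j then 1 else 0)"
  define S :: "complex mat" where "S = mat n n (\<lambda>(i, j). if xs ! i = j then 1 else 0)"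
  have TS: "T \<in> carrier_mat n n" "S \<in> carrier_mat n n" by (auto simp: T_def S_def)
  have SY: "(S * Y) $$ (i, j) = Y $$ (xs ! i, j)" if "Y \<in> carrier_mat n n" "i < n" "j < n" for Y i j
  proof -
    have "(S * Y) $$ (i, j) = (\<Sum>r<n. S $$ (i, r) * Y $$ (r, j))"
      using that TS by (simp add: index_mult_mat_sum del: index_mult_mat)
    also have "\<dots> = (\<Sum>r<n. if r = xs ! i then Y $$ (r, j) else 0)"
      using that by (intro sum.cong) (auto simp: S_def)
    finally show ?thesis using xs_lt[OF that(2)] by simp
  qed
  have YT: "(Y * T) $$ (i, j) = Y $$ (i, xs ! j)" if "Y \<in> carrier_mat n n" "i < n" "j < n" for Y i j
  proof -
    have "(Y * T) $$ (i, j) = (\<Sum>r<n. Y $$ (i, r) * T $$ (r, j))"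
      using that TS by (simp add: index_mult_mat_sum del: index_mult_mat)
    also have "\<dots> = (\<Sum>r<n. if r = xs ! j then Y $$ (i, r) else 0)"
      using that by (intro sum.cong) (auto simp: T_def)
    finally show ?thesis using xs_lt[OF that(3)] by simp
  qed
  have ST: "S * T = 1\<^sub>m n"
  proof (rule eq_matI)
    fix i j assume "i < dim_row (1\<^sub>m n :: complex mat)" "j < dim_col (1\<^sub>m n :: complex mat)"
    hence ij: "i < n" "j < n" by auto
    have "xs ! i = xs ! j \<longleftrightarrow> i = j" using ij len dist by (simp add: nth_eq_iff_index_eq)
    thus "(S * T) $$ (i, j) = 1\<^sub>m n $$ (i, j)"
      using SY[OF TS(1) ij] ij xs_lt[of i] by (simp add: T_def)
  qed (use TS in auto)
  have TS1: "T * S = 1\<^sub>m n" by (rule mat_mult_left_right_inverse[OF TS(2,1) ST])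
  show ?thesis
  proof (rule that[OF k TS TS1 ST], intro ballI allI impI)
    fix Y :: "complex mat" and i j
    assume Y: "Y \<in> carrier_mat n n" and z: "\<forall>r<n. \<forall>s<n. P r \<noteq> P s \<longrightarrow> Y $$ (r, s) = 0"
      and ij: "i < n" "j < n" "(i < k) \<noteq> (j < k)"
    have "S * Y \<in> carrier_mat n n" using TS Y by auto
    from YT[OF this ij(1,2)] SY[OF Y ij(1) xs_lt[OF ij(2)]]
    have "(S * Y * T) $$ (i, j) = Y $$ (xs ! i, xs ! j)" by simp
    thus "(S * Y * T) $$ (i, j) = 0" using z xs_lt[OF ij(1)] xs_lt[OF ij(2)] P_iff[OF ij(1)] P_iff[OF ij(2)] ij(3) by simp
  qed
qed

lemma commuting_similar:
  assumes x: "commuting n x" and T: "T \<in> carrier_mat n n" and S: "S \<in> carrier_mat n n" and TS: "T * S = 1\<^sub>m n"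
  shows "commuting n (\<lambda>i. S * x i * T)"
proof -
  note [simp] = assoc_mult_mat[of _ n n _ n _ n] mult_carrier_mat[of _ n n _ n] left_mult_one_mat[of _ n n]
  have c: "x i \<in> carrier_mat n n" for i using x by (rule commutingD)
  have *: "S * x i * T * (S * x j * T) = S * (x i * x j) * T" for i j
  proof -
    have "S * x i * T * (S * x j * T) = S * x i * (T * S) * x j * T" using c S T by simp
    also have "\<dots> = S * (x i * x j) * T" unfolding TS using c S T by simp
    finally show ?thesis .
  qed
  show ?thesis unfolding commuting_def
  proof (intro conjI allI)
    show "S * x i * T \<in> carrier_mat n n" for i using c S T by simp
    show "S * x i * T * (S * x j * T) = S * x j * T * (S * x i * T)" for i j
      unfolding * by (simp only: commutingD(2)[OF x, of i j])
  qed
qed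

lemma commuting_block_parts:
  assumes z: "commuting n z" and k: "k \<le> n"
    and off: "\<And>l i j. i < n \<Longrightarrow> j < n \<Longrightarrow> (i < k) \<noteq> (j < k) \<Longrightarrow> z l $$ (i, j) = 0"
  obtains b c where "commuting k b" "commuting (n - k) c"
    "\<forall>l. z l = four_block_mat (b l) (0\<^sub>m k (n - k)) (0\<^sub>m (n - k) k) (c l)"
proof -
  define b where "b l = mat k k (\<lambda>(i, j). z l $$ (i, j))" for l
  define c where "c l = mat (n - k) (n - k) (\<lambda>(i, j). z l $$ (i + k, j + k))" for l
  have zc: "z l \<in> carrier_mat n n" for l using z by (rule commutingD)
  have prod: "(z l * z m) $$ (i, j) = (\<Sum>t<n. z l $$ (i, t) * z m $$ (t, j))" if "i < n" "j < n" for l m i j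
    using that carrier_matD[OF zc] by (simp add: index_mult_mat_sum del: index_mult_mat)
  have b: "b l * b m = mat k k (\<lambda>(i, j). (z l * z m) $$ (i, j))" for l m
  proof (rule eq_matI)
    fix i j assume "i < dim_row (mat k k (\<lambda>(i, j). (z l * z m) $$ (i, j)))" "j < dim_col (mat k k (\<lambda>(i, j). (z l * z m) $$ (i, j)))"
    hence ij: "i < k" "j < k" by auto
    have "(\<Sum>t<n. z l $$ (i, t) * z m $$ (t, j)) = (\<Sum>t<k. z l $$ (i, t) * z m $$ (t, j))"
      using ij k off by (intro sum.mono_neutral_right) auto
    thus "(b l * b m) $$ (i, j) = mat k k (\<lambda>(i, j). (z l * z m) $$ (i, j)) $$ (i, j)"
      using ij k prod[of i j l m] by (simp add: b_def index_mult_mat_sum del: index_mult_mat)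
  qed (auto simp: b_def)
  have c: "c l * c m = mat (n - k) (n - k) (\<lambda>(i, j). (z l * z m) $$ (i + k, j + k))" for l m
  proof (rule eq_matI)
    fix i j assume "i < dim_row (mat (n - k) (n - k) (\<lambda>(i, j). (z l * z m) $$ (i + k, j + k)))"
      "j < dim_col (mat (n - k) (n - k) (\<lambda>(i, j). (z l * z m) $$ (i + k, j + k)))"
    hence ij: "i < n - k" "j < n - k" by auto
    have "(\<Sum>t<n. z l $$ (i + k, t) * z m $$ (t, j + k)) = (\<Sum>t\<in>{k..<n}. z l $$ (i + k, t) * z m $$ (t, j + k))"
      using ij k off by (intro sum.mono_neutral_right) auto
    also have "\<dots> = (\<Sum>t<n - k. z l $$ (i + k, t + k) * z m $$ (t + k, j + k))"
      by (rule sum.reindex_bij_witness[of _ "\<lambda>t. t + k" "\<lambda>t. t - k"]) auto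
    finally show "(c l * c m) $$ (i, j) = mat (n - k) (n - k) (\<lambda>(i, j). (z l * z m) $$ (i + k, j + k)) $$ (i, j)"
      using ij k prod[of "i + k" "j + k" l m] by (simp add: c_def index_mult_mat_sum del: index_mult_mat)
  qed (auto simp: c_def)
  show ?thesis
  proof (rule that[of b c])
    show "commuting k b" unfolding commuting_def using b commutingD(2)[OF z] by (auto simp: b_def)
    show "commuting (n - k) c" unfolding commuting_def using c commutingD(2)[OF z] by (auto simp: c_def)
    show "\<forall>l. z l = four_block_mat (b l) (0\<^sub>m k (n - k)) (0\<^sub>m (n - k) k) (c l)"
    proof
      fix l
      show "z l = four_block_mat (b l) (0\<^sub>m k (n - k)) (0\<^sub>m (n - k) k) (c l)"
        by (rule eq_matI) (use zc[of l] k off in \<open>auto simp: b_def c_def\<close>)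
    qed
  qed
qed

lemma similar_mat_wit_conj:
  assumes A: "A \<in> carrier_mat n n" and T: "T \<in> carrier_mat n n" and S: "S \<in> carrier_mat n n"
    and TS: "T * S = 1\<^sub>m n" "S * T = (1\<^sub>m n :: complex mat)"
  shows "similar_mat_wit A (S * A * T) T S"
proof (rule similar_mat_witI[OF TS])
  have "T * (S * A * T) * S = (T * S) * A * (T * S)"
    using A T S by (simp add: assoc_mult_mat[of _ n n _ n _ n] mult_carrier_mat[of _ n n _ n])
  thus "A = T * (S * A * T) * S"
    by (simp only: TS left_mult_one_mat[OF A] right_mult_one_mat[OF A])
qed (use A T S in auto)

text \<open>Induction on the size. If every coordinate has a single eigenvalue, the tuple is
  quasi-scalar. Otherwise some coordinate, in Jordan form, has two different diagonal entries; all
  coordinates commute with it and hence respect the splitting into the indices carrying its first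
  diagonal entry and the rest.\<close>

theorem joint_decomposition:
  fixes x :: "('d::finite) mat_tuple"
  assumes "commuting n x" "n \<ge> 1"
  shows "\<exists>us T S. (\<forall>(\<mu>, u)\<in>set us. \<exists>m. quasi_scalar m \<mu> u) \<and>
    (\<forall>i. similar_mat_wit (x i) (diag_block_mat (map (\<lambda>(\<mu>, u). u i) us)) T S)"
  using assms
proof (induction n arbitrary: x rule: less_induct)
  case (less n)
  note x = \<open>commuting n x\<close>
  have "\<forall>i. \<exists>J T S. similar_mat_wit (x i) J T S \<and> separated_triangular n J"
  proof
    fix i
    obtain J T S where "similar_mat_wit (x i) J T S" "separated_triangular n J"
      by (rule separated_triangular_form[OF commutingD(1)[OF x, of i]])
    thus "\<exists>J T S. similar_mat_wit (x i) J T S \<and> separated_triangular n J" by blast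
  qed
  then obtain J T S where Q: "\<And>i. similar_mat_wit (x i) (J i) (T i) (S i)" "\<And>i. separated_triangular n (J i)"
    by metis
  have JTS: "similar_mat_wit (x i) (J i) (T i) (S i)" "J i \<in> carrier_mat n n"
    "r < n \<Longrightarrow> s < r \<Longrightarrow> J i $$ (r, s) = 0"
    "r < n \<Longrightarrow> s < n \<Longrightarrow> J i $$ (r, s) \<noteq> 0 \<Longrightarrow> J i $$ (r, r) = J i $$ (s, s)" for i r s
    using Q(1) Q(2)[of i] unfolding separated_triangular_def by blast+
  show ?case
  proof (cases "\<forall>i. \<forall>r<n. J i $$ (r, r) = J i $$ (0, 0)")
    case True
    define \<mu> where "\<mu> = (\<chi> i. J i $$ (0, 0))"
    have "(x i - (\<mu> $ i) \<cdot>\<^sub>m 1\<^sub>m n) ^\<^sub>m n = 0\<^sub>m n n" for i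
    proof (rule single_eigenvalue_nilpotent[OF commutingD(1)[OF x] JTS(1)[of i] JTS(3)])
      fix r assume "r < n"
      with True have "J i $$ (r, r) = J i $$ (0, 0)" by blast
      thus "J i $$ (r, r) = \<mu> $ i" unfolding \<mu>_def by simp
    qed
    hence "quasi_scalar n \<mu> x" using x less.prems by (auto simp: quasi_scalar_def)
    thus ?thesis using similar_mat_wit_refl[OF commutingD(1)[OF x]]
      by (intro exI[of _ "[(\<mu>, x)]"] exI[of _ "1\<^sub>m n"]) (auto simp del: diag_block_mat.simps)
  next
    case False
    then obtain l r0 where lr: "r0 < n" "J l $$ (r0, r0) \<noteq> J l $$ (0, 0)" by auto
    let ?P = "\<lambda>r. J l $$ (r, r) = J l $$ (0, 0)"
    note D = similar_mat_witD2[OF commutingD(1)[OF x] JTS(1), of l]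
    have sim1: "similar_mat_wit (x i) (S l * x i * T l) (T l) (S l)" for i
      by (rule similar_mat_wit_conj[OF commutingD(1)[OF x] D(6,7,1,2)])
    define y where "y i = S l * x i * T l" for i
    have y: "commuting n y" unfolding y_def by (rule commuting_similar[OF x D(6,7,1)])
    have yl: "y l = J l"
      using similar_mat_witD(3)[OF refl similar_mat_wit_sym[OF JTS(1)], of l] by (simp add: y_def)
    have y0: "y i $$ (r, s) = 0" if "r < n" "s < n" "?P r \<noteq> ?P s" for i r s
    proof (rule commutes_with_separated_triangular[OF JTS(2)[of l] commutingD(1)[OF y] _ JTS(3,4) that(1,2)])
      show "y i * J l = J l * y i" using commutingD(2)[OF y, of i l] unfolding yl .
    qed (use that in auto)
    obtain k and T' S' :: "complex mat" where k: "k = card {r. r < n \<and> ?P r}" and T': "T' \<in> carrier_mat n n" "S' \<in> carrier_mat n n"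
      "T' * S' = 1\<^sub>m n" "S' * T' = 1\<^sub>m n"
      and off: "\<forall>Y\<in>carrier_mat n n. (\<forall>r<n. \<forall>s<n. ?P r \<noteq> ?P s \<longrightarrow> Y $$ (r, s) = 0) \<longrightarrow>
       (\<forall>i<n. \<forall>j<n. (i < k) \<noteq> (j < k) \<longrightarrow> (S' * Y * T') $$ (i, j) = 0)"
      by (rule permute_to_blocks[of n ?P]) (rule that; assumption)
    \<comment> \<open>Index \<open>r0\<close> violates the property and index 0 satisfies it, so
      both blocks are nonempty and smaller than n.\<close>
    have "{r. r < n \<and> ?P r} \<subset> {..<n}" using lr by auto
    hence "k < n" unfolding k using psubset_card_mono[of "{..<n}"] by (simp del: psubset_eq)
    moreover have "0 \<in> {r. r < n \<and> ?P r}" using less.prems by simp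
    hence "k > 0" unfolding k by (subst card_gt_0_iff) auto
    ultimately have kn: "0 < k" "k < n" by auto
    define z where "z i = S' * y i * T'" for i
    have z: "commuting n z" unfolding z_def by (rule commuting_similar[OF y T'(1,2,3)])
    have sim2: "similar_mat_wit (y i) (z i) T' S'" for i
      unfolding z_def by (rule similar_mat_wit_conj[OF commutingD(1)[OF y] T'])
    have z0: "z m $$ (i, j) = 0" if "i < n" "j < n" "(i < k) \<noteq> (j < k)" for m i j
      unfolding z_def using off[rule_format, OF commutingD(1)[OF y], of m i j] y0 that by blast
    obtain b c where bc: "commuting k b" "commuting (n - k) c"
      "\<forall>m. z m = four_block_mat (b m) (0\<^sub>m k (n - k)) (0\<^sub>m (n - k) k) (c m)"
      by (rule commuting_block_parts[OF z less_imp_le[OF kn(2)] z0]) (assumption | (rule that; assumption))+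
    obtain us T1 S1 where us: "\<forall>(\<mu>, u)\<in>set us. \<exists>m. quasi_scalar m \<mu> u"
      "\<And>i. similar_mat_wit (b i) (diag_block_mat (map (\<lambda>(\<mu>, u). u i) us)) T1 S1"
      using less.IH[OF kn(2) bc(1)] kn by auto
    obtain vs T2 S2 where vs: "\<forall>(\<mu>, u)\<in>set vs. \<exists>m. quasi_scalar m \<mu> u"
      "\<And>i. similar_mat_wit (c i) (diag_block_mat (map (\<lambda>(\<mu>, u). u i) vs)) T2 S2"
    proof -
      have "n - k < n" "1 \<le> n - k" using kn by auto
      from less.IH[OF this(1) bc(2) this(2)] that show ?thesis by blast
    qed
    define T3 where "T3 = four_block_mat T1 (0\<^sub>m k (n - k)) (0\<^sub>m (n - k) k) T2"
    define S3 where "S3 = four_block_mat S1 (0\<^sub>m k (n - k)) (0\<^sub>m (n - k) k) S2"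
    have sim3: "similar_mat_wit (z i) (diag_block_mat (map (\<lambda>(\<mu>, u). u i) (us @ vs))) T3 S3" for i
    proof -
      note D1 = similar_mat_witD2[OF commutingD(1)[OF bc(1), of i] us(2)[of i]]
      note D2 = similar_mat_witD2[OF commutingD(1)[OF bc(2), of i] vs(2)[of i]]
      have "diag_block_mat (map (\<lambda>(\<mu>, u). u i) (us @ vs)) =
        four_block_mat (diag_block_mat (map (\<lambda>(\<mu>, u). u i) us)) (0\<^sub>m k (n - k)) (0\<^sub>m (n - k) k)
          (diag_block_mat (map (\<lambda>(\<mu>, u). u i) vs))"
        using carrier_matD[OF D1(5)] carrier_matD[OF D2(5)] by (simp add: diag_block_mat_append Let_def)
      thus ?thesis unfolding bc(3)[rule_format] T3_def S3_def
        using D1 D2 us(2)[of i] vs(2)[of i]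
        by (auto intro!: similar_mat_wit_four_block commutingD(1)[OF bc(1)] commutingD(1)[OF bc(2)])
    qed
    have "similar_mat_wit (x i) (diag_block_mat (map (\<lambda>(\<mu>, u). u i) (us @ vs)))
       (T l * T' * T3) (S3 * (S' * S l))" for i
      using similar_mat_wit_trans[OF similar_mat_wit_trans[OF sim1[of i, folded y_def] sim2[of i]] sim3[of i]] .
    thus ?thesis using us(1) vs(1)
      by (intro exI[of _ "us @ vs"] exI[of _ "T l * T' * T3"] exI[of _ "S3 * (S' * S l)"]) auto
  qed
qed

section \<open>Power series at tuples with one joint eigenvalue\<close>

definition shift_tuple :: "nat \<Rightarrow> complex ^ 'd \<Rightarrow> ('d::finite) mat_tuple \<Rightarrow> 'd mat_tuple" where
  "shift_tuple n \<mu> x = (\<lambda>i. x i - (\<mu> $ i) \<cdot>\<^sub>m 1\<^sub>m n)"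

lemma commuting_shift_tuple:
  assumes x: "commuting n x"
  shows "commuting n (shift_tuple n \<mu> x)"
proof -
  have 1: "x i * (x j - c \<cdot>\<^sub>m 1\<^sub>m n) = (x j - c \<cdot>\<^sub>m 1\<^sub>m n) * x i" for i j c
    using commutingD[OF x] by (intro intertwine_shift) auto
  have "(x i - d \<cdot>\<^sub>m 1\<^sub>m n) * (x j - c \<cdot>\<^sub>m 1\<^sub>m n) = (x j - c \<cdot>\<^sub>m 1\<^sub>m n) * (x i - d \<cdot>\<^sub>m 1\<^sub>m n)" for i j c d
    by (rule intertwine_shift[OF shift_carrier commutingD(1)[OF x] commutingD(1)[OF x] 1[symmetric], OF commutingD(1)[OF x], symmetric])
  thus ?thesis using commutingD(1)[OF x] by (auto simp: commuting_def shift_tuple_def)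
qed

lemma quasi_scalarE:
  assumes "quasi_scalar n \<mu> x"
  obtains m where "n \<ge> 1" "commuting n x" "\<forall>i. shift_tuple n \<mu> x i ^\<^sub>m m = 0\<^sub>m n n"
  using assms unfolding quasi_scalar_def shift_tuple_def by blast

lemma finite_bounded_multiindices: "finite {\<alpha> :: ('d::finite) \<Rightarrow>\<^sub>0 nat. \<forall>i. Poly_Mapping.lookup \<alpha> i < m}"
proof (rule finite_imageD[where f = Poly_Mapping.lookup])
  have "Poly_Mapping.lookup ` {\<alpha> :: 'd \<Rightarrow>\<^sub>0 nat. \<forall>i. Poly_Mapping.lookup \<alpha> i < m} \<subseteq> (UNIV \<rightarrow>\<^sub>E {..<m})"
    by auto
  thus "finite (Poly_Mapping.lookup ` {\<alpha> :: 'd \<Rightarrow>\<^sub>0 nat. \<forall>i. Poly_Mapping.lookup \<alpha> i < m})"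
    by (rule finite_subset) (rule finite_PiE, rule finite, rule finite_lessThan)
qed (rule inj_onI, rule poly_mapping_eqI, simp)

text \<open>A monomial with an exponent at least m vanishes. Finiteness makes the sum in
  \<open>insert_series\<close> genuine: over an infinite index set it would be 0 by default.\<close>

lemma finite_nonzero_monomials:
  assumes "quasi_scalar n \<mu> x"
  shows "finite {\<alpha>. monom_mat \<alpha> (shift_tuple n \<mu> x) \<noteq> 0\<^sub>m n n}"
proof -
  obtain m where m: "n \<ge> 1" "commuting n x" "\<forall>i. shift_tuple n \<mu> x i ^\<^sub>m m = 0\<^sub>m n n"
    by (rule quasi_scalarE[OF assms]) (rule that; assumption)
  let ?N = "shift_tuple n \<mu> x"
  have N: "commuting n ?N" by (rule commuting_shift_tuple[OF m(2)])
  have "monom_mat \<alpha> ?N = 0\<^sub>m n n" if "Poly_Mapping.lookup \<alpha> i \<ge> m" for \<alpha> i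
  proof -
    have "\<alpha> = (\<alpha> - Poly_Mapping.single i m) + Poly_Mapping.single i m"
      using that by (intro poly_mapping_eqI) (auto simp: lookup_add lookup_minus lookup_single when_def)
    hence "monom_mat \<alpha> ?N = monom_mat (\<alpha> - Poly_Mapping.single i m) ?N * ?N i ^\<^sub>m m"
      by (metis monom_mat_add[OF N] monom_mat_single[OF N])
    thus ?thesis using right_mult_zero_mat[OF monom_mat_carrier[OF N]] by (simp add: m)
  qed
  hence "{\<alpha>. monom_mat \<alpha> ?N \<noteq> 0\<^sub>m n n} \<subseteq> {\<alpha>. \<forall>i. Poly_Mapping.lookup \<alpha> i < m}"
    by (auto simp: not_less[symmetric])
  thus ?thesis by (rule finite_subset) (rule finite_bounded_multiindices)
qed

definition trunc_series :: "('d \<Rightarrow>\<^sub>0 nat) set \<Rightarrow> (('d \<Rightarrow>\<^sub>0 nat) \<Rightarrow> complex) \<Rightarrow> 'd::finite mpoly" where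
  "trunc_series B a = (\<Sum>\<alpha>\<in>B. Poly_Mapping.single \<alpha> (a \<alpha>))"

lemma lookup_trunc_series: "finite B \<Longrightarrow> Poly_Mapping.lookup (trunc_series B a) \<alpha> = (if \<alpha> \<in> B then a \<alpha> else 0)"
  by (simp add: trunc_series_def lookup_sum lookup_single when_def)

text \<open>Inserting a series is evaluating a polynomial at the nilpotent part, so the intertwining
  calculus applies. B may be larger than the set of nonzero monomials, which lets two tuples share
  one polynomial.\<close>

lemma insert_series_eq_mpoly_mat:
  assumes x: "quasi_scalar n \<mu> x" and B: "finite B" "{\<alpha>. monom_mat \<alpha> (shift_tuple n \<mu> x) \<noteq> 0\<^sub>m n n} \<subseteq> B"
  shows "insert_series g \<mu> x = mpoly_mat (trunc_series B (power_series_at g \<mu>)) (shift_tuple n \<mu> x)"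
proof -
  have c: "commuting n x" using x by (simp add: quasi_scalar_def)
  let ?N = "shift_tuple n \<mu> x" and ?q = "trunc_series B (power_series_at g \<mu>)"
  have N: "commuting n ?N" by (rule commuting_shift_tuple[OF c])
  have "(\<Sum>\<alpha> | monom_mat \<alpha> ?N \<noteq> 0\<^sub>m n n. power_series_at g \<mu> \<alpha> * monom_mat \<alpha> ?N $$ (i, j)) =
        (\<Sum>\<alpha>\<in>Poly_Mapping.keys ?q. Poly_Mapping.lookup ?q \<alpha> * monom_mat \<alpha> ?N $$ (i, j))" if "i < n" "j < n" for i j
  proof -
    have "(\<Sum>\<alpha>\<in>Poly_Mapping.keys ?q. Poly_Mapping.lookup ?q \<alpha> * monom_mat \<alpha> ?N $$ (i, j)) =
      (\<Sum>\<alpha>\<in>B. Poly_Mapping.lookup ?q \<alpha> * monom_mat \<alpha> ?N $$ (i, j))"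
      by (rule sum_keys_superset) (auto simp: B in_keys_iff lookup_trunc_series split: if_splits)
    also have "\<dots> = (\<Sum>\<alpha>\<in>B. power_series_at g \<mu> \<alpha> * monom_mat \<alpha> ?N $$ (i, j))"
      by (simp add: B lookup_trunc_series)
    also have "\<dots> = (\<Sum>\<alpha> | monom_mat \<alpha> ?N \<noteq> 0\<^sub>m n n. power_series_at g \<mu> \<alpha> * monom_mat \<alpha> ?N $$ (i, j))"
      using B that by (intro sum.mono_neutral_right) auto
    finally show ?thesis ..
  qed
  thus ?thesis
    unfolding insert_series_def mpoly_mat_def commuting_tuple_size[OF c] commuting_tuple_size[OF N] Let_def shift_tuple_def[symmetric]
    by (intro eq_matI) auto
qed

lemma insert_series_carrier: "commuting n x \<Longrightarrow> insert_series g \<mu> x \<in> carrier_mat n n"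
  by (simp add: insert_series_def Let_def commuting_tuple_size)

lemma intertwine_insert_series:
  assumes W: "W \<in> carrier_mat m n" and x: "quasi_scalar n \<mu> x" and y: "quasi_scalar m \<mu> y"
    and eq: "\<And>i. W * x i = y i * W"
  shows "W * insert_series g \<mu> x = insert_series g \<mu> y * W"
proof -
  let ?N = "shift_tuple n \<mu> x" and ?M = "shift_tuple m \<mu> y"
  \<comment> \<open>The union serves both tuples with the same truncation.\<close>
  let ?B = "{\<alpha>. monom_mat \<alpha> ?N \<noteq> 0\<^sub>m n n} \<union> {\<alpha>. monom_mat \<alpha> ?M \<noteq> 0\<^sub>m m m}"
  have fin: "finite ?B" using finite_nonzero_monomials[OF x] finite_nonzero_monomials[OF y] by blast
  have c: "commuting n x" "commuting m y" using x y by (auto simp: quasi_scalar_def)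
  have "W * ?N i = ?M i * W" for i
    unfolding shift_tuple_def by (rule intertwine_shift[OF W commutingD(1)[OF c(1)] commutingD(1)[OF c(2)] eq])
  from intertwine_mpoly_mat[OF W commuting_shift_tuple[OF c(1)] commuting_shift_tuple[OF c(2)] this]
  show ?thesis
    using insert_series_eq_mpoly_mat[OF x fin Un_upper1] insert_series_eq_mpoly_mat[OF y fin Un_upper2] by simp
qed

text \<open>In a coordinate i where \<mu> and \<nu> differ, nilpotency of x_i - \<mu>_i gives (y_i -
  \<mu>_i)^k W = 0, while y_i - \<mu>_i is injective because \<nu>_i is the only eigenvalue of
  y_i.\<close>

lemma intertwine_distinct_zero:
  assumes W: "W \<in> carrier_mat m n" and x: "quasi_scalar n \<mu> x" and y: "quasi_scalar m \<nu> y" and ne: "\<mu> \<noteq> \<nu>"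
    and eq: "\<And>i. W * x i = y i * W"
  shows "W = 0\<^sub>m m n"
proof -
  obtain i where i: "\<mu> $ i \<noteq> \<nu> $ i" using ne by (auto simp: Finite_Cartesian_Product.vec_eq_iff)
  obtain k where k: "commuting n x" "shift_tuple n \<mu> x i ^\<^sub>m k = 0\<^sub>m n n" using quasi_scalarE[OF x] by metis
  obtain l where l: "commuting m y" "shift_tuple m \<nu> y i ^\<^sub>m l = 0\<^sub>m m m" using quasi_scalarE[OF y] by metis
  note xc = commutingD(1)[OF k(1), of i] and yc = commutingD(1)[OF l(1), of i]
  let ?B = "y i - (\<mu> $ i) \<cdot>\<^sub>m 1\<^sub>m m"
  have Bc: "?B \<in> carrier_mat m m" by (rule shift_carrier[OF yc])
  have "W * (x i - (\<mu> $ i) \<cdot>\<^sub>m 1\<^sub>m n) = ?B * W" by (rule intertwine_shift[OF W xc yc eq])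
  hence "W * (x i - (\<mu> $ i) \<cdot>\<^sub>m 1\<^sub>m n) ^\<^sub>m k = ?B ^\<^sub>m k * W"
    by (rule intertwine_pow_mat[OF W shift_carrier[OF xc] Bc])
  hence BW: "?B ^\<^sub>m k * W = 0\<^sub>m m n"
    using k(2) right_mult_zero_mat[OF W] by (simp add: shift_tuple_def)
  \<comment> \<open>On the kernel of y_i - \<mu>_i the nilpotent y_i - \<nu>_i acts as the nonzero
    scalar c, so a power of c annihilates U.\<close>
  have inj: "U = 0\<^sub>m m n" if U: "U \<in> carrier_mat m n" "?B * U = 0\<^sub>m m n" for U
  proof -
    let ?C = "y i - (\<nu> $ i) \<cdot>\<^sub>m 1\<^sub>m m"
    define c where "c = \<mu> $ i - \<nu> $ i"
    have Cc: "?C \<in> carrier_mat m m" by (rule shift_carrier[OF yc])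
    have "?C * U = ?B * U + c \<cdot>\<^sub>m U"
    proof -
      have "?C = ?B + c \<cdot>\<^sub>m 1\<^sub>m m" using yc by (intro eq_matI) (auto simp: c_def)
      hence "?C * U = ?B * U + (c \<cdot>\<^sub>m 1\<^sub>m m) * U"
        using add_mult_distrib_mat[OF Bc _ U(1), of "c \<cdot>\<^sub>m 1\<^sub>m m"] by simp
      thus ?thesis using mult_smult_assoc_mat[OF one_carrier_mat U(1), of c] left_mult_one_mat[OF U(1)] by simp
    qed
    hence CU: "?C * U = c \<cdot>\<^sub>m U" using U by (simp add: left_add_zero_mat[of _ m n])
    have "?C ^\<^sub>m j * U = c ^ j \<cdot>\<^sub>m U" for j
    proof (induction j)
      case 0
      thus ?case using left_mult_one_mat[OF U(1)] yc U by (intro eq_matI) auto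
    next
      case (Suc j)
      have "?C ^\<^sub>m Suc j * U = ?C ^\<^sub>m j * (?C * U)"
        using assoc_mult_mat[OF pow_carrier_mat[OF Cc] Cc U(1), of j] by simp
      also have "\<dots> = c \<cdot>\<^sub>m (?C ^\<^sub>m j * U)"
        unfolding CU by (rule mult_smult_distrib[OF pow_carrier_mat[OF Cc] U(1)])
      also have "\<dots> = c ^ Suc j \<cdot>\<^sub>m U" unfolding Suc using U by (intro eq_matI) auto
      finally show ?case .
    qed
    from this[of l] have z: "c ^ l \<cdot>\<^sub>m U = 0\<^sub>m m n"
      using l(2) left_mult_zero_mat[OF U(1)] by (simp add: shift_tuple_def)
    have c: "c \<noteq> 0" using i by (simp add: c_def)
    show ?thesis
    proof (rule eq_matI)
      fix r s assume rs: "r < dim_row (0\<^sub>m m n)" "s < dim_col (0\<^sub>m m n)"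
      have "(c ^ l \<cdot>\<^sub>m U) $$ (r, s) = 0" using rs by (simp add: z)
      thus "U $$ (r, s) = 0\<^sub>m m n $$ (r, s)" using rs U c by simp
    qed (use U in auto)
  qed
  have "?B ^\<^sub>m j * W = 0\<^sub>m m n \<Longrightarrow> W = 0\<^sub>m m n" for j
  proof (induction j)
    case 0
    thus ?case using left_mult_one_mat[OF W] yc by simp
  next
    case (Suc j)
    have e: "?B * (?B ^\<^sub>m j * W) = ?B ^\<^sub>m Suc j * W"
    proof -
      have "?B ^\<^sub>m Suc j = ?B * ?B ^\<^sub>m j"
        using pow_mat_add[OF Bc, of 1 j] Bc left_mult_one_mat[OF Bc] by simp
      thus ?thesis using assoc_mult_mat[OF Bc pow_carrier_mat[OF Bc] W, of j] by simp
    qed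
    have "?B ^\<^sub>m j * W = 0\<^sub>m m n"
      by (rule inj[OF mult_carrier_mat[OF pow_carrier_mat[OF Bc] W]]) (unfold e, rule Suc.prems)
    thus ?case by (rule Suc.IH)
  qed
  from this[OF BW] show ?thesis .
qed

section \<open>Projections onto diagonal blocks\<close>

definition block_proj :: "nat list \<Rightarrow> nat \<Rightarrow> complex mat" where
  "block_proj ns k = mat (ns ! k) (sum_list ns) (\<lambda>(i, j). if j = sum_list (take k ns) + i then 1 else 0)"

lemma block_offset_less: "k < length ns \<Longrightarrow> i < ns ! k \<Longrightarrow> sum_list (take k ns) + i < sum_list (ns :: nat list)"
proof (induction ns arbitrary: k)
  case (Cons a ns)
  thus ?case by (cases k) auto
qed auto

lemma block_index_exists: "j < sum_list (ns :: nat list) \<Longrightarrow> \<exists>k<length ns. \<exists>i<ns ! k. j = sum_list (take k ns) + i"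
proof (induction ns arbitrary: j)
  case (Cons a ns)
  show ?case
  proof (cases "j < a")
    case True
    thus ?thesis by (intro exI[of _ 0]) auto
  next
    case False
    hence "j - a < sum_list ns" using Cons.prems by auto
    from Cons.IH[OF this] obtain k i where "k < length ns" "i < ns ! k" "j - a = sum_list (take k ns) + i" by blast
    thus ?thesis using False by (intro exI[of _ "Suc k"]) (auto intro!: exI[of _ i])
  qed
qed auto

lemma diag_block_mat_row_entry:
  fixes As :: "complex mat list"
  assumes "\<forall>A\<in>set As. dim_col A = dim_row A"
  shows "k < length As \<Longrightarrow> i < dim_row (As ! k) \<Longrightarrow> j < sum_list (map dim_row As) \<Longrightarrow>
    diag_block_mat As $$ (sum_list (take k (map dim_row As)) + i, j) =
      (if sum_list (take k (map dim_row As)) \<le> j \<and> j < sum_list (take k (map dim_row As)) + dim_row (As ! k)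
       then As ! k $$ (i, j - sum_list (take k (map dim_row As))) else 0)"
  using assms
proof (induction As arbitrary: k j)
  case (Cons A As)
  have d: "map dim_col As = map dim_row As" using Cons.prems by simp
  have dims: "dim_row (diag_block_mat As) = sum_list (map dim_row As)" "dim_col (diag_block_mat As) = sum_list (map dim_row As)"
    by (simp_all add: dim_diag_block_mat d)
  show ?case
  proof (cases k)
    case 0
    thus ?thesis using Cons.prems by (auto simp: Let_def dims)
  next
    case (Suc k')
    have lt: "sum_list (take k' (map dim_row As)) + i < sum_list (map dim_row As)"
      using Cons.prems Suc by (intro block_offset_less) auto
    show ?thesis
    proof (cases "j < dim_row A")
      case True
      thus ?thesis using Cons.prems Suc lt by (auto simp: Let_def dims)
    next
      case False
      have "diag_block_mat As $$ (sum_list (take k' (map dim_row As)) + i, j - dim_row A) =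
       (if sum_list (take k' (map dim_row As)) \<le> j - dim_row A \<and> j - dim_row A < sum_list (take k' (map dim_row As)) + dim_row (As ! k')
       then As ! k' $$ (i, j - dim_row A - sum_list (take k' (map dim_row As))) else 0)"
        using Cons.prems Suc False by (intro Cons.IH) auto
      thus ?thesis using Cons.prems Suc False lt by (auto simp: Let_def dims diff_diff_left)
    qed
  qed
qed auto

lemma diag_block_mat_col_entry:
  fixes As :: "complex mat list"
  assumes "\<forall>A\<in>set As. dim_col A = dim_row A"
  shows "k < length As \<Longrightarrow> j < dim_row (As ! k) \<Longrightarrow> i < sum_list (map dim_row As) \<Longrightarrow>
    diag_block_mat As $$ (i, sum_list (take k (map dim_row As)) + j) =
      (if sum_list (take k (map dim_row As)) \<le> i \<and> i < sum_list (take k (map dim_row As)) + dim_row (As ! k)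
       then As ! k $$ (i - sum_list (take k (map dim_row As)), j) else 0)"
  using assms
proof (induction As arbitrary: k i)
  case (Cons A As)
  have d: "map dim_col As = map dim_row As" using Cons.prems by simp
  have dims: "dim_row (diag_block_mat As) = sum_list (map dim_row As)" "dim_col (diag_block_mat As) = sum_list (map dim_row As)"
    by (simp_all add: dim_diag_block_mat d)
  show ?case
  proof (cases k)
    case 0
    thus ?thesis using Cons.prems by (auto simp: Let_def dims)
  next
    case (Suc k')
    have lt: "sum_list (take k' (map dim_row As)) + j < sum_list (map dim_row As)"
      using Cons.prems Suc by (intro block_offset_less) auto
    show ?thesis
    proof (cases "i < dim_row A")
      case True
      thus ?thesis using Cons.prems Suc lt by (auto simp: Let_def dims)
    next
      case False
      have "diag_block_mat As $$ (i - dim_row A, sum_list (take k' (map dim_row As)) + j) =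
       (if sum_list (take k' (map dim_row As)) \<le> i - dim_row A \<and> i - dim_row A < sum_list (take k' (map dim_row As)) + dim_row (As ! k')
       then As ! k' $$ (i - dim_row A - sum_list (take k' (map dim_row As)), j) else 0)"
        using Cons.prems Suc False by (intro Cons.IH) auto
      thus ?thesis using Cons.prems Suc False lt by (auto simp: Let_def dims diff_diff_left)
    qed
  qed
qed auto

lemma block_proj_carrier: "block_proj ns k \<in> carrier_mat (ns ! k) (sum_list ns)"
  by (simp add: block_proj_def)

lemma block_proj_mult_entry:
  assumes "k < length ns" "i < ns ! k" "X \<in> carrier_mat (sum_list ns) m" "j < m"
  shows "(block_proj ns k * X) $$ (i, j) = X $$ (sum_list (take k ns) + i, j)"
proof -
  have "(block_proj ns k * X) $$ (i, j) = (\<Sum>t<sum_list ns. block_proj ns k $$ (i, t) * X $$ (t, j))"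
    using assms by (simp add: index_mult_mat_sum block_proj_def del: index_mult_mat)
  also have "\<dots> = (\<Sum>t<sum_list ns. if t = sum_list (take k ns) + i then X $$ (t, j) else 0)"
    using assms by (intro sum.cong) (auto simp: block_proj_def)
  finally show ?thesis using block_offset_less[OF assms(1,2)] by simp
qed

lemma mult_block_proj_transpose_entry:
  assumes "k < length ns" "j < ns ! k" "X \<in> carrier_mat m (sum_list ns)" "i < m"
  shows "(X * transpose_mat (block_proj ns k)) $$ (i, j) = X $$ (i, sum_list (take k ns) + j)"
proof -
  have "(X * transpose_mat (block_proj ns k)) $$ (i, j) = (\<Sum>t<sum_list ns. X $$ (i, t) * transpose_mat (block_proj ns k) $$ (t, j))"
    using assms by (simp add: index_mult_mat_sum block_proj_def del: index_mult_mat)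
  also have "\<dots> = (\<Sum>t<sum_list ns. if t = sum_list (take k ns) + j then X $$ (i, t) else 0)"
    using assms by (intro sum.cong) (auto simp: block_proj_def)
  finally show ?thesis using block_offset_less[OF assms(1,2)] by simp
qed

lemma mult_block_proj_entry:
  assumes "k < length ns" "A \<in> carrier_mat m (ns ! k)" "i < m" "j < sum_list ns"
  shows "(A * block_proj ns k) $$ (i, j) =
    (if sum_list (take k ns) \<le> j \<and> j < sum_list (take k ns) + ns ! k then A $$ (i, j - sum_list (take k ns)) else 0)"
proof -
  have "(A * block_proj ns k) $$ (i, j) = (\<Sum>t<ns ! k. A $$ (i, t) * block_proj ns k $$ (t, j))"
    using assms by (simp add: index_mult_mat_sum block_proj_def del: index_mult_mat)
  also have "\<dots> = (\<Sum>t<ns ! k. if t = j - sum_list (take k ns) \<and> sum_list (take k ns) \<le> j then A $$ (i, t) else 0)"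
    using assms by (intro sum.cong) (auto simp: block_proj_def)
  also have "\<dots> = (if sum_list (take k ns) \<le> j \<and> j < sum_list (take k ns) + ns ! k then A $$ (i, j - sum_list (take k ns)) else 0)"
    by (cases "sum_list (take k ns) \<le> j") auto
  finally show ?thesis .
qed

lemma block_proj_transpose_mult_entry:
  assumes "k < length ns" "A \<in> carrier_mat (ns ! k) m" "j < m" "i < sum_list ns"
  shows "(transpose_mat (block_proj ns k) * A) $$ (i, j) =
    (if sum_list (take k ns) \<le> i \<and> i < sum_list (take k ns) + ns ! k then A $$ (i - sum_list (take k ns), j) else 0)"
proof -
  have "(transpose_mat (block_proj ns k) * A) $$ (i, j) = (\<Sum>t<ns ! k. transpose_mat (block_proj ns k) $$ (i, t) * A $$ (t, j))"
    using assms by (simp add: index_mult_mat_sum block_proj_def del: index_mult_mat)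
  also have "\<dots> = (\<Sum>t<ns ! k. if t = i - sum_list (take k ns) \<and> sum_list (take k ns) \<le> i then A $$ (t, j) else 0)"
    using assms by (intro sum.cong) (auto simp: block_proj_def)
  also have "\<dots> = (if sum_list (take k ns) \<le> i \<and> i < sum_list (take k ns) + ns ! k then A $$ (i - sum_list (take k ns), j) else 0)"
    by (cases "sum_list (take k ns) \<le> i") auto
  finally show ?thesis .
qed

lemma diag_block_mat_carrier:
  assumes "\<forall>A\<in>set As. dim_col A = dim_row A" "map dim_row As = ns"
  shows "diag_block_mat As \<in> carrier_mat (sum_list ns) (sum_list ns)"
proof -
  have e: "map dim_col As = map dim_row As" using assms(1) by simp
  show ?thesis unfolding assms(2)[symmetric]
    by (rule carrier_matI) (simp_all only: dim_diag_block_mat e)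
qed

text \<open>Block diagonality as two intertwining relations, for the projection onto a block and for
  its transpose, the inclusion. From here on \<open>diag_block_mat\<close> need not be unfolded;
  matrix identities are tested block by block.\<close>

lemma block_proj_diag:
  assumes sq: "\<forall>A\<in>set As. dim_col A = dim_row A" and ns: "map dim_row As = ns" and k: "k < length As"
  shows "block_proj ns k * diag_block_mat As = As ! k * block_proj ns k"
    and "diag_block_mat As * transpose_mat (block_proj ns k) = transpose_mat (block_proj ns k) * As ! k"
proof -
  have k': "k < length ns" and nk: "ns ! k = dim_row (As ! k)" using k ns by auto
  have A: "As ! k \<in> carrier_mat (ns ! k) (ns ! k)" using sq k nk by auto
  note D = diag_block_mat_carrier[OF sq ns]
  show "block_proj ns k * diag_block_mat As = As ! k * block_proj ns k"
  proof (rule eq_matI)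
    fix i j assume "i < dim_row (As ! k * block_proj ns k)" "j < dim_col (As ! k * block_proj ns k)"
    hence ij: "i < ns ! k" "j < sum_list ns" using A by (auto simp: block_proj_def)
    show "(block_proj ns k * diag_block_mat As) $$ (i, j) = (As ! k * block_proj ns k) $$ (i, j)"
      using block_proj_mult_entry[OF k' ij(1) D ij(2)] mult_block_proj_entry[OF k' A ij]
        diag_block_mat_row_entry[OF sq k, of i j] ij nk by (simp add: ns del: index_mult_mat)
  qed (use A D in \<open>auto simp: block_proj_def\<close>)
  show "diag_block_mat As * transpose_mat (block_proj ns k) = transpose_mat (block_proj ns k) * As ! k"
  proof (rule eq_matI)
    fix i j assume "i < dim_row (transpose_mat (block_proj ns k) * As ! k)" "j < dim_col (transpose_mat (block_proj ns k) * As ! k)"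
    hence ij: "i < sum_list ns" "j < ns ! k" using A by (auto simp: block_proj_def)
    show "(diag_block_mat As * transpose_mat (block_proj ns k)) $$ (i, j) = (transpose_mat (block_proj ns k) * As ! k) $$ (i, j)"
      using mult_block_proj_transpose_entry[OF k' ij(2) D ij(1)] block_proj_transpose_mult_entry[OF k' A ij(2,1)]
        diag_block_mat_col_entry[OF sq k, of j i] ij nk by (simp add: ns del: index_mult_mat)
  qed (use A D in \<open>auto simp: block_proj_def\<close>)
qed

lemma block_proj_separates:
  assumes X: "X \<in> carrier_mat (sum_list ns) (sum_list ms)" and Y: "Y \<in> carrier_mat (sum_list ns) (sum_list ms)"
    and eq: "\<And>l k. l < length ns \<Longrightarrow> k < length ms \<Longrightarrow>
      block_proj ns l * X * transpose_mat (block_proj ms k) = block_proj ns l * Y * transpose_mat (block_proj ms k)"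
  shows "X = Y"
proof (rule eq_matI)
  fix i j assume "i < dim_row Y" "j < dim_col Y"
  hence ij: "i < sum_list ns" "j < sum_list ms" using Y by auto
  obtain l i' where l: "l < length ns" "i' < ns ! l" "i = sum_list (take l ns) + i'" using block_index_exists[OF ij(1)] by blast
  obtain k j' where k: "k < length ms" "j' < ms ! k" "j = sum_list (take k ms) + j'" using block_index_exists[OF ij(2)] by blast
  have *: "(block_proj ns l * Z * transpose_mat (block_proj ms k)) $$ (i', j') = Z $$ (i, j)" if Z: "Z \<in> carrier_mat (sum_list ns) (sum_list ms)" for Z
  proof -
    have "block_proj ns l * Z \<in> carrier_mat (ns ! l) (sum_list ms)" by (rule mult_carrier_mat[OF block_proj_carrier Z])
    from mult_block_proj_transpose_entry[OF k(1,2) this l(2)] block_proj_mult_entry[OF l(1,2) Z, of j] ij k l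
    show ?thesis by (simp del: index_mult_mat)
  qed
  show "X $$ (i, j) = Y $$ (i, j)" using *[OF X] *[OF Y] eq[OF l(1) k(1)] by simp
qed (use X Y in auto)

lemma block_proj_mult_transpose: 
  assumes "k < length ns"
  shows "block_proj ns k * transpose_mat (block_proj ns k) = 1\<^sub>m (ns ! k)"
proof (rule eq_matI)
  fix i j assume "i < dim_row (1\<^sub>m (ns ! k) :: complex mat)" "j < dim_col (1\<^sub>m (ns ! k) :: complex mat)"
  hence ij: "i < ns ! k" "j < ns ! k" by auto
  from mult_block_proj_transpose_entry[OF assms ij(2) block_proj_carrier ij(1)]
  show "(block_proj ns k * transpose_mat (block_proj ns k)) $$ (i, j) = 1\<^sub>m (ns ! k) $$ (i, j)"
    using ij block_offset_less[OF assms ij(2)] by (auto simp: block_proj_def)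
qed (auto simp: block_proj_def)

text \<open>A vector as a one-column matrix: a joint eigenvector is then an intertwiner from a
  scalar tuple, as \<open>joint_spectrum_iff\<close> records.\<close>

definition col_mat :: "complex Matrix.vec \<Rightarrow> complex mat" where
  "col_mat v = mat (dim_vec v) 1 (\<lambda>(i, j). vec_index v i)"

lemma col_mat_carrier: "col_mat v \<in> carrier_mat (dim_vec v) 1"
  by (simp add: col_mat_def)

lemma mult_col_mat: "dim_vec v = dim_col A \<Longrightarrow> A * col_mat v = col_mat (A *\<^sub>v v)"
  by (rule eq_matI) (auto simp: col_mat_def index_mult_mat_sum index_mult_mat_vec_sum simp del: index_mult_mat(1) index_mult_mat_vec)

lemma col_mat_mult_scalar: "col_mat v * mat 1 1 (\<lambda>_. c) = col_mat (c \<cdot>\<^sub>v v)"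
  by (rule eq_matI) (auto simp: col_mat_def index_mult_mat_sum mult.commute simp del: index_mult_mat(1))

lemma col_mat_inject: "col_mat u = col_mat v \<longleftrightarrow> u = v"
proof
  assume e: "col_mat u = col_mat v"
  hence d: "dim_vec u = dim_vec v" by (metis carrier_matD(1) col_mat_carrier)
  show "u = v"
  proof (rule eq_vecI[OF _ d])
    fix i assume "i < dim_vec v"
    thus "vec_index u i = vec_index v i" using arg_cong[OF e, of "\<lambda>A. A $$ (i, 0)"] d by (simp add: col_mat_def)
  qed
qed simp

lemma col_mat_zero: "col_mat (0\<^sub>v n) = 0\<^sub>m n 1"
  by (rule eq_matI) (auto simp: col_mat_def)

lemma joint_spectrum_iff:
  assumes x: "commuting n x"
  shows "\<mu> \<in> joint_spectrum x \<longleftrightarrow>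
    (\<exists>v. dim_vec v = n \<and> col_mat v \<noteq> 0\<^sub>m n 1 \<and> (\<forall>i. col_mat v * scalar_tuple \<mu> i = x i * col_mat v))"
proof -
  note c = commutingD(1)[OF x]
  have "eigenvector (x i) v (\<mu> $ i) \<longleftrightarrow>
      dim_vec v = n \<and> col_mat v \<noteq> 0\<^sub>m n 1 \<and> col_mat v * scalar_tuple \<mu> i = x i * col_mat v" for v i
  proof (cases "dim_vec v = n")
    case True
    have 1: "v \<noteq> 0\<^sub>v n \<longleftrightarrow> col_mat v \<noteq> 0\<^sub>m n 1"
      using col_mat_inject[of v "0\<^sub>v n"] by (simp add: col_mat_zero)
    have "x i * col_mat v = col_mat (x i *\<^sub>v v)"
      by (rule mult_col_mat) (simp add: True carrier_matD(2)[OF c])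
    moreover have "col_mat v * scalar_tuple \<mu> i = col_mat (\<mu> $ i \<cdot>\<^sub>v v)"
      unfolding scalar_tuple_def by (rule col_mat_mult_scalar)
    ultimately have 2: "x i *\<^sub>v v = \<mu> $ i \<cdot>\<^sub>v v \<longleftrightarrow> col_mat v * scalar_tuple \<mu> i = x i * col_mat v"
      by (metis col_mat_inject)
    show ?thesis unfolding eigenvector_def carrier_matD(1)[OF c] 1 2 carrier_dim_vec by simp
  next
    case False
    thus ?thesis unfolding eigenvector_def carrier_matD(1)[OF c] carrier_dim_vec by simp
  qed
  thus ?thesis unfolding joint_spectrum_def mem_Collect_eq by simp
qed

lemma quasi_scalar_scalar_tuple: "quasi_scalar 1 \<mu> (scalar_tuple \<mu>)"
proof -
  have "(scalar_tuple \<mu> i - (\<mu> $ i) \<cdot>\<^sub>m 1\<^sub>m 1) = 0\<^sub>m 1 1" for i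
    by (rule eq_matI) (auto simp: scalar_tuple_def)
  hence "(scalar_tuple \<mu> i - (\<mu> $ i) \<cdot>\<^sub>m 1\<^sub>m 1) ^\<^sub>m 1 = 0\<^sub>m 1 1" for i by simp
  thus ?thesis unfolding quasi_scalar_def using commuting_scalar_tuple by blast
qed

text \<open>Among the nonzero monomials in the nilpotent parts take one of maximal degree. Every
  coordinate of the nilpotent tuple annihilates it, so each of its nonzero columns is a joint
  eigenvector for \<mu>. A second joint eigenvalue is excluded by
  \<open>intertwine_distinct_zero\<close>.\<close>

lemma quasi_scalar_joint_spectrum:
  assumes x: "quasi_scalar n \<mu> x"
  shows "joint_spectrum x = {\<mu>}"
proof -
  have c: "commuting n x" and n: "n \<ge> 1" using x by (auto simp: quasi_scalar_def)
  let ?N = "shift_tuple n \<mu> x"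
  have N: "commuting n ?N" by (rule commuting_shift_tuple[OF c])
  let ?B = "{\<alpha>. monom_mat \<alpha> ?N \<noteq> 0\<^sub>m n n}"
  have fin: "finite ?B" by (rule finite_nonzero_monomials[OF x])
  \<comment> \<open>The empty monomial is the identity, nonzero because the size is positive; so the
    set of nonzero monomials is not empty.\<close>
  have "(1\<^sub>m n :: complex mat) $$ (0, 0) \<noteq> 0\<^sub>m n n $$ (0, 0)" using n by simp
  hence "(1\<^sub>m n :: complex mat) \<noteq> 0\<^sub>m n n" by metis
  hence "0 \<in> ?B" by (simp add: monom_mat_0[OF N])
  then obtain \<alpha> where \<alpha>: "\<alpha> \<in> ?B" "\<And>\<beta>. \<beta> \<in> ?B \<Longrightarrow> mono_deg \<beta> \<le> mono_deg \<alpha>"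
    using Max_in[of "mono_deg ` ?B"] Max_ge[of "mono_deg ` ?B"] fin by fastforce
  let ?M = "monom_mat \<alpha> ?N"
  have M: "?M \<in> carrier_mat n n" by (rule monom_mat_carrier[OF N])
  have NM: "?N i * ?M = 0\<^sub>m n n" for i
  proof (rule ccontr)
    assume "?N i * ?M \<noteq> 0\<^sub>m n n"
    moreover have "monom_mat (Poly_Mapping.single i 1 + \<alpha>) ?N = ?N i * ?M"
      using monom_mat_add[OF N] monom_mat_single[OF N, of i 1] commutingD(1)[OF N, of i] by simp
    ultimately have "Poly_Mapping.single i 1 + \<alpha> \<in> ?B" by simp
    from \<alpha>(2)[OF this] show False by (simp add: mono_deg_add)
  qed
  obtain r s where rs: "r < n" "s < n" "?M $$ (r, s) \<noteq> 0"
    using \<alpha>(1) M eq_matI[of ?M "0\<^sub>m n n"] by auto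
  define v where "v = col ?M s"
  have v: "dim_vec v = n" using M by (simp add: v_def)
  have "x i *\<^sub>v v = \<mu> $ i \<cdot>\<^sub>v v" for i
  proof (rule eq_vecI)
    fix t assume "t < dim_vec (\<mu> $ i \<cdot>\<^sub>v v)"
    hence t: "t < n" using v by simp
    have "0 = (?N i * ?M) $$ (t, s)" using NM[of i] t rs by simp
    also have "\<dots> = (\<Sum>j<n. (x i - \<mu> $ i \<cdot>\<^sub>m 1\<^sub>m n) $$ (t, j) * ?M $$ (j, s))"
      using t rs M commutingD(1)[OF N, of i] by (simp add: index_mult_mat_sum shift_tuple_def del: index_mult_mat)
    also have "\<dots> = (\<Sum>j<n. x i $$ (t, j) * ?M $$ (j, s) - (if j = t then \<mu> $ i * ?M $$ (j, s) else 0))"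
      using t commutingD(1)[OF c, of i] by (intro sum.cong) (auto simp: ring_distribs)
    also have "\<dots> = (\<Sum>j<n. x i $$ (t, j) * ?M $$ (j, s)) - \<mu> $ i * ?M $$ (t, s)"
      using t by (simp add: sum_subtractf)
    finally have "(\<Sum>j<n. x i $$ (t, j) * ?M $$ (j, s)) = \<mu> $ i * ?M $$ (t, s)" by simp
    thus "vec_index (x i *\<^sub>v v) t = vec_index (\<mu> $ i \<cdot>\<^sub>v v) t"
      using t rs M carrier_matD[OF commutingD(1)[OF c, of i]]
      by (simp add: index_mult_mat_vec_sum v_def del: index_mult_mat_vec)
  qed (use v commutingD(1)[OF c, of i] in auto)
  moreover have "v \<noteq> 0\<^sub>v n"
  proof
    assume "v = 0\<^sub>v n"
    hence "vec_index v r = 0" using rs by simp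
    thus False using rs M by (simp add: v_def)
  qed
  ultimately have "\<forall>i. eigenvector (x i) v (\<mu> $ i)"
    unfolding eigenvector_def carrier_matD(1)[OF commutingD(1)[OF c]] carrier_dim_vec using v by simp
  hence "\<mu> \<in> joint_spectrum x" by (auto simp: joint_spectrum_def)
  moreover have "\<nu> = \<mu>" if "\<nu> \<in> joint_spectrum x" for \<nu>
  proof (rule ccontr)
    assume ne: "\<nu> \<noteq> \<mu>"
    obtain w where w: "dim_vec w = n" "col_mat w \<noteq> 0\<^sub>m n 1" "\<forall>i. col_mat w * scalar_tuple \<nu> i = x i * col_mat w"
      using \<open>\<nu> \<in> joint_spectrum x\<close> unfolding joint_spectrum_iff[OF c] by blast
    have "col_mat w \<in> carrier_mat n 1" using col_mat_carrier[of w] w by simp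
    from intertwine_distinct_zero[OF this quasi_scalar_scalar_tuple x ne] w show False by blast
  qed
  ultimately show ?thesis by blast
qed

text \<open>The part of \<open>calc_value\<close> that does not involve functions, with singleton
  spectra replaced by \<open>quasi_scalar\<close>.\<close>

definition block_decomp :: "('d::finite) mat_tuple \<Rightarrow> ((complex ^ 'd) \<times> 'd mat_tuple) list \<Rightarrow> complex mat \<Rightarrow> complex mat \<Rightarrow> bool" where
  "block_decomp y us T S \<longleftrightarrow> (\<forall>(\<mu>, u)\<in>set us. quasi_scalar (tuple_size u) \<mu> u) \<and>
    (\<forall>i. similar_mat_wit (y i) (diag_block_mat (map (\<lambda>(\<mu>, u). u i) us)) T S)"

lemma quasi_scalar_tuple_size: "quasi_scalar m \<mu> u \<Longrightarrow> tuple_size u = m"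
  by (simp add: quasi_scalar_def commuting_tuple_size)

lemma block_decomp_exists:
  assumes "commuting n y" "n \<ge> 1"
  obtains us T S where "block_decomp y us T S"
proof -
  obtain us T S where us: "\<forall>(\<mu>, u)\<in>set us. \<exists>m. quasi_scalar m \<mu> u"
    "\<forall>i. similar_mat_wit (y i) (diag_block_mat (map (\<lambda>(\<mu>, u). u i) us)) T S"
    using joint_decomposition[OF assms] by blast
  have "block_decomp y us T S" unfolding block_decomp_def using us quasi_scalar_tuple_size by fastforce
  thus ?thesis by (rule that)
qed

text \<open>The last two conclusions supply the intertwiners between y and its blocks through which
  all later block arguments run.\<close>

lemma block_decompD:
  assumes bd: "block_decomp y us T S" and y: "commuting n y"
  defines "ns \<equiv> map (\<lambda>(\<mu>, u). tuple_size u) us"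
  shows "T \<in> carrier_mat n n" "S \<in> carrier_mat n n" "T * S = 1\<^sub>m n" "S * T = 1\<^sub>m n" "sum_list ns = n"
    and "k < length us \<Longrightarrow> quasi_scalar (ns ! k) (fst (us ! k)) (snd (us ! k))"
    and "k < length us \<Longrightarrow> block_proj ns k * S * y i = snd (us ! k) i * (block_proj ns k * S)"
    and "k < length us \<Longrightarrow> T * transpose_mat (block_proj ns k) * snd (us ! k) i = y i * (T * transpose_mat (block_proj ns k))"
proof -
  let ?D = "\<lambda>i. diag_block_mat (map (\<lambda>(\<mu>, u). u i) us)"
  have sim: "similar_mat_wit (y i) (?D i) T S" for i using bd by (simp add: block_decomp_def)
  note W = similar_mat_witD2[OF commutingD(1)[OF y] sim]
  show T: "T \<in> carrier_mat n n" and S: "S \<in> carrier_mat n n" and TS: "T * S = 1\<^sub>m n" and ST: "S * T = 1\<^sub>m n"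
    using W by blast+
  have q: "quasi_scalar (ns ! k) (fst (us ! k)) (snd (us ! k))" if "k < length us" for k
  proof -
    have "us ! k \<in> set us" using that by simp
    thus ?thesis using that bd by (auto simp: block_decomp_def ns_def case_prod_beta)
  qed
  thus "k < length us \<Longrightarrow> quasi_scalar (ns ! k) (fst (us ! k)) (snd (us ! k))" .
  have car: "u i \<in> carrier_mat (tuple_size u) (tuple_size u)" if "(\<mu>, u) \<in> set us" for \<mu> u i
  proof -
    have "quasi_scalar (tuple_size u) \<mu> u" using bd that by (auto simp: block_decomp_def)
    thus ?thesis by (auto simp: quasi_scalar_def intro: commutingD)
  qed
  have sq: "\<forall>A\<in>set (map (\<lambda>(\<mu>, u). u i) us). dim_col A = dim_row A" for i
    by (auto simp: carrier_matD[OF car])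
  have nsD: "map dim_row (map (\<lambda>(\<mu>, u). u i) us) = ns" for i
    by (auto simp: ns_def carrier_matD[OF car])
  have D: "?D i \<in> carrier_mat (sum_list ns) (sum_list ns)" for i
    by (rule diag_block_mat_carrier[OF sq nsD])
  show n: "sum_list ns = n" using D W(5) by (metis carrier_matD(1))
  have Sy: "S * y i = ?D i * S" and yT: "y i * T = T * ?D i" for i
  proof -
    have Di: "?D i \<in> carrier_mat n n" by (rule W(5))
    have e: "y i = T * ?D i * S" by (rule W(3))
    have "S * y i = (S * T) * (?D i * S)" unfolding e using T S Di
      by (simp add: assoc_mult_mat[of _ n n _ n _ n] mult_carrier_mat[of _ n n _ n])
    thus "S * y i = ?D i * S" unfolding ST using left_mult_one_mat[OF mult_carrier_mat[OF Di S]] by simp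
    have "y i * T = (T * ?D i) * (S * T)" unfolding e using T S Di
      by (simp add: assoc_mult_mat[of _ n n _ n _ n] mult_carrier_mat[of _ n n _ n])
    thus "y i * T = T * ?D i" unfolding ST using right_mult_one_mat[OF mult_carrier_mat[OF T Di]] by simp
  qed
  assume k: "k < length us"
  have P: "block_proj ns k \<in> carrier_mat (ns ! k) n" using block_proj_carrier[of ns k] n by simp
  hence E: "transpose_mat (block_proj ns k) \<in> carrier_mat n (ns ! k)" by simp
  have uk: "map (\<lambda>(\<mu>, u). u i) us ! k = snd (us ! k) i" using k by (simp add: case_prod_beta)
  have uc: "snd (us ! k) i \<in> carrier_mat (ns ! k) (ns ! k)"
    using q[OF k] by (auto simp: quasi_scalar_def intro: commutingD)
  note yc = commutingD(1)[OF y, of i] and Dc = W(5)[of i]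
  note pd = block_proj_diag[OF sq nsD, of k i, unfolded length_map uk, OF k]
  have "block_proj ns k * S * y i = block_proj ns k * (S * y i)" by (rule assoc_mult_mat[OF P S yc])
  also have "\<dots> = block_proj ns k * ?D i * S" unfolding Sy by (rule assoc_mult_mat[OF P Dc S, symmetric])
  also have "\<dots> = snd (us ! k) i * (block_proj ns k * S)" unfolding pd(1) by (rule assoc_mult_mat[OF uc P S])
  finally show "block_proj ns k * S * y i = snd (us ! k) i * (block_proj ns k * S)" .
  have "T * transpose_mat (block_proj ns k) * snd (us ! k) i = T * (transpose_mat (block_proj ns k) * snd (us ! k) i)"
    by (rule assoc_mult_mat[OF T E uc])
  also have "\<dots> = T * ?D i * transpose_mat (block_proj ns k)" unfolding pd(2)[symmetric] by (rule assoc_mult_mat[OF T Dc E, symmetric])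
  also have "\<dots> = y i * (T * transpose_mat (block_proj ns k))" unfolding yT[symmetric] by (rule assoc_mult_mat[OF yc T E])
  finally show "T * transpose_mat (block_proj ns k) * snd (us ! k) i = y i * (T * transpose_mat (block_proj ns k))" .
qed

lemma block_proj_separates_rows:
  assumes X: "X \<in> carrier_mat (sum_list ns) m" and Y: "Y \<in> carrier_mat (sum_list ns) m"
    and eq: "\<And>l. l < length ns \<Longrightarrow> block_proj ns l * X = block_proj ns l * Y"
  shows "X = Y"
proof (rule eq_matI)
  fix i j assume "i < dim_row Y" "j < dim_col Y"
  hence ij: "i < sum_list ns" "j < m" using Y by auto
  obtain l i' where l: "l < length ns" "i' < ns ! l" "i = sum_list (take l ns) + i'" using block_index_exists[OF ij(1)] by blast
  show "X $$ (i, j) = Y $$ (i, j)"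
    using block_proj_mult_entry[OF l(1,2) X ij(2)] block_proj_mult_entry[OF l(1,2) Y ij(2)] eq[OF l(1)] l(3) by simp
qed (use X Y in auto)

text \<open>A joint eigenvector of a block is carried to one of y by the inclusion of the block.
  Conversely, the component in each block of a joint eigenvector with a foreign eigenvalue is an
  intertwiner between different joint eigenvalues, hence 0.\<close>

lemma block_decomp_joint_spectrum:
  assumes bd: "block_decomp y us T S" and y: "commuting n y"
  shows "joint_spectrum y = fst ` set us"
proof (intro equalityI subsetI)
  define ns where "ns = map (\<lambda>(\<mu>, u). tuple_size u) us"
  note B = block_decompD[OF bd y, folded ns_def]
  have len: "length ns = length us" by (simp add: ns_def)
  {
    fix \<mu> assume "\<mu> \<in> fst ` set us"
    then obtain k where k: "k < length us" "\<mu> = fst (us ! k)" by (metis imageE in_set_conv_nth)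
    have q: "quasi_scalar (ns ! k) \<mu> (snd (us ! k))" using B(6)[OF k(1)] k(2) by simp
    hence c: "commuting (ns ! k) (snd (us ! k))" by (simp add: quasi_scalar_def)
    let ?u = "snd (us ! k)" and ?E = "transpose_mat (block_proj ns k)"
    have E: "?E \<in> carrier_mat n (ns ! k)" using block_proj_carrier[of ns k] B(5) by simp
    have "\<mu> \<in> joint_spectrum ?u" using quasi_scalar_joint_spectrum[OF q] by simp
    then obtain v where v: "dim_vec v = ns ! k" "col_mat v \<noteq> 0\<^sub>m (ns ! k) 1" "\<forall>i. col_mat v * scalar_tuple \<mu> i = ?u i * col_mat v"
      unfolding joint_spectrum_iff[OF c] by blast
    have vc: "col_mat v \<in> carrier_mat (ns ! k) 1" using col_mat_carrier[of v] v by simp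
    define w where "w = T *\<^sub>v (?E *\<^sub>v v)"
    have TE: "T * ?E \<in> carrier_mat n (ns ! k)" using B(1) E by simp
    have w: "col_mat w = T * ?E * col_mat v"
      unfolding w_def using E B(1) v assoc_mult_mat[OF B(1) E vc] by (simp add: mult_col_mat[symmetric])
    have wd: "dim_vec w = n" using B(1) by (simp add: w_def)
    have "col_mat w * scalar_tuple \<mu> i = y i * col_mat w" for i
    proof -
      have sc: "scalar_tuple \<mu> i \<in> carrier_mat 1 1" by (rule commutingD(1)[OF commuting_scalar_tuple])
      have "col_mat w * scalar_tuple \<mu> i = T * ?E * (?u i * col_mat v)"
        unfolding w using assoc_mult_mat[OF TE vc sc] v(3) by simp
      also have "\<dots> = (T * ?E * ?u i) * col_mat v"
        by (rule assoc_mult_mat[OF TE commutingD(1)[OF c] vc, symmetric])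
      also have "\<dots> = y i * col_mat w"
        unfolding B(8)[OF k(1)] w by (rule assoc_mult_mat[OF commutingD(1)[OF y] TE vc])
      finally show ?thesis .
    qed
    moreover have "col_mat w \<noteq> 0\<^sub>m n 1"
    proof
      assume z: "col_mat w = 0\<^sub>m n 1"
      have P: "block_proj ns k \<in> carrier_mat (ns ! k) n" using block_proj_carrier[of ns k] B(5) by simp
      have "S * (T * ?E * col_mat v) = (S * T) * (?E * col_mat v)"
        using assoc_mult_mat[OF B(2) B(1) mult_carrier_mat[OF E vc]] assoc_mult_mat[OF B(1) E vc] by simp
      also have "\<dots> = ?E * col_mat v" unfolding B(4) by (rule left_mult_one_mat[OF mult_carrier_mat[OF E vc]])
      finally have "block_proj ns k * (S * (T * ?E * col_mat v)) = block_proj ns k * ?E * col_mat v"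
        using assoc_mult_mat[OF P E vc] by simp
      also have "\<dots> = col_mat v"
        using block_proj_mult_transpose[of k ns] k len left_mult_one_mat[OF vc] by simp
      finally have "col_mat v = block_proj ns k * (S * 0\<^sub>m n 1)" using z w by simp
      also have "\<dots> = 0\<^sub>m (ns ! k) 1"
        using right_mult_zero_mat[OF B(2), of 1] right_mult_zero_mat[OF P, of 1] by simp
      finally show False using v by simp
    qed
    ultimately show "\<mu> \<in> joint_spectrum y" unfolding joint_spectrum_iff[OF y] using wd by blast
  }
  {
    fix \<mu> assume "\<mu> \<in> joint_spectrum y"
    then obtain v where v: "dim_vec v = n" "col_mat v \<noteq> 0\<^sub>m n 1" "\<forall>i. col_mat v * scalar_tuple \<mu> i = y i * col_mat v"
      unfolding joint_spectrum_iff[OF y] by blast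
    have vc: "col_mat v \<in> carrier_mat n 1" using col_mat_carrier[of v] v by simp
    show "\<mu> \<in> fst ` set us"
    proof (rule ccontr)
      assume no: "\<mu> \<notin> fst ` set us"
      have zero: "block_proj ns k * (S * col_mat v) = block_proj ns k * 0\<^sub>m n 1" if "k < length ns" for k
      proof -
        have k: "k < length us" using that len by simp
        have P: "block_proj ns k \<in> carrier_mat (ns ! k) n" using block_proj_carrier[of ns k] B(5) by simp
        have PS: "block_proj ns k * S \<in> carrier_mat (ns ! k) n" by (rule mult_carrier_mat[OF P B(2)])
        have sc: "scalar_tuple \<mu> i \<in> carrier_mat 1 1" for i by (rule commutingD(1)[OF commuting_scalar_tuple])
        have uc: "snd (us ! k) i \<in> carrier_mat (ns ! k) (ns ! k)" for i
          using B(6)[OF k] by (auto simp: quasi_scalar_def intro: commutingD)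
        have "fst (us ! k) \<noteq> \<mu>" using no k by (metis image_eqI nth_mem)
        moreover have "block_proj ns k * S * col_mat v * scalar_tuple \<mu> i = snd (us ! k) i * (block_proj ns k * S * col_mat v)" for i
        proof -
          have "block_proj ns k * S * col_mat v * scalar_tuple \<mu> i = block_proj ns k * S * (y i * col_mat v)"
            using assoc_mult_mat[OF PS vc sc] v(3) by simp
          also have "\<dots> = (block_proj ns k * S * y i) * col_mat v"
            by (rule assoc_mult_mat[OF PS commutingD(1)[OF y] vc, symmetric])
          also have "\<dots> = snd (us ! k) i * (block_proj ns k * S * col_mat v)"
            unfolding B(7)[OF k] by (rule assoc_mult_mat[OF uc PS vc])
          finally show ?thesis .
        qed
        ultimately have "block_proj ns k * S * col_mat v = 0\<^sub>m (ns ! k) 1"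
          by (intro intertwine_distinct_zero[OF mult_carrier_mat[OF PS vc] quasi_scalar_scalar_tuple B(6)[OF k]]) auto
        thus ?thesis using assoc_mult_mat[OF P B(2) vc] right_mult_zero_mat[OF P, of 1] by simp
      qed
      have "S * col_mat v = 0\<^sub>m n 1"
        by (rule block_proj_separates_rows[OF _ _ zero, where m = 1]) (use B(2,5) vc in auto)
      hence "T * (S * col_mat v) = 0\<^sub>m n 1" using right_mult_zero_mat[OF B(1), of 1] by simp
      hence "(T * S) * col_mat v = 0\<^sub>m n 1" using assoc_mult_mat[OF B(1,2) vc] by simp
      thus False using v(2) left_mult_one_mat[OF vc] by (simp add: B(3))
    qed
  }
qed

lemma pow_mat_zero_mono:
  assumes A: "(A :: complex mat) \<in> carrier_mat n n" and z: "A ^\<^sub>m m = 0\<^sub>m n n" and le: "m \<le> k"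
  shows "A ^\<^sub>m k = 0\<^sub>m n n"
  using pow_mat_add[OF A, of m "k - m"] le left_mult_zero_mat[OF pow_carrier_mat[OF A]] by (simp add: z)

lemma joint_spectrum_singleton_imp_quasi_scalar:
  assumes x: "commuting n x" "n \<ge> 1" and s: "joint_spectrum x = {\<mu>}"
  shows "quasi_scalar n \<mu> x"
proof -
  obtain us T S where bd: "block_decomp x us T S" by (rule block_decomp_exists[OF x])
  define ns where "ns = map (\<lambda>(\<mu>, u). tuple_size u) us"
  note B = block_decompD[OF bd x(1), folded ns_def]
  have len: "length ns = length us" by (simp add: ns_def)
  have mu: "fst (us ! k) = \<mu>" if "k < length us" for k
    using block_decomp_joint_spectrum[OF bd x(1)] s that by (metis image_eqI nth_mem singletonD)
  have "\<forall>k\<in>{..<length us}. \<exists>m. \<forall>i. shift_tuple (ns ! k) \<mu> (snd (us ! k)) i ^\<^sub>m m = 0\<^sub>m (ns ! k) (ns ! k)"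
  proof
    fix k assume "k \<in> {..<length us}"
    hence "k < length us" by simp
    from B(6)[OF this] mu[OF this] show "\<exists>m. \<forall>i. shift_tuple (ns ! k) \<mu> (snd (us ! k)) i ^\<^sub>m m = 0\<^sub>m (ns ! k) (ns ! k)"
      by (simp add: quasi_scalar_def shift_tuple_def)
  qed
  from bchoice[OF this] obtain m where
    m: "\<forall>k\<in>{..<length us}. \<forall>i. shift_tuple (ns ! k) \<mu> (snd (us ! k)) i ^\<^sub>m m k = 0\<^sub>m (ns ! k) (ns ! k)" by blast
  \<comment> \<open>A common exponent for all blocks; the sum is an upper bound of the exponents of
    the single blocks.\<close>
  define M where "M = (\<Sum>k<length us. m k)"
  have "(x i - (\<mu> $ i) \<cdot>\<^sub>m 1\<^sub>m n) ^\<^sub>m M = 0\<^sub>m n n" for i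
  proof -
    let ?A = "x i - (\<mu> $ i) \<cdot>\<^sub>m 1\<^sub>m n"
    have xc: "x i \<in> carrier_mat n n" by (rule commutingD(1)[OF x(1)])
    have Ac: "?A \<in> carrier_mat n n" by (rule shift_carrier[OF xc])
    have AM: "?A ^\<^sub>m M \<in> carrier_mat n n" by (rule pow_carrier_mat[OF Ac])
    have "block_proj ns k * (S * ?A ^\<^sub>m M) = block_proj ns k * 0\<^sub>m n n" if "k < length ns" for k
    proof -
      have k: "k < length us" using that len by simp
      have P: "block_proj ns k \<in> carrier_mat (ns ! k) n" using block_proj_carrier[of ns k] B(5) by simp
      have PS: "block_proj ns k * S \<in> carrier_mat (ns ! k) n" by (rule mult_carrier_mat[OF P B(2)])
      have uc: "snd (us ! k) i \<in> carrier_mat (ns ! k) (ns ! k)"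
        using B(6)[OF k] by (auto simp: quasi_scalar_def intro: commutingD)
      let ?U = "snd (us ! k) i - (\<mu> $ i) \<cdot>\<^sub>m 1\<^sub>m (ns ! k)"
      have Uc: "?U \<in> carrier_mat (ns ! k) (ns ! k)" by (rule shift_carrier[OF uc])
      have le: "m k \<le> M" unfolding M_def using k by (intro member_le_sum) auto
      have "?U ^\<^sub>m m k = 0\<^sub>m (ns ! k) (ns ! k)" using m k by (simp add: shift_tuple_def)
      from pow_mat_zero_mono[OF Uc this le] have UM: "?U ^\<^sub>m M = 0\<^sub>m (ns ! k) (ns ! k)" .
      have "block_proj ns k * S * ?A = ?U * (block_proj ns k * S)"
        by (rule intertwine_shift[OF PS xc uc B(7)[OF k]])
      hence "block_proj ns k * S * ?A ^\<^sub>m M = ?U ^\<^sub>m M * (block_proj ns k * S)"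
        by (rule intertwine_pow_mat[OF PS Ac Uc])
      also have "\<dots> = 0\<^sub>m (ns ! k) n" unfolding UM by (rule left_mult_zero_mat[OF PS])
      finally show ?thesis using assoc_mult_mat[OF P B(2) AM] right_mult_zero_mat[OF P, of n] by simp
    qed
    note proj = this
    have SA: "S * ?A ^\<^sub>m M = 0\<^sub>m n n"
      by (rule block_proj_separates_rows[of _ ns n, unfolded B(5), OF mult_carrier_mat[OF B(2) AM] zero_carrier_mat proj])
    have "(T * S) * ?A ^\<^sub>m M = T * (S * ?A ^\<^sub>m M)" by (rule assoc_mult_mat[OF B(1,2) AM])
    also have "\<dots> = 0\<^sub>m n n" unfolding SA by (rule right_mult_zero_mat[OF B(1)])
    finally show ?thesis unfolding B(3) left_mult_one_mat[OF AM] .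
  qed
  thus ?thesis unfolding quasi_scalar_def using x by blast
qed

lemma quasi_scalar_iff: "x \<in> comm_tuples \<and> joint_spectrum x = {\<mu>} \<longleftrightarrow> quasi_scalar (tuple_size x) \<mu> x"
proof
  assume "x \<in> comm_tuples \<and> joint_spectrum x = {\<mu>}"
  thus "quasi_scalar (tuple_size x) \<mu> x"
    by (metis comm_tuplesE joint_spectrum_singleton_imp_quasi_scalar)
next
  assume "quasi_scalar (tuple_size x) \<mu> x"
  thus "x \<in> comm_tuples \<and> joint_spectrum x = {\<mu>}"
    using quasi_scalar_joint_spectrum unfolding comm_tuples_eq quasi_scalar_def by blast
qed

section \<open>The functional calculus\<close>

definition calc_mat :: "((complex ^ 'd \<Rightarrow> complex) \<times> (complex ^ 'd) \<times> ('d::finite) mat_tuple) list \<Rightarrow> complex mat" where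
  "calc_mat ts = diag_block_mat (map (\<lambda>(g, \<mu>, x). insert_series g \<mu> x) ts)"

lemma calc_value_iff:
  "calc_value y ts z \<longleftrightarrow> (\<exists>T S. block_decomp y (map snd ts) T S \<and> z = T * calc_mat ts * S)"
proof -
  have 1: "(\<forall>(g, \<mu>, x)\<in>set ts. x \<in> comm_tuples \<and> joint_spectrum x = {\<mu>}) \<longleftrightarrow>
     (\<forall>(\<mu>, u)\<in>set (map snd ts). quasi_scalar (tuple_size u) \<mu> u)"
    unfolding quasi_scalar_iff by auto
  have 2: "map (\<lambda>(\<mu>, u). u i) (map snd ts) = map (\<lambda>(g, \<mu>, x). x i) ts" for i
    by (simp add: case_prod_beta)
  show ?thesis unfolding calc_value_def block_decomp_def calc_mat_def 1 2 by blast
qed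

lemma calc_mat_block_proj:
  assumes bd: "block_decomp y (map snd ts) T S" and y: "commuting n y" and k: "k < length ts"
  defines "ns \<equiv> map (\<lambda>(\<mu>, u). tuple_size u) (map snd ts)"
  shows "calc_mat ts \<in> carrier_mat n n"
    and "block_proj ns k * calc_mat ts = insert_series (fst (ts ! k)) (fst (snd (ts ! k))) (snd (snd (ts ! k))) * block_proj ns k"
    and "calc_mat ts * transpose_mat (block_proj ns k) =
      transpose_mat (block_proj ns k) * insert_series (fst (ts ! k)) (fst (snd (ts ! k))) (snd (snd (ts ! k)))"
proof -
  let ?As = "map (\<lambda>(g, \<mu>, x). insert_series g \<mu> x) ts"
  have car: "insert_series g \<mu> u \<in> carrier_mat (tuple_size u) (tuple_size u)" if "(g, \<mu>, u) \<in> set ts" for g \<mu> u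
  proof -
    have "quasi_scalar (tuple_size u) \<mu> u" using bd that by (force simp: block_decomp_def)
    thus ?thesis by (intro insert_series_carrier) (simp add: quasi_scalar_def)
  qed
  have sq: "\<forall>A\<in>set ?As. dim_col A = dim_row A" by (auto simp: carrier_matD[OF car])
  have nsD: "map dim_row ?As = ns" by (auto simp: ns_def carrier_matD[OF car])
  have n: "sum_list ns = n" unfolding ns_def by (rule block_decompD(5)[OF bd y])
  show "calc_mat ts \<in> carrier_mat n n"
    unfolding calc_mat_def using diag_block_mat_carrier[OF sq nsD] n by simp
  have "?As ! k = insert_series (fst (ts ! k)) (fst (snd (ts ! k))) (snd (snd (ts ! k)))"
    using k by (simp add: case_prod_beta)
  thus "block_proj ns k * calc_mat ts = insert_series (fst (ts ! k)) (fst (snd (ts ! k))) (snd (snd (ts ! k))) * block_proj ns k"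
    "calc_mat ts * transpose_mat (block_proj ns k) =
      transpose_mat (block_proj ns k) * insert_series (fst (ts ! k)) (fst (snd (ts ! k))) (snd (snd (ts ! k)))"
    unfolding calc_mat_def using block_proj_diag[OF sq nsD, of k] k by simp_all
qed

lemma block_decomp_nonempty:
  assumes bd: "block_decomp y us T S" and y: "commuting n y" "n \<ge> 1"
  shows "us \<noteq> []"
  using block_decompD(5)[OF bd y(1)] y(2) by auto

text \<open>W = S' T carries one decomposition into the other. Its (l, k) block intertwines the k-th
  block of the first with the l-th block of the second, so it is 0 unless their joint eigenvalues
  agree, and then it intertwines the inserted series. Hence W transports one calculated matrix to
  the other. The two functions are compared only on blocks of the second decomposition, which is
  what subordination can supply.\<close>

lemma calc_unique:
  assumes y: "commuting n y" "n \<ge> 1"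
    and bd: "block_decomp y (map snd ts) T S" and bd': "block_decomp y (map snd ts') T' S'"
    and compat: "\<And>g g' \<mu> x x'. (g, \<mu>, x) \<in> set ts \<Longrightarrow> (g', \<mu>, x') \<in> set ts' \<Longrightarrow> insert_series g \<mu> x' = insert_series g' \<mu> x'"
  shows "T * calc_mat ts * S = T' * calc_mat ts' * S'"
proof -
  define ns where "ns = map (\<lambda>(\<mu>, u). tuple_size u) (map snd ts)"
  define ms where "ms = map (\<lambda>(\<mu>, u). tuple_size u) (map snd ts')"
  note B = block_decompD[OF bd y(1), folded ns_def, unfolded length_map]
  note B' = block_decompD[OF bd' y(1), folded ms_def, unfolded length_map]
  have len: "length ns = length ts" "length ms = length ts'" by (simp_all add: ns_def ms_def)
  have ne: "ts \<noteq> []" "ts' \<noteq> []" using block_decomp_nonempty[OF bd y] block_decomp_nonempty[OF bd' y] by auto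
  note C = calc_mat_block_proj[OF bd y(1), folded ns_def] and C' = calc_mat_block_proj[OF bd' y(1), folded ms_def]
  have G: "calc_mat ts \<in> carrier_mat n n" using C(1)[of 0] ne by simp
  have G': "calc_mat ts' \<in> carrier_mat n n" using C'(1)[of 0] ne by simp
  have P: "block_proj ns k \<in> carrier_mat (ns ! k) n" for k using block_proj_carrier[of ns k] B(5) by simp
  have P': "block_proj ms k \<in> carrier_mat (ms ! k) n" for k using block_proj_carrier[of ms k] B'(5) by simp
  have E: "transpose_mat (block_proj ns k) \<in> carrier_mat n (ns ! k)" for k using P[of k] by simp
  define W where "W = S' * T"
  have Wc: "W \<in> carrier_mat n n" unfolding W_def by (rule mult_carrier_mat[OF B'(2) B(1)])
  have "W * calc_mat ts = calc_mat ts' * W"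
  proof (rule block_proj_separates[of _ ms ns, unfolded B(5) B'(5), OF mult_carrier_mat[OF Wc G] mult_carrier_mat[OF G' Wc]])
    fix l k assume "l < length ms" "k < length ns"
    hence l: "l < length ts'" and k: "k < length ts" using len by auto
    obtain g \<mu> x where t: "ts ! k = (g, \<mu>, x)" by (cases "ts ! k") auto
    obtain g' \<mu>' x' where t': "ts' ! l = (g', \<mu>', x')" by (cases "ts' ! l") auto
    have mem: "(g, \<mu>, x) \<in> set ts" "(g', \<mu>', x') \<in> set ts'" using k l t t' nth_mem by metis+
    have q: "quasi_scalar (ns ! k) \<mu> x" using B(6)[OF k] k t by simp
    have q': "quasi_scalar (ms ! l) \<mu>' x'" using B'(6)[OF l] l t' by simp
    let ?P = "block_proj ms l" and ?E = "transpose_mat (block_proj ns k)"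
    let ?I = "insert_series g \<mu> x" and ?I' = "insert_series g' \<mu>' x'"
    have c: "commuting (ns ! k) x" "commuting (ms ! l) x'" using q q' by (auto simp: quasi_scalar_def)
    have I: "?I \<in> carrier_mat (ns ! k) (ns ! k)" "?I' \<in> carrier_mat (ms ! l) (ms ! l)"
      using c insert_series_carrier by blast+
    define w where "w = (?P * S') * (T * ?E)"
    have PS: "?P * S' \<in> carrier_mat (ms ! l) n" by (rule mult_carrier_mat[OF P' B'(2)])
    have TE: "T * ?E \<in> carrier_mat n (ns ! k)" by (rule mult_carrier_mat[OF B(1) E])
    have wc: "w \<in> carrier_mat (ms ! l) (ns ! k)" unfolding w_def by (rule mult_carrier_mat[OF PS TE])
    have "w * x i = x' i * w" for i
    proof -
      note xc = commutingD(1)[OF c(1), of i] and xc' = commutingD(1)[OF c(2), of i] and yc = commutingD(1)[OF y(1), of i]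
      have "w * x i = ?P * S' * (T * ?E * x i)" unfolding w_def by (rule assoc_mult_mat[OF PS TE xc])
      also have "T * ?E * x i = y i * (T * ?E)" using B(8)[OF k, of i] k t by simp
      also have "?P * S' * (y i * (T * ?E)) = (?P * S' * y i) * (T * ?E)" by (rule assoc_mult_mat[OF PS yc TE, symmetric])
      also have "?P * S' * y i = x' i * (?P * S')" using B'(7)[OF l, of i] l t' by simp
      also have "x' i * (?P * S') * (T * ?E) = x' i * w" unfolding w_def by (rule assoc_mult_mat[OF xc' PS TE])
      finally show ?thesis .
    qed
    note inter = this
    have wI: "w * ?I = ?I' * w"
    proof (cases "\<mu> = \<mu>'")
      case True
      have "w * ?I = insert_series g \<mu> x' * w"
        by (rule intertwine_insert_series[OF wc q q'[folded True] inter])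
      thus ?thesis using compat[OF mem(1) mem(2)[folded True]] True by simp
    next
      case False
      have "w = 0\<^sub>m (ms ! l) (ns ! k)" by (rule intertwine_distinct_zero[OF wc q q' False inter])
      thus ?thesis using left_mult_zero_mat[OF I(1)] right_mult_zero_mat[OF I(2)] by simp
    qed
    have w: "?P * W * ?E = w"
    proof -
      have "?P * W * ?E = ?P * (W * ?E)" by (rule assoc_mult_mat[OF P' Wc E])
      also have "W * ?E = S' * (T * ?E)" unfolding W_def by (rule assoc_mult_mat[OF B'(2) B(1) E])
      also have "?P * (S' * (T * ?E)) = w" unfolding w_def by (rule assoc_mult_mat[OF P' B'(2) TE, symmetric])
      finally show ?thesis .
    qed
    have "?P * (W * calc_mat ts) * ?E = ?P * W * (calc_mat ts * ?E)"
      using assoc_mult_mat[OF P' Wc G, of l] assoc_mult_mat[OF mult_carrier_mat[OF P' Wc] G E, of l k] by simp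
    also have "calc_mat ts * ?E = ?E * ?I" using C(3)[OF k] t by simp
    also have "?P * W * (?E * ?I) = w * ?I"
      unfolding w[symmetric] by (rule assoc_mult_mat[OF mult_carrier_mat[OF P' Wc] E I(1), symmetric])
    also have "\<dots> = ?I' * w" by (rule wI)
    also have "\<dots> = ?I' * ?P * (W * ?E)"
    proof -
      have "w = ?P * (W * ?E)" unfolding w[symmetric] by (rule assoc_mult_mat[OF P' Wc E])
      thus ?thesis using assoc_mult_mat[OF I(2) P' mult_carrier_mat[OF Wc E], of k] by simp
    qed
    also have "?I' * ?P = ?P * calc_mat ts'" using C'(2)[OF l] t' by simp
    also have "?P * calc_mat ts' * (W * ?E) = ?P * (calc_mat ts' * W) * ?E"
      using assoc_mult_mat[OF mult_carrier_mat[OF P' G'] Wc E, of l k] assoc_mult_mat[OF P' G' Wc, of l] by simp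
    finally show "?P * (W * calc_mat ts) * ?E = ?P * (calc_mat ts' * W) * ?E" .
  qed
  note WG = this
  have TW: "T' * W = T"
  proof -
    have "T' * W = T' * S' * T" unfolding W_def by (rule assoc_mult_mat[OF B'(1,2) B(1), symmetric])
    thus ?thesis unfolding B'(3) using left_mult_one_mat[OF B(1)] by simp
  qed
  have WS: "W * S = S'"
  proof -
    have "W * S = S' * (T * S)" unfolding W_def by (rule assoc_mult_mat[OF B'(2) B(1,2)])
    thus ?thesis unfolding B(3) using right_mult_one_mat[OF B'(2)] by simp
  qed
  have "T * calc_mat ts * S = T' * W * calc_mat ts * S" unfolding TW ..
  also have "T' * W * calc_mat ts = T' * (calc_mat ts' * W)"
    unfolding WG[symmetric] by (rule assoc_mult_mat[OF B'(1) Wc G])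
  also have "T' * (calc_mat ts' * W) = T' * calc_mat ts' * W" by (rule assoc_mult_mat[OF B'(1) G' Wc, symmetric])
  also have "T' * calc_mat ts' * W * S = T' * calc_mat ts' * (W * S)"
    by (rule assoc_mult_mat[OF mult_carrier_mat[OF B'(1) G'] Wc B(2)])
  finally show ?thesis unfolding WS .
qed

text \<open>By uniqueness the definite description may be evaluated on any decomposition at
  hand.\<close>

lemma fun_calc_eq:
  assumes y: "commuting n y" "n \<ge> 1" and bd: "block_decomp y us T S"
  shows "fun_calc g y = T * calc_mat (map (\<lambda>(\<mu>, u). (g, \<mu>, u)) us) * S"
proof -
  let ?ts = "map (\<lambda>(\<mu>, u). (g, \<mu>, u)) us"
  have snd: "map snd ?ts = us" by (induction us) auto
  have bd': "block_decomp y (map snd ?ts) T S" using bd by (simp only: snd)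
  show ?thesis unfolding fun_calc_def
  proof (rule the_equality)
    show "\<exists>ts. calc_value y ts (T * calc_mat ?ts * S) \<and> (\<forall>(h, \<mu>, x)\<in>set ts. h = g)"
      by (rule exI[of _ ?ts]) (use bd' in \<open>auto simp: calc_value_iff\<close>)
    fix z assume "\<exists>ts. calc_value y ts z \<and> (\<forall>(h, \<mu>, x)\<in>set ts. h = g)"
    then obtain ts T' S' where ts: "block_decomp y (map snd ts) T' S'" "z = T' * calc_mat ts * S'" "\<forall>(h, \<mu>, x)\<in>set ts. h = g"
      unfolding calc_value_iff by blast
    show "z = T * calc_mat ?ts * S" unfolding ts(2)
      by (rule calc_unique[OF y ts(1) bd']) (use ts(3) in auto)
  qed
qed

lemma finite_joint_spectrum:
  assumes "commuting n y" "n \<ge> 1"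
  shows "finite (joint_spectrum y)"
proof -
  obtain us T S where bd: "block_decomp y us T S" by (rule block_decomp_exists[OF assms])
  thus ?thesis using block_decomp_joint_spectrum[OF bd assms(1)] by simp
qed

lemma insert_series_diff:
  assumes x: "quasi_scalar n \<mu> x" and ps: "\<And>\<alpha>. power_series_at g \<mu> \<alpha> = power_series_at h \<mu> \<alpha> - power_series_at k \<mu> \<alpha>"
    and z: "insert_series g \<mu> x = 0\<^sub>m n n"
  shows "insert_series h \<mu> x = insert_series k \<mu> x"
proof -
  have c: "commuting n x" using x by (simp add: quasi_scalar_def)
  show ?thesis
  proof (rule eq_matI)
    fix i j assume "i < dim_row (insert_series k \<mu> x)" "j < dim_col (insert_series k \<mu> x)"
    hence ij: "i < n" "j < n" using insert_series_carrier[OF c, of k \<mu>] by auto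
    have "insert_series g \<mu> x $$ (i, j) = insert_series h \<mu> x $$ (i, j) - insert_series k \<mu> x $$ (i, j)"
      using ij by (simp add: insert_series_def Let_def commuting_tuple_size[OF c] ps ring_distribs sum_subtractf)
    thus "insert_series h \<mu> x $$ (i, j) = insert_series k \<mu> x $$ (i, j)" using z ij by simp
  qed (simp_all add: carrier_matD[OF insert_series_carrier[OF c]])
qed

lemma holo_on_power_series_at_diff:
  fixes h k :: "complex ^ 'd::finite \<Rightarrow> complex"
  assumes "holo_on h U" "open U" "\<mu> \<in> U" "holo_on k U'" "open U'" "\<mu> \<in> U'"
  shows "power_series_at (\<lambda>z. h z - k z) \<mu> \<alpha> = power_series_at h \<mu> \<alpha> - power_series_at k \<mu> \<alpha>"
proof -
  obtain r where r: "r > 0" "\<And>z. norm z < r \<Longrightarrow> ((\<lambda>\<alpha>. power_series_at h \<mu> \<alpha> * monom_eval \<alpha> z) has_sum h (\<mu> + z)) UNIV"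
    using holo_on_power_series_at[OF assms(1-3)] by metis
  obtain r' where r': "r' > 0" "\<And>z. norm z < r' \<Longrightarrow> ((\<lambda>\<alpha>. power_series_at k \<mu> \<alpha> * monom_eval \<alpha> z) has_sum k (\<mu> + z)) UNIV"
    using holo_on_power_series_at[OF assms(4-6)] by metis
  have "power_series_at (\<lambda>z. h z - k z) \<mu> = (\<lambda>\<alpha>. power_series_at h \<mu> \<alpha> - power_series_at k \<mu> \<alpha>)"
  proof (rule power_series_at_eqI[of "min r r'"])
    fix z :: "complex ^ 'd" assume z: "norm z < min r r'"
    hence "norm z < r" "norm z < r'" by auto
    from has_sum_add[OF r(2)[OF this(1)] has_sum_uminusI[OF r'(2)[OF this(2)]]]
    show "((\<lambda>\<alpha>. (power_series_at h \<mu> \<alpha> - power_series_at k \<mu> \<alpha>) * monom_eval \<alpha> z) has_sum h (\<mu> + z) - k (\<mu> + z)) UNIV"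
      by (simp add: ring_distribs)
  qed (use r r' in auto)
  thus ?thesis by simp
qed

lemma holo_on_cong_open:
  assumes "holo_on g U" "open U" "\<And>z. z \<in> U \<Longrightarrow> h z = g z"
  shows "holo_on h U"
  unfolding holo_on_def
proof
  fix z assume z: "z \<in> U"
  then obtain D where D: "(g has_derivative D) (at z)" "\<And>c v. D (c *s v) = c * D v"
    using holo_on_imp_has_derivative[OF assms(1,2)] by metis
  have "(h has_derivative D) (at z)"
    by (rule has_derivative_transform_within_open[OF D(1) assms(2) z]) (use assms(3) in auto)
  thus "\<exists>D. (h has_derivative D) (at z within U) \<and> (\<forall>c v. D (c *s v) = c * D v)"
    using D(2) has_derivative_at_withinI by blast
qed

lemma holo_on_diff:
  assumes "holo_on g U" "holo_on h U"
  shows "holo_on (\<lambda>z. g z - h z) U"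
  unfolding holo_on_def
proof
  fix z assume z: "z \<in> U"
  obtain D where D: "(g has_derivative D) (at z within U)" "\<And>c v. D (c *s v) = c * D v"
    using assms(1) z unfolding holo_on_def by blast
  obtain D' where D': "(h has_derivative D') (at z within U)" "\<And>c v. D' (c *s v) = c * D' v"
    using assms(2) z unfolding holo_on_def by blast
  show "\<exists>D. ((\<lambda>z. g z - h z) has_derivative D) (at z within U) \<and> (\<forall>c v. D (c *s v) = c * D v)"
    using has_derivative_diff[OF D(1) D'(1)] D(2) D'(2)
    by (intro exI[of _ "\<lambda>v. D v - D' v"]) (auto simp: ring_distribs)
qed

lemma holo_on_Un_open:
  assumes "holo_on g U" "holo_on g V" "open U" "open V"
  shows "holo_on g (U \<union> V)"
  unfolding holo_on_def
proof
  fix z assume "z \<in> U \<union> V"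
  then obtain D where "(g has_derivative D) (at z)" "\<And>c v. D (c *s v) = c * D v"
    using holo_on_imp_has_derivative[OF assms(1,3), of z] holo_on_imp_has_derivative[OF assms(2,4), of z] by (metis Un_iff)
  thus "\<exists>D. (g has_derivative D) (at z within U \<union> V) \<and> (\<forall>c v. D (c *s v) = c * D v)"
    using has_derivative_at_withinI by blast
qed

lemma holo_on_const: "holo_on (\<lambda>_. c) U"
  unfolding holo_on_def by (intro ballI exI[of _ "\<lambda>_. 0"]) auto

text \<open>Subordination makes the choice of the local extension irrelevant: the difference of two local
  extensions at one joint eigenvalue, continued by \<open>0\<close> near the others, annihilates \<open>y\<close>.\<close>

lemma subordinate_insert_series_eq:
  assumes y: "commuting n y" "n \<ge> 1" and sub: "subordinate V y" and bd: "block_decomp y us T S"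
    and mem: "(\<mu>, u) \<in> set us" and h: "local_extension V f \<mu> h" and h': "local_extension V f \<mu> h'"
  shows "insert_series h \<mu> u = insert_series h' \<mu> u"
proof -
  obtain U where U: "open U" "\<mu> \<in> U" "holo_on h U" "\<And>z. z \<in> U \<inter> V \<Longrightarrow> h z = f z"
    using h unfolding local_extension_def by blast
  obtain U' where U': "open U'" "\<mu> \<in> U'" "holo_on h' U'" "\<And>z. z \<in> U' \<inter> V \<Longrightarrow> h' z = f z"
    using h' unfolding local_extension_def by blast
  have fin: "finite (joint_spectrum y - {\<mu>})" using finite_joint_spectrum[OF y] by simp
  obtain d where d: "d > 0" "\<And>\<nu>. \<nu> \<in> joint_spectrum y \<Longrightarrow> \<nu> \<noteq> \<mu> \<Longrightarrow> d \<le> dist \<mu> \<nu>"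
    using finite_set_avoid[OF finite_joint_spectrum[OF y], of \<mu>] by metis
  \<comment> \<open>\<open>U1\<close> and \<open>U2\<close> are disjoint and open, so the piecewise
    g is holomorphic on their union. The other joint eigenvalues have distance at least d from \<mu>
    and lie in \<open>U2\<close>.\<close>
  define U1 where "U1 = ball \<mu> (d / 2) \<inter> U \<inter> U'"
  define U2 where "U2 = - cball \<mu> (d / 2)"
  define g where "g z = (if z \<in> U1 then h z - h' z else 0)" for z
  have o: "open U1" "open U2" using U U' by (auto simp: U1_def U2_def open_Compl)
  have \<mu>: "\<mu> \<in> U1" using U U' d by (simp add: U1_def)
  have "holo_on (\<lambda>z. h z - h' z) U1"
    by (rule holo_on_diff; rule holo_on_subset[where V = U1]) (use U U' in \<open>auto simp: U1_def\<close>)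
  hence g1: "holo_on g U1" by (rule holo_on_cong_open[OF _ o(1)]) (simp add: g_def)
  have g2: "holo_on g U2"
    by (rule holo_on_cong_open[OF holo_on_const[of 0] o(2)]) (auto simp: g_def U1_def U2_def)
  have fz: "fun_calc g y = 0\<^sub>m (tuple_size y) (tuple_size y)"
  proof (rule sub[unfolded subordinate_def, rule_format], intro conjI)
    show "open (U1 \<union> U2)" using o by blast
    show "joint_spectrum y \<subseteq> U1 \<union> U2"
    proof
      fix \<nu> assume "\<nu> \<in> joint_spectrum y"
      show "\<nu> \<in> U1 \<union> U2"
      proof (cases "\<nu> = \<mu>")
        case False
        from d(2)[OF \<open>\<nu> \<in> joint_spectrum y\<close> False] d(1) have "\<nu> \<in> U2" by (simp add: U2_def)
        thus ?thesis by simp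
      qed (use \<mu> in simp)
    qed
    show "holo_on g (U1 \<union> U2)" by (rule holo_on_Un_open[OF g1 g2 o])
    show "\<forall>z\<in>(U1 \<union> U2) \<inter> V. g z = 0"
      using U(4) U'(4) by (auto simp: g_def U1_def)
  qed
  define ts where "ts = map (\<lambda>(\<mu>, u). (g, \<mu>, u)) us"
  have sndts: "map snd ts = us" unfolding ts_def by (induction us) auto
  have bd': "block_decomp y (map snd ts) T S" using bd by (simp only: sndts)
  have tsl: "length ts = length us" by (simp add: ts_def)
  have z: "T * calc_mat ts * S = 0\<^sub>m n n"
    using fz unfolding commuting_tuple_size[OF y(1)] fun_calc_eq[OF y bd, of g, folded ts_def] .
  obtain k where k: "k < length us" "us ! k = (\<mu>, u)" using mem by (metis in_set_conv_nth)
  define ns where "ns = map (\<lambda>(\<mu>, u). tuple_size u) us"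
  note B = block_decompD[OF bd y(1), folded ns_def]
  note C = calc_mat_block_proj[OF bd' y(1), of k, unfolded sndts, folded ns_def, unfolded tsl, OF k(1)]
  have "ts ! k = (g, \<mu>, u)" using k by (simp add: ts_def)
  hence tk: "fst (ts ! k) = g" "fst (snd (ts ! k)) = \<mu>" "snd (snd (ts ! k)) = u" by auto
  note C' = C[unfolded tk]
  have "calc_mat ts = 0\<^sub>m n n"
  proof -
    have "S * (T * calc_mat ts * S) * T = (S * T) * calc_mat ts * (S * T)"
      using B(1,2) C'(1) by (simp add: assoc_mult_mat[of _ n n _ n _ n] mult_carrier_mat[of _ n n _ n])
    also have "\<dots> = calc_mat ts"
      unfolding B(4) left_mult_one_mat[OF C'(1)] right_mult_one_mat[OF C'(1)] ..
    finally show ?thesis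
      unfolding z right_mult_zero_mat[OF B(2)] left_mult_zero_mat[OF B(1)] by (rule sym)
  qed
  have q: "quasi_scalar (ns ! k) \<mu> u" using B(6)[OF k(1)] k by simp
  hence c: "commuting (ns ! k) u" by (simp add: quasi_scalar_def)
  have P: "block_proj ns k \<in> carrier_mat (ns ! k) n" using block_proj_carrier[of ns k] B(5) by simp
  hence E: "transpose_mat (block_proj ns k) \<in> carrier_mat n (ns ! k)" by simp
  note I = insert_series_carrier[OF c, of g \<mu>]
  have "insert_series g \<mu> u * block_proj ns k = 0\<^sub>m (ns ! k) n"
    using C'(2) right_mult_zero_mat[OF P, of n] by (simp add: \<open>calc_mat ts = 0\<^sub>m n n\<close>)
  hence "insert_series g \<mu> u * (block_proj ns k * transpose_mat (block_proj ns k)) = 0\<^sub>m (ns ! k) (ns ! k)"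
    using assoc_mult_mat[OF I P E] left_mult_zero_mat[OF E, of "ns ! k"] by simp
  hence "insert_series g \<mu> u = 0\<^sub>m (ns ! k) (ns ! k)"
    using block_proj_mult_transpose[of k ns] k right_mult_one_mat[OF I] by (simp add: ns_def)
  moreover have "power_series_at g \<mu> \<alpha> = power_series_at h \<mu> \<alpha> - power_series_at h' \<mu> \<alpha>" for \<alpha>
  proof -
    have "eventually (\<lambda>z. g z = h z - h' z) (nhds \<mu>)"
      using eventually_nhds_in_open[OF o(1) \<mu>] by eventually_elim (simp add: g_def)
    hence "power_series_at g \<mu> = power_series_at (\<lambda>z. h z - h' z) \<mu>" by (rule power_series_at_cong)
    thus ?thesis using holo_on_power_series_at_diff[OF U(3,1,2) U'(3,1,2)] by simp
  qed
  ultimately show ?thesis by (intro insert_series_diff[OF q]) auto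
qed

text \<open>One local extension fixed for each joint eigenvalue computes the value; the arbitrary
  choices allowed in the definite description are reconciled with it by
  \<open>subordinate_insert_series_eq\<close>.\<close>

lemma fun_calc_sub_eq:
  assumes y: "commuting n y" "n \<ge> 1" and sub: "subordinate V y" and bd: "block_decomp y us T S"
    and h: "\<And>\<mu>. \<mu> \<in> joint_spectrum y \<Longrightarrow> local_extension V f \<mu> (h \<mu>)"
  shows "fun_calc_sub V f y = T * calc_mat (map (\<lambda>(\<mu>, u). (h \<mu>, \<mu>, u)) us) * S"
proof -
  let ?ts = "map (\<lambda>(\<mu>, u). (h \<mu>, \<mu>, u)) us"
  have snd: "map snd ?ts = us" by (induction us) auto
  have bd': "block_decomp y (map snd ?ts) T S" using bd by (simp only: snd)
  have js: "joint_spectrum y = fst ` set us" by (rule block_decomp_joint_spectrum[OF bd y(1)])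
  have loc: "\<forall>(g, \<mu>, x)\<in>set ?ts. local_extension V f \<mu> g" using h js by force
  show ?thesis unfolding fun_calc_sub_def
  proof (rule the_equality)
    show "\<exists>ts. calc_value y ts (T * calc_mat ?ts * S) \<and> (\<forall>(h, \<mu>, x)\<in>set ts. local_extension V f \<mu> h)"
      by (rule exI[of _ ?ts]) (use bd' loc in \<open>auto simp: calc_value_iff\<close>)
    fix z assume "\<exists>ts. calc_value y ts z \<and> (\<forall>(h, \<mu>, x)\<in>set ts. local_extension V f \<mu> h)"
    then obtain ts T' S' where ts: "block_decomp y (map snd ts) T' S'" "z = T' * calc_mat ts * S'"
      "\<forall>(h, \<mu>, x)\<in>set ts. local_extension V f \<mu> h"
      unfolding calc_value_iff by blast
    show "z = T * calc_mat ?ts * S" unfolding ts(2)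
    proof (rule calc_unique[OF y ts(1) bd'])
      fix g g' \<mu> x x' assume m: "(g, \<mu>, x) \<in> set ts" "(g', \<mu>, x') \<in> set ?ts"
      show "insert_series g \<mu> x' = insert_series g' \<mu> x'"
      proof (rule subordinate_insert_series_eq[OF y sub bd])
        show "(\<mu>, x') \<in> set us" using m(2) by auto
        show "local_extension V f \<mu> g" using m(1) ts(3) by auto
        show "local_extension V f \<mu> g'" using m(2) loc by auto
      qed
    qed
  qed
qed

text \<open>Taylor expansion of a polynomial around \<mu>, obtained by replacing one factor x_i at a
  time by (x_i - \<mu>_i) + \<mu>_i. One q' serves all tuples of all sizes: scalar tuples identify
  its coefficients with the power series at \<mu>, and nilpotent parts then give the functional
  calculus.\<close>

lemma mpoly_mat_shift:
  fixes q :: "'d::finite mpoly"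
  shows "\<exists>q'. \<forall>n x. commuting n x \<longrightarrow> mpoly_mat q x = mpoly_mat q' (shift_tuple n \<mu> x)"
proof (induction q rule: mpoly_induct)
  case zero
  have "mpoly_mat 0 x = mpoly_mat 0 (shift_tuple n \<mu> x)" if "commuting n x" for n x
    using mpoly_mat_0[OF that] mpoly_mat_0[OF commuting_shift_tuple[OF that]] by simp
  thus ?case by blast
next
  case (single \<alpha> c)
  show ?case
  proof (induction "mono_deg \<alpha>" arbitrary: \<alpha>)
    case 0
    hence "\<alpha> = 0" by (simp add: mono_deg_eq_0_iff)
    have "mpoly_mat (Poly_Mapping.single \<alpha> c) x = mpoly_mat (Poly_Mapping.single \<alpha> c) (shift_tuple n \<mu> x)"
      if "commuting n x" for n x
      using mpoly_mat_single[OF that] mpoly_mat_single[OF commuting_shift_tuple[OF that]]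
        monom_mat_0[OF that] monom_mat_0[OF commuting_shift_tuple[OF that]] unfolding \<open>\<alpha> = 0\<close> by simp
    thus ?case by blast
  next
    case (Suc m)
    hence "\<alpha> \<noteq> 0" by auto
    then obtain i where i: "Poly_Mapping.lookup \<alpha> i \<noteq> 0" by (metis lookup_zero poly_mapping_eqI)
    define \<beta> where "\<beta> = \<alpha> - Poly_Mapping.single i 1"
    have \<alpha>: "\<alpha> = \<beta> + Poly_Mapping.single i 1"
      using i unfolding \<beta>_def by (intro poly_mapping_eqI) (auto simp: lookup_add lookup_minus lookup_single when_def)
    hence "m = mono_deg \<beta>" using Suc(2) by (simp add: mono_deg_add)
    from Suc(1)[OF this] obtain q' where
      q': "\<And>n x. commuting n x \<Longrightarrow> mpoly_mat (Poly_Mapping.single \<beta> c) x = mpoly_mat q' (shift_tuple n \<mu> x)" by blast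
    let ?X = "Poly_Mapping.single (Poly_Mapping.single i 1) 1 :: 'd mpoly"
    let ?C = "Poly_Mapping.single 0 (\<mu> $ i) :: 'd mpoly"
    have split: "Poly_Mapping.single \<alpha> c = Poly_Mapping.single \<beta> c * ?X"
      unfolding mult_single by (simp add: \<alpha>)
    have "mpoly_mat (Poly_Mapping.single \<alpha> c) x = mpoly_mat (q' * (?X + ?C)) (shift_tuple n \<mu> x)"
      if x: "commuting n x" for n x
    proof -
      have N: "commuting n (shift_tuple n \<mu> x)" by (rule commuting_shift_tuple[OF x])
      have one: "A ^\<^sub>m 1 = A" if "A \<in> carrier_mat n n" for A :: "complex mat" using that by simp
      have var: "mpoly_mat ?X z = z i" if "commuting n z" for z
        unfolding mpoly_mat_single[OF that] monom_mat_single[OF that] one[OF commutingD(1)[OF that]]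
        by (rule eq_matI) auto
      have cst: "mpoly_mat ?C z = \<mu> $ i \<cdot>\<^sub>m 1\<^sub>m n" if "commuting n z" for z
        unfolding mpoly_mat_single[OF that] monom_mat_0[OF that] ..
      have "mpoly_mat (?X + ?C) (shift_tuple n \<mu> x) = x i"
        unfolding mpoly_mat_add[OF N] var[OF N] cst[OF N]
        using commutingD(1)[OF x, of i] by (intro eq_matI) (auto simp: shift_tuple_def)
      thus ?thesis
        unfolding split mpoly_mat_mult[OF x] mpoly_mat_mult[OF N] var[OF x] q'[OF x] by simp
    qed
    thus ?case by blast
  qed
next
  case (add p q)
  then obtain p' q' where "\<And>n x. commuting n x \<Longrightarrow> mpoly_mat p x = mpoly_mat p' (shift_tuple n \<mu> x)"
    "\<And>n x. commuting n x \<Longrightarrow> mpoly_mat q x = mpoly_mat q' (shift_tuple n \<mu> x)" by blast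
  hence "mpoly_mat (p + q) x = mpoly_mat (p' + q') (shift_tuple n \<mu> x)" if "commuting n x" for n x
    using mpoly_mat_add[OF that] mpoly_mat_add[OF commuting_shift_tuple[OF that]] that by simp
  thus ?case by blast
qed

lemma shift_scalar_tuple: "shift_tuple 1 \<mu> (scalar_tuple (\<mu> + z)) = scalar_tuple z"
  by (rule ext, rule eq_matI) (auto simp: shift_tuple_def scalar_tuple_def)

lemma power_series_at_mpoly:
  fixes q q' :: "'d::finite mpoly"
  assumes "\<And>n x. commuting n x \<Longrightarrow> mpoly_mat q x = mpoly_mat q' (shift_tuple n \<mu> x)"
  shows "power_series_at (mpoly_eval q) \<mu> = Poly_Mapping.lookup q'"
proof (rule power_series_at_eqI[of 1])
  fix z :: "complex ^ 'd"
  have "mpoly_mat q (scalar_tuple (\<mu> + z)) = mpoly_mat q' (scalar_tuple z)"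
    using assms[OF commuting_scalar_tuple] by (simp only: shift_scalar_tuple)
  hence "mat 1 1 (\<lambda>_. mpoly_eval q (\<mu> + z)) $$ (0, 0) = mat 1 1 (\<lambda>_. mpoly_eval q' z) $$ (0, 0)"
    by (simp only: mpoly_mat_scalar_tuple)
  hence "mpoly_eval q (\<mu> + z) = mpoly_eval q' z" by simp
  thus "((\<lambda>\<alpha>. Poly_Mapping.lookup q' \<alpha> * monom_eval \<alpha> z) has_sum mpoly_eval q (\<mu> + z)) UNIV"
    by (intro has_sum_finite_neutralI[where B = "Poly_Mapping.keys q'"]) (auto simp: mpoly_eval_def in_keys_iff)
qed simp

lemma insert_series_mpoly:
  assumes x: "quasi_scalar n \<mu> x"
  shows "insert_series (mpoly_eval q) \<mu> x = mpoly_mat q x"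
proof -
  have c: "commuting n x" using x by (simp add: quasi_scalar_def)
  obtain q' where q': "\<And>n x. commuting n x \<Longrightarrow> mpoly_mat q x = mpoly_mat q' (shift_tuple n \<mu> x)"
    using mpoly_mat_shift[of q \<mu>] by blast
  define B where "B = Poly_Mapping.keys q' \<union> {\<alpha>. monom_mat \<alpha> (shift_tuple n \<mu> x) \<noteq> 0\<^sub>m n n}"
  have B: "finite B" "{\<alpha>. monom_mat \<alpha> (shift_tuple n \<mu> x) \<noteq> 0\<^sub>m n n} \<subseteq> B" "Poly_Mapping.keys q' \<subseteq> B"
    using finite_nonzero_monomials[OF x] by (auto simp: B_def)
  have "trunc_series B (Poly_Mapping.lookup q') = q'"
    using B(1,3) by (intro poly_mapping_eqI) (auto simp: lookup_trunc_series in_keys_iff)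
  moreover have "power_series_at (mpoly_eval q) \<mu> = Poly_Mapping.lookup q'"
    by (rule power_series_at_mpoly) (rule q')
  ultimately show ?thesis
    unfolding insert_series_eq_mpoly_mat[OF x B(1,2)] q'[OF c] by simp
qed

text \<open>Lets the norms of the polynomial approximants on \<open>F_dom p\<close> be computed by
  plain substitution, away from any block decomposition.\<close>

lemma fun_calc_mpoly:
  assumes y: "commuting n y" "n \<ge> 1"
  shows "fun_calc (mpoly_eval q) y = mpoly_mat q y"
proof -
  obtain us T S where bd: "block_decomp y us T S" by (rule block_decomp_exists[OF y])
  define ns where "ns = map (\<lambda>(\<mu>, u). tuple_size u) us"
  define ts where "ts = map (\<lambda>(\<mu>, u). (mpoly_eval q, \<mu>, u)) us"
  have sndts: "map snd ts = us" unfolding ts_def by (induction us) auto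
  have bd': "block_decomp y (map snd ts) T S" using bd by (simp only: sndts)
  have tsl: "length ts = length us" and nsl: "length ns = length us" by (simp_all add: ts_def ns_def)
  note B = block_decompD[OF bd y(1), folded ns_def]
  note C = calc_mat_block_proj[OF bd' y(1), unfolded sndts, folded ns_def, unfolded tsl]
  have "0 < length us" using block_decomp_nonempty[OF bd y] by simp
  note G = C(1)[OF this]
  have M: "mpoly_mat q y \<in> carrier_mat n n" by (rule mpoly_mat_carrier[OF y(1)])
  have "block_proj ns k * (S * mpoly_mat q y) = block_proj ns k * (calc_mat ts * S)" if "k < length ns" for k
  proof -
    have k: "k < length us" using that nsl by simp
    have P: "block_proj ns k \<in> carrier_mat (ns ! k) n" using block_proj_carrier[of ns k] B(5) by simp
    have PS: "block_proj ns k * S \<in> carrier_mat (ns ! k) n" by (rule mult_carrier_mat[OF P B(2)])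
    have q: "quasi_scalar (ns ! k) (fst (us ! k)) (snd (us ! k))" by (rule B(6)[OF k])
    hence c: "commuting (ns ! k) (snd (us ! k))" by (simp add: quasi_scalar_def)
    have ins: "insert_series (fst (ts ! k)) (fst (snd (ts ! k))) (snd (snd (ts ! k))) = mpoly_mat q (snd (us ! k))"
      using insert_series_mpoly[OF q, of q] k by (simp add: ts_def case_prod_beta)
    have "block_proj ns k * (S * mpoly_mat q y) = block_proj ns k * S * mpoly_mat q y"
      by (rule assoc_mult_mat[OF P B(2) M, symmetric])
    also have "\<dots> = mpoly_mat q (snd (us ! k)) * (block_proj ns k * S)"
      by (rule intertwine_mpoly_mat[OF PS y(1) c B(7)[OF k]])
    also have "\<dots> = (mpoly_mat q (snd (us ! k)) * block_proj ns k) * S"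
      by (rule assoc_mult_mat[OF mpoly_mat_carrier[OF c] P B(2), symmetric])
    also have "mpoly_mat q (snd (us ! k)) * block_proj ns k = block_proj ns k * calc_mat ts"
      using C(2)[OF k] unfolding ins by simp
    also have "block_proj ns k * calc_mat ts * S = block_proj ns k * (calc_mat ts * S)"
      by (rule assoc_mult_mat[OF P G B(2)])
    finally show ?thesis .
  qed
  note proj = this
  have SM: "S * mpoly_mat q y = calc_mat ts * S"
    by (rule block_proj_separates_rows[of _ ns n, unfolded B(5), OF mult_carrier_mat[OF B(2) M] mult_carrier_mat[OF G B(2)] proj])
  have "fun_calc (mpoly_eval q) y = T * calc_mat ts * S"
    unfolding fun_calc_eq[OF y bd] ts_def ..
  also have "\<dots> = T * (S * mpoly_mat q y)"
    unfolding SM by (rule assoc_mult_mat[OF B(1) G B(2)])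
  also have "\<dots> = T * S * mpoly_mat q y" by (rule assoc_mult_mat[OF B(1,2) M, symmetric])
  also have "\<dots> = mpoly_mat q y" unfolding B(3) by (rule left_mult_one_mat[OF M])
  finally show ?thesis .
qed

text \<open>If v is a joint eigenvector, p(y) maps the stacked vectors c_b v to those with
  coefficients p(\<mu>) c. Restricted to such vectors it has the norm of p(\<mu>).\<close>

lemma joint_spectrum_op_norm_le:
  assumes y: "commuting n y" and p: "p \<in> carrier_mat I J" and \<mu>: "\<mu> \<in> joint_spectrum y"
  shows "op_norm (pmat_eval p \<mu>) \<le> op_norm (pmat_mat p y)"
proof -
  obtain v where v: "dim_vec v = n" "col_mat v \<noteq> 0\<^sub>m n 1" "\<forall>i. col_mat v * scalar_tuple \<mu> i = y i * col_mat v"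
    using \<mu> unfolding joint_spectrum_iff[OF y] by blast
  have vc: "col_mat v \<in> carrier_mat n 1" using col_mat_carrier[of v] v by simp
  have ev: "mpoly_mat q y *\<^sub>v v = mpoly_eval q \<mu> \<cdot>\<^sub>v v" for q
  proof -
    have "col_mat v * mpoly_mat q (scalar_tuple \<mu>) = mpoly_mat q y * col_mat v"
      by (rule intertwine_mpoly_mat[OF vc commuting_scalar_tuple y]) (use v in auto)
    hence "col_mat (mpoly_eval q \<mu> \<cdot>\<^sub>v v) = col_mat (mpoly_mat q y *\<^sub>v v)"
      using v carrier_matD[OF mpoly_mat_carrier[OF y, of q]]
      unfolding mpoly_mat_scalar_tuple col_mat_mult_scalar by (simp add: mult_col_mat)
    thus ?thesis by (simp only: col_mat_inject)
  qed
  have vpos: "vec_l2 v > 0"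
  proof -
    have "\<exists>i<n. vec_index v i \<noteq> 0"
    proof (rule ccontr)
      assume "\<not> ?thesis"
      hence "col_mat v = 0\<^sub>m n 1" using v(1) by (intro eq_matI) (auto simp: col_mat_def)
      thus False using v by simp
    qed
    then obtain i where i: "i < n" "vec_index v i \<noteq> 0" by blast
    have "0 < cmod (vec_index v i)" using i by simp
    also have "\<dots> \<le> vec_l2 v" unfolding vec_l2_L2_set using i v by (intro member_le_L2_set) auto
    finally show ?thesis .
  qed
  show ?thesis
  proof (rule op_norm_le[OF op_norm_nonneg])
    fix c :: "complex Matrix.vec" assume c: "dim_vec c = dim_col (pmat_eval p \<mu>)"
    hence c': "dim_vec c = J" using p by (simp add: pmat_eval_def)
    have e: "vec_index (pmat_eval p \<mu> *\<^sub>v c) a = (\<Sum>b<J. mpoly_eval (p $$ (a, b)) \<mu> * vec_index c b)" if "a < I" for a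
      using that p c' by (simp add: index_mult_mat_vec_sum pmat_eval_def del: index_mult_mat_vec)
    have te: "vec_index (mpoly_mat (p $$ (a, b)) y *\<^sub>v (vec_index c b \<cdot>\<^sub>v v)) r = mpoly_eval (p $$ (a, b)) \<mu> * vec_index c b * vec_index v r"
      if "r < n" for a b r
    proof -
      have "mpoly_mat (p $$ (a, b)) y *\<^sub>v (vec_index c b \<cdot>\<^sub>v v) = vec_index c b \<cdot>\<^sub>v (mpoly_mat (p $$ (a, b)) y *\<^sub>v v)"
        by (rule mult_mat_vec[OF mpoly_mat_carrier[OF y]]) (use v in \<open>intro carrier_vecI\<close>)
      thus ?thesis using that v by (simp add: ev del: index_mult_mat_vec)
    qed
    have "(vec_l2 (pmat_eval p \<mu> *\<^sub>v c) * vec_l2 v)\<^sup>2 =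
      (\<Sum>a<I. \<Sum>r<n. (cmod (\<Sum>b<J. vec_index (mpoly_mat (p $$ (a, b)) y *\<^sub>v (vec_index c b \<cdot>\<^sub>v v)) r))\<^sup>2)"
    proof -
      have "(vec_l2 (pmat_eval p \<mu> *\<^sub>v c) * vec_l2 v)\<^sup>2 =
        (\<Sum>a<I. (cmod (\<Sum>b<J. mpoly_eval (p $$ (a, b)) \<mu> * vec_index c b))\<^sup>2) * (\<Sum>r<n. (cmod (vec_index v r))\<^sup>2)"
        using p v(1) e by (simp add: power_mult_distrib vec_l2_square pmat_eval_def del: index_mult_mat_vec)
      also have "\<dots> = (\<Sum>a<I. \<Sum>r<n. (cmod ((\<Sum>b<J. mpoly_eval (p $$ (a, b)) \<mu> * vec_index c b) * vec_index v r))\<^sup>2)"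
        by (simp add: sum_product norm_mult power_mult_distrib)
      also have "\<dots> = (\<Sum>a<I. \<Sum>r<n. (cmod (\<Sum>b<J. vec_index (mpoly_mat (p $$ (a, b)) y *\<^sub>v (vec_index c b \<cdot>\<^sub>v v)) r))\<^sup>2)"
        by (intro sum.cong refl) (simp add: te sum_distrib_right del: index_mult_mat_vec)
      finally show ?thesis .
    qed
    also have "\<dots> \<le> (op_norm (pmat_mat p y))\<^sup>2 * (\<Sum>b<J. \<Sum>r<n. (cmod (vec_index (vec_index c b \<cdot>\<^sub>v v) r))\<^sup>2)"
      by (rule pmat_mat_norm_bound[OF y p]) (use v in simp)
    also have "(\<Sum>b<J. \<Sum>r<n. (cmod (vec_index (vec_index c b \<cdot>\<^sub>v v) r))\<^sup>2) = (vec_l2 c * vec_l2 v)\<^sup>2"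
      using v(1) c' by (simp add: power_mult_distrib vec_l2_square sum_product norm_mult)
    also have "(op_norm (pmat_mat p y))\<^sup>2 * (vec_l2 c * vec_l2 v)\<^sup>2 = (op_norm (pmat_mat p y) * vec_l2 c * vec_l2 v)\<^sup>2"
      by (simp add: power_mult_distrib)
    finally have "vec_l2 (pmat_eval p \<mu> *\<^sub>v c) * vec_l2 v \<le> op_norm (pmat_mat p y) * vec_l2 c * vec_l2 v"
      by (rule power2_le_imp_le) (intro mult_nonneg_nonneg op_norm_nonneg vec_l2_nonneg)
    thus "vec_l2 (pmat_eval p \<mu> *\<^sub>v c) \<le> op_norm (pmat_mat p y) * vec_l2 c"
      using vpos by simp
  qed
qed

lemma joint_spectrum_subset_G_dom:
  assumes "p \<in> carrier_mat I J" "y \<in> F_dom p"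
  shows "joint_spectrum y \<subseteq> G_dom p"
proof
  fix \<mu> assume "\<mu> \<in> joint_spectrum y"
  moreover obtain "commuting (tuple_size y) y" using assms(2) comm_tuplesE unfolding F_dom_def by blast
  ultimately have "op_norm (pmat_eval p \<mu>) \<le> op_norm (pmat_mat p y)"
    using joint_spectrum_op_norm_le[OF _ assms(1)] by blast
  thus "\<mu> \<in> G_dom p" using assms(2) by (simp add: G_dom_def F_dom_def)
qed

lemma fun_calc_sub_extension:
  assumes p: "p \<in> carrier_mat I J" and V: "V \<subseteq> G_dom p" and F: "holo_on F (G_dom p)"
    and agree: "\<And>z. z \<in> V \<Longrightarrow> F z = f z" and y: "y \<in> F_dom_sub p V"
  shows "fun_calc_sub V f y = fun_calc F y"
proof -
  have y': "y \<in> comm_tuples" "joint_spectrum y \<subseteq> V" "subordinate V y"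
    using y by (auto simp: F_dom_sub_def Y_set_def)
  obtain c: "tuple_size y \<ge> 1" "commuting (tuple_size y) y" using comm_tuplesE[OF y'(1)] .
  obtain us T S where bd: "block_decomp y us T S" by (rule block_decomp_exists[OF c(2,1)])
  have "local_extension V f \<mu> F" if "\<mu> \<in> joint_spectrum y" for \<mu>
    unfolding local_extension_def using that y'(2) V F agree open_G_dom[OF p] by blast
  from fun_calc_sub_eq[OF c(2,1) y'(3) bd, of f "\<lambda>_. F"] this
  show ?thesis unfolding fun_calc_eq[OF c(2,1) bd] by blast
qed

lemma norm_p_sub_le_norm_p:
  assumes p: "p \<in> carrier_mat I J" and V: "V \<subseteq> G_dom p" and F: "holo_on F (G_dom p)"
    and agree: "\<And>z. z \<in> V \<Longrightarrow> F z = f z"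
  shows "norm_p_sub p V f \<le> norm_p p F"
  unfolding norm_p_sub_def norm_p_def
proof (rule SUP_mono)
  fix y assume y: "y \<in> F_dom_sub p V"
  hence "y \<in> F_dom p" by (simp add: F_dom_sub_def)
  thus "\<exists>x\<in>F_dom p. ennreal (op_norm (fun_calc_sub V f y)) \<le> ennreal (op_norm (fun_calc F x))"
    using fun_calc_sub_extension[OF p V F agree y] by (intro bexI[of _ y]) auto
qed

lemma restrict_in_Hol_inf_sub:
  assumes p: "p \<in> carrier_mat I J" and V: "V \<subseteq> G_dom p" and F: "F \<in> Hol_inf p"
  shows "restrict F V \<in> Hol_inf_sub p V" "norm_p_sub p V (restrict F V) \<le> norm_p p F"
proof -
  have hol: "holo_on F (G_dom p)" and fin: "norm_p p F < \<infinity>" using F by (auto simp: Hol_inf_def)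
  show le: "norm_p_sub p V (restrict F V) \<le> norm_p p F"
    by (rule norm_p_sub_le_norm_p[OF p V hol]) simp
  have "local_extension V (restrict F V) \<mu> F" if "\<mu> \<in> V" for \<mu>
    unfolding local_extension_def using that V hol open_G_dom[OF p] by (intro exI[of _ "G_dom p"]) auto
  hence "restrict F V \<in> Hol_sub V" unfolding Hol_sub_def by blast
  thus "restrict F V \<in> Hol_inf_sub p V"
    unfolding Hol_inf_sub_def using le_less_trans[OF le fin] by simp
qed

section \<open>Positive kernels and lurking isometries\<close>

definition herm_form :: "'a set \<Rightarrow> ('a \<Rightarrow> 'a \<Rightarrow> complex) \<Rightarrow> ('a \<Rightarrow> complex) \<Rightarrow> real" where
  "herm_form X G v = Re (\<Sum>x\<in>X. \<Sum>y\<in>X. cnj (v x) * G x y * v y)"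

text \<open>Hermitian symmetry is demanded separately, since the real part in
  \<open>herm_form\<close> does not see a skew-Hermitian summand.\<close>

definition psd_on :: "'a set \<Rightarrow> ('a \<Rightarrow> 'a \<Rightarrow> complex) \<Rightarrow> bool" where
  "psd_on X G \<longleftrightarrow> (\<forall>x\<in>X. \<forall>y\<in>X. G x y = cnj (G y x)) \<and> (\<forall>v. 0 \<le> herm_form X G v)"

lemma cnj_mult_cmod: "cnj z * z = (complex_of_real (cmod z))\<^sup>2" "z * cnj z = (complex_of_real (cmod z))\<^sup>2"
  by (simp_all add: complex_norm_square[symmetric] mult.commute[of "cnj z"] flip: of_real_power)

lemma herm_form_cong: "(\<And>x. x \<in> X \<Longrightarrow> v x = w x) \<Longrightarrow> herm_form X G v = herm_form X G w"
  unfolding herm_form_def by (intro arg_cong[where f = Re] sum.cong) auto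

lemma herm_form_insert:
  assumes X: "finite X" "x0 \<notin> X" and herm: "\<forall>y\<in>X. G y x0 = cnj (G x0 y)"
  shows "herm_form (insert x0 X) G v =
    Re (G x0 x0) * (cmod (v x0))\<^sup>2 + 2 * Re (cnj (v x0) * (\<Sum>y\<in>X. G x0 y * v y)) + herm_form X G v"
proof -
  have "(\<Sum>x\<in>insert x0 X. \<Sum>y\<in>insert x0 X. cnj (v x) * G x y * v y) =
     cnj (v x0) * G x0 x0 * v x0 + (\<Sum>y\<in>X. cnj (v x0) * G x0 y * v y) + (\<Sum>x\<in>X. cnj (v x) * G x x0 * v x0)
     + (\<Sum>x\<in>X. \<Sum>y\<in>X. cnj (v x) * G x y * v y)"
    using X by (simp add: sum.distrib add.assoc)
  also have "cnj (v x0) * G x0 x0 * v x0 = G x0 x0 * of_real ((cmod (v x0))\<^sup>2)"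
    using cnj_mult_cmod(1)[of "v x0"] by (simp add: mult_ac)
  also have "(\<Sum>y\<in>X. cnj (v x0) * G x0 y * v y) = cnj (v x0) * (\<Sum>y\<in>X. G x0 y * v y)"
    by (simp add: sum_distrib_left mult.assoc)
  also have "(\<Sum>x\<in>X. cnj (v x) * G x x0 * v x0) = cnj (cnj (v x0) * (\<Sum>y\<in>X. G x0 y * v y))"
    using herm by (simp add: sum_distrib_left mult_ac)
  finally have e: "(\<Sum>x\<in>insert x0 X. \<Sum>y\<in>insert x0 X. cnj (v x) * G x y * v y) =
     G x0 x0 * of_real ((cmod (v x0))\<^sup>2) + cnj (v x0) * (\<Sum>y\<in>X. G x0 y * v y)
     + cnj (cnj (v x0) * (\<Sum>y\<in>X. G x0 y * v y)) + (\<Sum>x\<in>X. \<Sum>y\<in>X. cnj (v x) * G x y * v y)" .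
  have r: "Re (z * of_real t) = Re z * t" for z t by simp
  have rc: "Re (cnj z) = Re z" for z by simp
  show ?thesis unfolding herm_form_def e plus_complex.sel rc r by linarith
qed

lemma psd_on_diag:
  assumes "psd_on X G" "finite X" "x \<in> X"
  shows "Re (G x x) \<ge> 0" "Im (G x x) = 0"
proof -
  have "herm_form X G (\<lambda>y. if y = x then 1 else 0) = Re (G x x)"
    unfolding herm_form_def using assms(2,3)
    by (simp add: if_distrib[of cnj] if_distrib[of "\<lambda>z. z * _"] if_distrib[of "\<lambda>z. _ * z"] cong: if_cong)
  moreover have "0 \<le> herm_form X G (\<lambda>y. if y = x then 1 else 0)" using assms(1) by (simp add: psd_on_def)
  ultimately show "Re (G x x) \<ge> 0" by simp
  have "G x x = cnj (G x x)" using assms(1,3) unfolding psd_on_def by blast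
  hence "Im (G x x) = - Im (G x x)" by (metis cnj.simps(2))
  thus "Im (G x x) = 0" by simp
qed

text \<open>Cholesky factorization by successive Schur complements.\<close>

lemma psd_factorization:
  assumes "finite X" "psd_on X G"
  shows "\<exists>u :: 'a \<Rightarrow> nat \<Rightarrow> complex. \<forall>x\<in>X. \<forall>y\<in>X. G x y = (\<Sum>k<card X. cnj (u x k) * u y k)"
  using assms
proof (induction X arbitrary: G rule: finite_induct)
  case (insert x0 X)
  have herm: "G x y = cnj (G y x)" if "x \<in> insert x0 X" "y \<in> insert x0 X" for x y
    using insert.prems that by (auto simp: psd_on_def)
  have pos: "herm_form (insert x0 X) G v \<ge> 0" for v using insert.prems by (simp add: psd_on_def)
  have form: "herm_form (insert x0 X) G v =
    Re (G x0 x0) * (cmod (v x0))\<^sup>2 + 2 * Re (cnj (v x0) * (\<Sum>y\<in>X. G x0 y * v y)) + herm_form X G v" for v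
    using insert.hyps herm[of _ x0] by (intro herm_form_insert) auto
  define d where "d = Re (G x0 x0)"
  have d: "d \<ge> 0" "G x0 x0 = of_real d"
    using psd_on_diag[OF insert.prems, of x0] insert.hyps by (auto simp: d_def complex_eq_iff)
  have cX: "card (insert x0 X) = Suc (card X)" using insert.hyps by simp
  show ?case
  proof (cases "d = 0")
    case True
    have z: "G x0 y = 0" if y: "y \<in> X" for y
    proof (rule ccontr)
      assume ne: "G x0 y \<noteq> 0"
      \<comment> \<open>Chosen so that the cross term 2 t |G x0 y|^2 exceeds G y y by 1, and the
        form takes the value -1.\<close>
      define t where "t = (Re (G y y) + 1) / (2 * (cmod (G x0 y))\<^sup>2)"
      define v where "v x = (if x = x0 then - of_real t * G x0 y else if x = y then 1 else 0)" for x
      have vx: "v y = 1" "v x0 = - of_real t * G x0 y" using y insert.hyps by (auto simp: v_def)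
      have "(\<Sum>y'\<in>X. G x0 y' * v y') = (\<Sum>y'\<in>X. if y' = y then G x0 y else 0)"
        using insert.hyps by (intro sum.cong) (auto simp: v_def)
      hence s: "(\<Sum>y'\<in>X. G x0 y' * v y') = G x0 y" using insert.hyps y by simp
      have "herm_form X G v = herm_form X G (\<lambda>x. if x = y then 1 else 0)"
        using insert.hyps by (intro herm_form_cong) (auto simp: v_def)
      also have "\<dots> = Re (G y y)"
        unfolding herm_form_def using insert.hyps y
        by (simp add: if_distrib[of cnj] if_distrib[of "\<lambda>z. z * _"] if_distrib[of "\<lambda>z. _ * z"] cong: if_cong)
      finally have h: "herm_form X G v = Re (G y y)" .
      have "Re (cnj (v x0) * G x0 y) = - t * (cmod (G x0 y))\<^sup>2"
      proof -
        have "cnj (v x0) * G x0 y = - (of_real t * (cnj (G x0 y) * G x0 y))" unfolding vx by simp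
        also have "\<dots> = of_real (- (t * (cmod (G x0 y))\<^sup>2))" unfolding cnj_mult_cmod by simp
        finally show ?thesis by (simp only: Re_complex_of_real)
      qed
      hence "herm_form (insert x0 X) G v = - (2 * t * (cmod (G x0 y))\<^sup>2) + Re (G y y)"
        unfolding form s h using True by (simp add: d_def)
      also have "2 * t * (cmod (G x0 y))\<^sup>2 = Re (G y y) + 1" using ne by (simp add: t_def)
      finally have "herm_form (insert x0 X) G v = -1" by simp
      thus False using pos[of v] by simp
    qed
    have "psd_on X G" unfolding psd_on_def
    proof (intro conjI ballI allI)
      fix v
      have "herm_form X G v = herm_form (insert x0 X) G v"
        unfolding form using z True by (simp add: d_def)
      thus "0 \<le> herm_form X G v" using pos by simp
    next
      fix x y assume "x \<in> X" "y \<in> X"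
      thus "G x y = cnj (G y x)" by (intro herm) auto
    qed
    then obtain u where u: "\<forall>x\<in>X. \<forall>y\<in>X. G x y = (\<Sum>k<card X. cnj (u x k) * u y k)" using insert.IH by blast
    define u' where "u' x k = (if x = x0 \<or> k = card X then 0 else u x k)" for x k
    have "G x y = (\<Sum>k<card (insert x0 X). cnj (u' x k) * u' y k)" if "x \<in> insert x0 X" "y \<in> insert x0 X" for x y
    proof (cases "x = x0 \<or> y = x0")
      case True
      have z': "G x0 w = 0" if "w \<in> insert x0 X" for w
        using that z d(2) \<open>d = 0\<close> by auto
      have "G x y = 0"
      proof (cases "x = x0")
        case True
        thus ?thesis using z' that by simp
      next
        case False
        hence "y = x0" using \<open>x = x0 \<or> y = x0\<close> by simp
        have "G x x0 = cnj (G x0 x)" by (rule herm) (use that in auto)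
        thus ?thesis unfolding \<open>y = x0\<close> using z'[OF that(1)] by simp
      qed
      thus ?thesis using True by (auto simp: u'_def)
    next
      case False
      hence "G x y = (\<Sum>k<card X. cnj (u x k) * u y k)" using u that by auto
      also have "\<dots> = (\<Sum>k<card X. cnj (u' x k) * u' y k)" using False by (intro sum.cong) (auto simp: u'_def)
      finally show ?thesis unfolding cX by (simp add: u'_def)
    qed
    thus ?thesis by blast
  next
    case False
    hence dpos: "d > 0" using d by simp
    define G' where "G' x y = G x y - G x x0 * G x0 y / of_real d" for x y
    have "psd_on X G'" unfolding psd_on_def
    proof (intro conjI ballI allI)
      fix x y assume "x \<in> X" "y \<in> X"
      thus "G' x y = cnj (G' y x)"
        using herm[of x y] herm[of x x0] herm[of x0 y] by (simp add: G'_def mult.commute)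
    next
      fix v
      define s where "s = (\<Sum>y\<in>X. G x0 y * v y)"
      \<comment> \<open>The value at \<open>x0\<close> minimizes the form of G for fixed v on X; the
        minimum is the form of G' at v.\<close>
      define w where "w = v(x0 := - s / of_real d)"
      have wX: "w x = v x" if "x \<in> X" for x using that insert.hyps by (auto simp: w_def)
      have sw: "(\<Sum>y\<in>X. G x0 y * w y) = s" unfolding s_def by (intro sum.cong) (auto simp: wX)
      have hw: "herm_form X G w = herm_form X G v" by (rule herm_form_cong) (rule wX)
      have cs: "cnj s = (\<Sum>x\<in>X. cnj (v x) * G x x0)"
        unfolding s_def cnj_sum by (intro sum.cong) (auto simp: herm[of _ x0] mult.commute)
      have "(\<Sum>x\<in>X. \<Sum>y\<in>X. cnj (v x) * G' x y * v y) =
        (\<Sum>x\<in>X. \<Sum>y\<in>X. cnj (v x) * G x y * v y) - (\<Sum>x\<in>X. \<Sum>y\<in>X. cnj (v x) * G x x0 * (G x0 y * v y)) / of_real d"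
        by (simp add: G'_def algebra_simps sum_subtractf sum_divide_distrib)
      also have "(\<Sum>x\<in>X. \<Sum>y\<in>X. cnj (v x) * G x x0 * (G x0 y * v y)) = cnj s * s"
        unfolding cs unfolding s_def by (simp add: sum_product)
      also have "cnj s * s = of_real ((cmod s)\<^sup>2)" by (simp add: cnj_mult_cmod)
      finally have hG': "herm_form X G' v = herm_form X G v - (cmod s)\<^sup>2 / d"
        unfolding herm_form_def by (simp flip: of_real_divide)
      have w0: "w x0 = - s / of_real d" by (simp add: w_def)
      have "Re (cnj (w x0) * s) = - (cmod s)\<^sup>2 / d"
      proof -
        have "cnj (w x0) * s = - of_real ((cmod s)\<^sup>2 / d)"
          unfolding w0 by (simp add: cnj_mult_cmod)
        thus ?thesis by (simp only: uminus_complex.sel Re_complex_of_real)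
      qed
      moreover have "(cmod (w x0))\<^sup>2 = (cmod s)\<^sup>2 / d\<^sup>2"
        unfolding w0 using dpos by (simp add: norm_divide power_divide)
      moreover have "d * ((cmod s)\<^sup>2 / d\<^sup>2) = (cmod s)\<^sup>2 / d" using dpos by (simp add: power2_eq_square)
      ultimately have "herm_form (insert x0 X) G w = herm_form X G v - (cmod s)\<^sup>2 / d"
        unfolding form sw hw by (simp add: d_def[symmetric])
      thus "0 \<le> herm_form X G' v" using pos[of w] hG' by simp
    qed
    then obtain u where u: "\<forall>x\<in>X. \<forall>y\<in>X. G' x y = (\<Sum>k<card X. cnj (u x k) * u y k)" using insert.IH by blast
    \<comment> \<open>The new coordinate \<open>card X\<close> carries the row of the pivot, scaled
      by the square root of d so that its products restore the rank-one term subtracted in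
      G'.\<close>
    define u' where "u' x k = (if k = card X then G x0 x / of_real (sqrt d) else if x = x0 then 0 else u x k)" for x k
    have sq: "complex_of_real (sqrt d) * complex_of_real (sqrt d) = of_real d"
      using dpos by (simp flip: of_real_mult)
    have "G x y = (\<Sum>k<card (insert x0 X). cnj (u' x k) * u' y k)" if xy: "x \<in> insert x0 X" "y \<in> insert x0 X" for x y
    proof -
      have last: "cnj (u' x (card X)) * u' y (card X) = G x x0 * G x0 y / of_real d"
        using herm[OF xy(1), of x0] by (simp add: u'_def sq)
      have rest: "(\<Sum>k<card X. cnj (u' x k) * u' y k) = (if x = x0 \<or> y = x0 then 0 else G' x y)"
      proof (cases "x = x0 \<or> y = x0")
        case True
        thus ?thesis by (auto simp: u'_def)
      next
        case False
        hence "G' x y = (\<Sum>k<card X. cnj (u x k) * u y k)" using u xy by auto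
        also have "\<dots> = (\<Sum>k<card X. cnj (u' x k) * u' y k)" using False by (intro sum.cong) (auto simp: u'_def)
        finally show ?thesis using False by simp
      qed
      have "(\<Sum>k<card (insert x0 X). cnj (u' x k) * u' y k) = (if x = x0 \<or> y = x0 then 0 else G' x y) + G x x0 * G x0 y / of_real d"
        unfolding cX by (simp add: rest last)
      also have "\<dots> = G x y" using d(2) dpos by (auto simp: G'_def)
      finally show ?thesis ..
    qed
    thus ?thesis by blast
  qed
qed auto

section \<open>Orthonormal systems and the lurking isometry\<close>

definition ip :: "'a set \<Rightarrow> ('a \<Rightarrow> complex) \<Rightarrow> ('a \<Rightarrow> complex) \<Rightarrow> complex" where
  "ip A f g = (\<Sum>x\<in>A. cnj (f x) * g x)"

lemma ip_sym: "ip A f g = cnj (ip A g f)"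
  by (simp add: ip_def mult.commute)

lemma ip_diff_right: "ip A f (\<lambda>x. g x - h x) = ip A f g - ip A f h"
  by (simp add: ip_def ring_distribs sum_subtractf)

lemma ip_sum_right: "ip A f (\<lambda>x. \<Sum>k\<in>K. c k * g k x) = (\<Sum>k\<in>K. c k * ip A f (g k))"
proof -
  have "ip A f (\<lambda>x. \<Sum>k\<in>K. c k * g k x) = (\<Sum>x\<in>A. \<Sum>k\<in>K. c k * (cnj (f x) * g k x))"
    by (simp add: ip_def sum_distrib_left mult_ac)
  also have "\<dots> = (\<Sum>k\<in>K. \<Sum>x\<in>A. c k * (cnj (f x) * g k x))" by (rule sum.swap)
  finally show ?thesis by (simp add: ip_def sum_distrib_left)
qed

lemma ip_scale_right: "ip A f (\<lambda>x. c * g x) = c * ip A f g"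
  by (simp add: ip_def sum_distrib_left mult_ac)

lemma ip_diff_left: "ip A (\<lambda>x. g x - h x) f = ip A g f - ip A h f"
  by (simp add: ip_def ring_distribs sum_subtractf)

lemma ip_sum_left: "ip A (\<lambda>x. \<Sum>k\<in>K. c k * g k x) f = (\<Sum>k\<in>K. cnj (c k) * ip A (g k) f)"
  unfolding ip_sym[of A _ f] ip_sum_right by simp

lemma ip_scale_left: "ip A (\<lambda>x. c * g x) f = cnj c * ip A g f"
  by (simp add: ip_def sum_distrib_left mult_ac)

lemma ip_self: "ip A f f = of_real (\<Sum>x\<in>A. (cmod (f x))\<^sup>2)"
  by (simp add: ip_def cnj_mult_cmod)

lemma ip_self_zero: "finite A \<Longrightarrow> ip A f f = 0 \<Longrightarrow> x \<in> A \<Longrightarrow> f x = 0"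
  unfolding ip_self of_real_eq_0_iff by (subst (asm) sum_nonneg_eq_0_iff) auto

lemma ip_cong: "(\<And>x. x \<in> A \<Longrightarrow> f x = f' x) \<Longrightarrow> (\<And>x. x \<in> A \<Longrightarrow> g x = g' x) \<Longrightarrow> ip A f g = ip A f' g'"
  unfolding ip_def by (intro sum.cong) auto

definition orthonormal_on :: "'a set \<Rightarrow> nat \<Rightarrow> (nat \<Rightarrow> 'a \<Rightarrow> complex) \<Rightarrow> bool" where
  "orthonormal_on A K e \<longleftrightarrow> (\<forall>k<K. \<forall>l<K. ip A (e k) (e l) = (if k = l then 1 else 0))"

lemma orthonormal_sum_norm:
  assumes "orthonormal_on A K e"
  shows "ip A (\<lambda>x. \<Sum>k<K. c k * e k x) (\<lambda>x. \<Sum>k<K. c k * e k x) = of_real (\<Sum>k<K. (cmod (c k))\<^sup>2)"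
proof -
  have "ip A (\<lambda>x. \<Sum>k<K. c k * e k x) (\<lambda>x. \<Sum>k<K. c k * e k x) = (\<Sum>l<K. \<Sum>k<K. c l * (cnj (c k) * ip A (e k) (e l)))"
    unfolding ip_sum_right ip_sum_left by (simp add: sum_distrib_left)
  also have "\<dots> = (\<Sum>l<K. \<Sum>k<K. if k = l then c l * cnj (c l) else 0)"
    using assms by (intro sum.cong refl) (auto simp: orthonormal_on_def)
  finally show ?thesis by (simp add: cnj_mult_cmod)
qed

lemma bessel:
  assumes "orthonormal_on A K e"
  shows "(\<Sum>k<K. (cmod (ip A (e k) v))\<^sup>2) \<le> (\<Sum>x\<in>A. (cmod (v x))\<^sup>2)"
proof -
  let ?s = "\<lambda>x. \<Sum>k<K. ip A (e k) v * e k x"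
  let ?S = "\<Sum>k<K. (cmod (ip A (e k) v))\<^sup>2"
  have 1: "ip A v ?s = of_real ?S"
    unfolding ip_sum_right ip_sym[of A v] by (simp add: cnj_mult_cmod)
  have 2: "ip A ?s v = of_real ?S" unfolding ip_sym[of A ?s v] 1 by simp
  have "ip A (\<lambda>x. v x - ?s x) (\<lambda>x. v x - ?s x) = of_real ((\<Sum>x\<in>A. (cmod (v x))\<^sup>2) - ?S)"
    unfolding ip_diff_right ip_diff_left 1 2 orthonormal_sum_norm[OF assms] ip_self[of A v] by simp
  hence "(\<Sum>x\<in>A. (cmod (v x - ?s x))\<^sup>2) = (\<Sum>x\<in>A. (cmod (v x))\<^sup>2) - ?S"
    unfolding ip_self of_real_eq_iff .
  moreover have "(\<Sum>x\<in>A. (cmod (v x - ?s x))\<^sup>2) \<ge> 0" by (rule sum_nonneg) simp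
  ultimately show ?thesis by linarith
qed

text \<open>Gram-Schmidt is run on both families in step: equal Gram matrices force equal
  coefficients and equal norms of the residuals, so a vector is skipped in both families or in
  neither. The coefficients are required to agree for all j < M, not only for those already treated,
  because the next residual is compared with the vectors still to come.\<close>

lemma parallel_gram_schmidt:
  fixes a :: "nat \<Rightarrow> 'a \<Rightarrow> complex" and b :: "nat \<Rightarrow> 'b \<Rightarrow> complex" and M n :: nat
  assumes A: "finite A" and B: "finite B"
    and gram: "\<And>i j. i < M \<Longrightarrow> j < M \<Longrightarrow> ip A (a i) (a j) = ip B (b i) (b j)"
  shows "n \<le> M \<Longrightarrow> \<exists>K e e'. orthonormal_on A K e \<and> orthonormal_on B K e' \<and>
    (\<forall>k<K. \<forall>j<M. ip A (e k) (a j) = ip B (e' k) (b j)) \<and>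
    (\<forall>j<n. \<forall>x\<in>A. a j x = (\<Sum>k<K. ip A (e k) (a j) * e k x)) \<and>
    (\<forall>j<n. \<forall>y\<in>B. b j y = (\<Sum>k<K. ip A (e k) (a j) * e' k y))"
proof (induction n)
  case 0
  show ?case by (intro exI[of _ 0]) (auto simp: orthonormal_on_def)
next
  case (Suc n)
  obtain K e e' where oA: "orthonormal_on A K e" and oB: "orthonormal_on B K e'"
    and eq': "\<forall>k<K. \<forall>j<M. ip A (e k) (a j) = ip B (e' k) (b j)"
    and sA': "\<forall>j<n. \<forall>x\<in>A. a j x = (\<Sum>k<K. ip A (e k) (a j) * e k x)"
    and sB': "\<forall>j<n. \<forall>y\<in>B. b j y = (\<Sum>k<K. ip A (e k) (a j) * e' k y)"
    using Suc.IH[OF Suc_leD[OF Suc.prems]] by (elim exE conjE) (rule that)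
  note eq = eq'[rule_format] and sA = sA'[rule_format] and sB = sB'[rule_format]
  have n: "n < M" using Suc.prems by simp
  define c where "c k = ip A (e k) (a n)" for k
  have c': "c k = ip B (e' k) (b n)" if "k < K" for k using eq[OF that n] by (simp add: c_def)
  define r where "r x = a n x - (\<Sum>k<K. c k * e k x)" for x
  define r' where "r' y = b n y - (\<Sum>k<K. c k * e' k y)" for y
  have perp: "ip A (e l) r = 0" if "l < K" for l
  proof -
    have "(\<Sum>k<K. c k * ip A (e l) (e k)) = (\<Sum>k<K. if k = l then c l else 0)"
      using oA that by (intro sum.cong) (auto simp: orthonormal_on_def)
    thus ?thesis using that by (simp add: r_def[abs_def] ip_diff_right ip_sum_right c_def[symmetric])
  qed
  have perp': "ip B (e' l) r' = 0" if "l < K" for l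
  proof -
    have "(\<Sum>k<K. c k * ip B (e' l) (e' k)) = (\<Sum>k<K. if k = l then c l else 0)"
      using oB that by (intro sum.cong) (auto simp: orthonormal_on_def)
    thus ?thesis using that by (simp add: r'_def[abs_def] ip_diff_right ip_sum_right c'[symmetric])
  qed
  have ra: "ip A r (a j) = ip B r' (b j)" if "j < M" for j
    unfolding r_def[abs_def] r'_def[abs_def] ip_diff_left ip_sum_left
    using gram[OF n that] eq[OF _ that] by simp
  have rr: "ip A r r = ip A r (a n)"
  proof -
    have "ip A r r = ip A r (a n) - (\<Sum>k<K. c k * ip A r (e k))"
      by (subst (2) r_def[abs_def]) (simp add: ip_diff_right ip_sum_right)
    also have "(\<Sum>k<K. c k * ip A r (e k)) = 0"
      by (intro sum.neutral) (auto simp: ip_sym[of A r] perp)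
    finally show ?thesis by simp
  qed
  have rr': "ip B r' r' = ip B r' (b n)"
  proof -
    have "ip B r' r' = ip B r' (b n) - (\<Sum>k<K. c k * ip B r' (e' k))"
      by (subst (2) r'_def[abs_def]) (simp add: ip_diff_right ip_sum_right)
    also have "(\<Sum>k<K. c k * ip B r' (e' k)) = 0"
      by (intro sum.neutral) (auto simp: ip_sym[of B r'] perp')
    finally show ?thesis by simp
  qed
  have same: "ip A r r = ip B r' r'" unfolding rr rr' by (rule ra[OF n])
  show ?case
  proof (cases "ip A r r = 0")
    case True
    have "a n x = (\<Sum>k<K. c k * e k x)" if "x \<in> A" for x
      using ip_self_zero[OF A True that] by (simp add: r_def)
    moreover have "b n y = (\<Sum>k<K. c k * e' k y)" if "y \<in> B" for y
      using ip_self_zero[OF B True[unfolded same] that] by (simp add: r'_def)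
    ultimately show ?thesis using oA oB eq sA sB
      by (intro exI[of _ K] exI[of _ e] exI[of _ e']) (auto simp: less_Suc_eq c_def)
  next
    case False
    define t where "t = sqrt (\<Sum>x\<in>A. (cmod (r x))\<^sup>2)"
    have t2: "ip A r r = of_real (t\<^sup>2)" unfolding ip_self t_def by (simp add: sum_nonneg)
    have t0: "t \<noteq> 0" using False t2 by auto
    define f where "f k = (if k = K then (\<lambda>x. (1 / of_real t) * r x) else e k)" for k
    define f' where "f' k = (if k = K then (\<lambda>y. (1 / of_real t) * r' y) else e' k)" for k
    have fK: "f K = (\<lambda>x. (1 / of_real t) * r x)" "f' K = (\<lambda>y. (1 / of_real t) * r' y)" by (auto simp: f_def f'_def)
    have fk: "f k = e k" "f' k = e' k" if "k < K" for k using that by (auto simp: f_def f'_def)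
    have last: "ip A (f K) (a n) = of_real t"
      unfolding fK ip_scale_left rr[symmetric] t2 using t0 by (simp add: power2_eq_square)
    have prev: "ip A (f K) (a j) = 0" if "j < n" for j
    proof -
      have "ip A r (a j) = ip A r (\<lambda>x. \<Sum>k<K. ip A (e k) (a j) * e k x)"
        by (rule ip_cong) (use sA[OF that] in auto)
      also have "\<dots> = 0" unfolding ip_sum_right by (intro sum.neutral) (auto simp: ip_sym[of A r] perp)
      finally show ?thesis unfolding fK ip_scale_left by simp
    qed
    have one: "ip A (f K) (f K) = 1" "ip B (f' K) (f' K) = 1"
      unfolding fK ip_scale_left ip_scale_right same[symmetric] t2 using t0 by (simp_all add: power2_eq_square)
    have zero: "ip A (f k) (f K) = 0" "ip A (f K) (f k) = 0" "ip B (f' k) (f' K) = 0" "ip B (f' K) (f' k) = 0" if "k < K" for k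
      using perp[OF that] perp'[OF that] ip_sym[of A r "e k"] ip_sym[of B r' "e' k"]
      unfolding fK fk[OF that] ip_scale_left ip_scale_right by simp_all
    have "orthonormal_on A (Suc K) f" "orthonormal_on B (Suc K) f'"
      unfolding orthonormal_on_def using one zero oA oB fk
      by (auto simp: less_Suc_eq orthonormal_on_def)
    moreover have "ip A (f k) (a j) = ip B (f' k) (b j)" if "k < Suc K" "j < M" for k j
    proof (cases "k = K")
      case True
      show ?thesis unfolding True fK ip_scale_left ra[OF that(2)] ..
    next
      case False
      thus ?thesis using that eq fk by simp
    qed
    moreover have "a j x = (\<Sum>k<Suc K. ip A (f k) (a j) * f k x)" if j: "j < Suc n" and x: "x \<in> A" for j x
    proof (cases "j = n")
      case True
      have "(\<Sum>k<K. ip A (f k) (a n) * f k x) = (\<Sum>k<K. c k * e k x)"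
        by (intro sum.cong) (auto simp: fk c_def)
      moreover have "ip A (f K) (a n) * f K x = r x" unfolding last unfolding fK using t0 by simp
      ultimately show ?thesis using True by (simp add: r_def)
    next
      case False
      hence "j < n" using j by simp
      have "(\<Sum>k<K. ip A (f k) (a j) * f k x) = (\<Sum>k<K. ip A (e k) (a j) * e k x)"
        by (intro sum.cong) (auto simp: fk)
      thus ?thesis using prev[OF \<open>j < n\<close>] sA[OF \<open>j < n\<close> x] by simp
    qed
    moreover have "b j y = (\<Sum>k<Suc K. ip A (f k) (a j) * f' k y)" if j: "j < Suc n" and y: "y \<in> B" for j y
    proof (cases "j = n")
      case True
      have "(\<Sum>k<K. ip A (f k) (a n) * f' k y) = (\<Sum>k<K. c k * e' k y)"
        by (intro sum.cong) (auto simp: fk c_def)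
      moreover have "ip A (f K) (a n) * f' K y = r' y" unfolding last unfolding fK using t0 by simp
      ultimately show ?thesis using True by (simp add: r'_def)
    next
      case False
      hence "j < n" using j by simp
      have "(\<Sum>k<K. ip A (f k) (a j) * f' k y) = (\<Sum>k<K. ip A (e k) (a j) * e' k y)"
        by (intro sum.cong) (auto simp: fk)
      thus ?thesis using prev[OF \<open>j < n\<close>] sB[OF \<open>j < n\<close> y] by simp
    qed
    ultimately show ?thesis
      by (intro exI[of _ "Suc K"] exI[of _ f] exI[of _ f'] conjI allI impI ballI)
  qed
qed

text \<open>L is the partial isometry that sends e_k to e'_k and annihilates the orthogonal
  complement of the e_k. It is a contraction by Bessel's inequality, which is all the realization
  asks of it.\<close>

lemma lurking_isometry:
  fixes a :: "nat \<Rightarrow> 'a \<Rightarrow> complex" and b :: "nat \<Rightarrow> 'b \<Rightarrow> complex" and M :: nat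
  assumes A: "finite A" and B: "finite B"
    and gram: "\<And>i j. i < M \<Longrightarrow> j < M \<Longrightarrow> ip A (a i) (a j) = ip B (b i) (b j)"
  shows "\<exists>L. (\<forall>j<M. \<forall>y\<in>B. (\<Sum>x\<in>A. L y x * a j x) = b j y) \<and>
    (\<forall>v. (\<Sum>y\<in>B. (cmod (\<Sum>x\<in>A. L y x * v x))\<^sup>2) \<le> (\<Sum>x\<in>A. (cmod (v x))\<^sup>2))"
proof -
  have gs: "\<exists>K e e'. orthonormal_on A K e \<and> orthonormal_on B K e' \<and>
    (\<forall>k<K. \<forall>j<M. ip A (e k) (a j) = ip B (e' k) (b j)) \<and>
    (\<forall>j<M. \<forall>x\<in>A. a j x = (\<Sum>k<K. ip A (e k) (a j) * e k x)) \<and>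
    (\<forall>j<M. \<forall>y\<in>B. b j y = (\<Sum>k<K. ip A (e k) (a j) * e' k y))"
    by (rule parallel_gram_schmidt[OF A B _ order_refl]) (rule gram)
  obtain K e e' where oA: "orthonormal_on A K e" and oB: "orthonormal_on B K e'"
    and sB: "\<forall>j<M. \<forall>y\<in>B. b j y = (\<Sum>k<K. ip A (e k) (a j) * e' k y)"
    using gs by (elim exE conjE) (rule that)
  define L where "L y x = (\<Sum>k<K. e' k y * cnj (e k x))" for y x
  have L: "(\<Sum>x\<in>A. L y x * v x) = (\<Sum>k<K. ip A (e k) v * e' k y)" for v y
  proof -
    have "(\<Sum>x\<in>A. L y x * v x) = (\<Sum>x\<in>A. \<Sum>k<K. e' k y * (cnj (e k x) * v x))"
      by (simp add: L_def sum_distrib_right mult.assoc)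
    also have "\<dots> = (\<Sum>k<K. \<Sum>x\<in>A. e' k y * (cnj (e k x) * v x))" by (rule sum.swap)
    finally show ?thesis by (simp add: ip_def sum_distrib_left mult_ac)
  qed
  have "(\<Sum>y\<in>B. (cmod (\<Sum>x\<in>A. L y x * v x))\<^sup>2) = (\<Sum>k<K. (cmod (ip A (e k) v))\<^sup>2)" for v
    using orthonormal_sum_norm[OF oB, of "\<lambda>k. ip A (e k) v"] unfolding L ip_self of_real_eq_iff .
  thus ?thesis using sB L bessel[OF oA] by (intro exI[of _ L]) auto
qed

text \<open>Tychonoff's theorem for bounded coordinates. It is used twice: for the best
  approximation in \<open>model_exists\<close> and for the cluster point of the Taylor
  coefficients.\<close>

lemma compact_bounded_functions: "compact {G :: 'i \<Rightarrow> complex. \<forall>p. cmod (G p) \<le> B p}"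
proof -
  have "compactin (product_topology (\<lambda>_. euclidean) UNIV) (PiE UNIV (\<lambda>p::'i. cball (0::complex) (B p)))"
    unfolding compactin_PiE by (simp add: compactin_euclidean_iff)
  moreover have "PiE UNIV (\<lambda>p::'i. cball (0::complex) (B p)) = {G. \<forall>p. cmod (G p) \<le> B p}"
    by (auto simp: PiE_def)
  ultimately show ?thesis by (simp add: euclidean_product_topology compactin_euclidean_iff)
qed

lemma psd_on_add_scaled:
  assumes "psd_on X G" "psd_on X H" "t \<ge> 0"
  shows "psd_on X (\<lambda>x y. G x y + of_real t * H x y)"
proof -
  have form: "herm_form X (\<lambda>x y. G x y + of_real t * H x y) v = herm_form X G v + t * herm_form X H v" for v
  proof -
    have "(\<Sum>x\<in>X. \<Sum>y\<in>X. cnj (v x) * (G x y + of_real t * H x y) * v y) =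
      (\<Sum>x\<in>X. \<Sum>y\<in>X. cnj (v x) * G x y * v y) + of_real t * (\<Sum>x\<in>X. \<Sum>y\<in>X. cnj (v x) * H x y * v y)"
      by (simp add: algebra_simps sum.distrib sum_distrib_left)
    thus ?thesis unfolding herm_form_def by simp
  qed
  show ?thesis unfolding psd_on_def form
  proof (intro conjI ballI allI)
    fix x y assume "x \<in> X" "y \<in> X"
    hence "G x y = cnj (G y x)" "H x y = cnj (H y x)" using assms unfolding psd_on_def by blast+
    thus "G x y + of_real t * H x y = cnj (G y x + of_real t * H y x)" by simp
  next
    fix v
    have "0 \<le> herm_form X G v" "0 \<le> herm_form X H v" using assms unfolding psd_on_def by blast+
    thus "0 \<le> herm_form X G v + t * herm_form X H v" using assms(3) by simp
  qed
qed

lemma psd_on_scaled: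
  assumes "psd_on X G" "t \<ge> 0"
  shows "psd_on X (\<lambda>x y. of_real t * G x y)"
proof -
  have "psd_on X (\<lambda>x y. 0)" by (simp add: psd_on_def herm_form_def)
  from psd_on_add_scaled[OF this assms] show ?thesis by simp
qed

lemma psd_on_rank_one: "psd_on X (\<lambda>x y. cnj (u x) * u y)"
  unfolding psd_on_def
proof (intro conjI ballI allI)
  fix v
  have "(\<Sum>x\<in>X. \<Sum>y\<in>X. cnj (v x) * (cnj (u x) * u y) * v y) = cnj (\<Sum>y\<in>X. u y * v y) * (\<Sum>y\<in>X. u y * v y)"
    unfolding cnj_sum sum_product complex_cnj_mult by (simp add: mult_ac)
  hence "herm_form X (\<lambda>x y. cnj (u x) * u y) v = (cmod (\<Sum>y\<in>X. u y * v y))\<^sup>2"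
    unfolding herm_form_def cnj_mult_cmod by (simp flip: of_real_power)
  thus "0 \<le> herm_form X (\<lambda>x y. cnj (u x) * u y) v" by simp
qed (simp add: mult.commute)

lemma cmod_add_scaled_square:
  "(cmod (a + of_real t * b))\<^sup>2 = (cmod a)\<^sup>2 + 2 * t * Re (cnj a * b) + t\<^sup>2 * (cmod b)\<^sup>2"
  unfolding cmod_power2 by (simp add: power2_eq_square algebra_simps)

text \<open>The first-order condition at a minimum: divide by 2 t and let t tend to 0.\<close>

lemma quadratic_nonneg_imp_linear_nonneg:
  fixes A B t0 :: real
  assumes "t0 > 0" "\<And>t. 0 < t \<Longrightarrow> t < t0 \<Longrightarrow> 0 \<le> 2 * t * A + t\<^sup>2 * B"
  shows "A \<ge> 0"
proof (rule tendsto_lowerbound)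
  show "((\<lambda>t. A + t * B / 2) \<longlongrightarrow> A) (at_right 0)"
  proof -
    have "((\<lambda>t. A + t * B / 2) \<longlongrightarrow> A + 0 * B / 2) (at_right 0)" by (intro tendsto_intros) auto
    thus ?thesis by simp
  qed
  show "eventually (\<lambda>t. 0 \<le> A + t * B / 2) (at_right 0)"
    using eventually_at_right_real[OF assms(1)]
  proof eventually_elim
    case (elim t)
    have "0 \<le> t * (2 * A + t * B)" using assms(2)[of t] elim by (simp add: power2_eq_square algebra_simps)
    thus ?case using elim by (simp add: zero_le_mult_iff)
  qed
qed auto

lemma norm_sum_cnj_mult_le:
  fixes u w :: "nat \<Rightarrow> complex"
  shows "cmod (\<Sum>k<K. cnj (u k) * w k) \<le> ((\<Sum>k<K. (cmod (u k))\<^sup>2) + (\<Sum>k<K. (cmod (w k))\<^sup>2)) / 2"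
proof -
  have "cmod (cnj (u k) * w k) \<le> ((cmod (u k))\<^sup>2 + (cmod (w k))\<^sup>2) / 2" for k
    using sum_squares_bound[of "cmod (u k)" "cmod (w k)"] by (simp add: norm_mult)
  hence "cmod (\<Sum>k<K. cnj (u k) * w k) \<le> (\<Sum>k<K. ((cmod (u k))\<^sup>2 + (cmod (w k))\<^sup>2) / 2)"
    by (intro sum_norm_le) auto
  thus ?thesis by (simp add: sum.distrib sum_divide_distrib[symmetric])
qed

section \<open>The cone of models on a finite set\<close>

context
  fixes P :: "nat \<Rightarrow> nat \<Rightarrow> nat \<Rightarrow> complex" and I J :: nat
begin

text \<open>\<open>P i a b\<close> stands for the entry (a, b) of p at the i-th point. The value
  pairs the J by J block of G at (i, j) with the identity minus p(i)* p(j); the map is linear in G,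
  so the positive G are mapped onto a convex cone.\<close>

definition model_map :: "((nat \<times> nat) \<times> (nat \<times> nat) \<Rightarrow> complex) \<Rightarrow> nat \<Rightarrow> nat \<Rightarrow> complex" where
  "model_map G i j = (\<Sum>b<J. G ((i, b), (j, b))) -
     (\<Sum>a<I. \<Sum>b<J. \<Sum>b'<J. cnj (P i a b) * P j a b' * G ((i, b), (j, b')))"

text \<open>With a factorization of G the kernel becomes a difference of two Gram matrices, the form
  from which a lurking isometry is read off.\<close>

lemma model_map_gram:
  assumes "\<And>b b'. b < J \<Longrightarrow> b' < J \<Longrightarrow> G ((i, b), (j, b')) = (\<Sum>k<K. cnj (u i b k) * u j b' k)"
  shows "model_map G i j = (\<Sum>k<K. (\<Sum>b<J. cnj (u i b k) * u j b k) -
    (\<Sum>a<I. cnj (\<Sum>b<J. P i a b * u i b k) * (\<Sum>b<J. P j a b * u j b k)))"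
proof -
  have 1: "(\<Sum>b<J. G ((i, b), (j, b))) = (\<Sum>k<K. \<Sum>b<J. cnj (u i b k) * u j b k)"
    by (subst sum.swap) (simp add: assms)
  have "(\<Sum>b<J. \<Sum>b'<J. cnj (P i a b) * P j a b' * G ((i, b), (j, b'))) =
     (\<Sum>k<K. cnj (\<Sum>b<J. P i a b * u i b k) * (\<Sum>b<J. P j a b * u j b k))" for a
  proof -
    have "(\<Sum>k<K. cnj (\<Sum>b<J. P i a b * u i b k) * (\<Sum>b<J. P j a b * u j b k)) =
      (\<Sum>k<K. \<Sum>b<J. \<Sum>b'<J. cnj (P i a b) * P j a b' * (cnj (u i b k) * u j b' k))"
      unfolding cnj_sum sum_product complex_cnj_mult by (simp add: mult_ac)
    also have "\<dots> = (\<Sum>b<J. \<Sum>k<K. \<Sum>b'<J. cnj (P i a b) * P j a b' * (cnj (u i b k) * u j b' k))"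
      by (rule sum.swap)
    also have "\<dots> = (\<Sum>b<J. \<Sum>b'<J. \<Sum>k<K. cnj (P i a b) * P j a b' * (cnj (u i b k) * u j b' k))"
      by (intro sum.cong refl sum.swap)
    also have "\<dots> = (\<Sum>b<J. \<Sum>b'<J. cnj (P i a b) * P j a b' * G ((i, b), (j, b')))"
      by (intro sum.cong refl) (simp add: assms sum_distrib_left)
    finally show ?thesis ..
  qed
  hence 2: "(\<Sum>a<I. \<Sum>b<J. \<Sum>b'<J. cnj (P i a b) * P j a b' * G ((i, b), (j, b'))) =
     (\<Sum>k<K. \<Sum>a<I. cnj (\<Sum>b<J. P i a b * u i b k) * (\<Sum>b<J. P j a b * u j b k))"
    by (subst sum.swap) simp
  show ?thesis unfolding model_map_def 1 2 by (simp add: sum_subtractf)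
qed

lemma model_map_add_scaled:
  "model_map (\<lambda>p. G p + of_real t * H p) i j = model_map G i j + of_real t * model_map H i j"
  by (simp add: model_map_def algebra_simps sum.distrib sum_distrib_left)

lemma model_map_cong:
  assumes "\<And>b b'. b < J \<Longrightarrow> b' < J \<Longrightarrow> G ((i, b), (j, b')) = H ((i, b), (j, b'))"
  shows "model_map G i j = model_map H i j"
  unfolding model_map_def by (intro arg_cong2[where f = "(-)"] sum.cong refl) (auto simp: assms)

text \<open>Otherwise the residual \<open>L\<close> of a best approximation of \<open>M\<close> by the cone of kernels
  \<open>model_map G\<close>, with \<open>G\<close> positive, separates \<open>M\<close> from the cone. Its conjugate,
  made definite by a multiple of the identity, is an inner product in which the multiplication operators by \<open>P\<close>
  form a strict contraction.\<close>

lemma model_exists: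
  fixes M :: "nat \<Rightarrow> nat \<Rightarrow> complex" and N :: nat
  assumes J: "J \<ge> 1" and R: "0 \<le> R" "R < 1"
    and contr: "\<And>i w. i < N \<Longrightarrow> (\<Sum>a<I. (cmod (\<Sum>b<J. P i a b * w b))\<^sup>2) \<le> R * (\<Sum>b<J. (cmod (w b))\<^sup>2)"
    and Mherm: "\<And>i j. M i j = cnj (M j i)"
    and H: "\<And>Q \<epsilon> \<delta>. psd_on {..<N} Q \<Longrightarrow> \<epsilon> > 0 \<Longrightarrow> (\<And>v. \<epsilon> * (\<Sum>i<N. (cmod (v i))\<^sup>2) \<le> herm_form {..<N} Q v) \<Longrightarrow>
      0 < \<delta> \<Longrightarrow> \<delta> \<le> 1 \<Longrightarrow>
      (\<And>u. (\<Sum>a<I. herm_form {..<N} Q (\<lambda>i. \<Sum>b<J. P i a b * u i b)) \<le> (1 - \<delta>) * (\<Sum>b<J. herm_form {..<N} Q (\<lambda>i. u i b))) \<Longrightarrow>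
      0 \<le> Re (\<Sum>i<N. \<Sum>j<N. Q i j * M i j)"
  shows "\<exists>u. \<forall>i<N. \<forall>j<N. M i j = (\<Sum>k<N * J. (\<Sum>b<J. cnj (u i b k) * u j b k) -
    (\<Sum>a<I. cnj (\<Sum>b<J. P i a b * u i b k) * (\<Sum>b<J. P j a b * u j b k)))"
proof -
  let ?X = "{..<N} \<times> {..<J}"
  define psd where "psd G \<longleftrightarrow> psd_on ?X (\<lambda>x y. G (x, y))" for G :: "(nat \<times> nat) \<times> (nat \<times> nat) \<Rightarrow> complex"
  define \<phi> where "\<phi> G = (\<Sum>i<N. \<Sum>j<N. (cmod (model_map G i j - M i j))\<^sup>2)" for G
  have fact: "\<exists>u. \<forall>i<N. \<forall>j<N. \<forall>b<J. \<forall>b'<J. G ((i, b), (j, b')) = (\<Sum>k<N * J. cnj (u i b k) * u j b' k)"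
    if psdG: "psd G" for G
  proof -
    obtain u where "\<forall>x\<in>?X. \<forall>y\<in>?X. G (x, y) = (\<Sum>k<card ?X. cnj (u x k) * u y k)"
      using psd_factorization[of ?X "\<lambda>x y. G (x, y)"] psdG unfolding psd_def by auto
    thus ?thesis by (intro exI[of _ "\<lambda>i b k. u (i, b) k"]) (auto simp: card_cartesian_product)
  qed
  \<comment> \<open>\<open>m0\<close> is the value of \<open>\<phi>\<close> at the zero kernel, so a
    minimizer may be sought where \<open>\<phi>\<close> is at most \<open>m0\<close>. There the
    diagonal of \<open>model_map G\<close> is at most \<open>m1\<close>, and since p contracts by R
    < 1 this bounds the entries of G by \<open>m1 / (1 - R)\<close>. This is the source of
    compactness.\<close>
  define m0 where "m0 = (\<Sum>i<N. \<Sum>j<N. (cmod (M i j))\<^sup>2)"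
  define m1 where "m1 = (\<Sum>i<N. cmod (M i i)) + sqrt m0"
  define B where "B = m1 / (1 - R)"
  have m0: "m0 \<ge> 0" unfolding m0_def by (intro sum_nonneg) auto
  have m1: "m1 \<ge> 0" unfolding m1_def using m0 by (intro add_nonneg_nonneg sum_nonneg) auto
  have B: "B \<ge> 0" unfolding B_def using m1 R by simp
  have bound: "cmod (G ((i, b), (j, b'))) \<le> B"
    if psdG: "psd G" and \<phi>G: "\<phi> G \<le> m0" and lt: "i < N" "j < N" "b < J" "b' < J" for G i j b b'
  proof -
    obtain u where u: "\<forall>i<N. \<forall>j<N. \<forall>b<J. \<forall>b'<J. G ((i, b), (j, b')) = (\<Sum>k<N * J. cnj (u i b k) * u j b' k)"
      using fact[OF psdG] by blast
    have diag: "(\<Sum>k<N * J. (cmod (u i b k))\<^sup>2) \<le> B" if ib: "i < N" "b < J" for i b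
    proof -
      let ?w = "\<lambda>k a. \<Sum>b<J. P i a b * u i b k"
      have "model_map G i i = (\<Sum>k<N * J. (\<Sum>b<J. cnj (u i b k) * u i b k) - (\<Sum>a<I. cnj (?w k a) * ?w k a))"
        by (rule model_map_gram) (use u ib in auto)
      also have "\<dots> = of_real (\<Sum>k<N * J. (\<Sum>b<J. (cmod (u i b k))\<^sup>2) - (\<Sum>a<I. (cmod (?w k a))\<^sup>2))"
        unfolding cnj_mult_cmod by simp
      finally have mm: "model_map G i i = of_real (\<Sum>k<N * J. (\<Sum>b<J. (cmod (u i b k))\<^sup>2) - (\<Sum>a<I. (cmod (?w k a))\<^sup>2))" .
      have "(1 - R) * (\<Sum>k<N * J. \<Sum>b<J. (cmod (u i b k))\<^sup>2) = (\<Sum>k<N * J. (\<Sum>b<J. (cmod (u i b k))\<^sup>2) - R * (\<Sum>b<J. (cmod (u i b k))\<^sup>2))"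
        by (simp add: sum_subtractf sum_distrib_left[symmetric] left_diff_distrib)
      also have "\<dots> \<le> (\<Sum>k<N * J. (\<Sum>b<J. (cmod (u i b k))\<^sup>2) - (\<Sum>a<I. (cmod (?w k a))\<^sup>2))"
        by (intro sum_mono diff_mono order_refl contr ib)
      also have "\<dots> \<le> cmod (model_map G i i)" unfolding mm norm_of_real by (rule abs_ge_self)
      also have "\<dots> \<le> cmod (M i i) + cmod (model_map G i i - M i i)"
        using norm_triangle_ineq[of "M i i" "model_map G i i - M i i"] by simp
      also have "cmod (model_map G i i - M i i) \<le> sqrt m0"
      proof (rule real_le_rsqrt)
        have "(cmod (model_map G i i - M i i))\<^sup>2 \<le> (\<Sum>j<N. (cmod (model_map G i j - M i j))\<^sup>2)"
          using ib by (intro member_le_sum[where f = "\<lambda>j. (cmod (model_map G i j - M i j))\<^sup>2"]) auto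
        also have "\<dots> \<le> \<phi> G" unfolding \<phi>_def
          using ib by (intro member_le_sum[where f = "\<lambda>i. \<Sum>j<N. (cmod (model_map G i j - M i j))\<^sup>2"]) (auto intro!: sum_nonneg)
        finally show "(cmod (model_map G i i - M i i))\<^sup>2 \<le> m0" using \<phi>G by simp
      qed
      also have "cmod (M i i) \<le> (\<Sum>i<N. cmod (M i i))"
        using ib by (intro member_le_sum) auto
      finally have "(1 - R) * (\<Sum>k<N * J. \<Sum>b<J. (cmod (u i b k))\<^sup>2) \<le> m1" by (simp add: m1_def)
      hence "(\<Sum>k<N * J. \<Sum>b<J. (cmod (u i b k))\<^sup>2) \<le> B"
        unfolding B_def using R by (simp add: field_simps)
      moreover have "(\<Sum>k<N * J. (cmod (u i b k))\<^sup>2) \<le> (\<Sum>k<N * J. \<Sum>b<J. (cmod (u i b k))\<^sup>2)"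
      proof (rule sum_mono)
        fix k
        show "(cmod (u i b k))\<^sup>2 \<le> (\<Sum>b<J. (cmod (u i b k))\<^sup>2)"
          using ib by (intro member_le_sum[where f = "\<lambda>b. (cmod (u i b k))\<^sup>2"]) auto
      qed
      ultimately show ?thesis by linarith
    qed
    have "cmod (G ((i, b), (j, b'))) \<le> ((\<Sum>k<N * J. (cmod (u i b k))\<^sup>2) + (\<Sum>k<N * J. (cmod (u j b' k))\<^sup>2)) / 2"
      using u lt norm_sum_cnj_mult_le[where K = "N * J" and u = "u i b" and w = "u j b'"] by simp
    also have "\<dots> \<le> B" using diag[OF lt(1,3)] diag[OF lt(2,4)] by simp
    finally show ?thesis .
  qed
  define C where "C = {G :: (nat \<times> nat) \<times> (nat \<times> nat) \<Rightarrow> complex. \<forall>p. cmod (G p) \<le> B} \<inter> {G. psd G}"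
  have coord: "continuous_on UNIV (\<lambda>G :: (nat \<times> nat) \<times> (nat \<times> nat) \<Rightarrow> complex. G p)" for p
    by (rule continuous_on_product_coordinates)
  have "closed {G. psd G}"
  proof -
    have "{G. psd G} = (\<Inter>x\<in>?X. \<Inter>y\<in>?X. {G. G (x, y) = cnj (G (y, x))}) \<inter> (\<Inter>v. {G. 0 \<le> herm_form ?X (\<lambda>x y. G (x, y)) v})"
      unfolding psd_def psd_on_def by blast
    moreover have "closed {G :: (nat \<times> nat) \<times> (nat \<times> nat) \<Rightarrow> complex. G (x, y) = cnj (G (y, x))}" for x y
      by (intro closed_Collect_eq continuous_intros coord)
    moreover have "closed {G :: (nat \<times> nat) \<times> (nat \<times> nat) \<Rightarrow> complex. 0 \<le> herm_form ?X (\<lambda>x y. G (x, y)) v}" for v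
      unfolding herm_form_def by (intro closed_Collect_le continuous_intros coord)
    ultimately show ?thesis by (auto intro!: closed_Int closed_INT)
  qed
  hence compact: "compact C" unfolding C_def by (intro compact_Int_closed compact_bounded_functions)
  have zero: "(\<lambda>_. 0) \<in> C" using B by (simp add: C_def psd_def psd_on_def herm_form_def)
  have "continuous_on UNIV \<phi>"
    unfolding \<phi>_def[abs_def] model_map_def by (intro continuous_intros coord)
  hence "continuous_on C \<phi>" by (rule continuous_on_subset) auto
  then obtain G0 where G0: "G0 \<in> C" "\<And>G. G \<in> C \<Longrightarrow> \<phi> G0 \<le> \<phi> G"
    using continuous_attains_inf[OF compact] zero by blast
  have psd0: "psd G0" using G0 by (simp add: C_def)
  have \<phi>_zero: "\<phi> (\<lambda>_. 0) = m0" by (simp add: \<phi>_def m0_def model_map_def)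
  have global: "\<phi> G0 \<le> \<phi> G" if "psd G" for G
  proof (cases "\<phi> G \<le> m0")
    case False
    thus ?thesis using G0(2)[OF zero] \<phi>_zero by simp
  next
    case True
    \<comment> \<open>C bounds the entries of a kernel at all indices, also outside
      \<open>?X\<close>; there they are set to 0, which changes neither positivity nor
      \<open>\<phi>\<close>.\<close>
    define G' where "G' p = (if fst p \<in> ?X \<and> snd p \<in> ?X then G p else 0)" for p
    have GX: "G' (x, y) = G (x, y)" if "x \<in> ?X" "y \<in> ?X" for x y using that by (simp add: G'_def)
    have form: "herm_form ?X (\<lambda>x y. G' (x, y)) v = herm_form ?X (\<lambda>x y. G (x, y)) v" for v
      unfolding herm_form_def by (intro arg_cong[where f = Re] sum.cong refl) (simp only: GX)
    have "psd G'" unfolding psd_def psd_on_def form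
    proof (intro conjI ballI allI)
      show "0 \<le> herm_form ?X (\<lambda>x y. G (x, y)) v" for v using that unfolding psd_def psd_on_def by blast
      fix x y assume xy: "x \<in> ?X" "y \<in> ?X"
      have "G (x, y) = cnj (G (y, x))" using that xy unfolding psd_def psd_on_def by blast
      thus "G' (x, y) = cnj (G' (y, x))" by (simp only: GX[OF xy] GX[OF xy(2,1)])
    qed
    moreover have "cmod (G' p) \<le> B" for p
    proof -
      obtain i b j b' where p: "p = ((i, b), (j, b'))" by (metis surj_pair)
      show ?thesis using bound[OF that True, of i j b b'] B unfolding p G'_def by auto
    qed
    ultimately have "G' \<in> C" by (simp add: C_def)
    moreover have "\<phi> G' = \<phi> G"
    proof -
      have "model_map G' i j = model_map G i j" if "i < N" "j < N" for i j
        by (rule model_map_cong) (use that GX in auto)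
      thus ?thesis unfolding \<phi>_def by (intro sum.cong refl) auto
    qed
    ultimately show ?thesis using G0(2)[of G'] by simp
  qed
  define L where "L i j = model_map G0 i j - M i j" for i j
  define inn where "inn H = Re (\<Sum>i<N. \<Sum>j<N. cnj (L i j) * H i j)" for H :: "nat \<Rightarrow> nat \<Rightarrow> complex"
  have expand: "\<phi> (\<lambda>p. G0 p + of_real t * G p) = \<phi> G0 + 2 * t * inn (model_map G) + t\<^sup>2 * (\<Sum>i<N. \<Sum>j<N. (cmod (model_map G i j))\<^sup>2)" for t G
  proof -
    have "\<phi> (\<lambda>p. G0 p + of_real t * G p) = (\<Sum>i<N. \<Sum>j<N. (cmod (L i j + of_real t * model_map G i j))\<^sup>2)"
      unfolding \<phi>_def model_map_add_scaled L_def by (simp add: algebra_simps)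
    also have "\<dots> = (\<Sum>i<N. \<Sum>j<N. (cmod (L i j))\<^sup>2) + 2 * t * inn (model_map G) + t\<^sup>2 * (\<Sum>i<N. \<Sum>j<N. (cmod (model_map G i j))\<^sup>2)"
      unfolding cmod_add_scaled_square inn_def Re_sum by (simp only: sum.distrib sum_distrib_left)
    finally show ?thesis by (simp add: \<phi>_def L_def)
  qed
  \<comment> \<open>Adding a positive multiple of G to the minimizer stays in the cone, so the
    derivative of \<open>\<phi>\<close> in that direction is nonnegative.\<close>
  have inn_nonneg: "inn (model_map G) \<ge> 0" if "psd G" for G
  proof (rule quadratic_nonneg_imp_linear_nonneg[of 1])
    fix t :: real assume "0 < t"
    hence "psd (\<lambda>p. G0 p + of_real t * G p)"
      using psd_on_add_scaled[of ?X "\<lambda>x y. G0 (x, y)" "\<lambda>x y. G (x, y)" t] psd0 that by (simp add: psd_def)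
    from global[OF this] show "0 \<le> 2 * t * inn (model_map G) + t\<^sup>2 * (\<Sum>i<N. \<Sum>j<N. (cmod (model_map G i j))\<^sup>2)"
      unfolding expand by simp
  qed simp
  \<comment> \<open>Shrinking \<open>G0\<close> towards 0 stays in the cone too, which bounds the
    derivative along \<open>G0\<close> from the other side.\<close>
  have inn_zero: "inn (model_map G0) \<le> 0"
  proof -
    have "- inn (model_map G0) \<ge> 0"
    proof (rule quadratic_nonneg_imp_linear_nonneg[of 1])
      fix t :: real assume t: "0 < t" "t < 1"
      have "psd (\<lambda>p. of_real (1 - t) * G0 p)"
        using psd_on_scaled[of ?X "\<lambda>x y. G0 (x, y)" "1 - t"] psd0 t by (simp add: psd_def)
      also have "(\<lambda>p. of_real (1 - t) * G0 p) = (\<lambda>p. G0 p + of_real (- t) * G0 p)"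
        by (simp add: algebra_simps)
      finally have "\<phi> G0 \<le> \<phi> (\<lambda>p. G0 p + of_real (- t) * G0 p)" by (rule global)
      thus "0 \<le> 2 * t * (- inn (model_map G0)) + t\<^sup>2 * (\<Sum>i<N. \<Sum>j<N. (cmod (model_map G0 i j))\<^sup>2)"
        unfolding expand by simp
    qed simp
    thus ?thesis by simp
  qed
  have inn_M: "inn M = inn (model_map G0) - \<phi> G0"
  proof -
    have "inn (model_map G0) - inn M = Re (\<Sum>i<N. \<Sum>j<N. cnj (L i j) * L i j)"
      unfolding inn_def L_def by (simp add: right_diff_distrib sum_subtractf)
    also have "\<dots> = \<phi> G0" unfolding \<phi>_def L_def[symmetric] cnj_mult_cmod by (simp flip: of_real_power)
    finally show ?thesis by simp
  qed
  obtain u0 where u0: "\<forall>i<N. \<forall>j<N. \<forall>b<J. \<forall>b'<J. G0 ((i, b), (j, b')) = (\<Sum>k<N * J. cnj (u0 i b k) * u0 j b' k)"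
    using fact[OF psd0] by blast
  have mm0: "model_map G0 i j = (\<Sum>k<N * J. (\<Sum>b<J. cnj (u0 i b k) * u0 j b k) -
    (\<Sum>a<I. cnj (\<Sum>b<J. P i a b * u0 i b k) * (\<Sum>b<J. P j a b * u0 j b k)))" if "i < N" "j < N" for i j
    by (rule model_map_gram) (use u0 that in auto)
  have Lherm: "L i j = cnj (L j i)" if "i < N" "j < N" for i j
  proof -
    have "model_map G0 i j = cnj (model_map G0 j i)" unfolding mm0[OF that] mm0[OF that(2,1)] by (simp add: mult.commute)
    moreover have "M i j = cnj (M j i)" by (rule Mherm)
    ultimately show ?thesis by (simp add: L_def)
  qed
  define q where "q = herm_form {..<N} (\<lambda>i j. cnj (L i j))"
  \<comment> \<open>Tested on rank-one kernels, the separation says that p is contractive for the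
    form q.\<close>
  have rank: "0 \<le> (\<Sum>b<J. q (\<lambda>i. u i b)) - (\<Sum>a<I. q (\<lambda>i. \<Sum>b<J. P i a b * u i b))" for u
  proof -
    define G where "G = (\<lambda>((i, b), (j, b')). cnj (u i b) * u j b')"
    have "psd G" using psd_on_rank_one[of ?X "\<lambda>(i, b). u i b"] unfolding psd_def G_def by (simp add: case_prod_beta)
    hence "0 \<le> inn (model_map G)" by (rule inn_nonneg)
    also have "model_map G i j = (\<Sum>b<J. cnj (u i b) * u j b) - (\<Sum>a<I. cnj (\<Sum>b<J. P i a b * u i b) * (\<Sum>b<J. P j a b * u j b))" for i j
      using model_map_gram[where G = G and i = i and j = j and K = "Suc 0" and u = "\<lambda>i b k. u i b"]
      by (simp add: G_def lessThan_Suc)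
    hence "inn (model_map G) = Re ((\<Sum>i<N. \<Sum>j<N. \<Sum>b<J. cnj (u i b) * cnj (L i j) * u j b) -
       (\<Sum>i<N. \<Sum>j<N. \<Sum>a<I. cnj (\<Sum>b<J. P i a b * u i b) * cnj (L i j) * (\<Sum>b<J. P j a b * u j b)))"
      unfolding inn_def by (simp add: right_diff_distrib sum_subtractf sum_distrib_left mult_ac)
    also have "(\<Sum>i<N. \<Sum>j<N. \<Sum>b<J. cnj (u i b) * cnj (L i j) * u j b) = (\<Sum>b<J. \<Sum>i<N. \<Sum>j<N. cnj (u i b) * cnj (L i j) * u j b)"
      by (subst (2) sum.swap, subst sum.swap) (intro sum.cong refl sum.swap)
    also have "(\<Sum>i<N. \<Sum>j<N. \<Sum>a<I. cnj (\<Sum>b<J. P i a b * u i b) * cnj (L i j) * (\<Sum>b<J. P j a b * u j b)) =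
       (\<Sum>a<I. \<Sum>i<N. \<Sum>j<N. cnj (\<Sum>b<J. P i a b * u i b) * cnj (L i j) * (\<Sum>b<J. P j a b * u j b))"
      by (subst (2) sum.swap, subst sum.swap) (intro sum.cong refl sum.swap)
    finally show ?thesis by (simp add: q_def herm_form_def)
  qed
  define K where "K = (\<Sum>i<N. \<Sum>j<N. cmod (L i j))"
  have K: "K \<ge> 0" unfolding K_def by (intro sum_nonneg) auto
  have qbound: "\<bar>q v\<bar> \<le> K * (\<Sum>i<N. (cmod (v i))\<^sup>2)" for v
  proof -
    have le: "cmod (cnj (v i) * cnj (L i j) * v j) \<le> cmod (L i j) * (\<Sum>i<N. (cmod (v i))\<^sup>2)" if "i < N" "j < N" for i j
    proof -
      have "cmod (v i) * cmod (v j) \<le> ((cmod (v i))\<^sup>2 + (cmod (v j))\<^sup>2) / 2"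
        using sum_squares_bound[of "cmod (v i)" "cmod (v j)"] by simp
      also have "\<dots> \<le> ((\<Sum>i<N. (cmod (v i))\<^sup>2) + (\<Sum>i<N. (cmod (v i))\<^sup>2)) / 2"
        using that by (intro divide_right_mono add_mono member_le_sum[where f = "\<lambda>i. (cmod (v i))\<^sup>2"]) auto
      finally have "cmod (L i j) * (cmod (v i) * cmod (v j)) \<le> cmod (L i j) * (\<Sum>i<N. (cmod (v i))\<^sup>2)"
        by (intro mult_left_mono) auto
      thus ?thesis by (simp add: norm_mult mult_ac)
    qed
    have "\<bar>q v\<bar> \<le> cmod (\<Sum>i<N. \<Sum>j<N. cnj (v i) * cnj (L i j) * v j)"
      unfolding q_def herm_form_def by (rule abs_Re_le_cmod)
    also have "\<dots> \<le> (\<Sum>i<N. \<Sum>j<N. cmod (L i j) * (\<Sum>i<N. (cmod (v i))\<^sup>2))"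
      by (intro sum_norm_le) (use le in auto)
    finally show ?thesis by (simp add: K_def sum_distrib_right)
  qed
  \<comment> \<open>Positivity of q is not given but follows from contractivity. With u equal to v
    in column 0 and 0 elsewhere, q v is at least the sum of q over the vectors P i a 0 * v i, whose
    total squared norm is smaller by the factor R. Iterating m times leaves an error of order
    \<open>R ^ m\<close>. Column 0 exists because J is positive.\<close>
  have qlow: "q v \<ge> - K * R ^ m * (\<Sum>i<N. (cmod (v i))\<^sup>2)" for m v
  proof (induction m arbitrary: v)
    case 0
    thus ?case using qbound[of v] by (simp add: abs_le_iff)
  next
    case (Suc m)
    define u where "u i b = (if b = 0 then v i else 0)" for i b :: nat
    have uP: "(\<Sum>b<J. P i a b * u i b) = P i a 0 * v i" for i a
    proof -
      have "(\<Sum>b<J. P i a b * u i b) = (\<Sum>b<J. if b = 0 then P i a 0 * v i else 0)"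
        by (intro sum.cong) (auto simp: u_def)
      thus ?thesis using J by simp
    qed
    have un: "(\<Sum>b<J. (cmod (u i b))\<^sup>2) = (cmod (v i))\<^sup>2" for i
    proof -
      have "(\<Sum>b<J. (cmod (u i b))\<^sup>2) = (\<Sum>b<J. if b = 0 then (cmod (v i))\<^sup>2 else 0)"
        by (intro sum.cong) (auto simp: u_def)
      thus ?thesis using J by simp
    qed
    have qz: "q (\<lambda>i. 0) = 0" by (simp add: q_def herm_form_def)
    have "(\<Sum>b<J. q (\<lambda>i. u i b)) = (\<Sum>b<J. if b = 0 then q v else 0)"
      by (intro sum.cong) (auto simp: u_def qz)
    hence "(\<Sum>b<J. q (\<lambda>i. u i b)) = q v" using J by simp
    with rank[of u] have "(\<Sum>a<I. q (\<lambda>i. P i a 0 * v i)) \<le> q v" by (simp add: uP)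
    moreover have "(\<Sum>a<I. - K * R ^ m * (\<Sum>i<N. (cmod (P i a 0 * v i))\<^sup>2)) \<le> (\<Sum>a<I. q (\<lambda>i. P i a 0 * v i))"
      by (intro sum_mono Suc.IH)
    moreover have "(\<Sum>a<I. \<Sum>i<N. (cmod (P i a 0 * v i))\<^sup>2) \<le> R * (\<Sum>i<N. (cmod (v i))\<^sup>2)"
    proof -
      have "(\<Sum>a<I. \<Sum>i<N. (cmod (P i a 0 * v i))\<^sup>2) = (\<Sum>i<N. \<Sum>a<I. (cmod (\<Sum>b<J. P i a b * u i b))\<^sup>2)"
        unfolding uP by (rule sum.swap)
      also have "\<dots> \<le> (\<Sum>i<N. R * (\<Sum>b<J. (cmod (u i b))\<^sup>2))"
        by (intro sum_mono contr) auto
      also have "\<dots> = (\<Sum>i<N. R * (cmod (v i))\<^sup>2)" by (simp only: un)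
      finally show ?thesis by (simp add: sum_distrib_left)
    qed
    hence "- (K * R ^ m) * (R * (\<Sum>i<N. (cmod (v i))\<^sup>2)) \<le> - (K * R ^ m) * (\<Sum>a<I. \<Sum>i<N. (cmod (P i a 0 * v i))\<^sup>2)"
      using K R by (intro mult_left_mono_neg) auto
    ultimately show ?case by (simp add: sum_distrib_left sum_negf mult_ac)
  qed
  have qnn: "q v \<ge> 0" for v
  proof (rule tendsto_upperbound)
    have "(\<lambda>m. - K * R ^ m * (\<Sum>i<N. (cmod (v i))\<^sup>2)) \<longlonglongrightarrow> - K * 0 * (\<Sum>i<N. (cmod (v i))\<^sup>2)"
      using R by (intro tendsto_intros LIMSEQ_realpow_zero) auto
    thus "(\<lambda>m. - K * R ^ m * (\<Sum>i<N. (cmod (v i))\<^sup>2)) \<longlonglongrightarrow> 0" by simp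
  qed (use qlow in auto)
  have pert: "0 \<le> inn M + \<epsilon> * Re (\<Sum>i<N. M i i)" if \<epsilon>: "\<epsilon> > 0" for \<epsilon>
  proof -
    define Q where "Q i j = cnj (L i j) + (if i = j then of_real \<epsilon> else 0)" for i j
    have form: "herm_form {..<N} Q v = q v + \<epsilon> * (\<Sum>i<N. (cmod (v i))\<^sup>2)" for v
    proof -
      have "(\<Sum>i<N. \<Sum>j<N. cnj (v i) * Q i j * v j) =
        (\<Sum>i<N. \<Sum>j<N. cnj (v i) * cnj (L i j) * v j + (if j = i then of_real \<epsilon> * (cnj (v i) * v i) else 0))"
        by (intro sum.cong refl) (auto simp: Q_def algebra_simps)
      also have "\<dots> = (\<Sum>i<N. \<Sum>j<N. cnj (v i) * cnj (L i j) * v j) + of_real (\<epsilon> * (\<Sum>i<N. (cmod (v i))\<^sup>2))"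
        by (simp add: sum.distrib sum_distrib_left cnj_mult_cmod)
      finally show ?thesis unfolding herm_form_def q_def by simp
    qed
    have "0 \<le> Re (\<Sum>i<N. \<Sum>j<N. Q i j * M i j)"
    proof (rule H[OF _ \<epsilon>])
      show "\<epsilon> * (\<Sum>i<N. (cmod (v i))\<^sup>2) \<le> herm_form {..<N} Q v" for v unfolding form using qnn by simp
      show "psd_on {..<N} Q" unfolding psd_on_def
      proof (intro conjI ballI allI)
        show "0 \<le> herm_form {..<N} Q v" for v
          unfolding form using qnn[of v] \<epsilon> by (intro add_nonneg_nonneg mult_nonneg_nonneg sum_nonneg) auto
        fix i j assume "i \<in> {..<N}" "j \<in> {..<N}"
        hence "cnj (L i j) = L j i" using Lherm[of j i] by simp
        thus "Q i j = cnj (Q j i)" by (simp add: Q_def)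
      qed
      \<comment> \<open>Passing from q to Q, the contraction gains \<epsilon> (1 - R) times the
        Euclidean norm squared of u, while the form of Q is at most K + \<epsilon> times that norm
        squared; \<delta> is the quotient.\<close>
      define \<delta> where "\<delta> = \<epsilon> * (1 - R) / (K + \<epsilon>)"
      show "0 < \<delta>" unfolding \<delta>_def using \<epsilon> R K by simp
      have "\<epsilon> * (1 - R) \<le> \<epsilon> * 1" using \<epsilon> R by (intro mult_left_mono) auto
      hence le: "\<epsilon> * (1 - R) \<le> K + \<epsilon>" using K by linarith
      have "0 < K + \<epsilon>" using \<epsilon> K by linarith
      with le show "\<delta> \<le> 1" unfolding \<delta>_def by (simp only: divide_le_eq_1_pos)
      fix u :: "nat \<Rightarrow> nat \<Rightarrow> complex"
      let ?w = "\<lambda>a i. \<Sum>b<J. P i a b * u i b"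
      let ?n = "\<Sum>b<J. \<Sum>i<N. (cmod (u i b))\<^sup>2"
      have "(\<Sum>a<I. herm_form {..<N} Q (?w a)) = (\<Sum>a<I. q (?w a)) + \<epsilon> * (\<Sum>a<I. \<Sum>i<N. (cmod (?w a i))\<^sup>2)"
        unfolding form by (simp add: sum.distrib sum_distrib_left)
      also have "(\<Sum>a<I. q (?w a)) \<le> (\<Sum>b<J. q (\<lambda>i. u i b))" using rank[of u] by simp
      also have "(\<Sum>a<I. \<Sum>i<N. (cmod (?w a i))\<^sup>2) \<le> R * ?n"
      proof -
        have "(\<Sum>a<I. \<Sum>i<N. (cmod (?w a i))\<^sup>2) = (\<Sum>i<N. \<Sum>a<I. (cmod (?w a i))\<^sup>2)" by (rule sum.swap)
        also have "\<dots> \<le> (\<Sum>i<N. R * (\<Sum>b<J. (cmod (u i b))\<^sup>2))" by (intro sum_mono contr) auto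
        also have "\<dots> = R * ?n" unfolding sum_distrib_left[symmetric] by (subst sum.swap) simp
        finally show ?thesis .
      qed
      finally have 1: "(\<Sum>a<I. herm_form {..<N} Q (?w a)) \<le> (\<Sum>b<J. q (\<lambda>i. u i b)) + \<epsilon> * (R * ?n)"
        using \<epsilon> by simp
      have 2: "(\<Sum>b<J. herm_form {..<N} Q (\<lambda>i. u i b)) = (\<Sum>b<J. q (\<lambda>i. u i b)) + \<epsilon> * ?n"
        unfolding form by (simp add: sum.distrib sum_distrib_left)
      have "(\<Sum>b<J. q (\<lambda>i. u i b)) \<le> (\<Sum>b<J. K * (\<Sum>i<N. (cmod (u i b))\<^sup>2))"
        by (intro sum_mono) (use qbound in \<open>auto simp: abs_le_iff\<close>)
      hence "(\<Sum>b<J. herm_form {..<N} Q (\<lambda>i. u i b)) \<le> (K + \<epsilon>) * ?n"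
        unfolding 2 by (simp add: sum_distrib_left distrib_right)
      hence "\<delta> * (\<Sum>b<J. herm_form {..<N} Q (\<lambda>i. u i b)) \<le> \<delta> * ((K + \<epsilon>) * ?n)"
        using \<open>0 < \<delta>\<close> by (intro mult_left_mono) auto
      also have "\<dots> = \<epsilon> * (1 - R) * ?n" unfolding \<delta>_def using K \<epsilon> by simp
      finally show "(\<Sum>a<I. herm_form {..<N} Q (?w a)) \<le> (1 - \<delta>) * (\<Sum>b<J. herm_form {..<N} Q (\<lambda>i. u i b))"
        using 1 unfolding left_diff_distrib mult_1 2 by (simp add: algebra_simps)
    qed
    also have "(\<Sum>i<N. \<Sum>j<N. Q i j * M i j) = (\<Sum>i<N. \<Sum>j<N. cnj (L i j) * M i j) + of_real \<epsilon> * (\<Sum>i<N. M i i)"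
    proof -
      have "(\<Sum>i<N. \<Sum>j<N. Q i j * M i j) = (\<Sum>i<N. \<Sum>j<N. cnj (L i j) * M i j + (if j = i then of_real \<epsilon> * M i i else 0))"
        by (intro sum.cong refl) (auto simp: Q_def algebra_simps)
      thus ?thesis by (simp add: sum.distrib sum_distrib_left)
    qed
    finally show ?thesis unfolding inn_def by simp
  qed
  have "0 \<le> inn M"
  proof (rule tendsto_lowerbound)
    have "((\<lambda>\<epsilon>. inn M + \<epsilon> * Re (\<Sum>i<N. M i i)) \<longlongrightarrow> inn M + 0 * Re (\<Sum>i<N. M i i)) (at_right 0)"
      by (intro tendsto_intros)
    thus "((\<lambda>\<epsilon>. inn M + \<epsilon> * Re (\<Sum>i<N. M i i)) \<longlongrightarrow> inn M) (at_right 0)" by simp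
    show "eventually (\<lambda>\<epsilon>. 0 \<le> inn M + \<epsilon> * Re (\<Sum>i<N. M i i)) (at_right 0)"
      using eventually_at_right_less by eventually_elim (rule pert)
  qed auto
  \<comment> \<open>\<open>inn M\<close> equals \<open>inn (model_map G0) - \<phi> G0\<close> and is
    therefore at most \<open>- \<phi> G0\<close>; being nonnegative, it forces the distance from M
    to the cone to be 0.\<close>
  hence "\<phi> G0 \<le> 0" using inn_M inn_zero by simp
  moreover have "(cmod (model_map G0 i j - M i j))\<^sup>2 \<le> \<phi> G0" if "i < N" "j < N" for i j
  proof -
    have "(cmod (model_map G0 i j - M i j))\<^sup>2 \<le> (\<Sum>j<N. (cmod (model_map G0 i j - M i j))\<^sup>2)"
      using that by (intro member_le_sum[where f = "\<lambda>j. (cmod (model_map G0 i j - M i j))\<^sup>2"]) auto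
    also have "\<dots> \<le> \<phi> G0" unfolding \<phi>_def
      using that by (intro member_le_sum[where f = "\<lambda>i. \<Sum>j<N. (cmod (model_map G0 i j - M i j))\<^sup>2"]) (auto intro!: sum_nonneg)
    finally show ?thesis .
  qed
  ultimately have "M i j = model_map G0 i j" if "i < N" "j < N" for i j
    using that by (smt (verit) norm_eq_zero power2_less_eq_zero_iff right_minus_eq)
  thus ?thesis using mm0 by (intro exI[of _ u0]) auto
qed

end

section \<open>Interpolating models\<close>

definition diag_entries :: "nat \<Rightarrow> (nat \<Rightarrow> complex) \<Rightarrow> complex mat" where
  "diag_entries n a = mat n n (\<lambda>(i, j). if i = j then a i else 0)"

lemma diag_entries_carrier: "diag_entries n a \<in> carrier_mat n n"
  by (simp add: diag_entries_def)

lemma diag_block_mat_1_1: "diag_block_mat (map (\<lambda>j. mat 1 1 (\<lambda>_. a j)) [0..<n]) = diag_entries n a"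
proof (induction n)
  case 0
  show ?case by (rule eq_matI) (auto simp: diag_entries_def)
next
  case (Suc n)
  have e: "map (\<lambda>j. mat 1 1 (\<lambda>_. a j)) [0..<Suc n] = map (\<lambda>j. mat 1 1 (\<lambda>_. a j)) [0..<n] @ [mat 1 1 (\<lambda>_. a n)]"
    by simp
  show ?case unfolding e diag_block_mat_last Suc Let_def
    by (rule eq_matI) (auto simp: diag_entries_def less_Suc_eq)
qed

lemma diag_entries_mult_vec:
  assumes "dim_vec v = n"
  shows "diag_entries n a *\<^sub>v v = Matrix.vec n (\<lambda>j. a j * vec_index v j)"
proof (rule eq_vecI)
  fix i assume "i < dim_vec (Matrix.vec n (\<lambda>j. a j * vec_index v j))"
  hence i: "i < n" by simp
  have "vec_index (diag_entries n a *\<^sub>v v) i = (\<Sum>j<n. diag_entries n a $$ (i, j) * vec_index v j)"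
    using i assms by (subst index_mult_mat_vec_sum) (auto simp: diag_entries_def)
  also have "\<dots> = (\<Sum>j<n. if j = i then a i * vec_index v i else 0)"
    using i by (intro sum.cong) (auto simp: diag_entries_def)
  finally show "vec_index (diag_entries n a *\<^sub>v v) i = vec_index (Matrix.vec n (\<lambda>j. a j * vec_index v j)) i"
    using i by (simp add: sum.delta)
qed (simp add: diag_entries_def)

lemma diag_entries_commute: "diag_entries n a * diag_entries n b = diag_entries n b * diag_entries n a"
proof -
  have "diag_entries n a * diag_entries n b = diag_entries n (\<lambda>i. a i * b i)" for a b
  proof (rule eq_matI)
    fix i j assume "i < dim_row (diag_entries n (\<lambda>i. a i * b i))" "j < dim_col (diag_entries n (\<lambda>i. a i * b i))"
    hence ij: "i < n" "j < n" by (auto simp: diag_entries_def)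
    have "(diag_entries n a * diag_entries n b) $$ (i, j) = (\<Sum>k<n. diag_entries n a $$ (i, k) * diag_entries n b $$ (k, j))"
      using ij by (simp add: index_mult_mat_sum diag_entries_def del: index_mult_mat(1))
    also have "\<dots> = (\<Sum>k<n. if k = i then a i * diag_entries n b $$ (i, j) else 0)"
      using ij by (intro sum.cong) (auto simp: diag_entries_def)
    finally show "(diag_entries n a * diag_entries n b) $$ (i, j) = diag_entries n (\<lambda>i. a i * b i) $$ (i, j)"
      using ij by (simp add: diag_entries_def)
  qed (simp_all add: diag_entries_def)
  thus ?thesis by (simp add: mult.commute)
qed

lemma mpoly_eval_zero: "mpoly_eval q 0 = Poly_Mapping.lookup q 0"
proof -
  have "mpoly_eval q 0 = (\<Sum>\<alpha>\<in>Poly_Mapping.keys q. if \<alpha> = 0 then Poly_Mapping.lookup q 0 else 0)"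
    unfolding mpoly_eval_def by (intro sum.cong) (auto simp: monom_eval_zero)
  thus ?thesis by (simp add: in_keys_iff)
qed

lemma insert_series_scalar_tuple:
  "insert_series g \<mu> (scalar_tuple \<mu>) = mat 1 1 (\<lambda>_. power_series_at g \<mu> 0)"
proof -
  note q = quasi_scalar_scalar_tuple[of \<mu>]
  have sh: "shift_tuple 1 \<mu> (scalar_tuple \<mu>) = scalar_tuple 0"
    using shift_scalar_tuple[of \<mu> 0] by simp
  define B where "B = insert 0 {\<alpha>. monom_mat \<alpha> (shift_tuple 1 \<mu> (scalar_tuple \<mu>)) \<noteq> 0\<^sub>m 1 1}"
  have B: "finite B" "{\<alpha>. monom_mat \<alpha> (shift_tuple 1 \<mu> (scalar_tuple \<mu>)) \<noteq> 0\<^sub>m 1 1} \<subseteq> B" "0 \<in> B"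
    using finite_nonzero_monomials[OF q] by (auto simp: B_def)
  show ?thesis
    unfolding insert_series_eq_mpoly_mat[OF q B(1,2)] sh mpoly_mat_scalar_tuple mpoly_eval_zero
    using B by (simp add: lookup_trunc_series)
qed

lemma holo_on_power_series_at_0:
  assumes "holo_on g U" "open U" "\<mu> \<in> U"
  shows "power_series_at g \<mu> 0 = g \<mu>"
proof -
  obtain r where "r > 0"
    "\<And>z. norm z < r \<Longrightarrow> ((\<lambda>\<alpha>. power_series_at g \<mu> \<alpha> * monom_eval \<alpha> z) has_sum g (\<mu> + z)) UNIV"
    using holo_on_power_series_at[OF assms] by metis
  thus ?thesis by (rule power_series_constant_coeff)
qed

text \<open>A factor S of the Gram matrix Q turns the abstract inner product into the standard one,
  so that the GNS tuple consists of actual matrices. Definiteness makes S injective, hence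
  invertible.\<close>

lemma gram_matrix_invertible:
  assumes psd: "psd_on {..<N} Q" and \<epsilon>: "\<epsilon> > 0"
    and pd: "\<And>v. \<epsilon> * (\<Sum>i<N. (cmod (v i))\<^sup>2) \<le> herm_form {..<N} Q v"
  obtains S T where "S \<in> carrier_mat N N" "T \<in> carrier_mat N N" "S * T = 1\<^sub>m N" "T * S = (1\<^sub>m N :: complex mat)"
    "\<forall>v. dim_vec v = N \<longrightarrow> (vec_l2 (S *\<^sub>v v))\<^sup>2 = herm_form {..<N} Q (vec_index v)"
proof -
  obtain u where u: "\<forall>x\<in>{..<N}. \<forall>y\<in>{..<N}. Q x y = (\<Sum>k<card {..<N}. cnj (u x k) * u y k)"
    using psd_factorization[OF finite_lessThan psd] by blast
  define S :: "complex mat" where "S = mat N N (\<lambda>(k, j). u j k)"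
  have S: "S \<in> carrier_mat N N" by (simp add: S_def)
  have norm: "(vec_l2 (S *\<^sub>v v))\<^sup>2 = herm_form {..<N} Q (vec_index v)" if v: "dim_vec v = N" for v
  proof -
    let ?s = "\<lambda>k. \<Sum>j<N. u j k * vec_index v j"
    have Sv: "vec_index (S *\<^sub>v v) k = ?s k" if "k < N" for k
      using that v by (subst index_mult_mat_vec_sum) (auto simp: S_def)
    have "(\<Sum>x<N. \<Sum>y<N. cnj (vec_index v x) * Q x y * vec_index v y) =
      (\<Sum>x<N. \<Sum>y<N. \<Sum>k<N. cnj (u x k * vec_index v x) * (u y k * vec_index v y))"
      using u by (intro sum.cong refl) (simp add: sum_distrib_left sum_distrib_right mult_ac)
    also have "\<dots> = (\<Sum>x<N. \<Sum>k<N. \<Sum>y<N. cnj (u x k * vec_index v x) * (u y k * vec_index v y))"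
      by (intro sum.cong refl sum.swap)
    also have "\<dots> = (\<Sum>k<N. \<Sum>x<N. \<Sum>y<N. cnj (u x k * vec_index v x) * (u y k * vec_index v y))"
      by (rule sum.swap)
    also have "\<dots> = (\<Sum>k<N. cnj (?s k) * ?s k)"
      unfolding cnj_sum sum_product ..
    also have "\<dots> = of_real (\<Sum>k<N. (cmod (?s k))\<^sup>2)" unfolding cnj_mult_cmod by simp
    finally have "herm_form {..<N} Q (vec_index v) = (\<Sum>k<N. (cmod (?s k))\<^sup>2)"
      unfolding herm_form_def by (simp only: Re_complex_of_real)
    also have "\<dots> = (vec_l2 (S *\<^sub>v v))\<^sup>2"
      unfolding vec_l2_square using S Sv by (intro sum.cong) (auto simp del: index_mult_mat_vec)
    finally show ?thesis ..
  qed
  have "det S \<noteq> 0"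
  proof
    assume "det S = 0"
    then obtain v where v: "v \<in> carrier_vec N" "v \<noteq> 0\<^sub>v N" "S *\<^sub>v v = 0\<^sub>v N"
      unfolding det_0_iff_vec_prod_zero[OF S] by blast
    have dv: "dim_vec v = N" using v(1) by simp
    have "\<epsilon> * (\<Sum>i<N. (cmod (vec_index v i))\<^sup>2) \<le> 0"
      using pd[of "vec_index v"] norm[OF dv] v(3) by simp
    hence "(\<Sum>i<N. (cmod (vec_index v i))\<^sup>2) \<le> 0" using \<epsilon> by (simp add: mult_le_0_iff)
    hence "(\<Sum>i<N. (cmod (vec_index v i))\<^sup>2) = 0" by (intro antisym sum_nonneg) auto
    hence "\<forall>i<N. vec_index v i = 0" by (subst (asm) sum_nonneg_eq_0_iff) auto
    hence "v = 0\<^sub>v N" using dv by (intro eq_vecI) auto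
    with v(2) show False by simp
  qed
  from det_non_zero_imp_unit[OF S this, of "()"] obtain T where T: "T \<in> carrier_mat N N" "T * S = 1\<^sub>m N" "S * T = 1\<^sub>m N"
    unfolding Units_def by (auto simp: ring_mat_simps)
  show ?thesis by (rule that[OF S T(1,3,2)]) (use norm in blast)
qed

text \<open>The tuple with joint eigenvalues \<open>lam j\<close> whose eigenvectors have Gram matrix \<open>Q\<close>.\<close>

lemma gns_positivity:
  fixes lam :: "nat \<Rightarrow> complex ^ 'd::finite"
  assumes p: "p \<in> carrier_mat I J" and V: "lam ` {..<N} \<subseteq> V" and N: "N \<ge> 1"
    and f: "f \<in> Hol_sub V" and c: "c \<ge> 0"
    and bound: "\<And>y. y \<in> F_dom_sub p V \<Longrightarrow> op_norm (fun_calc_sub V f y) \<le> c"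
    and psd: "psd_on {..<N} Q" and \<epsilon>: "\<epsilon> > 0"
    and pd: "\<And>v. \<epsilon> * (\<Sum>i<N. (cmod (v i))\<^sup>2) \<le> herm_form {..<N} Q v"
    and \<delta>: "0 < \<delta>" "\<delta> \<le> 1"
    and contr: "\<And>u. (\<Sum>a<I. herm_form {..<N} Q (\<lambda>i. \<Sum>b<J. mpoly_eval (p $$ (a, b)) (lam i) * u i b))
      \<le> (1 - \<delta>) * (\<Sum>b<J. herm_form {..<N} Q (\<lambda>i. u i b))"
  shows "0 \<le> Re (\<Sum>i<N. \<Sum>j<N. Q i j * (of_real (c\<^sup>2) - cnj (f (lam i)) * f (lam j)))"
proof -
  obtain S T :: "complex mat" where S: "S \<in> carrier_mat N N" and T: "T \<in> carrier_mat N N"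
    and ST: "S * T = 1\<^sub>m N" and TS: "T * S = 1\<^sub>m N"
    and norm: "\<forall>v. dim_vec v = N \<longrightarrow> (vec_l2 (S *\<^sub>v v))\<^sup>2 = herm_form {..<N} Q (vec_index v)"
    by (rule gram_matrix_invertible[OF psd \<epsilon> pd]) (rule that; assumption)
  \<comment> \<open>The j-th column of S is a joint eigenvector for \<open>lam j\<close>, and the
    Gram matrix of these columns is Q.\<close>
  define y where "y i = S * diag_entries N (\<lambda>j. lam j $ i) * T" for i
  define us where "us = map (\<lambda>j. (lam j, scalar_tuple (lam j))) [0..<N]"
  have "commuting N (\<lambda>i. diag_entries N (\<lambda>j. lam j $ i))"
    by (simp add: commuting_def diag_entries_carrier diag_entries_commute)
  hence y: "commuting N y" unfolding y_def by (rule commuting_similar[OF _ T S TS])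
  have yt: "tuple_size y = N" by (rule commuting_tuple_size[OF y])
  have ds: "diag_block_mat (map (\<lambda>(\<mu>, u). u i) us) = diag_entries N (\<lambda>j. lam j $ i)" for i
    unfolding us_def scalar_tuple_def by (simp add: o_def diag_block_mat_1_1[symmetric])
  have bd: "block_decomp y us S T" unfolding block_decomp_def ds
  proof (intro conjI allI ballI)
    show "similar_mat_wit (y i) (diag_entries N (\<lambda>j. lam j $ i)) S T" for i
      by (rule similar_mat_witI[OF ST TS _ commutingD(1)[OF y] diag_entries_carrier S T]) (simp add: y_def)
    fix x assume "x \<in> set us"
    thus "case x of (\<mu>, u) \<Rightarrow> quasi_scalar (tuple_size u) \<mu> u"
      by (auto simp: us_def commuting_tuple_size[OF commuting_scalar_tuple] quasi_scalar_scalar_tuple[unfolded One_nat_def])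
  qed
  have js: "joint_spectrum y = lam ` {..<N}"
    unfolding block_decomp_joint_spectrum[OF bd y] us_def by (auto simp: image_image)
  have calc: "calc_mat (map (\<lambda>(\<mu>, u). (g \<mu>, \<mu>, u)) us) = diag_entries N (\<lambda>j. insert_series (g (lam j)) (lam j) (scalar_tuple (lam j)) $$ (0, 0))" for g
  proof -
    have "map (\<lambda>(g, \<mu>, x). insert_series g \<mu> x) (map (\<lambda>(\<mu>, u). (g \<mu>, \<mu>, u)) us) =
      map (\<lambda>j. mat 1 1 (\<lambda>_. insert_series (g (lam j)) (lam j) (scalar_tuple (lam j)) $$ (0, 0))) [0..<N]"
      by (simp add: us_def insert_series_scalar_tuple)
    thus ?thesis unfolding calc_mat_def by (simp only: diag_block_mat_1_1)
  qed
  have Svec: "S * diag_entries N a * T *\<^sub>v (S *\<^sub>v v) = S *\<^sub>v Matrix.vec N (\<lambda>j. a j * vec_index v j)" if v: "dim_vec v = N" for a v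
  proof -
    have vc: "v \<in> carrier_vec N" by (rule carrier_vecI[OF v])
    have Sv: "S *\<^sub>v v \<in> carrier_vec N" using S vc by simp
    have SD: "S * diag_entries N a \<in> carrier_mat N N" by (rule mult_carrier_mat[OF S diag_entries_carrier])
    have "S * diag_entries N a * T *\<^sub>v (S *\<^sub>v v) = S * diag_entries N a *\<^sub>v (T *\<^sub>v (S *\<^sub>v v))"
      by (rule assoc_mult_mat_vec[OF SD T Sv])
    also have "T *\<^sub>v (S *\<^sub>v v) = v"
      using assoc_mult_mat_vec[OF T S vc] TS vc by simp
    also have "S * diag_entries N a *\<^sub>v v = S *\<^sub>v (diag_entries N a *\<^sub>v v)"
      by (rule assoc_mult_mat_vec[OF S diag_entries_carrier vc])
    finally show ?thesis unfolding diag_entries_mult_vec[OF v] .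
  qed
  have mp: "mpoly_mat q y = S * diag_entries N (\<lambda>j. mpoly_eval q (lam j)) * T" for q
  proof -
    have "mpoly_mat q y = S * calc_mat (map (\<lambda>(\<mu>, u). (mpoly_eval q, \<mu>, u)) us) * T"
      unfolding fun_calc_mpoly[OF y N, symmetric] by (rule fun_calc_eq[OF y N bd])
    thus ?thesis unfolding calc insert_series_mpoly[OF quasi_scalar_scalar_tuple] mpoly_mat_scalar_tuple by simp
  qed
  \<comment> \<open>In the coordinates u = T w the matrix p(y) acts pointwise at the joint
    eigenvalues, so the contraction hypothesis on Q is this norm bound; positivity of \<delta> makes
    it strict.\<close>
  have "op_norm (pmat_mat p y) \<le> sqrt (1 - \<delta>)"
  proof (rule pmat_mat_norm_le[OF y p])
    show "0 \<le> sqrt (1 - \<delta>)" using \<delta> by simp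
    fix w :: "nat \<Rightarrow> complex Matrix.vec" assume w: "\<And>b. dim_vec (w b) = N"
    define u where "u b = T *\<^sub>v w b" for b
    have u: "dim_vec (u b) = N" for b using T by (simp add: u_def)
    have wu: "w b = S *\<^sub>v u b" for b
    proof -
      have wc: "w b \<in> carrier_vec N" by (rule carrier_vecI[OF w])
      show ?thesis unfolding u_def using assoc_mult_mat_vec[OF S T wc] ST wc by simp
    qed
    define x where "x a = Matrix.vec N (\<lambda>j. \<Sum>b<J. mpoly_eval (p $$ (a, b)) (lam j) * vec_index (u b) j)" for a
    have xd: "dim_vec (x a) = N" for a by (simp add: x_def)
    have "(\<Sum>b<J. vec_index (mpoly_mat (p $$ (a, b)) y *\<^sub>v w b) r) = vec_index (S *\<^sub>v x a) r" if r: "r < N" for a r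
    proof -
      have "(\<Sum>b<J. vec_index (mpoly_mat (p $$ (a, b)) y *\<^sub>v w b) r) =
        (\<Sum>b<J. \<Sum>j<N. S $$ (r, j) * (mpoly_eval (p $$ (a, b)) (lam j) * vec_index (u b) j))"
        unfolding mp wu Svec[OF u] using r S
        by (intro sum.cong refl) (subst index_mult_mat_vec_sum, auto)
      also have "\<dots> = (\<Sum>j<N. \<Sum>b<J. S $$ (r, j) * (mpoly_eval (p $$ (a, b)) (lam j) * vec_index (u b) j))"
        by (rule sum.swap)
      also have "\<dots> = vec_index (S *\<^sub>v x a) r"
        using r S by (subst index_mult_mat_vec_sum) (auto simp: x_def sum_distrib_left)
      finally show ?thesis .
    qed
    hence "(\<Sum>a<I. \<Sum>r<N. (cmod (\<Sum>b<J. vec_index (mpoly_mat (p $$ (a, b)) y *\<^sub>v w b) r))\<^sup>2) = (\<Sum>a<I. (vec_l2 (S *\<^sub>v x a))\<^sup>2)"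
      unfolding vec_l2_square using S by (intro sum.cong refl) (auto simp del: index_mult_mat_vec)
    also have "\<dots> = (\<Sum>a<I. herm_form {..<N} Q (\<lambda>i. \<Sum>b<J. mpoly_eval (p $$ (a, b)) (lam i) * vec_index (u b) i))"
    proof (intro sum.cong refl)
      fix a
      have "(vec_l2 (S *\<^sub>v x a))\<^sup>2 = herm_form {..<N} Q (vec_index (x a))" using norm xd by blast
      also have "\<dots> = herm_form {..<N} Q (\<lambda>i. \<Sum>b<J. mpoly_eval (p $$ (a, b)) (lam i) * vec_index (u b) i)"
        by (rule herm_form_cong) (simp add: x_def)
      finally show "(vec_l2 (S *\<^sub>v x a))\<^sup>2 = \<dots>" .
    qed
    also have "\<dots> \<le> (1 - \<delta>) * (\<Sum>b<J. herm_form {..<N} Q (\<lambda>i. vec_index (u b) i))"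
      by (rule contr[of "\<lambda>i b. vec_index (u b) i"])
    also have "(\<Sum>b<J. herm_form {..<N} Q (\<lambda>i. vec_index (u b) i)) = (\<Sum>b<J. (vec_l2 (w b))\<^sup>2)"
      unfolding wu using norm u by simp
    also have "\<dots> = (\<Sum>b<J. \<Sum>r<N. (cmod (vec_index (w b) r))\<^sup>2)" unfolding vec_l2_square w ..
    also have "1 - \<delta> = (sqrt (1 - \<delta>))\<^sup>2" using \<delta> by simp
    finally show "(\<Sum>a<I. \<Sum>r<N. (cmod (\<Sum>b<J. vec_index (mpoly_mat (p $$ (a, b)) y *\<^sub>v w b) r))\<^sup>2)
      \<le> (sqrt (1 - \<delta>))\<^sup>2 * (\<Sum>b<J. \<Sum>r<N. (cmod (vec_index (w b) r))\<^sup>2)" .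
  qed
  also have "sqrt (1 - \<delta>) < 1" using \<delta> by (simp add: real_sqrt_lt_1_iff)
  finally have yF: "y \<in> F_dom p" unfolding F_dom_def comm_tuples_eq using y N by auto
  \<comment> \<open>All blocks have size 1, so only the values of g at the points
    \<open>lam j\<close> enter, and these points lie in both U and V.\<close>
  have sub: "subordinate V y" unfolding subordinate_def
  proof (intro allI impI, elim conjE)
    fix U g assume U: "open U" "joint_spectrum y \<subseteq> U" "holo_on g U" "\<forall>z\<in>U \<inter> V. g z = 0"
    have "fun_calc g y = S * diag_entries N (\<lambda>j. insert_series g (lam j) (scalar_tuple (lam j)) $$ (0, 0)) * T"
      unfolding fun_calc_eq[OF y N bd] calc ..
    also have "diag_entries N (\<lambda>j. insert_series g (lam j) (scalar_tuple (lam j)) $$ (0, 0)) = 0\<^sub>m N N"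
    proof (rule eq_matI)
      fix i j assume "i < dim_row (0\<^sub>m N N)" "j < dim_col (0\<^sub>m N N)"
      hence ij: "i < N" "j < N" by auto
      have "lam i \<in> U" using U(2) js ij by auto
      moreover have "lam i \<in> V" using V ij by auto
      ultimately have "power_series_at g (lam i) 0 = 0"
        using holo_on_power_series_at_0[OF U(3,1)] U(4) by simp
      thus "diag_entries N (\<lambda>j. insert_series g (lam j) (scalar_tuple (lam j)) $$ (0, 0)) $$ (i, j) = 0\<^sub>m N N $$ (i, j)"
        using ij by (cases "i = j") (simp_all add: diag_entries_def insert_series_scalar_tuple)
    qed (simp_all add: diag_entries_def)
    finally show "fun_calc g y = 0\<^sub>m (tuple_size y) (tuple_size y)"
      unfolding yt using right_mult_zero_mat[OF S] left_mult_zero_mat[OF T] by simp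
  qed
  have mem: "y \<in> F_dom_sub p V"
    unfolding F_dom_sub_def Y_set_def using yF sub js V by (auto simp: F_dom_def)
  have "\<forall>\<mu>. \<exists>h. \<mu> \<in> V \<longrightarrow> local_extension V f \<mu> h" using f unfolding Hol_sub_def by blast
  then obtain h where h: "\<And>\<mu>. \<mu> \<in> V \<Longrightarrow> local_extension V f \<mu> (h \<mu>)" by metis
  have hv: "power_series_at (h \<mu>) \<mu> 0 = f \<mu>" if \<mu>: "\<mu> \<in> V" for \<mu>
  proof -
    obtain U where "open U" "\<mu> \<in> U" "holo_on (h \<mu>) U" "\<forall>z\<in>U \<inter> V. h \<mu> z = f z"
      using h[OF \<mu>] unfolding local_extension_def by blast
    thus ?thesis using holo_on_power_series_at_0[of "h \<mu>" U \<mu>] \<mu> by simp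
  qed
  have fs: "fun_calc_sub V f y = S * diag_entries N (\<lambda>j. insert_series (h (lam j)) (lam j) (scalar_tuple (lam j)) $$ (0, 0)) * T"
    unfolding calc[symmetric] by (rule fun_calc_sub_eq[OF y N sub bd]) (use h js V in auto)
  \<comment> \<open>S applied to this vector is the sum of the eigenvectors. Its norm squared is the
    sum of all Q i j, and f(y) weights the eigenvectors by the values of f; the bound c on f(y),
    tested on this single vector, is the claim.\<close>
  define one where "one = Matrix.vec N (\<lambda>_. 1 :: complex)"
  define v where "v = S *\<^sub>v one"
  have od: "dim_vec one = N" by (simp add: one_def)
  have Zc: "fun_calc_sub V f y \<in> carrier_mat N N"
    unfolding fs by (intro mult_carrier_mat[OF mult_carrier_mat[OF S diag_entries_carrier] T])
  have "vec_l2 (fun_calc_sub V f y *\<^sub>v v) \<le> op_norm (fun_calc_sub V f y) * vec_l2 v"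
    by (rule op_norm_bound) (use Zc S in \<open>simp add: v_def\<close>)
  also have "\<dots> \<le> c * vec_l2 v" by (intro mult_right_mono bound mem) simp
  finally have "(vec_l2 (fun_calc_sub V f y *\<^sub>v v))\<^sup>2 \<le> (c * vec_l2 v)\<^sup>2"
    by (rule power_mono) simp
  moreover have "(vec_l2 (fun_calc_sub V f y *\<^sub>v v))\<^sup>2 = herm_form {..<N} Q (\<lambda>i. f (lam i))"
  proof -
    have "(vec_l2 (fun_calc_sub V f y *\<^sub>v v))\<^sup>2 = herm_form {..<N} Q
       (vec_index (Matrix.vec N (\<lambda>j. insert_series (h (lam j)) (lam j) (scalar_tuple (lam j)) $$ (0, 0) * vec_index one j)))"
      unfolding fs v_def Svec[OF od] using norm by simp
    also have "\<dots> = herm_form {..<N} Q (\<lambda>i. f (lam i))"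
      by (rule herm_form_cong) (use hv V in \<open>auto simp: insert_series_scalar_tuple one_def\<close>)
    finally show ?thesis .
  qed
  moreover have "(vec_l2 v)\<^sup>2 = herm_form {..<N} Q (\<lambda>i. 1)"
  proof -
    have "(vec_l2 v)\<^sup>2 = herm_form {..<N} Q (vec_index one)" unfolding v_def using norm od by simp
    also have "\<dots> = herm_form {..<N} Q (\<lambda>i. 1)" by (rule herm_form_cong) (simp add: one_def)
    finally show ?thesis .
  qed
  ultimately have "herm_form {..<N} Q (\<lambda>i. f (lam i)) \<le> c\<^sup>2 * herm_form {..<N} Q (\<lambda>i. 1)"
    by (simp add: power_mult_distrib)
  moreover have "(\<Sum>i<N. \<Sum>j<N. Q i j * (of_real (c\<^sup>2) - cnj (f (lam i)) * f (lam j))) =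
    of_real (c\<^sup>2) * (\<Sum>i<N. \<Sum>j<N. cnj 1 * Q i j * 1) - (\<Sum>i<N. \<Sum>j<N. cnj (f (lam i)) * Q i j * f (lam j))"
    by (simp only: right_diff_distrib sum_subtractf sum_distrib_left complex_cnj_one mult_1_left mult_1_right) (simp only: mult_ac)
  ultimately show ?thesis unfolding herm_form_def by (simp only: minus_complex.sel Re_complex_of_real times_complex.sel Im_complex_of_real)
qed

section \<open>Polynomial realizations\<close>

text \<open>At a stationary state the energy inequality would give w^2 \<le> \<sigma>^2. Started at
  0, the states move by at most \<rho>^m \<sigma> in step m and stay below \<sigma> / (1 - \<rho>),
  so x_m^2 - x_(m+1)^2 is at most their product with 2; this is the excess in the bound.\<close>

lemma energy_iteration_bound:
  fixes w x d :: "nat \<Rightarrow> real"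
  assumes \<rho>: "0 \<le> \<rho>" "\<rho> < 1" and x: "x 0 = 0" "\<And>m. 0 \<le> x m"
    and energy: "\<And>m. (w m)\<^sup>2 + (x (Suc m))\<^sup>2 \<le> \<sigma>\<^sup>2 + \<rho>\<^sup>2 * (x m)\<^sup>2"
    and step: "\<And>m. \<bar>x (Suc m) - x m\<bar> \<le> d m" "\<And>m. d (Suc m) \<le> \<rho> * d m" "d 0 \<le> \<sigma>"
  shows "(w m)\<^sup>2 \<le> \<sigma>\<^sup>2 * (1 + 2 * \<rho> ^ m / (1 - \<rho>))"
proof -
  have d: "d m \<le> \<rho> ^ m * \<sigma>" for m
  proof (induction m)
    case (Suc m)
    have "d (Suc m) \<le> \<rho> * d m" by (rule step)
    also have "\<dots> \<le> \<rho> * (\<rho> ^ m * \<sigma>)" using Suc \<rho> by (intro mult_left_mono) auto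
    finally show ?case by simp
  qed (use step in simp)
  have \<sigma>: "\<sigma> \<ge> 0" using d[of 0] step(1)[of 0] by simp
  have xb: "(1 - \<rho>) * x m \<le> \<sigma> * (1 - \<rho> ^ m)" for m
  proof (induction m)
    case (Suc m)
    have "x (Suc m) \<le> x m + \<rho> ^ m * \<sigma>" using step(1)[of m] d[of m] by simp
    hence "(1 - \<rho>) * x (Suc m) \<le> (1 - \<rho>) * (x m + \<rho> ^ m * \<sigma>)" using \<rho> by (intro mult_left_mono) auto
    also have "\<dots> \<le> \<sigma> * (1 - \<rho> ^ m) + (1 - \<rho>) * (\<rho> ^ m * \<sigma>)" using Suc by (simp add: algebra_simps)
    finally show ?case by (simp add: algebra_simps)
  qed (use x in simp)
  have xs: "x m \<le> \<sigma> / (1 - \<rho>)" for m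
  proof -
    have "\<sigma> * (1 - \<rho> ^ m) \<le> \<sigma> * 1" using \<sigma> \<rho> by (intro mult_left_mono) auto
    thus ?thesis using xb[of m] \<rho> by (simp add: field_simps)
  qed
  have "(x m)\<^sup>2 - (x (Suc m))\<^sup>2 = (x m - x (Suc m)) * (x m + x (Suc m))"
    by (simp add: power2_eq_square algebra_simps)
  also have "\<dots> \<le> \<bar>x m - x (Suc m)\<bar> * (x m + x (Suc m))" using x by (intro mult_right_mono) auto
  also have "\<dots> \<le> (\<rho> ^ m * \<sigma>) * (\<sigma> / (1 - \<rho>) + \<sigma> / (1 - \<rho>))"
    using step(1)[of m] d[of m] x xs \<rho> \<sigma> by (intro mult_mono add_mono) (auto simp: abs_minus_commute)
  also have "\<dots> = \<sigma>\<^sup>2 * (2 * \<rho> ^ m / (1 - \<rho>))" by (simp add: power2_eq_square field_simps)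
  finally have a: "(x m)\<^sup>2 - (x (Suc m))\<^sup>2 \<le> \<sigma>\<^sup>2 * (2 * \<rho> ^ m / (1 - \<rho>))" .
  have "\<rho>\<^sup>2 * (x m)\<^sup>2 \<le> 1 * (x m)\<^sup>2" using \<rho> by (intro mult_right_mono power_le_one) auto
  with energy[of m] a have "(w m)\<^sup>2 \<le> \<sigma>\<^sup>2 + \<sigma>\<^sup>2 * (2 * \<rho> ^ m / (1 - \<rho>))" by linarith
  thus ?thesis by (simp only: ring_distribs mult_1_right)
qed

lemma sum_Times_swap: "(\<Sum>z\<in>A \<times> B. g z) = (\<Sum>b\<in>B. \<Sum>a\<in>A. g (a, b))"
  by (subst sum.swap) (simp add: sum.cartesian_product)

section \<open>Polynomials applied to a fixed vector\<close>

definition mpoly_coord :: "'d::finite mat_tuple \<Rightarrow> complex Matrix.vec \<Rightarrow> 'd mpoly \<Rightarrow> nat \<Rightarrow> complex" where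
  "mpoly_coord x v q r = vec_index (mpoly_mat q x *\<^sub>v v) r"

context
  fixes n :: nat and x :: "'d::finite mat_tuple" and v :: "complex Matrix.vec"
  assumes x: "commuting n x" and v: "dim_vec v = n"
begin

lemma mpoly_coord_sum_index:
  assumes "r < n"
  shows "mpoly_coord x v q r = (\<Sum>s<n. mpoly_mat q x $$ (r, s) * vec_index v s)"
  using assms mpoly_mat_carrier[OF x, of q] v unfolding mpoly_coord_def
  by (subst index_mult_mat_vec_sum) auto

lemma mpoly_coord_add: "r < n \<Longrightarrow> mpoly_coord x v (p + q) r = mpoly_coord x v p r + mpoly_coord x v q r"
  using mpoly_mat_carrier[OF x, of p] mpoly_mat_carrier[OF x, of q]
  by (simp add: mpoly_coord_sum_index mpoly_mat_add[OF x] ring_distribs sum.distrib)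

lemma mpoly_coord_diff: "r < n \<Longrightarrow> mpoly_coord x v (p - q) r = mpoly_coord x v p r - mpoly_coord x v q r"
  using mpoly_coord_add[of r "p - q" q] by simp

lemma mpoly_coord_zero: "r < n \<Longrightarrow> mpoly_coord x v 0 r = 0"
  by (simp add: mpoly_coord_sum_index mpoly_mat_0[OF x])

lemma mpoly_coord_sum: "finite A \<Longrightarrow> r < n \<Longrightarrow> mpoly_coord x v (\<Sum>i\<in>A. q i) r = (\<Sum>i\<in>A. mpoly_coord x v (q i) r)"
  by (induction A rule: finite_induct) (simp_all add: mpoly_coord_add mpoly_coord_zero)

lemma mpoly_mat_const: "mpoly_mat (Poly_Mapping.single 0 c) x = c \<cdot>\<^sub>m 1\<^sub>m n"
  by (simp add: mpoly_mat_single[OF x] monom_mat_0[OF x])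

lemma mpoly_coord_const: "r < n \<Longrightarrow> mpoly_coord x v (Poly_Mapping.single 0 c) r = c * vec_index v r"
  by (simp add: mpoly_coord_sum_index mpoly_mat_const if_distrib[of "\<lambda>t. t * _"] if_distrib[of "\<lambda>t. _ * t"] cong: if_cong)

lemma mpoly_coord_mult:
  "mpoly_coord x v (p * q) r = vec_index (mpoly_mat p x *\<^sub>v (mpoly_mat q x *\<^sub>v v)) r"
  unfolding mpoly_coord_def mpoly_mat_mult[OF x]
  by (subst assoc_mult_mat_vec[OF mpoly_mat_carrier[OF x] mpoly_mat_carrier[OF x] carrier_vecI[OF v]]) simp

lemma mpoly_coord_const_mult: "r < n \<Longrightarrow> mpoly_coord x v (Poly_Mapping.single 0 c * q) r = c * mpoly_coord x v q r"
  using carrier_matD[OF mpoly_mat_carrier[OF x, of q]]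
  by (simp add: mpoly_coord_sum_index mpoly_mat_mult[OF x] mpoly_mat_const sum_distrib_left mult.assoc
      mult_smult_assoc_mat[OF one_carrier_mat mpoly_mat_carrier[OF x]] left_mult_one_mat[OF mpoly_mat_carrier[OF x]])

definition mpoly_vec_norm :: "'d mpoly \<Rightarrow> real" where
  "mpoly_vec_norm q = L2_set (\<lambda>r. cmod (mpoly_coord x v q r)) {..<n}"

lemma mpoly_vec_norm_nonneg: "mpoly_vec_norm q \<ge> 0"
  by (simp add: mpoly_vec_norm_def L2_set_nonneg)

lemma mpoly_vec_norm_square: "(mpoly_vec_norm q)\<^sup>2 = (\<Sum>r<n. (cmod (mpoly_coord x v q r))\<^sup>2)"
  by (simp add: mpoly_vec_norm_def L2_set_def sum_nonneg)

lemma mpoly_vec_norm_vec_l2: "mpoly_vec_norm q = vec_l2 (mpoly_mat q x *\<^sub>v v)"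
  using mpoly_mat_carrier[OF x, of q] by (simp add: mpoly_vec_norm_def vec_l2_L2_set mpoly_coord_def)

lemma mpoly_vec_norm_triangle: "mpoly_vec_norm q \<le> mpoly_vec_norm q' + mpoly_vec_norm (q - q')"
proof -
  have "mpoly_vec_norm q \<le> L2_set (\<lambda>r. cmod (mpoly_coord x v q' r) + cmod (mpoly_coord x v (q - q') r)) {..<n}"
    unfolding mpoly_vec_norm_def
    by (intro L2_set_mono) (auto simp: mpoly_coord_diff intro: norm_triangle_sub)
  also have "\<dots> \<le> mpoly_vec_norm q' + mpoly_vec_norm (q - q')"
    unfolding mpoly_vec_norm_def by (rule L2_set_triangle_ineq)
  finally show ?thesis .
qed

lemma mpoly_vec_norm_commute: "mpoly_vec_norm (q - q') = mpoly_vec_norm (q' - q)"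
  unfolding mpoly_vec_norm_def by (intro L2_set_cong) (auto simp: mpoly_coord_diff norm_minus_commute)

end

section \<open>The realization and its iteration\<close>

context
  fixes p :: "'d::finite mpoly mat" and I J K :: nat
    and L :: "(nat \<times> nat) option \<Rightarrow> (nat \<times> nat) option \<Rightarrow> complex"
begin

text \<open>L is the system matrix of the realization. On both sides \<open>None\<close> is the
  scalar channel, with the constant c as input and the value of the function as output;
  \<open>Some\<close> carries the K copies of p times the state on the input side and of the new
  state on the output side.\<close>

definition realization_input :: "complex \<Rightarrow> (nat \<times> nat \<Rightarrow> 'd mpoly) \<Rightarrow> (nat \<times> nat) option \<Rightarrow> 'd mpoly" where
  "realization_input c W s = (case s of None \<Rightarrow> Poly_Mapping.single 0 c
     | Some (a, k) \<Rightarrow> \<Sum>b<J. p $$ (a, b) * W (b, k))"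

definition realization_step :: "complex \<Rightarrow> (nat \<times> nat \<Rightarrow> 'd mpoly) \<Rightarrow> (nat \<times> nat) option \<Rightarrow> 'd mpoly" where
  "realization_step c W t =
     (\<Sum>s\<in>insert None (Some ` ({..<I} \<times> {..<K})). Poly_Mapping.single 0 (L t s) * realization_input c W s)"

primrec realization_state :: "complex \<Rightarrow> nat \<Rightarrow> nat \<times> nat \<Rightarrow> 'd mpoly" where
  "realization_state c 0 = (\<lambda>_. 0)"
| "realization_state c (Suc m) = (\<lambda>z. realization_step c (realization_state c m) (Some z))"

lemma mpoly_coord_realization_step:
  assumes x: "commuting n x" and v: "dim_vec v = n" and r: "r < n"
  shows "mpoly_coord x v (realization_step c W t) r =
    (\<Sum>s\<in>insert None (Some ` ({..<I} \<times> {..<K})). L t s * mpoly_coord x v (realization_input c W s) r)"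
proof -
  have "finite (insert None (Some ` ({..<I} \<times> {..<K})))" by simp
  thus ?thesis
    using r by (simp only: realization_step_def mpoly_coord_sum[OF x v] mpoly_coord_const_mult[OF x v])
qed

lemma mpoly_eval_realization_step:
  "mpoly_eval (realization_step c W t) z = (\<Sum>s\<in>insert None (Some ` ({..<I} \<times> {..<K})). L t s *
     (case s of None \<Rightarrow> c | Some (a, k) \<Rightarrow> \<Sum>b<J. mpoly_eval (p $$ (a, b)) z * mpoly_eval (W (b, k)) z))"
proof -
  have sum: "mpoly_eval (\<Sum>i\<in>A. q i) z = (\<Sum>i\<in>A. mpoly_eval (q i) z)" if "finite A" for A :: "'i set" and q
    using that by (induction A rule: finite_induct) (simp_all add: mpoly_eval_add)
  have "mpoly_eval (realization_input c W s) z =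
    (case s of None \<Rightarrow> c | Some (a, k) \<Rightarrow> \<Sum>b<J. mpoly_eval (p $$ (a, b)) z * mpoly_eval (W (b, k)) z)" for s
    by (auto simp: realization_input_def mpoly_eval_single sum mpoly_eval_mult split: option.splits)
  thus ?thesis
    unfolding realization_step_def by (subst sum) (simp_all add: mpoly_eval_mult mpoly_eval_single del: sum.insert)
qed

text \<open>Linearity in the pair (c, W) reduces increments and errors to the case c = 0, where the
  step is a contraction.\<close>

lemma realization_step_diff:
  "realization_step c W t - realization_step c' W' t = realization_step (c - c') (\<lambda>z. W z - W' z) t"
proof -
  have "realization_input c W s - realization_input c' W' s = realization_input (c - c') (\<lambda>z. W z - W' z) s" for s
    by (auto simp: realization_input_def single_diff right_diff_distrib sum_subtractf split: option.splits)
  thus ?thesis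
    unfolding realization_step_def sum_subtractf[symmetric] right_diff_distrib[symmetric] by simp
qed

lemma sum_insert_None:
  fixes g :: "(nat \<times> nat) option \<Rightarrow> 'z::comm_monoid_add"
  shows "(\<Sum>s\<in>insert None (Some ` ({..<i} \<times> {..<k})). g s) = g None + (\<Sum>z\<in>{..<i} \<times> {..<k}. g (Some z))"
  by (subst sum.insert) (auto simp: sum.reindex)

context
  assumes p: "p \<in> carrier_mat I J"
    and L: "\<And>v. (\<Sum>t\<in>insert None (Some ` ({..<J} \<times> {..<K})).
      (cmod (\<Sum>s\<in>insert None (Some ` ({..<I} \<times> {..<K})). L t s * v s))\<^sup>2)
      \<le> (\<Sum>s\<in>insert None (Some ` ({..<I} \<times> {..<K})). (cmod (v s))\<^sup>2)"
begin

text \<open>The contraction L mixes channels but not the coordinates of a vector, so its inequality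
  is applied for each coordinate r and summed. Only the input fed through p picks up the norm of
  p(x).\<close>

lemma realization_step_energy:
  assumes x: "commuting n x" and v: "dim_vec v = n"
  shows "(mpoly_vec_norm n x v (realization_step c W None))\<^sup>2
      + (\<Sum>z\<in>{..<J} \<times> {..<K}. (mpoly_vec_norm n x v (realization_step c W (Some z)))\<^sup>2)
    \<le> (cmod c * vec_l2 v)\<^sup>2 + (op_norm (pmat_mat p x))\<^sup>2 * (\<Sum>z\<in>{..<J} \<times> {..<K}. (mpoly_vec_norm n x v (W z))\<^sup>2)"
proof -
  let ?A = "insert None (Some ` ({..<I} \<times> {..<K}))" and ?B = "insert None (Some ` ({..<J} \<times> {..<K}))"
  let ?c = "mpoly_coord x v" and ?N = "mpoly_vec_norm n x v"
  have "(\<Sum>t\<in>?B. (?N (realization_step c W t))\<^sup>2) = (\<Sum>r<n. \<Sum>t\<in>?B. (cmod (\<Sum>s\<in>?A. L t s * ?c (realization_input c W s) r))\<^sup>2)"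
    unfolding mpoly_vec_norm_square[OF x v]
    by (subst sum.swap) (intro sum.cong refl, simp only: mpoly_coord_realization_step[OF x v] lessThan_iff)
  also have "\<dots> \<le> (\<Sum>r<n. \<Sum>s\<in>?A. (cmod (?c (realization_input c W s) r))\<^sup>2)"
    by (intro sum_mono L)
  also have "\<dots> = (\<Sum>s\<in>?A. (?N (realization_input c W s))\<^sup>2)"
    unfolding mpoly_vec_norm_square[OF x v] by (rule sum.swap)
  also have "\<dots> = (?N (realization_input c W None))\<^sup>2 + (\<Sum>z\<in>{..<I} \<times> {..<K}. (?N (realization_input c W (Some z)))\<^sup>2)"
    by (rule sum_insert_None)
  also have "(?N (realization_input c W None))\<^sup>2 = (cmod c * vec_l2 v)\<^sup>2"
    unfolding mpoly_vec_norm_square[OF x v] power_mult_distrib vec_l2_square v sum_distrib_left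
    by (intro sum.cong) (auto simp: realization_input_def mpoly_coord_const[OF x v] norm_mult power_mult_distrib)
  also have "(\<Sum>z\<in>{..<I} \<times> {..<K}. (?N (realization_input c W (Some z)))\<^sup>2) =
    (\<Sum>k<K. \<Sum>a<I. \<Sum>r<n. (cmod (\<Sum>b<J. vec_index (mpoly_mat (p $$ (a, b)) x *\<^sub>v (mpoly_mat (W (b, k)) x *\<^sub>v v)) r))\<^sup>2)"
    unfolding mpoly_vec_norm_square[OF x v] sum_Times_swap
    by (intro sum.cong refl) (simp add: realization_input_def mpoly_coord_sum[OF x v] mpoly_coord_mult[OF x v])
  also have "\<dots> \<le> (\<Sum>k<K. (op_norm (pmat_mat p x))\<^sup>2 * (\<Sum>b<J. \<Sum>r<n. (cmod (vec_index (mpoly_mat (W (b, k)) x *\<^sub>v v) r))\<^sup>2))"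
    using mpoly_mat_carrier[OF x] by (intro sum_mono pmat_mat_norm_bound[OF x p]) (simp add: carrier_matD[OF mpoly_mat_carrier[OF x]])
  also have "\<dots> = (op_norm (pmat_mat p x))\<^sup>2 * (\<Sum>z\<in>{..<J} \<times> {..<K}. (?N (W z))\<^sup>2)"
    unfolding mpoly_vec_norm_square[OF x v] mpoly_coord_def sum_Times_swap sum_distrib_left ..
  finally show ?thesis unfolding sum_insert_None by simp
qed

definition state_norm :: "nat \<Rightarrow> 'd mat_tuple \<Rightarrow> complex Matrix.vec \<Rightarrow> (nat \<times> nat \<Rightarrow> 'd mpoly) \<Rightarrow> real" where
  "state_norm n x v W = L2_set (\<lambda>z. mpoly_vec_norm n x v (W z)) ({..<J} \<times> {..<K})"

lemma state_norm_square: "(state_norm n x v W)\<^sup>2 = (\<Sum>z\<in>{..<J} \<times> {..<K}. (mpoly_vec_norm n x v (W z))\<^sup>2)"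
  by (simp add: state_norm_def L2_set_def sum_nonneg)

lemma state_norm_nonneg: "state_norm n x v W \<ge> 0"
  by (simp add: state_norm_def L2_set_nonneg)

lemma realization_step_contraction:
  assumes x: "commuting n x" and v: "dim_vec v = n"
  shows "state_norm n x v (\<lambda>z. realization_step 0 W (Some z)) \<le> op_norm (pmat_mat p x) * state_norm n x v W"
    and "mpoly_vec_norm n x v (realization_step 0 W None) \<le> op_norm (pmat_mat p x) * state_norm n x v W"
proof -
  have e: "(mpoly_vec_norm n x v (realization_step 0 W None))\<^sup>2 + (state_norm n x v (\<lambda>z. realization_step 0 W (Some z)))\<^sup>2
    \<le> (op_norm (pmat_mat p x) * state_norm n x v W)\<^sup>2"
    using realization_step_energy[OF x v, of 0 W] by (simp add: state_norm_square power_mult_distrib)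
  have n: "0 \<le> op_norm (pmat_mat p x) * state_norm n x v W"
    by (intro mult_nonneg_nonneg op_norm_nonneg state_norm_nonneg)
  show "state_norm n x v (\<lambda>z. realization_step 0 W (Some z)) \<le> op_norm (pmat_mat p x) * state_norm n x v W"
    by (rule power2_le_imp_le[OF _ n])
      (use e zero_le_power2[of "mpoly_vec_norm n x v (realization_step 0 W None)"] in linarith)
  show "mpoly_vec_norm n x v (realization_step 0 W None) \<le> op_norm (pmat_mat p x) * state_norm n x v W"
    by (rule power2_le_imp_le[OF _ n])
      (use e zero_le_power2[of "state_norm n x v (\<lambda>z. realization_step 0 W (Some z))"] in linarith)
qed

lemma state_norm_triangle:
  assumes x: "commuting n x" and v: "dim_vec v = n"
  shows "state_norm n x v W \<le> state_norm n x v W' + state_norm n x v (\<lambda>z. W z - W' z)"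
proof -
  have "state_norm n x v W \<le> L2_set (\<lambda>z. mpoly_vec_norm n x v (W' z) + mpoly_vec_norm n x v (W z - W' z)) ({..<J} \<times> {..<K})"
    unfolding state_norm_def
    by (intro L2_set_mono mpoly_vec_norm_triangle[OF x v] mpoly_vec_norm_nonneg[OF x v])
  also have "\<dots> \<le> state_norm n x v W' + state_norm n x v (\<lambda>z. W z - W' z)"
    unfolding state_norm_def by (rule L2_set_triangle_ineq)
  finally show ?thesis .
qed

lemma realization_output_bound:
  assumes x: "commuting n x" and \<rho>: "op_norm (pmat_mat p x) < 1" and c: "c \<ge> 0"
  shows "op_norm (mpoly_mat (realization_step (of_real c) (realization_state (of_real c) m) None) x)
    \<le> c * sqrt (1 + 2 * op_norm (pmat_mat p x) ^ m / (1 - op_norm (pmat_mat p x)))"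
proof (rule op_norm_le)
  let ?\<rho> = "op_norm (pmat_mat p x)" and ?W = "realization_state (of_real c)"
  have \<rho>0: "?\<rho> \<ge> 0" by (rule op_norm_nonneg)
  have pos: "1 + 2 * ?\<rho> ^ m / (1 - ?\<rho>) \<ge> 0" using \<rho> \<rho>0 by simp
  show C: "0 \<le> c * sqrt (1 + 2 * ?\<rho> ^ m / (1 - ?\<rho>))" using c pos by (intro mult_nonneg_nonneg real_sqrt_ge_zero) auto
  let ?q = "\<lambda>m. realization_step (of_real c) (?W m) None"
  fix v :: "complex Matrix.vec" assume "dim_vec v = dim_col (mpoly_mat (?q m) x)"
  hence v: "dim_vec v = n" using mpoly_mat_carrier[OF x, of "?q m"] by simp
  let ?x = "\<lambda>m. state_norm n x v (?W m)" and ?d = "\<lambda>m. state_norm n x v (\<lambda>z. ?W (Suc m) z - ?W m z)"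
  have en: "(mpoly_vec_norm n x v (?q m))\<^sup>2 + (?x (Suc m))\<^sup>2 \<le> (c * vec_l2 v)\<^sup>2 + ?\<rho>\<^sup>2 * (?x m)\<^sup>2" for m
    using realization_step_energy[OF x v, of "of_real c" "?W m"] c by (simp add: state_norm_square)
  have x0: "?x 0 = 0"
    by (simp add: state_norm_def mpoly_vec_norm_def[OF x v] mpoly_coord_zero[OF x v] L2_set_def)
  have "(mpoly_vec_norm n x v (?q m))\<^sup>2 \<le> (c * vec_l2 v)\<^sup>2 * (1 + 2 * ?\<rho> ^ m / (1 - ?\<rho>))"
  proof (rule energy_iteration_bound[OF \<rho>0 \<rho>])
    show "?x 0 = 0" by (rule x0)
    show "0 \<le> ?x m" for m by (rule state_norm_nonneg)
    show "(mpoly_vec_norm n x v (?q m))\<^sup>2 + (?x (Suc m))\<^sup>2 \<le> (c * vec_l2 v)\<^sup>2 + ?\<rho>\<^sup>2 * (?x m)\<^sup>2" for m by (rule en)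
    have sym: "state_norm n x v (\<lambda>z. W z - W' z) = state_norm n x v (\<lambda>z. W' z - W z)" for W W'
      unfolding state_norm_def by (intro L2_set_cong refl mpoly_vec_norm_commute[OF x v])
    show "\<bar>?x (Suc m) - ?x m\<bar> \<le> ?d m" for m
      using state_norm_triangle[OF x v, of "?W (Suc m)" "?W m"] state_norm_triangle[OF x v, of "?W m" "?W (Suc m)"]
        sym[of "?W (Suc m)" "?W m"] by linarith
    show "?d (Suc m) \<le> ?\<rho> * ?d m" for m
    proof -
      have "(\<lambda>z. ?W (Suc (Suc m)) z - ?W (Suc m) z) = (\<lambda>z. realization_step 0 (\<lambda>z. ?W (Suc m) z - ?W m z) (Some z))"
        using realization_step_diff[of "of_real c" "?W (Suc m)" _ "of_real c" "?W m"] by simp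
      thus ?thesis using realization_step_contraction(1)[OF x v, of "\<lambda>z. ?W (Suc m) z - ?W m z"] by simp
    qed
    \<comment> \<open>The first increment is the first state, and the energy balance bounds it by c
      |v| because the iteration starts at 0.\<close>
    have "?\<rho>\<^sup>2 * (?x 0)\<^sup>2 = 0" by (simp only: x0) simp
    hence "(?x (Suc 0))\<^sup>2 \<le> (c * vec_l2 v)\<^sup>2"
      using en[of 0] zero_le_power2[of "mpoly_vec_norm n x v (?q 0)"] by linarith
    hence "?x (Suc 0) \<le> c * vec_l2 v" by (rule power2_le_imp_le) (use c in simp)
    thus "?d 0 \<le> c * vec_l2 v" by simp
  qed
  also have "\<dots> = (c * sqrt (1 + 2 * ?\<rho> ^ m / (1 - ?\<rho>)) * vec_l2 v)\<^sup>2"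
    using pos by (simp add: power_mult_distrib mult_ac)
  finally show "vec_l2 (mpoly_mat (?q m) x *\<^sub>v v) \<le> c * sqrt (1 + 2 * ?\<rho> ^ m / (1 - ?\<rho>)) * vec_l2 v"
    unfolding mpoly_vec_norm_vec_l2[OF x v] by (rule power2_le_imp_le) (use C in simp)
qed

text \<open>Where p has norm below 1 the step contracts the state, so the iteration converges
  geometrically to any fixed point. At a node the fixed point U consists of the model vectors and
  the output there is the value of f.\<close>

lemma realization_output_limit:
  assumes z: "op_norm (pmat_eval p z) < 1"
    and fixpoint: "\<And>y. y \<in> {..<J} \<times> {..<K} \<Longrightarrow> mpoly_eval (realization_step c (\<lambda>y. Poly_Mapping.single 0 (U y)) (Some y)) z = U y"
    and out: "mpoly_eval (realization_step c (\<lambda>y. Poly_Mapping.single 0 (U y)) None) z = w"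
  shows "(\<lambda>m. mpoly_eval (realization_step c (realization_state c m) None) z) \<longlonglongrightarrow> w"
proof -
  let ?x = "scalar_tuple z" and ?v = "unit_vec 1 0 :: complex Matrix.vec" and ?W = "realization_state c"
  \<comment> \<open>The fixed point is a family of numbers at the single point z. Encoding it by
    constant polynomials lets the estimates for polynomial states be reused, with z as a scalar
    tuple.\<close>
  let ?U = "\<lambda>y. Poly_Mapping.single 0 (U y) :: 'd mpoly"
  note x = commuting_scalar_tuple[of z]
  have v: "dim_vec ?v = 1" by simp
  have nrm: "mpoly_vec_norm 1 ?x ?v q = cmod (mpoly_eval q z)" for q
    unfolding mpoly_vec_norm_def[OF x v] mpoly_coord_def mpoly_mat_scalar_tuple L2_set_def
    by (simp add: scalar_prod_def)
  define \<rho> where "\<rho> = op_norm (pmat_mat p ?x)"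
  have \<rho>: "0 \<le> \<rho>" "\<rho> < 1" using z by (auto simp: \<rho>_def op_norm_nonneg pmat_mat_scalar_tuple)
  have ediff: "mpoly_eval (q - q') z = mpoly_eval q z - mpoly_eval q' z" for q q'
    using mpoly_eval_add[of "q - q'" q' z] by simp
  have e: "state_norm 1 ?x ?v (\<lambda>y. ?W m y - ?U y) \<le> \<rho> ^ m * state_norm 1 ?x ?v (\<lambda>y. ?W 0 y - ?U y)" for m
  proof (induction m)
    case (Suc m)
    have "state_norm 1 ?x ?v (\<lambda>y. ?W (Suc m) y - ?U y) = state_norm 1 ?x ?v (\<lambda>y. realization_step 0 (\<lambda>y. ?W m y - ?U y) (Some y))"
      unfolding state_norm_def nrm
      using realization_step_diff[of c "?W m" _ c ?U, symmetric] fixpoint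
      by (intro L2_set_cong refl) (simp add: ediff mpoly_eval_single monom_eval_0)
    also have "\<dots> \<le> \<rho> * state_norm 1 ?x ?v (\<lambda>y. ?W m y - ?U y)"
      unfolding \<rho>_def by (rule realization_step_contraction[OF x v])
    also have "\<dots> \<le> \<rho> * (\<rho> ^ m * state_norm 1 ?x ?v (\<lambda>y. ?W 0 y - ?U y))"
      by (intro mult_left_mono Suc \<rho>)
    finally show ?case by simp
  qed simp
  have bd: "cmod (mpoly_eval (realization_step c (?W m) None) z - w) \<le> \<rho> ^ Suc m * state_norm 1 ?x ?v (\<lambda>y. ?W 0 y - ?U y)" for m
  proof -
    have "cmod (mpoly_eval (realization_step c (?W m) None) z - w) = mpoly_vec_norm 1 ?x ?v (realization_step 0 (\<lambda>y. ?W m y - ?U y) None)"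
      unfolding nrm using realization_step_diff[of c "?W m" None c ?U, symmetric] out by (simp add: ediff)
    also have "\<dots> \<le> \<rho> * state_norm 1 ?x ?v (\<lambda>y. ?W m y - ?U y)"
      unfolding \<rho>_def by (rule realization_step_contraction[OF x v])
    also have "\<dots> \<le> \<rho> * (\<rho> ^ m * state_norm 1 ?x ?v (\<lambda>y. ?W 0 y - ?U y))"
      by (intro mult_left_mono e \<rho>)
    finally show ?thesis by simp
  qed
  have lim: "(\<lambda>m. \<rho> ^ Suc m * state_norm 1 ?x ?v (\<lambda>y. ?W 0 y - ?U y)) \<longlonglongrightarrow> 0"
    by (rule tendsto_mult_left_zero[OF LIMSEQ_Suc[OF LIMSEQ_power_zero]]) (use \<rho> in simp)
  have "\<forall>m. norm (mpoly_eval (realization_step c (?W m) None) z - w) \<le> \<rho> ^ Suc m * state_norm 1 ?x ?v (\<lambda>y. ?W 0 y - ?U y)"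
    using bd by blast
  from Lim_null_comparison[OF always_eventually[OF this] lim] have "(\<lambda>m. mpoly_eval (realization_step c (?W m) None) z - w) \<longlonglongrightarrow> 0"
    .
  thus ?thesis by (simp add: LIM_zero_iff)
qed

end

end

lemma sum_pmat_eval_bound:
  assumes p: "p \<in> carrier_mat I J"
  shows "(\<Sum>a<I. (cmod (\<Sum>b<J. mpoly_eval (p $$ (a, b)) z * w b))\<^sup>2) \<le> (op_norm (pmat_eval p z))\<^sup>2 * (\<Sum>b<J. (cmod (w b))\<^sup>2)"
proof -
  have "(\<Sum>a<I. \<Sum>r<1. (cmod (\<Sum>b<J. vec_index (mpoly_mat (p $$ (a, b)) (scalar_tuple z) *\<^sub>v Matrix.vec 1 (\<lambda>_. w b)) r))\<^sup>2)
    \<le> (op_norm (pmat_mat p (scalar_tuple z)))\<^sup>2 * (\<Sum>b<J. \<Sum>r<1. (cmod (vec_index (Matrix.vec 1 (\<lambda>_. w b)) r))\<^sup>2)"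
    by (rule pmat_mat_norm_bound[OF commuting_scalar_tuple p]) simp
  thus ?thesis
    by (simp add: pmat_mat_scalar_tuple mpoly_mat_scalar_tuple scalar_prod_def)
qed

text \<open>The index k prescribes the quality of the norm bound: an iterate with index m \<ge> k is
  taken, and the bound decreases in m. Interpolation on \<Lambda> is only approximate because the
  iteration reaches the fixed point in the limit.\<close>

lemma polynomial_approximants:
  fixes p :: "'d::finite mpoly mat"
  assumes p: "p \<in> carrier_mat I J" and J: "J \<ge> 1" and V: "V \<subseteq> G_dom p"
    and f: "f \<in> Hol_sub V" and c: "c \<ge> 0"
    and bound: "\<And>y. y \<in> F_dom_sub p V \<Longrightarrow> op_norm (fun_calc_sub V f y) \<le> c"
    and \<Lambda>: "finite \<Lambda>" "\<Lambda> \<subseteq> V" and \<epsilon>: "\<epsilon> > 0"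
  shows "\<exists>q. (\<forall>x\<in>F_dom p. op_norm (mpoly_mat q x) \<le> c * sqrt (1 + 2 * op_norm (pmat_mat p x) ^ k / (1 - op_norm (pmat_mat p x)))) \<and>
    (\<forall>z\<in>\<Lambda>. cmod (mpoly_eval q z - f z) < \<epsilon>)"
proof (cases "\<Lambda> = {}")
  case True
  have "op_norm (mpoly_mat 0 x) \<le> c * sqrt (1 + 2 * op_norm (pmat_mat p x) ^ k / (1 - op_norm (pmat_mat p x)))"
    if x: "x \<in> F_dom p" for x
  proof -
    have "x \<in> comm_tuples" and \<rho>: "op_norm (pmat_mat p x) < 1" using x by (auto simp: F_dom_def)
    then obtain n where n: "commuting n x" unfolding comm_tuples_eq by blast
    have "op_norm (mpoly_mat 0 x) \<le> 0" unfolding mpoly_mat_0[OF n]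
    proof (rule op_norm_le)
      fix v :: "complex Matrix.vec" assume "dim_vec v = dim_col (0\<^sub>m n n :: complex mat)"
      hence "0\<^sub>m n n *\<^sub>v v = 0\<^sub>v n" by (intro eq_vecI) (auto simp: scalar_prod_def)
      thus "vec_l2 (0\<^sub>m n n *\<^sub>v v) \<le> 0 * vec_l2 v" by simp
    qed simp
    also have "\<dots> \<le> c * sqrt (1 + 2 * op_norm (pmat_mat p x) ^ k / (1 - op_norm (pmat_mat p x)))"
      using c \<rho> op_norm_nonneg[of "pmat_mat p x"] by simp
    finally show ?thesis .
  qed
  thus ?thesis using True by (intro exI[of _ 0]) auto
next
  case False
  define N where "N = card \<Lambda>"
  have N: "N \<ge> 1" using False \<Lambda>(1) by (simp add: N_def Suc_le_eq card_gt_0_iff)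
  obtain lam where lam: "bij_betw lam {..<N} \<Lambda>"
    using ex_bij_betw_nat_finite[OF \<Lambda>(1)] unfolding N_def atLeast0LessThan by blast
  have lamV: "lam ` {..<N} \<subseteq> V" and lams: "lam ` {..<N} = \<Lambda>" using lam \<Lambda>(2) by (auto simp: bij_betw_def)
  have lamG: "op_norm (pmat_eval p (lam i)) < 1" if "i < N" for i
    using that lamV V by (auto simp: G_dom_def)
  define P where "P i a b = mpoly_eval (p $$ (a, b)) (lam i)" for i a b
  \<comment> \<open>A common bound over the finitely many nodes, squared because the contraction is
    stated for squared norms.\<close>
  define R where "R = (Max ((\<lambda>i. op_norm (pmat_eval p (lam i))) ` {..<N}))\<^sup>2"
  have max: "op_norm (pmat_eval p (lam i)) \<le> Max ((\<lambda>i. op_norm (pmat_eval p (lam i))) ` {..<N})" if "i < N" for i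
    using that by (intro Max_ge) auto
  have "Max ((\<lambda>i. op_norm (pmat_eval p (lam i))) ` {..<N}) < 1"
    using N lamG by (subst Max_less_iff) (auto simp: lessThan_empty_iff)
  moreover have "0 \<le> Max ((\<lambda>i. op_norm (pmat_eval p (lam i))) ` {..<N})"
    using max[of 0] N op_norm_nonneg[of "pmat_eval p (lam 0)"] by linarith
  ultimately have R: "0 \<le> R" "R < 1" by (auto simp: R_def abs_square_less_1)
  define M where "M i j = of_real (c\<^sup>2) - cnj (f (lam i)) * f (lam j)" for i j
  have "\<exists>u. \<forall>i<N. \<forall>j<N. M i j = (\<Sum>k<N * J. (\<Sum>b<J. cnj (u i b k) * u j b k) -
    (\<Sum>a<I. cnj (\<Sum>b<J. P i a b * u i b k) * (\<Sum>b<J. P j a b * u j b k)))"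
  proof (rule model_exists[OF J R])
    show "(\<Sum>a<I. (cmod (\<Sum>b<J. P i a b * w b))\<^sup>2) \<le> R * (\<Sum>b<J. (cmod (w b))\<^sup>2)" if "i < N" for i w
    proof -
      have "(\<Sum>a<I. (cmod (\<Sum>b<J. P i a b * w b))\<^sup>2) \<le> (op_norm (pmat_eval p (lam i)))\<^sup>2 * (\<Sum>b<J. (cmod (w b))\<^sup>2)"
        unfolding P_def by (rule sum_pmat_eval_bound[OF p])
      also have "\<dots> \<le> R * (\<Sum>b<J. (cmod (w b))\<^sup>2)"
        unfolding R_def using max[OF that] by (intro mult_right_mono power_mono op_norm_nonneg sum_nonneg) auto
      finally show ?thesis .
    qed
    show "M i j = cnj (M j i)" for i j by (simp add: M_def mult.commute)
    show "0 \<le> Re (\<Sum>i<N. \<Sum>j<N. Q i j * M i j)"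
      if "psd_on {..<N} Q" "\<epsilon> > 0" "\<And>v. \<epsilon> * (\<Sum>i<N. (cmod (v i))\<^sup>2) \<le> herm_form {..<N} Q v" "0 < \<delta>" "\<delta> \<le> 1"
        "\<And>u. (\<Sum>a<I. herm_form {..<N} Q (\<lambda>i. \<Sum>b<J. P i a b * u i b)) \<le> (1 - \<delta>) * (\<Sum>b<J. herm_form {..<N} Q (\<lambda>i. u i b))"
      for Q \<epsilon> \<delta>
      unfolding M_def by (rule gns_positivity[OF p lamV N f c bound that[unfolded P_def]])
  qed
  then obtain u where u: "\<forall>i<N. \<forall>j<N. M i j = (\<Sum>k<N * J. (\<Sum>b<J. cnj (u i b k) * u j b k) -
    (\<Sum>a<I. cnj (\<Sum>b<J. P i a b * u i b k) * (\<Sum>b<J. P j a b * u j b k)))" ..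
  define K where "K = N * J"
  let ?A = "insert None (Some ` ({..<I} \<times> {..<K}))" and ?B = "insert None (Some ` ({..<J} \<times> {..<K}))"
  \<comment> \<open>Moving the negative terms of the model to the other side makes it an equality of
    Gram matrices: of the inputs (c, p u) and of the outputs (f, u) at the nodes.\<close>
  define av where "av j s = (case s of None \<Rightarrow> of_real c | Some (a, k) \<Rightarrow> \<Sum>b<J. P j a b * u j b k)" for j s
  define bv where "bv j t = (case t of None \<Rightarrow> f (lam j) | Some (b, k) \<Rightarrow> u j b k)" for j t
  have "ip ?A (av i) (av j) = ip ?B (bv i) (bv j)" if "i < N" "j < N" for i j
  proof -
    have "ip ?A (av i) (av j) = of_real (c\<^sup>2) + (\<Sum>k<K. \<Sum>a<I. cnj (\<Sum>b<J. P i a b * u i b k) * (\<Sum>b<J. P j a b * u j b k))"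
      unfolding ip_def sum_insert_None sum_Times_swap
      by (simp add: av_def power2_eq_square)
    moreover have "ip ?B (bv i) (bv j) = cnj (f (lam i)) * f (lam j) + (\<Sum>k<K. \<Sum>b<J. cnj (u i b k) * u j b k)"
      unfolding ip_def sum_insert_None sum_Times_swap
      by (simp add: bv_def)
    moreover have "of_real (c\<^sup>2) - cnj (f (lam i)) * f (lam j) = (\<Sum>k<K. \<Sum>b<J. cnj (u i b k) * u j b k) -
      (\<Sum>k<K. \<Sum>a<I. cnj (\<Sum>b<J. P i a b * u i b k) * (\<Sum>b<J. P j a b * u j b k))"
      using u that unfolding M_def K_def sum_subtractf by blast
    ultimately show ?thesis by (simp add: algebra_simps)
  qed
  hence "\<exists>L. (\<forall>j<N. \<forall>t\<in>?B. (\<Sum>s\<in>?A. L t s * av j s) = bv j t) \<and>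
    (\<forall>v. (\<Sum>t\<in>?B. (cmod (\<Sum>s\<in>?A. L t s * v s))\<^sup>2) \<le> (\<Sum>s\<in>?A. (cmod (v s))\<^sup>2))"
    by (intro lurking_isometry finite.insertI finite_imageI finite_cartesian_product finite_lessThan)
  then obtain L where L1: "\<forall>j<N. \<forall>t\<in>?B. (\<Sum>s\<in>?A. L t s * av j s) = bv j t" and
    L2: "\<forall>v. (\<Sum>t\<in>?B. (cmod (\<Sum>s\<in>?A. L t s * v s))\<^sup>2) \<le> (\<Sum>s\<in>?A. (cmod (v s))\<^sup>2)"
    by (elim exE conjE) (rule that)
  define q where "q m = realization_step p I J K L (of_real c) (realization_state p I J K L (of_real c) m) None" for m
  have "(\<lambda>m. mpoly_eval (q m) (lam i)) \<longlonglongrightarrow> f (lam i)" if i: "i < N" for i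
    unfolding q_def
  proof (rule realization_output_limit[OF p spec[OF L2] lamG[OF i], where U = "\<lambda>(b, k). u i b k"])
    have e: "mpoly_eval (realization_step p I J K L (of_real c) (\<lambda>y. Poly_Mapping.single 0 (case y of (b, k) \<Rightarrow> u i b k)) t) (lam i) = bv i t"
      if "t \<in> ?B" for t
    proof -
      have "(\<Sum>s\<in>?A. L t s * av i s) = bv i t" using L1 i that by blast
      thus ?thesis unfolding mpoly_eval_realization_step av_def P_def
        by (simp only: mpoly_eval_single monom_eval_0 mult_1_right case_prod_conv)
    qed
    show "mpoly_eval (realization_step p I J K L (of_real c) (\<lambda>y. Poly_Mapping.single 0 (case y of (b, k) \<Rightarrow> u i b k)) (Some y)) (lam i)
        = (case y of (b, k) \<Rightarrow> u i b k)" if "y \<in> {..<J} \<times> {..<K}" for y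
      using e[of "Some y"] that by (auto simp: bv_def)
    show "mpoly_eval (realization_step p I J K L (of_real c) (\<lambda>y. Poly_Mapping.single 0 (case y of (b, k) \<Rightarrow> u i b k)) None) (lam i) = f (lam i)"
      using e[of None] by (simp add: bv_def)
  qed
  hence "\<forall>i<N. eventually (\<lambda>m. cmod (mpoly_eval (q m) (lam i) - f (lam i)) < \<epsilon>) sequentially"
    using \<epsilon> by (auto simp: tendsto_iff dist_norm)
  hence "eventually (\<lambda>m. \<forall>i\<in>{..<N}. cmod (mpoly_eval (q m) (lam i) - f (lam i)) < \<epsilon>) sequentially"
    by (intro eventually_ball_finite) auto
  hence "eventually (\<lambda>m. m \<ge> k \<and> (\<forall>i\<in>{..<N}. cmod (mpoly_eval (q m) (lam i) - f (lam i)) < \<epsilon>)) sequentially"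
    by (intro eventually_conj eventually_ge_at_top)
  then obtain m where m: "m \<ge> k" "\<forall>i\<in>{..<N}. cmod (mpoly_eval (q m) (lam i) - f (lam i)) < \<epsilon>"
    unfolding eventually_sequentially by blast
  show ?thesis
  proof (intro exI[of _ "q m"] conjI ballI)
    fix z assume "z \<in> \<Lambda>"
    thus "cmod (mpoly_eval (q m) z - f z) < \<epsilon>" using m(2) unfolding lams[symmetric] by blast
  next
    fix x assume x: "x \<in> F_dom p"
    let ?\<rho> = "op_norm (pmat_mat p x)"
    have "x \<in> comm_tuples" and \<rho>: "?\<rho> < 1" using x by (auto simp: F_dom_def)
    then obtain n where n: "commuting n x" unfolding comm_tuples_eq by blast
    have \<rho>0: "?\<rho> \<ge> 0" by (rule op_norm_nonneg)
    have "op_norm (mpoly_mat (q m) x) \<le> c * sqrt (1 + 2 * ?\<rho> ^ m / (1 - ?\<rho>))"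
      unfolding q_def by (rule realization_output_bound[OF p spec[OF L2] n \<rho> c])
    also have "\<dots> \<le> c * sqrt (1 + 2 * ?\<rho> ^ k / (1 - ?\<rho>))"
      using c m(1) \<rho> \<rho>0
      by (intro mult_left_mono real_sqrt_le_mono add_left_mono divide_right_mono power_decreasing) auto
    finally show "op_norm (mpoly_mat (q m) x) \<le> c * sqrt (1 + 2 * ?\<rho> ^ k / (1 - ?\<rho>))" .
  qed
qed

section \<open>Limits of polynomial approximants\<close>

text \<open>In place of a convergent subnet, the filter is refined by the preimages of the
  neighbourhoods of a cluster point; along the refinement all coordinates converge at once.\<close>

lemma coordinatewise_cluster_filter:
  fixes g :: "'n \<Rightarrow> 'i \<Rightarrow> complex"
  assumes F: "F \<noteq> bot" and B: "\<And>n i. cmod (g n i) \<le> B i"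
  obtains F' b where "F' \<le> F" "F' \<noteq> bot" "\<forall>i. ((\<lambda>n. g n i) \<longlongrightarrow> b i) F'" "\<forall>i. cmod (b i) \<le> B i"
proof -
  let ?K = "{G :: 'i \<Rightarrow> complex. \<forall>p. cmod (G p) \<le> B p}"
  have "filtermap g F \<noteq> bot" using F by (simp add: filtermap_bot_iff)
  moreover have "eventually (\<lambda>G. G \<in> ?K) (filtermap g F)" using B by (simp add: eventually_filtermap)
  ultimately have "\<exists>b\<in>?K. inf (nhds b) (filtermap g F) \<noteq> bot"
    using compact_bounded_functions[of B] unfolding compact_filter by blast
  then obtain b where b: "b \<in> ?K" "inf (nhds b) (filtermap g F) \<noteq> bot" by blast
  define F' where "F' = inf (filtercomap g (nhds b)) F"
  have le: "F' \<le> F" by (simp add: F'_def)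
  have nb: "F' \<noteq> bot"
  proof
    assume "F' = bot"
    hence "eventually (\<lambda>_. False) F'" by simp
    then obtain Q R where Q: "eventually Q (filtercomap g (nhds b))" and R: "eventually R F" and QR: "\<And>n. Q n \<Longrightarrow> R n \<Longrightarrow> False"
      unfolding F'_def eventually_inf by blast
    obtain Q' where Q': "eventually Q' (nhds b)" "\<And>n. Q' (g n) \<Longrightarrow> Q n"
      using Q unfolding eventually_filtercomap by blast
    have "eventually (\<lambda>y. \<not> Q' y) (filtermap g F)"
      unfolding eventually_filtermap using R by (rule eventually_mono) (use QR Q'(2) in blast)
    hence "eventually (\<lambda>_. False) (inf (nhds b) (filtermap g F))"
      unfolding eventually_inf using Q'(1) by blast
    thus False using b(2) by (simp add: trivial_limit_def)
  qed
  have tl: "((\<lambda>n. g n i) \<longlongrightarrow> b i) F'" for i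
  proof -
    have "filterlim g (nhds b) (filtercomap g (nhds b))" by (rule filterlim_filtercomap)
    hence "filterlim g (nhds b) F'" by (rule filterlim_mono) (auto simp: F'_def)
    moreover have "((\<lambda>G :: 'i \<Rightarrow> complex. G i) \<longlongrightarrow> b i) (nhds b)"
    proof (rule topological_tendstoI)
      fix S :: "complex set" assume S: "open S" "b i \<in> S"
      have "open ((\<lambda>G :: 'i \<Rightarrow> complex. G i) -` S)"
        by (rule open_vimage[OF S(1) continuous_on_product_coordinates])
      thus "eventually (\<lambda>G. G i \<in> S) (nhds b)"
        unfolding eventually_nhds using S(2) by (intro exI[of _ "(\<lambda>G. G i) -` S"]) simp
    qed
    ultimately show ?thesis by (rule filterlim_compose[rotated])
  qed
  show ?thesis by (rule that[OF le nb]) (use tl b(1) in simp_all)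
qed

section \<open>Continuity of the functional calculus in the Taylor coefficients\<close>

definition mat_tendsto :: "nat \<Rightarrow> 'n filter \<Rightarrow> ('n \<Rightarrow> complex mat) \<Rightarrow> complex mat \<Rightarrow> bool" where
  "mat_tendsto m F A A0 \<longleftrightarrow> (\<forall>n. A n \<in> carrier_mat m m) \<and> A0 \<in> carrier_mat m m \<and>
     (\<forall>i<m. \<forall>j<m. ((\<lambda>n. A n $$ (i, j)) \<longlongrightarrow> A0 $$ (i, j)) F)"

lemma mat_tendsto_const: "A \<in> carrier_mat m m \<Longrightarrow> mat_tendsto m F (\<lambda>_. A) A"
  by (simp add: mat_tendsto_def)

lemma mat_tendsto_mult:
  assumes "mat_tendsto m F A A0" "mat_tendsto m F B B0"
  shows "mat_tendsto m F (\<lambda>n. A n * B n) (A0 * B0)"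
proof -
  have c: "A n \<in> carrier_mat m m" "B n \<in> carrier_mat m m" "A0 \<in> carrier_mat m m" "B0 \<in> carrier_mat m m" for n
    using assms by (auto simp: mat_tendsto_def)
  have lim: "((\<lambda>n. \<Sum>k<m. A n $$ (i, k) * B n $$ (k, j)) \<longlongrightarrow> (\<Sum>k<m. A0 $$ (i, k) * B0 $$ (k, j))) F" if "i < m" "j < m" for i j
    using assms that by (intro tendsto_sum tendsto_mult) (auto simp: mat_tendsto_def)
  have e: "(A n * B n) $$ (i, j) = (\<Sum>k<m. A n $$ (i, k) * B n $$ (k, j))"
    "(A0 * B0) $$ (i, j) = (\<Sum>k<m. A0 $$ (i, k) * B0 $$ (k, j))" if "i < m" "j < m" for i j n
    using that index_mult_mat_sum[of i "A n" j "B n"] index_mult_mat_sum[of i A0 j B0]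
      carrier_matD[OF c(1)] carrier_matD[OF c(2)] carrier_matD[OF c(3)] carrier_matD[OF c(4)] by simp_all
  show ?thesis unfolding mat_tendsto_def
  proof (intro conjI allI impI)
    fix i j assume ij: "i < m" "j < m"
    show "((\<lambda>n. (A n * B n) $$ (i, j)) \<longlongrightarrow> (A0 * B0) $$ (i, j)) F"
      unfolding e(1)[OF ij] e(2)[OF ij] by (rule lim[OF ij])
  qed (rule mult_carrier_mat[OF c(1) c(2)] mult_carrier_mat[OF c(3) c(4)])+
qed

lemma mat_tendsto_diag_block_mat:
  assumes "\<And>u. u \<in> set us \<Longrightarrow> mat_tendsto (m u) F (\<lambda>n. A n u) (A0 u)"
  shows "mat_tendsto (sum_list (map m us)) F (\<lambda>n. diag_block_mat (map (A n) us)) (diag_block_mat (map A0 us))"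
  using assms
proof (induction us)
  case Nil
  show ?case by (simp add: mat_tendsto_def)
next
  case (Cons u us)
  have 1: "mat_tendsto (m u) F (\<lambda>n. A n u) (A0 u)" using Cons.prems by simp
  have 2: "mat_tendsto (sum_list (map m us)) F (\<lambda>n. diag_block_mat (map (A n) us)) (diag_block_mat (map A0 us))"
    by (rule Cons.IH) (use Cons.prems in simp)
  have "mat_tendsto (k + l) F (\<lambda>n. four_block_mat (X n) (0\<^sub>m k l) (0\<^sub>m l k) (Y n)) (four_block_mat X0 (0\<^sub>m k l) (0\<^sub>m l k) Y0)"
    if X: "mat_tendsto k F X X0" and Y: "mat_tendsto l F Y Y0" for k l X X0 Y Y0
  proof -
    have c: "dim_row (X n) = k" "dim_col (X n) = k" "dim_row (Y n) = l" "dim_col (Y n) = l"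
      "dim_row X0 = k" "dim_col X0 = k" "dim_row Y0 = l" "dim_col Y0 = l" for n
      using X Y by (auto simp: mat_tendsto_def)
    show ?thesis unfolding mat_tendsto_def
    proof (intro conjI allI impI)
      fix i j assume ij: "i < k + l" "j < k + l"
      show "((\<lambda>n. four_block_mat (X n) (0\<^sub>m k l) (0\<^sub>m l k) (Y n) $$ (i, j)) \<longlongrightarrow>
        four_block_mat X0 (0\<^sub>m k l) (0\<^sub>m l k) Y0 $$ (i, j)) F"
        using X Y ij by (cases "i < k"; cases "j < k") (simp_all add: c mat_tendsto_def)
    qed (auto intro!: carrier_matI simp: c)
  qed
  from this[OF 1 2] show ?case
    using 1 2 by (simp add: Let_def mat_tendsto_def carrier_matD[of _ "m u" "m u"]
        carrier_matD[of _ "sum_list (map m us)" "sum_list (map m us)"])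
qed

lemma mat_tendsto_insert_series:
  assumes x: "commuting m x" and psa: "\<And>\<alpha>. ((\<lambda>n. power_series_at (g n) \<mu> \<alpha>) \<longlongrightarrow> power_series_at g0 \<mu> \<alpha>) F"
  shows "mat_tendsto m F (\<lambda>n. insert_series (g n) \<mu> x) (insert_series g0 \<mu> x)"
  unfolding mat_tendsto_def
proof (intro conjI allI impI)
  fix i j assume "i < m" "j < m"
  thus "((\<lambda>n. insert_series (g n) \<mu> x $$ (i, j)) \<longlongrightarrow> insert_series g0 \<mu> x $$ (i, j)) F"
    unfolding insert_series_def Let_def commuting_tuple_size[OF x]
    by (simp add: tendsto_sum tendsto_mult psa)
qed (rule insert_series_carrier[OF x])+

text \<open>One block decomposition of x serves all functions, and each block sees finitely many
  Taylor coefficients. Convergence of the coefficients at the joint eigenvalues, without any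
  uniformity, is therefore enough.\<close>

lemma mat_tendsto_fun_calc:
  assumes x: "commuting m x" "m \<ge> 1"
    and psa: "\<And>\<mu> \<alpha>. \<mu> \<in> joint_spectrum x \<Longrightarrow> ((\<lambda>n. power_series_at (g n) \<mu> \<alpha>) \<longlongrightarrow> power_series_at g0 \<mu> \<alpha>) F"
  shows "mat_tendsto m F (\<lambda>n. fun_calc (g n) x) (fun_calc g0 x)"
proof -
  obtain us T S where bd: "block_decomp x us T S" by (rule block_decomp_exists[OF x])
  note D = block_decompD[OF bd x(1)]
  have cm: "calc_mat (map (\<lambda>(\<mu>, u). (h, \<mu>, u)) us) = diag_block_mat (map (\<lambda>(\<mu>, u). insert_series h \<mu> u) us)" for h
    unfolding calc_mat_def by (simp add: case_prod_unfold o_def)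
  have "mat_tendsto (sum_list (map (\<lambda>(\<mu>, u). tuple_size u) us)) F
    (\<lambda>n. diag_block_mat (map (\<lambda>(\<mu>, u). insert_series (g n) \<mu> u) us)) (diag_block_mat (map (\<lambda>(\<mu>, u). insert_series g0 \<mu> u) us))"
  proof (rule mat_tendsto_diag_block_mat)
    fix z assume z: "z \<in> set us"
    obtain \<mu> u where zu: "z = (\<mu>, u)" by (cases z)
    have "quasi_scalar (tuple_size u) \<mu> u" using bd z zu by (auto simp: block_decomp_def)
    hence c: "commuting (tuple_size u) u" by (simp add: quasi_scalar_def)
    have "\<mu> \<in> joint_spectrum x" unfolding block_decomp_joint_spectrum[OF bd x(1)] using z zu by force
    from mat_tendsto_insert_series[OF c psa[OF this]]
    show "mat_tendsto (case z of (\<mu>, u) \<Rightarrow> tuple_size u) F (\<lambda>n. case z of (\<mu>, u) \<Rightarrow> insert_series (g n) \<mu> u)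
        (case z of (\<mu>, u) \<Rightarrow> insert_series g0 \<mu> u)" by (simp add: zu)
  qed
  hence "mat_tendsto m F (\<lambda>n. calc_mat (map (\<lambda>(\<mu>, u). (g n, \<mu>, u)) us)) (calc_mat (map (\<lambda>(\<mu>, u). (g0, \<mu>, u)) us))"
    unfolding cm D(5) .
  thus ?thesis unfolding fun_calc_eq[OF x bd]
    by (intro mat_tendsto_mult mat_tendsto_const D)
qed

lemma op_norm_limit_le:
  assumes A: "mat_tendsto m F A A0" and F: "F \<noteq> bot" and C: "\<And>n. op_norm (A n) \<le> C n" "(C \<longlongrightarrow> C0) F"
  shows "op_norm A0 \<le> C0"
proof (rule op_norm_le)
  have "0 \<le> C n" for n using op_norm_nonneg[of "A n"] C(1)[of n] by linarith
  thus "C0 \<ge> 0" by (intro tendsto_lowerbound[OF C(2) _ F]) auto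
  have c: "A n \<in> carrier_mat m m" "A0 \<in> carrier_mat m m" for n
    using A by (auto simp: mat_tendsto_def)
  fix v :: "complex Matrix.vec" assume "dim_vec v = dim_col A0"
  hence v: "dim_vec v = m" using c by simp
  have e: "vec_l2 (B *\<^sub>v v) = sqrt (\<Sum>i<m. (cmod (\<Sum>j<m. B $$ (i, j) * vec_index v j))\<^sup>2)" if "B \<in> carrier_mat m m" for B
    unfolding vec_l2_def using that v
    by (intro arg_cong[of _ _ sqrt] sum.cong) (auto simp: index_mult_mat_vec_sum simp del: index_mult_mat_vec)
  have lim: "((\<lambda>n. vec_l2 (A n *\<^sub>v v)) \<longlongrightarrow> vec_l2 (A0 *\<^sub>v v)) F"
    unfolding e[OF c(1)] e[OF c(2)] using A
    by (intro tendsto_intros) (auto simp: mat_tendsto_def)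
  have "\<forall>n. vec_l2 (A n *\<^sub>v v) \<le> C n * vec_l2 v"
  proof
    fix n
    have "vec_l2 (A n *\<^sub>v v) \<le> op_norm (A n) * vec_l2 v" by (rule op_norm_bound) (use carrier_matD[OF c(1)] v in simp)
    also have "\<dots> \<le> C n * vec_l2 v" by (intro mult_right_mono C) simp
    finally show "vec_l2 (A n *\<^sub>v v) \<le> C n * vec_l2 v" .
  qed
  from tendsto_le[OF F tendsto_mult_right[OF C(2)] lim always_eventually[OF this]]
  show "vec_l2 (A0 *\<^sub>v v) \<le> C0 * vec_l2 v" .
qed

section \<open>The extension\<close>

lemma cmod_mpoly_eval_le: "cmod (mpoly_eval q z) \<le> op_norm (mpoly_mat q (scalar_tuple z))"
proof -
  have "vec_l2 (mpoly_mat q (scalar_tuple z) *\<^sub>v unit_vec 1 0) \<le> op_norm (mpoly_mat q (scalar_tuple z)) * vec_l2 (unit_vec 1 0)"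
    by (rule op_norm_bound) (simp add: mpoly_mat_scalar_tuple)
  thus ?thesis unfolding mpoly_mat_scalar_tuple vec_l2_def by (simp add: scalar_prod_def)
qed

lemma mpoly_eval_coord_holomorphic: "(\<lambda>t. mpoly_eval q (\<mu> + coord_upd z i t)) holomorphic_on A"
proof -
  have "(\<lambda>t. (\<mu> + coord_upd z i t) $ j) holomorphic_on A" for j
    by (cases "j = i") (auto simp: coord_upd_def intro!: holomorphic_intros)
  thus ?thesis unfolding mpoly_eval_def monom_eval_def by (intro holomorphic_intros)
qed

lemma extension_exists:
  fixes p :: "'d::finite mpoly mat"
  assumes p: "p \<in> carrier_mat I J" and J: "J \<ge> 1" and V: "V \<subseteq> G_dom p"
    and f: "f \<in> Hol_sub V" and c: "c \<ge> 0"
    and bound: "\<And>y. y \<in> F_dom_sub p V \<Longrightarrow> op_norm (fun_calc_sub V f y) \<le> c"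
  shows "\<exists>F. holo_on F (G_dom p) \<and> (\<forall>z\<in>V. F z = f z) \<and> (\<forall>x\<in>F_dom p. op_norm (fun_calc F x) \<le> c)"
proof -
  define C where "C k \<rho> = c * sqrt (1 + 2 * \<rho> ^ k / (1 - \<rho>))" for k :: nat and \<rho> :: real
  \<comment> \<open>The approximants are indexed by pairs of an iteration quality and a set of
    nodes. For an infinite set the nodes default to none, so that the choice is total.\<close>
  have "\<forall>n. \<exists>q. (\<forall>x\<in>F_dom p. op_norm (mpoly_mat q x) \<le> C (fst n) (op_norm (pmat_mat p x))) \<and>
    (\<forall>z\<in>(if finite (snd n) then snd n \<inter> V else {}). cmod (mpoly_eval q z - f z) < 1 / Suc (fst n))"
    unfolding C_def by (intro allI polynomial_approximants[OF p J V f c bound]) auto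
  then obtain q where "\<forall>n. (\<forall>x\<in>F_dom p. op_norm (mpoly_mat (q n) x) \<le> C (fst n) (op_norm (pmat_mat p x))) \<and>
    (\<forall>z\<in>(if finite (snd n) then snd n \<inter> V else {}). cmod (mpoly_eval (q n) z - f z) < 1 / Suc (fst n))"
    by (rule choice[THEN exE]) (rule that)
  hence q: "\<And>n x. x \<in> F_dom p \<Longrightarrow> op_norm (mpoly_mat (q n) x) \<le> C (fst n) (op_norm (pmat_mat p x))"
    and qf: "\<And>n z. finite (snd n) \<Longrightarrow> z \<in> snd n \<Longrightarrow> z \<in> V \<Longrightarrow> cmod (mpoly_eval (q n) z - f z) < 1 / Suc (fst n)"
    by auto
  have "\<forall>\<mu>. \<exists>RM. \<mu> \<in> G_dom p \<longrightarrow> fst RM > 0 \<and> snd RM \<ge> 0 \<and>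
    (\<forall>z\<in>polydisc (fst RM). \<mu> + z \<in> G_dom p \<and> (\<forall>n. cmod (mpoly_eval (q n) (\<mu> + z)) \<le> snd RM))"
  proof
    fix \<mu>
    show "\<exists>RM. \<mu> \<in> G_dom p \<longrightarrow> fst RM > 0 \<and> snd RM \<ge> 0 \<and>
      (\<forall>z\<in>polydisc (fst RM). \<mu> + z \<in> G_dom p \<and> (\<forall>n. cmod (mpoly_eval (q n) (\<mu> + z)) \<le> snd RM))"
    proof (cases "\<mu> \<in> G_dom p")
      case True
      \<comment> \<open>Midway between the norm at \<mu> and 1. Near \<mu> the norm stays below r,
        and there \<open>C\<close> is at most \<open>c * sqrt (1 + 2 / (1 - r))\<close> for every
        index, which gives the local bound for the Cauchy estimates.\<close>
      define r where "r = (1 + op_norm (pmat_eval p \<mu>)) / 2"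
      have r: "op_norm (pmat_eval p \<mu>) < r" "r < 1" using True by (auto simp: r_def G_dom_def)
      have "((\<lambda>z. op_norm (pmat_eval p z)) \<longlongrightarrow> op_norm (pmat_eval p \<mu>)) (nhds \<mu>)"
        using continuous_op_norm_pmat_eval[OF p, of \<mu>] unfolding isCont_def
        by (rule iffD1[OF tendsto_at_iff_tendsto_nhds[of "\<lambda>z. op_norm (pmat_eval p z)" \<mu>]])
      from order_tendstoD(2)[OF this r(1)] obtain d where d: "d > 0" "\<And>z. dist z \<mu> < d \<Longrightarrow> op_norm (pmat_eval p z) < r"
        unfolding eventually_nhds_metric by blast
      have near: "op_norm (pmat_eval p (\<mu> + z)) < r" if "z \<in> polydisc (d / CARD('d))" for z
        using polydisc_imp_norm_less[OF that] by (intro d) (simp add: dist_norm)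
      have near_1: "op_norm (pmat_eval p (\<mu> + z)) < 1" if "z \<in> polydisc (d / CARD('d))" for z
        using near[OF that] r(2) by simp
      have M: "0 \<le> c * sqrt (1 + 2 / (1 - r))" using c r(2) by simp
      have "cmod (mpoly_eval (q n) (\<mu> + z)) \<le> c * sqrt (1 + 2 / (1 - r))" if z: "z \<in> polydisc (d / CARD('d))" for n z
      proof -
        let ?\<rho> = "op_norm (pmat_mat p (scalar_tuple (\<mu> + z)))"
        have \<rho>: "0 \<le> ?\<rho>" "?\<rho> < r" using near[OF z] by (auto simp: op_norm_nonneg pmat_mat_scalar_tuple)
        have "\<mu> + z \<in> G_dom p" using near[OF z] r(2) by (simp add: G_dom_def)
        hence "cmod (mpoly_eval (q n) (\<mu> + z)) \<le> C (fst n) ?\<rho>"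
          using cmod_mpoly_eval_le[of "q n" "\<mu> + z"] q[of "scalar_tuple (\<mu> + z)" n] scalar_tuple_in_F_dom[of "\<mu> + z" p] by simp
        also have "\<dots> \<le> c * sqrt (1 + 2 / (1 - r))"
          unfolding C_def using \<rho> r(2) c power_le_one[of ?\<rho> "fst n"]
          by (intro mult_left_mono real_sqrt_le_mono add_left_mono frac_le) auto
        finally show ?thesis .
      qed
      thus ?thesis using near_1 d(1) M
        by (intro exI[of _ "(d / CARD('d), c * sqrt (1 + 2 / (1 - r)))"]) (auto simp: G_dom_def)
    qed simp
  qed
  then obtain RM where RM: "\<forall>\<mu>. \<mu> \<in> G_dom p \<longrightarrow> fst (RM \<mu>) > 0 \<and> snd (RM \<mu>) \<ge> 0 \<and>
    (\<forall>z\<in>polydisc (fst (RM \<mu>)). \<mu> + z \<in> G_dom p \<and> (\<forall>n. cmod (mpoly_eval (q n) (\<mu> + z)) \<le> snd (RM \<mu>)))"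
    by (rule choice[THEN exE]) (rule that)
  define R where "R \<mu> = fst (RM \<mu>)" for \<mu>
  define M where "M \<mu> = snd (RM \<mu>)" for \<mu>
  have R: "R \<mu> > 0" and M: "M \<mu> \<ge> 0" if "\<mu> \<in> G_dom p" for \<mu> using RM that by (auto simp: R_def M_def)
  have GR: "\<mu> + z \<in> G_dom p" and qM: "cmod (mpoly_eval (q n) (\<mu> + z)) \<le> M \<mu>"
    if "\<mu> \<in> G_dom p" "z \<in> polydisc (R \<mu>)" for \<mu> z n using RM that unfolding R_def M_def by blast+
  define a where "a n \<mu> = power_series_at (mpoly_eval (q n)) \<mu>" for n \<mu>
  have a_bound: "cmod (a n \<mu> \<alpha>) \<le> M \<mu> / R \<mu> ^ mono_deg \<alpha>" if \<mu>: "\<mu> \<in> G_dom p" for n \<mu> \<alpha>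
    unfolding a_def
    by (rule separately_holomorphic_power_series_at(1)[OF R[OF \<mu>] mpoly_eval_coord_holomorphic qM[OF \<mu>]])
  have a_sum: "((\<lambda>\<alpha>. a n \<mu> \<alpha> * monom_eval \<alpha> z) has_sum mpoly_eval (q n) (\<mu> + z)) UNIV"
    if \<mu>: "\<mu> \<in> G_dom p" and z: "z \<in> polydisc (R \<mu>)" for n \<mu> z
    unfolding a_def
    by (rule separately_holomorphic_power_series_at(2)[OF R[OF \<mu>] mpoly_eval_coord_holomorphic qM[OF \<mu>] z])
  have a0: "a n \<mu> 0 = mpoly_eval (q n) \<mu>" if "\<mu> \<in> G_dom p" for n \<mu>
    by (rule power_series_constant_coeff[OF R[OF that]]) (rule a_sum[OF that norm_less_imp_polydisc])
  \<comment> \<open>The iteration quality tends to infinity while the node sets run through the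
    finite subsets of V.\<close>
  define B where "B = sequentially \<times>\<^sub>F finite_subsets_at_top V"
  have B: "B \<noteq> bot" by (simp add: B_def prod_filter_eq_bot)
  \<comment> \<open>The coefficients at all points are treated as one function of (\<mu>, \<alpha>),
    so that a single cluster filter serves every point; outside \<open>G_dom p\<close> both values
    and bounds are set to 0.\<close>
  let ?b = "\<lambda>(\<mu>, \<alpha>). if \<mu> \<in> G_dom p then M \<mu> / R \<mu> ^ mono_deg \<alpha> else 0"
  obtain FF b where FF: "FF \<le> B" "FF \<noteq> bot"
    and b: "\<forall>i. ((\<lambda>n. (\<lambda>(\<mu>, \<alpha>). if \<mu> \<in> G_dom p then a n \<mu> \<alpha> else 0) i) \<longlongrightarrow> b i) FF" "\<forall>i. cmod (b i) \<le> ?b i"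
    by (rule coordinatewise_cluster_filter[OF B, of "\<lambda>n (\<mu>, \<alpha>). if \<mu> \<in> G_dom p then a n \<mu> \<alpha> else 0" ?b])
      (use a_bound in auto)
  have lim: "((\<lambda>n. a n \<mu> \<alpha>) \<longlongrightarrow> b (\<mu>, \<alpha>)) FF" if "\<mu> \<in> G_dom p" for \<mu> \<alpha>
    using b(1)[rule_format, of "(\<mu>, \<alpha>)"] that by simp
  have b_bound: "cmod (b (\<mu>, \<alpha>)) \<le> M \<mu> / R \<mu> ^ mono_deg \<alpha>" if "\<mu> \<in> G_dom p" for \<mu> \<alpha>
    using b(2)[rule_format, of "(\<mu>, \<alpha>)"] that by simp
  \<comment> \<open>The constant coefficient of a polynomial is its value, so F is the pointwise
    limit. That the other limit coefficients at \<mu> expand F around \<mu> is the dominated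
    convergence in \<open>F_sum\<close>.\<close>
  define F where "F \<mu> = b (\<mu>, 0)" for \<mu>
  have limF: "((\<lambda>n. mpoly_eval (q n) \<mu>) \<longlongrightarrow> F \<mu>) FF" if "\<mu> \<in> G_dom p" for \<mu>
    using lim[OF that, of 0] by (simp add: a0[OF that] F_def)
  have F_sum: "((\<lambda>\<alpha>. b (\<mu>, \<alpha>) * monom_eval \<alpha> z) has_sum F (\<mu> + z)) UNIV"
    if \<mu>: "\<mu> \<in> G_dom p" and z: "z \<in> polydisc (R \<mu>)" for \<mu> z
  proof (rule has_sum_dominated_limit[OF FF(2)])
    let ?m = "\<lambda>\<alpha>. complex_of_real (M \<mu> / R \<mu> ^ mono_deg \<alpha>)"
    have m: "0 \<le> M \<mu> / R \<mu> ^ mono_deg \<alpha>" for \<alpha> :: "'d \<Rightarrow>\<^sub>0 nat" using R[OF \<mu>] M[OF \<mu>] by simp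
    have nm: "cmod (?m \<alpha>) = M \<mu> / R \<mu> ^ mono_deg \<alpha>" for \<alpha> :: "'d \<Rightarrow>\<^sub>0 nat"
      using m by (simp only: norm_of_real abs_of_nonneg)
    show "(\<lambda>\<alpha>. cmod (?m \<alpha> * monom_eval \<alpha> z)) summable_on UNIV"
      by (rule abs_summable_power_series[OF eq_refl[OF nm] R[OF \<mu>] z])
    show "cmod (a n \<mu> \<alpha> * monom_eval \<alpha> z) \<le> cmod (?m \<alpha> * monom_eval \<alpha> z)" for n \<alpha>
      unfolding norm_mult nm by (intro mult_right_mono a_bound[OF \<mu>]) simp
    show "((\<lambda>n. a n \<mu> \<alpha> * monom_eval \<alpha> z) \<longlongrightarrow> b (\<mu>, \<alpha>) * monom_eval \<alpha> z) FF" for \<alpha>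
      by (intro tendsto_mult_right lim[OF \<mu>])
    show "((\<lambda>\<alpha>. a n \<mu> \<alpha> * monom_eval \<alpha> z) has_sum mpoly_eval (q n) (\<mu> + z)) UNIV" for n
      by (rule a_sum[OF \<mu> z])
    show "((\<lambda>n. mpoly_eval (q n) (\<mu> + z)) \<longlongrightarrow> F (\<mu> + z)) FF" by (rule limF[OF GR[OF \<mu> z]])
  qed
  have psF: "power_series_at F \<mu> = (\<lambda>\<alpha>. b (\<mu>, \<alpha>))" if "\<mu> \<in> G_dom p" for \<mu>
    by (rule power_series_at_eqI[OF R[OF that]]) (rule F_sum[OF that norm_less_imp_polydisc])
  have hol: "holo_on F (G_dom p)" unfolding holo_on_def
  proof (intro ballI exI conjI allI)
    fix \<mu> assume \<mu>: "\<mu> \<in> G_dom p"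
    let ?D = "\<lambda>h :: complex ^ 'd. \<Sum>i\<in>UNIV. b (\<mu>, Poly_Mapping.single i 1) * h $ i"
    show "(F has_derivative ?D) (at \<mu> within G_dom p)"
      by (rule has_derivative_at_withinI[OF power_series_has_derivative[OF R[OF \<mu>] b_bound[OF \<mu>] F_sum[OF \<mu>]]])
    show "?D (s *s v) = s * ?D v" for s v by (simp add: sum_distrib_left mult_ac)
  qed
  have "F z = f z" if z: "z \<in> V" for z
  proof -
    have fs: "filterlim fst sequentially B" unfolding B_def by (rule filterlim_fst)
    have "eventually (\<lambda>\<Lambda>. finite \<Lambda> \<and> z \<in> \<Lambda>) (finite_subsets_at_top V)"
      unfolding eventually_finite_subsets_at_top using z by (intro exI[of _ "{z}"]) auto
    hence "eventually (\<lambda>n. finite (snd n) \<and> z \<in> snd n) B"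
      unfolding B_def by (intro eventually_compose_filterlim[OF _ filterlim_snd])
    hence "eventually (\<lambda>n. cmod (mpoly_eval (q n) z - f z) \<le> 1 / Suc (fst n)) B"
      by (rule eventually_mono) (use qf z in \<open>auto intro: less_imp_le\<close>)
    moreover have "((\<lambda>n. 1 / real (Suc (fst n))) \<longlongrightarrow> 0) B"
      using filterlim_compose[OF LIMSEQ_Suc[OF lim_1_over_n[where 'a = real]] fs] by simp
    ultimately have "((\<lambda>n. mpoly_eval (q n) z - f z) \<longlongrightarrow> 0) B" by (rule Lim_null_comparison)
    hence "((\<lambda>n. mpoly_eval (q n) z - f z) \<longlongrightarrow> 0) FF" by (rule tendsto_mono[OF FF(1)])
    hence "((\<lambda>n. mpoly_eval (q n) z) \<longlongrightarrow> f z) FF" by (simp add: LIM_zero_iff)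
    thus ?thesis using tendsto_unique[OF FF(2)] limF z V by blast
  qed
  moreover have "op_norm (fun_calc F x) \<le> c" if x: "x \<in> F_dom p" for x
  proof -
    have \<rho>: "op_norm (pmat_mat p x) < 1" and "x \<in> comm_tuples" using x by (auto simp: F_dom_def)
    then obtain m where m: "commuting m x" "m \<ge> 1" unfolding comm_tuples_eq by blast
    have "mat_tendsto m FF (\<lambda>n. fun_calc (mpoly_eval (q n)) x) (fun_calc F x)"
    proof (rule mat_tendsto_fun_calc[OF m])
      fix \<mu> \<alpha> assume "\<mu> \<in> joint_spectrum x"
      hence \<mu>: "\<mu> \<in> G_dom p" using joint_spectrum_subset_G_dom[OF p x] by blast
      show "((\<lambda>n. power_series_at (mpoly_eval (q n)) \<mu> \<alpha>) \<longlongrightarrow> power_series_at F \<mu> \<alpha>) FF"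
        unfolding psF[OF \<mu>] a_def[symmetric] by (rule lim[OF \<mu>])
    qed
    thus ?thesis unfolding fun_calc_mpoly[OF m]
    proof (rule op_norm_limit_le[OF _ FF(2)])
      show "op_norm (mpoly_mat (q n) x) \<le> C (fst n) (op_norm (pmat_mat p x))" for n by (rule q[OF x])
      have fs: "filterlim fst sequentially FF" by (rule filterlim_mono[OF filterlim_fst order_refl FF(1)[unfolded B_def]])
      have "(\<lambda>k. op_norm (pmat_mat p x) ^ k) \<longlonglongrightarrow> 0"
        by (rule LIMSEQ_power_zero) (use \<rho> op_norm_nonneg[of "pmat_mat p x"] in simp)
      hence "((\<lambda>n. op_norm (pmat_mat p x) ^ fst n) \<longlongrightarrow> 0) FF" by (rule filterlim_compose[OF _ fs])
      \<comment> \<open>The excess factor tends to 1 for each x separately, because the norm at x is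
        below 1; the resulting bound c does not depend on x.\<close>
      hence "((\<lambda>n. C (fst n) (op_norm (pmat_mat p x))) \<longlongrightarrow> c * sqrt (1 + 2 * 0 / (1 - op_norm (pmat_mat p x)))) FF"
        unfolding C_def by (intro tendsto_intros) (use \<rho> in auto)
      thus "((\<lambda>n. C (fst n) (op_norm (pmat_mat p x))) \<longlongrightarrow> c) FF" by simp
    qed
  qed
  ultimately show ?thesis using hol by blast
qed

theorem theorem10p19:
  fixes p :: "'d::finite mpoly mat" and V :: "(complex ^ 'd) set" and I J :: nat
  assumes "I \<ge> 1" and "J \<ge> 1" and "p \<in> carrier_mat I J"
    and "algebraic_in V (G_dom p)"
  shows "(\<forall>f \<in> Hol_inf_sub p V. \<exists>F \<in> Hol_inf p.
            (\<forall>z\<in>V. F z = f z) \<and> norm_p p F = norm_p_sub p V f) \<and>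
         (\<forall>F \<in> Hol_inf p.
            restrict F V \<in> Hol_inf_sub p V \<and> norm_p_sub p V (restrict F V) \<le> norm_p p F)"
proof (intro conjI ballI)
  have V: "V \<subseteq> G_dom p" using assms(4) by (auto simp: algebraic_in_def)
  fix f assume "f \<in> Hol_inf_sub p V"
  hence f: "f \<in> Hol_sub V" and fin: "norm_p_sub p V f < \<infinity>" by (auto simp: Hol_inf_sub_def)
  \<comment> \<open>The norm is finite, so passing to a real number loses nothing. For empty V it is
    0, the supremum of the empty set in \<open>ennreal\<close>.\<close>
  define c where "c = enn2real (norm_p_sub p V f)"
  have c: "c \<ge> 0" and cn: "ennreal c = norm_p_sub p V f" using fin by (auto simp: c_def)
  have bound: "op_norm (fun_calc_sub V f y) \<le> c" if "y \<in> F_dom_sub p V" for y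
  proof -
    have "ennreal (op_norm (fun_calc_sub V f y)) \<le> ennreal c"
      unfolding cn norm_p_sub_def using that by (rule SUP_upper)
    thus ?thesis using c by simp
  qed
  obtain F where F: "holo_on F (G_dom p)" "\<forall>z\<in>V. F z = f z" "\<forall>x\<in>F_dom p. op_norm (fun_calc F x) \<le> c"
    using extension_exists[OF assms(3,2) V f c bound] by blast
  have "norm_p p F \<le> ennreal c"
    unfolding norm_p_def using F(3) by (intro SUP_least ennreal_leI) auto
  \<comment> \<open>The second half of the theorem, applied to the extension, turns the bound into
    an equality.\<close>
  moreover have "norm_p_sub p V f \<le> norm_p p F"
    by (rule norm_p_sub_le_norm_p[OF assms(3) V F(1)]) (use F(2) in blast)
  ultimately have "norm_p p F = norm_p_sub p V f" unfolding cn by (rule antisym)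
  thus "\<exists>F\<in>Hol_inf p. (\<forall>z\<in>V. F z = f z) \<and> norm_p p F = norm_p_sub p V f"
    using F fin by (intro bexI[of _ F]) (auto simp: Hol_inf_def)
next
  have V: "V \<subseteq> G_dom p" using assms(4) by (auto simp: algebraic_in_def)
  fix F assume F: "F \<in> Hol_inf p"
  show "restrict F V \<in> Hol_inf_sub p V" "norm_p_sub p V (restrict F V) \<le> norm_p p F"
    by (rule restrict_in_Hol_inf_sub[OF assms(3) V F])+
qed

end
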